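(* Let $K$ be a nested fractal with scaling parameter $\lambda$, eigenvalue $\rho$ for the eigenforms, and set $\mathscr F$ of finite energy functions, endowed with the discrete spectral triple. Then, for any non-constant $f\in\mathscr F$, the abscissa of convergence of $$Z_{|[D,f]|^2}(s)=\operatorname{Tr}\big(|[D,f]|^2\,|D|^{-s}\big)$$ is equal to $\delta=2-\frac{\log\rho}{\log\lambda}$, and the residue produces a self-similar Dirichlet form: $$\mathcal E_D[f]:=\operatorname{Res}_{s=\delta}Z_{|[D,f]|^2}(s)=\frac{1}{\log(1/\lambda)}\,\mathcal E_\infty[f],$$ where $\mathcal E$ is the quadratic functional on $C(V_0)$ given by $\mathcal E[g]=\sum_{e\in E_0}\ell(e)^{\delta-2}\,|g(e^+)-g(e^-)|^2$, and $\mathcal E_\infty[f]=\lim_{n\to\infty}\rho^{-n}S_n(\mathcal E)[f]$.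
   Context: Nested fractals. Let $w_1,\dots,w_k:\mathbb R^N\to\mathbb R^N$ be contracting similarities, $\|w_i(x)-w_i(y)\|=\lambda_i\|x-y\|$ with $\lambda_i\in(0,1)$, and let $K$ be the unique non-empty compact set with $K=\bigcup_{i=1}^k w_i(K)$. Let $p_i$ be the fixed point of $w_i$; $p_i$ is an essential fixed point if there are $i',j,j'\in\{1,\dots,k\}$ with $i'\ne i$ and $w_j(p_i)=w_{j'}(p_{i'})$. $V_0$ is the set of essential fixed points (assumed to have at least two elements) and $E_0=\{(p,q):p,q\in V_0,\ p\neq q\}$ is the set of oriented edges; for $e=(p,q)$ write $e^+=p$, $e^-=q$, and $\ell(e)=\|e^+-e^-\|$ for its length. $\Sigma_n$ is the set of maps $\sigma:\{1,\dots,n\}\to\{1,\dots,k\}$, $w_\sigma=w_{\sigma(1)}\circ\cdots\circ w_{\sigma(n)}$, $|\sigma|=n$; $\Sigma_0=\{\emptyset\}$, $w_\emptyset=\mathrm{id}$, $\Sigma=\bigcup_{n\ge0}\Sigma_n$. $V_n=\bigcup_{\sigma\in\Sigma_n}w_\sigma(V_0)$, $E_n=\{(w_\sigma(p),w_\sigma(q)):\sigma\in\Sigma_n,\ (p,q)\in E_0\}$. Sets $w_\sigma(V_0)$, $\sigma\in\Sigma_n$, are combinatorial $n$-cells. $K$ (with its maps) is a nested fractal if: (1) $\lambda_i=\lambda$ for all $i$; (2) there is a (non-empty) bounded open set $U\subset\mathbb R^N$ with $\bigcup_i w_i(U)\subset U$ and $w_i(U)\cap w_j(U)=\emptyset$ for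 $i\neq j$; (3) the graph $(V_1,E_1)$ is connected; (4) for all $n$ and $\sigma\neq\sigma'$ in $\Sigma_n$, $w_\sigma(V_0)\neq w_{\sigma'}(V_0)$ and $w_\sigma(K)\cap w_{\sigma'}(K)=w_\sigma(V_0)\cap w_{\sigma'}(V_0)$; (5) for $p\neq q$ in $V_0$, the reflection in the hyperplane $\Pi_{pq}=\{z:\|z-p\|=\|z-q\|\}$ maps combinatorial $n$-cells to combinatorial $n$-cells for all $n\ge0$, and maps any combinatorial $n$-cell lying on both sides of $\Pi_{pq}$ to itself. Energy forms. For a set $X$ finite, $C(X)$ is the set of functions $X\to\mathbb R$. $\mathscr D$ is the set of functionals $\mathcal E:C(V_0)\to\mathbb R$, $\mathcal E[g]=\sum_{(p,q)\in E_0}c_{pq}(g(p)-g(q))^2$ with $c_{pq}=c_{qp}>0$. For $\mathcal E\in\mathscr D$, $S_n(\mathcal E)[f]=\sum_{\sigma\in\Sigma_n}\mathcal E[f\circ w_\sigma]$ for $f\in C(V_n)$ (and for $f$ on $K$ by restriction). $\mathcal E\in\mathscr D$ is an eigenform with eigenvalue $\rho>0$ if $\inf\{S_1(\mathcal E)[g]:g\in C(V_1),\ g|_{V_0}=f\}=\rho\,\mathcal E[f]$ for all $f\in C(V_0)$. Known facts: an eigenform $\widehat{\mathcal E}\in\mathscr D$ exists (Lindstrøm); all eigenforms have the same eigenvalue $\rho\in(0,1)$ (Sabot); $\widehat{\mathcal E}_\infty[f]=\lim_n\rho^{-n}S_n(\widehat{\mathcal E})[f]$ defines a Dirichlet form on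 $K$, and $\mathscr F=\{f\in C(K):\widehat{\mathcal E}_\infty[f]<\infty\}$ (real-valued continuous functions) does not depend on the eigenform; for every $\mathcal E\in\mathscr D$ and $f\in\mathscr F$ the limit $\mathcal E_\infty[f]=\lim_n\rho^{-n}S_n(\mathcal E)[f]$ exists, and there is an eigenform $\mathcal E'$ with $\mathcal E_\infty=\mathcal E'_\infty$ (Peirone). Self-similar Dirichlet forms on $K$ are the forms $\mathcal E'_\infty$ obtained from eigenforms $\mathcal E'$. Discrete spectral triple. $\mathcal H$ is the Hilbert space with orthonormal basis $\{\delta_{\sigma,e}:\sigma\in\Sigma,\ e\in E_0\}$. A function $f\in C(K)$ acts by $f\,\delta_{\sigma,e}=f(w_\sigma(e^+))\,\delta_{\sigma,e}$, and $D$ is the self-adjoint operator with $D\,\delta_{\sigma,e}=\lambda^{-|\sigma|}\ell(e)^{-1}\delta_{\sigma,\bar e}$, where $\bar e=(e^-,e^+)$. For $f\in\mathscr F$ the operator $[D,f]$ may be unbounded; $|[D,f]|$ and $|D|$ are both diagonal in the basis $\{\delta_{\sigma,e}\}$, and $|[D,f]|^2|D|^{-s}$ ($s$ real) denotes the corresponding positive diagonal operator, its trace being the sum (in $[0,\infty]$) of its diagonal entries. The residue is $\operatorname{Res}_{s=\delta}Z(s)=\lim_{s\to\delta^+}(s-\delta)Z(s)$. *)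

theory Defs
  imports "HOL-Analysis.Analysis"
begin

section \<open>Nested fractals\<close>

text \<open>
  The maps \<open>w 1, \<dots>, w k\<close> form an indexed family; the elements of \<open>\<Sigma>\<^sub>n\<close> are rendered as
  lists of length \<open>n\<close> over \<open>{1..k}\<close>.
\<close>

definition words :: "nat \<Rightarrow> nat \<Rightarrow> nat list set" where
  "words k n = {\<sigma>. length \<sigma> = n \<and> set \<sigma> \<subseteq> {1..k}}"

definition word_map :: "(nat \<Rightarrow> 'a \<Rightarrow> 'a) \<Rightarrow> nat list \<Rightarrow> 'a \<Rightarrow> 'a" where
  "word_map w \<sigma> = foldr (\<lambda>i g. w i \<circ> g) \<sigma> id"

definition fixed_pt :: "('a \<Rightarrow> 'a) \<Rightarrow> 'a" where
  "fixed_pt g = (THE x. g x = x)"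

definition ess_fixed_pts :: "nat \<Rightarrow> (nat \<Rightarrow> 'a \<Rightarrow> 'a) \<Rightarrow> 'a set" where
  "ess_fixed_pts k w =
    {fixed_pt (w i) | i. i \<in> {1..k} \<and>
       (\<exists>i'\<in>{1..k}. \<exists>j\<in>{1..k}. \<exists>j'\<in>{1..k}.
          i' \<noteq> i \<and> w j (fixed_pt (w i)) = w j' (fixed_pt (w i')))}"

definition edges0 :: "nat \<Rightarrow> (nat \<Rightarrow> 'a \<Rightarrow> 'a) \<Rightarrow> ('a \<times> 'a) set" where
  "edges0 k w = {(p, q). p \<in> ess_fixed_pts k w \<and> q \<in> ess_fixed_pts k w \<and> p \<noteq> q}"

definition vertices :: "nat \<Rightarrow> (nat \<Rightarrow> 'a \<Rightarrow> 'a) \<Rightarrow> nat \<Rightarrow> 'a set" where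
  "vertices k w n = (\<Union>\<sigma>\<in>words k n. word_map w \<sigma> ` ess_fixed_pts k w)"

definition edges :: "nat \<Rightarrow> (nat \<Rightarrow> 'a \<Rightarrow> 'a) \<Rightarrow> nat \<Rightarrow> ('a \<times> 'a) set" where
  "edges k w n =
    {(word_map w \<sigma> p, word_map w \<sigma> q) | \<sigma> p q. \<sigma> \<in> words k n \<and> (p, q) \<in> edges0 k w}"

definition cells :: "nat \<Rightarrow> (nat \<Rightarrow> 'a \<Rightarrow> 'a) \<Rightarrow> nat \<Rightarrow> 'a set set" where
  "cells k w n = {word_map w \<sigma> ` ess_fixed_pts k w | \<sigma>. \<sigma> \<in> words k n}"

definition edge_length :: "'a::real_normed_vector \<times> 'a \<Rightarrow> real" where
  "edge_length e = norm (fst e - snd e)"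

text \<open>Reflection in the hyperplane of the points equidistant from \<open>p\<close> and \<open>q\<close>.\<close>

definition bisector_reflection :: "'a::real_inner \<Rightarrow> 'a \<Rightarrow> 'a \<Rightarrow> 'a" where
  "bisector_reflection p q z =
    z - (2 * ((z - midpoint p q) \<bullet> (q - p)) / ((q - p) \<bullet> (q - p))) *\<^sub>R (q - p)"

definition both_sides :: "'a::real_normed_vector \<Rightarrow> 'a \<Rightarrow> 'a set \<Rightarrow> bool" where
  "both_sides p q C \<longleftrightarrow>
    (\<exists>x\<in>C. norm (x - p) < norm (x - q)) \<and> (\<exists>y\<in>C. norm (y - q) < norm (y - p))"

text \<open>The two conditions on \<open>K\<close> determine it uniquely (Hutchinson).\<close>

definition nested_fractal ::
    "nat \<Rightarrow> (nat \<Rightarrow> 'a::euclidean_space \<Rightarrow> 'a) \<Rightarrow> real \<Rightarrow> 'a set \<Rightarrow> bool" where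
  "nested_fractal k w lam K \<longleftrightarrow>
    0 < lam \<and> lam < 1 \<and>
    (\<forall>i\<in>{1..k}. \<forall>x y. norm (w i x - w i y) = lam * norm (x - y)) \<and>
    compact K \<and> K \<noteq> {} \<and> K = (\<Union>i\<in>{1..k}. w i ` K) \<and>
    card (ess_fixed_pts k w) \<ge> 2 \<and>
    (\<exists>U. open U \<and> bounded U \<and> U \<noteq> {} \<and> (\<Union>i\<in>{1..k}. w i ` U) \<subseteq> U \<and>
       (\<forall>i\<in>{1..k}. \<forall>j\<in>{1..k}. i \<noteq> j \<longrightarrow> w i ` U \<inter> w j ` U = {})) \<and>
    (\<forall>x\<in>vertices k w 1. \<forall>y\<in>vertices k w 1. (x, y) \<in> (edges k w 1)\<^sup>*) \<and>
    (\<forall>n. \<forall>\<sigma>\<in>words k n. \<forall>\<tau>\<in>words k n. \<sigma> \<noteq> \<tau> \<longrightarrow>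
       word_map w \<sigma> ` ess_fixed_pts k w \<noteq> word_map w \<tau> ` ess_fixed_pts k w \<and>
       word_map w \<sigma> ` K \<inter> word_map w \<tau> ` K =
         word_map w \<sigma> ` ess_fixed_pts k w \<inter> word_map w \<tau> ` ess_fixed_pts k w) \<and>
    (\<forall>p\<in>ess_fixed_pts k w. \<forall>q\<in>ess_fixed_pts k w. p \<noteq> q \<longrightarrow>
       (\<forall>n. \<forall>C\<in>cells k w n. bisector_reflection p q ` C \<in> cells k w n \<and>
          (both_sides p q C \<longrightarrow> bisector_reflection p q ` C = C)))"


section \<open>Energy forms\<close>

text \<open>
  Functions on \<open>V\<^sub>0\<close>, on \<open>V\<^sub>n\<close> and on \<open>K\<close> are all represented by functions on the whole space;
  the functionals below only look at the values on the relevant set.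
\<close>

definition discrete_form ::
    "nat \<Rightarrow> (nat \<Rightarrow> 'a \<Rightarrow> 'a) \<Rightarrow> (('a \<Rightarrow> real) \<Rightarrow> real) \<Rightarrow> bool" where
  "discrete_form k w E \<longleftrightarrow>
    (\<exists>c. (\<forall>(p, q)\<in>edges0 k w. c p q = c q p \<and> c p q > 0) \<and>
         (\<forall>g. E g = (\<Sum>(p, q)\<in>edges0 k w. c p q * (g p - g q)\<^sup>2)))"

definition level_form ::
    "nat \<Rightarrow> (nat \<Rightarrow> 'a \<Rightarrow> 'a) \<Rightarrow> nat \<Rightarrow> (('a \<Rightarrow> real) \<Rightarrow> real) \<Rightarrow> ('a \<Rightarrow> real) \<Rightarrow> real" where
  "level_form k w n E f = (\<Sum>\<sigma>\<in>words k n. E (f \<circ> word_map w \<sigma>))"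

definition eigenform ::
    "nat \<Rightarrow> (nat \<Rightarrow> 'a \<Rightarrow> 'a) \<Rightarrow> (('a \<Rightarrow> real) \<Rightarrow> real) \<Rightarrow> real \<Rightarrow> bool" where
  "eigenform k w E rho \<longleftrightarrow>
    discrete_form k w E \<and> rho > 0 \<and>
    (\<forall>f. Inf {level_form k w 1 E g | g. \<forall>x\<in>ess_fixed_pts k w. g x = f x} = rho * E f)"

text \<open>
  The limit is taken in \<open>[0,\<infinity>]\<close>; \<open>lim\<close> is only meaningful where the sequence converges.
  For an eigenform the sequence is increasing.
\<close>

definition limit_form ::
    "nat \<Rightarrow> (nat \<Rightarrow> 'a \<Rightarrow> 'a) \<Rightarrow> real \<Rightarrow> (('a \<Rightarrow> real) \<Rightarrow> real) \<Rightarrow> ('a \<Rightarrow> real) \<Rightarrow> ennreal" where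
  "limit_form k w rho E f = lim (\<lambda>n. ennreal (level_form k w n E f / rho ^ n))"

definition finite_energy ::
    "nat \<Rightarrow> (nat \<Rightarrow> 'a::topological_space \<Rightarrow> 'a) \<Rightarrow> 'a set \<Rightarrow> real \<Rightarrow>
      (('a \<Rightarrow> real) \<Rightarrow> real) \<Rightarrow> ('a \<Rightarrow> real) set" where
  "finite_energy k w K rho E = {f. continuous_on K f \<and> limit_form k w rho E f < \<infinity>}"

text \<open>\<open>Q\<close> with domain \<open>F\<close> is the Dirichlet form of some eigenform.\<close>

definition self_similar_dirichlet_form ::
    "nat \<Rightarrow> (nat \<Rightarrow> 'a::topological_space \<Rightarrow> 'a) \<Rightarrow> 'a set \<Rightarrow>
      ('a \<Rightarrow> real) set \<Rightarrow> (('a \<Rightarrow> real) \<Rightarrow> ennreal) \<Rightarrow> bool" where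
  "self_similar_dirichlet_form k w K F Q \<longleftrightarrow>
    (\<exists>E rho. eigenform k w E rho \<and> F = finite_energy k w K rho E \<and>
       (\<forall>f\<in>F. Q f = limit_form k w rho E f))"

definition critical_exponent :: "real \<Rightarrow> real \<Rightarrow> real" where
  "critical_exponent lam rho = 2 - ln rho / ln lam"

definition length_form ::
    "nat \<Rightarrow> (nat \<Rightarrow> 'a::real_normed_vector \<Rightarrow> 'a) \<Rightarrow> real \<Rightarrow> ('a \<Rightarrow> real) \<Rightarrow> real" where
  "length_form k w d g =
    (\<Sum>e\<in>edges0 k w. edge_length e powr (d - 2) * \<bar>g (fst e) - g (snd e)\<bar>\<^sup>2)"


section \<open>Unbounded operators on the complex sequence space over an index set\<close>

text \<open>
  The Hilbert space with orthonormal basis indexed by \<open>I\<close> is the space of square summable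
  functions vanishing outside \<open>I\<close>. An operator, with its domain, is given by its graph.
\<close>

type_synonym 'i lin_op = "(('i \<Rightarrow> complex) \<times> ('i \<Rightarrow> complex)) set"

definition ell2 :: "'i set \<Rightarrow> ('i \<Rightarrow> complex) set" where
  "ell2 I = {\<psi>. (\<forall>i. i \<notin> I \<longrightarrow> \<psi> i = 0) \<and> (\<lambda>i. (cmod (\<psi> i))\<^sup>2) summable_on I}"

definition ell2_inner :: "'i set \<Rightarrow> ('i \<Rightarrow> complex) \<Rightarrow> ('i \<Rightarrow> complex) \<Rightarrow> complex" where
  "ell2_inner I \<phi> \<psi> = (\<Sum>\<^sub>\<infinity>i\<in>I. cnj (\<phi> i) * \<psi> i)"

definition ell2_norm :: "'i set \<Rightarrow> ('i \<Rightarrow> complex) \<Rightarrow> real" where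
  "ell2_norm I \<psi> = sqrt (\<Sum>\<^sub>\<infinity>i\<in>I. (cmod (\<psi> i))\<^sup>2)"

definition basis_vec :: "'i \<Rightarrow> 'i \<Rightarrow> complex" where
  "basis_vec i = (\<lambda>j. if j = i then 1 else 0)"

definition op_comp :: "'i lin_op \<Rightarrow> 'i lin_op \<Rightarrow> 'i lin_op" where
  "op_comp A B = B O A"

definition op_diff :: "'i lin_op \<Rightarrow> 'i lin_op \<Rightarrow> 'i lin_op" where
  "op_diff A B = {(\<psi>, \<lambda>i. \<xi> i - \<eta> i) | \<psi> \<xi> \<eta>. (\<psi>, \<xi>) \<in> A \<and> (\<psi>, \<eta>) \<in> B}"

definition commutator :: "'i lin_op \<Rightarrow> 'i lin_op \<Rightarrow> 'i lin_op" where
  "commutator A B = op_diff (op_comp A B) (op_comp B A)"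

definition op_adjoint :: "'i set \<Rightarrow> 'i lin_op \<Rightarrow> 'i lin_op" where
  "op_adjoint I T =
    {(\<phi>, \<eta>). \<phi> \<in> ell2 I \<and> \<eta> \<in> ell2 I \<and>
       (\<forall>(\<psi>, \<xi>)\<in>T. ell2_inner I \<phi> \<xi> = ell2_inner I \<eta> \<psi>)}"

definition op_closure :: "'i set \<Rightarrow> 'i lin_op \<Rightarrow> 'i lin_op" where
  "op_closure I T =
    {(\<psi>, \<xi>). \<psi> \<in> ell2 I \<and> \<xi> \<in> ell2 I \<and>
       (\<forall>\<epsilon>>0. \<exists>(\<psi>', \<xi>')\<in>T. ell2_norm I (\<lambda>i. \<psi> i - \<psi>' i) < \<epsilon> \<and>
                            ell2_norm I (\<lambda>i. \<xi> i - \<xi>' i) < \<epsilon>)}"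

definition positive_self_adjoint :: "'i set \<Rightarrow> 'i lin_op \<Rightarrow> bool" where
  "positive_self_adjoint I A \<longleftrightarrow>
    op_adjoint I A = A \<and> (\<forall>(\<psi>, \<xi>)\<in>A. Re (ell2_inner I \<psi> \<xi>) \<ge> 0)"

text \<open>
  The absolute value of a densely defined closable operator \<open>T\<close>: the positive square root of
  \<open>T\<^sup>* T\<close>, where the right-hand factor is replaced by the closure of \<open>T\<close>, because a commutator
  need not be closed on its natural domain.
\<close>

definition op_abs :: "'i set \<Rightarrow> 'i lin_op \<Rightarrow> 'i lin_op" where
  "op_abs I T = (THE A. positive_self_adjoint I A \<and>
                        op_comp A A = op_comp (op_adjoint I T) (op_closure I T))"

definition op_apply :: "'i lin_op \<Rightarrow> ('i \<Rightarrow> complex) \<Rightarrow> 'i \<Rightarrow> complex" where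
  "op_apply A \<psi> = (THE \<xi>. (\<psi>, \<xi>) \<in> A)"

definition diag_entry :: "'i set \<Rightarrow> 'i lin_op \<Rightarrow> 'i \<Rightarrow> real" where
  "diag_entry I A i = Re (ell2_inner I (basis_vec i) (op_apply A (basis_vec i)))"

definition diag_op :: "'i set \<Rightarrow> ('i \<Rightarrow> real) \<Rightarrow> 'i lin_op" where
  "diag_op I a =
    {(\<psi>, \<xi>). \<psi> \<in> ell2 I \<and> \<xi> \<in> ell2 I \<and> (\<forall>i\<in>I. \<xi> i = of_real (a i) * \<psi> i)}"

definition op_trace :: "'i set \<Rightarrow> 'i lin_op \<Rightarrow> ennreal" where
  "op_trace I A = (\<Sum>\<^sub>\<infinity>i\<in>I. ennreal (diag_entry I A i))"


section \<open>The discrete spectral triple\<close>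

type_synonym 'a edge_index = "nat list \<times> 'a \<times> 'a"

definition triple_index :: "nat \<Rightarrow> (nat \<Rightarrow> 'a \<Rightarrow> 'a) \<Rightarrow> 'a edge_index set" where
  "triple_index k w = (\<Union>n. words k n) \<times> edges0 k w"

definition function_op ::
    "nat \<Rightarrow> (nat \<Rightarrow> 'a \<Rightarrow> 'a) \<Rightarrow> ('a \<Rightarrow> complex) \<Rightarrow> 'a edge_index lin_op" where
  "function_op k w f =
    {(\<psi>, \<xi>). \<psi> \<in> ell2 (triple_index k w) \<and> \<xi> \<in> ell2 (triple_index k w) \<and>
       (\<forall>(\<sigma>, p, q)\<in>triple_index k w. \<xi> (\<sigma>, p, q) = f (word_map w \<sigma> p) * \<psi> (\<sigma>, p, q))}"

text \<open>
  In coordinates: since reversal of edges preserves lengths and is an involution, the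
  coefficient of \<open>D \<psi>\<close> at \<open>(\<sigma>, e)\<close> is a multiple of that of \<open>\<psi>\<close> at the reversed edge.
  The domain is the maximal one, on which \<open>D\<close> is self-adjoint.
\<close>

definition dirac_op ::
    "nat \<Rightarrow> (nat \<Rightarrow> 'a::real_normed_vector \<Rightarrow> 'a) \<Rightarrow> real \<Rightarrow> 'a edge_index lin_op" where
  "dirac_op k w lam =
    {(\<psi>, \<xi>). \<psi> \<in> ell2 (triple_index k w) \<and> \<xi> \<in> ell2 (triple_index k w) \<and>
       (\<forall>(\<sigma>, p, q)\<in>triple_index k w.
          \<xi> (\<sigma>, p, q) = of_real (inverse (lam ^ length \<sigma>) * inverse (edge_length (p, q)))
                          * \<psi> (\<sigma>, q, p))}"

text \<open>The positive diagonal operator \<open>|[D,f]|\<^sup>2 |D|\<^bsup>-s\<^esup>\<close>.\<close>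

definition commutator_density ::
    "nat \<Rightarrow> (nat \<Rightarrow> 'a::real_normed_vector \<Rightarrow> 'a) \<Rightarrow> real \<Rightarrow> ('a \<Rightarrow> real) \<Rightarrow> real \<Rightarrow>
      'a edge_index lin_op" where
  "commutator_density k w lam f s =
    (let I = triple_index k w;
         D = dirac_op k w lam;
         T = commutator D (function_op k w (\<lambda>x. complex_of_real (f x)))
     in diag_op I (\<lambda>i. (diag_entry I (op_abs I T) i)\<^sup>2 *
                       diag_entry I (op_abs I D) i powr (- s)))"

definition zeta ::
    "nat \<Rightarrow> (nat \<Rightarrow> 'a::real_normed_vector \<Rightarrow> 'a) \<Rightarrow> real \<Rightarrow> ('a \<Rightarrow> real) \<Rightarrow> real \<Rightarrow> ennreal" where
  "zeta k w lam f s = op_trace (triple_index k w) (commutator_density k w lam f s)"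

definition abscissa_of_convergence :: "(real \<Rightarrow> ennreal) \<Rightarrow> ereal" where
  "abscissa_of_convergence Z = Inf {ereal s | s. Z s < \<infinity>}"

text \<open>As with \<open>lim\<close>, the value of \<open>right_residue\<close> is only meaningful where the limit exists.\<close>

definition has_right_residue :: "(real \<Rightarrow> ennreal) \<Rightarrow> real \<Rightarrow> ennreal \<Rightarrow> bool" where
  "has_right_residue Z d r \<longleftrightarrow> ((\<lambda>s. ennreal (s - d) * Z s) \<longlongrightarrow> r) (at_right d)"

definition right_residue :: "(real \<Rightarrow> ennreal) \<Rightarrow> real \<Rightarrow> ennreal" where
  "right_residue Z d = Lim (at_right d) (\<lambda>s. ennreal (s - d) * Z s)"

end

theory Submission
  imports Defs
begin

text \<open>
  The operators are diagonal up to the reversal of edges, so the zeta function of \<open>f\<close> is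
  \<open>\<Sum>\<^sub>n \<lambda>\<^bsup>n (s - \<delta>)\<^esup> \<rho>\<^bsup>- n\<^esup> S\<^sub>n(E\<^sub>s)[f]\<close>, where \<open>E\<^sub>s\<close> is the edge form with conductances
  \<open>\<ell>(e)\<^bsup>s - 2\<^esup>\<close>. Once the rescaled energies \<open>\<rho>\<^bsup>- n\<^esup> S\<^sub>n(E\<^sub>\<delta>)[f]\<close> are known to converge, Abel's
  theorem turns their limit into the residue at \<open>\<delta>\<close>, with the factor \<open>1 / log (1 / \<lambda>)\<close>.

  Convergence is that of the powers of a positive operator \<open>T\<close> on quadratic forms on \<open>V\<^sub>0\<close>, namely
  \<open>T q = \<rho>\<^bsup>-1\<^esup> \<Sum>\<^sub>i q \<circ> A\<^sub>i\<close> with \<open>A\<^sub>i\<close> the harmonic extension to \<open>V\<^sub>1\<close> restricted to the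
  \<open>i\<close>-th cell; the eigenform is a fixed point of \<open>T\<close>. The maps \<open>A\<^sub>i\<close> of the cells at the vertices
  have Perron vectors, which exclude periodic behaviour of \<open>T\<close>. The eigenform whose limit is the
  residue is the trace on \<open>V\<^sub>0\<close> of the limit form. Its conductances are nonnegative because
  contractions reduce energy, and positive because the reflections make \<open>V\<^sub>0\<close> free of cut vertices.
\<close>

subsection \<open>Diagonal operators on the sequence space\<close>

text \<open>The length form is not an eigenform, so its rescaled energies are not monotone and
  convergence has to be forced. On forms on \<open>V0\<close> the eigenform \<open>E\<close> is an
  order unit fixed by \<open>T\<close>, which keeps all powers bounded. Averages then converge by
  compactness, and the real issue is that \<open>T\<close> applied n times to \<open>Y - T Y\<close>
  dies out. Back on functions, what makes \<open>T\<close> relevant is that a function of finite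
  energy is, on small cells, close in energy to the harmonic extension of its vertex values. A fixed
  point of \<open>T\<close> need not be an eigenform: \<open>T\<close> extends harmonically for
  \<open>E\<close>, whereas an eigenform has to be minimised by its own extensions. This is why the
  trace is taken. The given eigenform may lack symmetry; all symmetry used for the trace comes from
  the length form, whose conductances depend on distances only. Since positivity of the trace
  conductances is itself at stake, the maximum principle is developed for graphs that may miss
  edges. Finite energy is imposed on vertex values alone, without continuity, so that extensions can
  be built by gluing.\<close>

lemma infsum_single:
  fixes f :: "'i \<Rightarrow> 'b::{comm_monoid_add, t2_space}"
  assumes "i \<in> A" "\<And>j. j \<in> A \<Longrightarrow> j \<noteq> i \<Longrightarrow> f j = 0"
  shows "infsum f A = f i"
proof -
  have "infsum f A = infsum f {i}"
    by (rule infsum_cong_neutral) (use assms in auto)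
  then show ?thesis by simp
qed

lemma infsum_complex_of_real: "(\<Sum>\<^sub>\<infinity>x\<in>A. complex_of_real (f x)) = of_real (infsum f A)"
proof (cases "f summable_on A")
  case True
  then show ?thesis by (intro infsumI) (simp add: has_sum_of_real_iff has_sum_infsum)
next
  case False
  moreover have "f summable_on A" if "(\<lambda>x. complex_of_real (f x)) summable_on A"
    using summable_on_Re[OF that] by simp
  ultimately show ?thesis by (metis infsum_not_exists of_real_0)
qed

lemma ell2_summable: "\<psi> \<in> ell2 I \<Longrightarrow> (\<lambda>i. (cmod (\<psi> i))\<^sup>2) summable_on I"
  by (simp add: ell2_def)

lemma ell2_outside: "\<psi> \<in> ell2 I \<Longrightarrow> i \<notin> I \<Longrightarrow> \<psi> i = 0"
  by (simp add: ell2_def)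

lemma ell2_I:
  assumes "\<And>i. i \<notin> I \<Longrightarrow> \<psi> i = 0" "(\<lambda>i. (cmod (\<psi> i))\<^sup>2) summable_on I"
  shows "\<psi> \<in> ell2 I"
  using assms by (simp add: ell2_def)

lemma ell2_finite_support:
  assumes "finite F" "F \<subseteq> I" "\<And>i. i \<notin> F \<Longrightarrow> \<psi> i = 0"
  shows "\<psi> \<in> ell2 I"
proof (rule ell2_I)
  show "\<psi> i = 0" if "i \<notin> I" for i using assms that by auto
  show "(\<lambda>i. (cmod (\<psi> i))\<^sup>2) summable_on I"
    by (rule finite_nonzero_values_imp_summable_on, rule finite_subset[OF _ assms(1)])
      (use assms(3) in auto)
qed

lemma ell2_basis_vec [simp]: "i \<in> I \<Longrightarrow> basis_vec i \<in> ell2 I"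
  by (rule ell2_finite_support[of "{i}"]) (auto simp: basis_vec_def)

lemma ell2_product_summable:
  assumes "\<phi> \<in> ell2 I" "\<psi> \<in> ell2 I"
  shows "(\<lambda>i. cnj (\<phi> i) * \<psi> i) summable_on I"
proof (rule abs_summable_summable)
  have "(\<lambda>i. (cmod (\<phi> i))\<^sup>2 + (cmod (\<psi> i))\<^sup>2) summable_on I"
    using assms by (intro summable_on_add ell2_summable)
  then show "(\<lambda>i. norm (cnj (\<phi> i) * \<psi> i)) summable_on I"
  proof (rule summable_on_comparison_test)
    fix i assume "i \<in> I"
    have "2 * (cmod (\<phi> i) * cmod (\<psi> i)) \<le> (cmod (\<phi> i))\<^sup>2 + (cmod (\<psi> i))\<^sup>2"
      using sum_squares_bound[of "cmod (\<phi> i)" "cmod (\<psi> i)"] by (simp add: mult.assoc)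
    moreover have "0 \<le> cmod (\<phi> i) * cmod (\<psi> i)" by simp
    ultimately show "norm (cnj (\<phi> i) * \<psi> i) \<le> (cmod (\<phi> i))\<^sup>2 + (cmod (\<psi> i))\<^sup>2"
      unfolding norm_mult complex_mod_cnj by linarith
  qed simp
qed

lemma ell2_comb:
  assumes "\<phi> \<in> ell2 I" "\<psi> \<in> ell2 I"
  shows "(\<lambda>i. \<phi> i - c * \<psi> i) \<in> ell2 I"
proof (rule ell2_I)
  show "\<phi> i - c * \<psi> i = 0" if "i \<notin> I" for i using assms that by (simp add: ell2_outside)
  have "(\<lambda>i. 2 * (cmod (\<phi> i))\<^sup>2 + 2 * (cmod c)\<^sup>2 * (cmod (\<psi> i))\<^sup>2) summable_on I"
    using assms by (intro summable_on_add summable_on_cmult_right ell2_summable)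
  then show "(\<lambda>i. (cmod (\<phi> i - c * \<psi> i))\<^sup>2) summable_on I"
  proof (rule summable_on_comparison_test)
    fix i assume "i \<in> I"
    have "cmod (\<phi> i - c * \<psi> i) \<le> cmod (\<phi> i) + cmod c * cmod (\<psi> i)"
      by (metis norm_mult norm_triangle_ineq4)
    then have "(cmod (\<phi> i - c * \<psi> i))\<^sup>2 \<le> (cmod (\<phi> i) + cmod c * cmod (\<psi> i))\<^sup>2"
      by (rule power_mono) simp
    also have "\<dots> \<le> 2 * (cmod (\<phi> i))\<^sup>2 + 2 * (cmod c * cmod (\<psi> i))\<^sup>2"
      using sum_squares_bound[of "cmod (\<phi> i)" "cmod c * cmod (\<psi> i)"]
      by (simp add: power2_sum mult.assoc)
    finally show "(cmod (\<phi> i - c * \<psi> i))\<^sup>2 \<le> 2 * (cmod (\<phi> i))\<^sup>2 + 2 * (cmod c)\<^sup>2 * (cmod (\<psi> i))\<^sup>2"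
      by (simp add: power_mult_distrib)
  qed simp
qed

lemma ell2_diff: "\<phi> \<in> ell2 I \<Longrightarrow> \<psi> \<in> ell2 I \<Longrightarrow> (\<lambda>i. \<phi> i - \<psi> i) \<in> ell2 I"
  using ell2_comb[of \<phi> I \<psi> 1] by simp

lemma ell2_inner_basis_left: "i \<in> I \<Longrightarrow> ell2_inner I (basis_vec i) \<psi> = \<psi> i"
  unfolding ell2_inner_def by (subst infsum_single[where i=i]) (auto simp: basis_vec_def)

lemma ell2_inner_basis_right: "i \<in> I \<Longrightarrow> ell2_inner I \<psi> (basis_vec i) = cnj (\<psi> i)"
  unfolding ell2_inner_def by (subst infsum_single[where i=i]) (auto simp: basis_vec_def)

lemma ell2_inner_right_comb:
  assumes "\<phi> \<in> ell2 I" "\<psi> \<in> ell2 I" "\<xi> \<in> ell2 I"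
  shows "ell2_inner I \<phi> (\<lambda>i. \<psi> i - c * \<xi> i) = ell2_inner I \<phi> \<psi> - c * ell2_inner I \<phi> \<xi>"
proof -
  have "ell2_inner I \<phi> (\<lambda>i. \<psi> i - c * \<xi> i) =
      (\<Sum>\<^sub>\<infinity>i\<in>I. cnj (\<phi> i) * \<psi> i + (- c) * (cnj (\<phi> i) * \<xi> i))"
    unfolding ell2_inner_def by (rule infsum_cong) (simp add: algebra_simps)
  also have "\<dots> = (\<Sum>\<^sub>\<infinity>i\<in>I. cnj (\<phi> i) * \<psi> i) + (\<Sum>\<^sub>\<infinity>i\<in>I. (- c) * (cnj (\<phi> i) * \<xi> i))"
    using assms by (intro infsum_add summable_on_cmult_right ell2_product_summable)
  also have "\<dots> = ell2_inner I \<phi> \<psi> - c * ell2_inner I \<phi> \<xi>"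
    using infsum_cmult_right'[of "-c" "\<lambda>i. cnj (\<phi> i) * \<xi> i" I] by (simp add: ell2_inner_def)
  finally show ?thesis .
qed

lemma ell2_inner_commute: "ell2_inner I \<phi> \<psi> = cnj (ell2_inner I \<psi> \<phi>)"
  unfolding ell2_inner_def infsum_cnj[symmetric] by (simp add: mult.commute)

lemma ell2_inner_self:
  "ell2_inner I \<psi> \<psi> = of_real (\<Sum>\<^sub>\<infinity>i\<in>I. (cmod (\<psi> i))\<^sup>2)"
proof -
  have "cnj (\<psi> i) * \<psi> i = of_real ((cmod (\<psi> i))\<^sup>2)" for i
    by (metis complex_norm_square mult.commute)
  then show ?thesis unfolding ell2_inner_def by (simp only: infsum_complex_of_real)
qed

lemma ell2_norm_ge:
  assumes "\<psi> \<in> ell2 I" "i \<in> I"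
  shows "(cmod (\<psi> i))\<^sup>2 \<le> (\<Sum>\<^sub>\<infinity>i\<in>I. (cmod (\<psi> i))\<^sup>2)" "cmod (\<psi> i) \<le> ell2_norm I \<psi>"
proof -
  have "(\<Sum>\<^sub>\<infinity>j\<in>{i}. (cmod (\<psi> j))\<^sup>2) \<le> (\<Sum>\<^sub>\<infinity>j\<in>I. (cmod (\<psi> j))\<^sup>2)"
    using assms by (intro infsum_mono_neutral) (auto intro: ell2_summable)
  then show 1: "(cmod (\<psi> i))\<^sup>2 \<le> (\<Sum>\<^sub>\<infinity>i\<in>I. (cmod (\<psi> i))\<^sup>2)" by simp
  show "cmod (\<psi> i) \<le> ell2_norm I \<psi>"
    unfolding ell2_norm_def using real_sqrt_le_mono[OF 1] by simp
qed

text \<open>The pairing is sesquilinear, so adjoints are linear whether or not \<open>T\<close> is.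
  Operators being mere sets of pairs, this is how a self-adjoint operator is seen to be
  linear.\<close>

lemma op_adjoint_comb:
  assumes T: "\<And>\<psi> \<xi>. (\<psi>, \<xi>) \<in> T \<Longrightarrow> \<psi> \<in> ell2 I \<and> \<xi> \<in> ell2 I"
    and 1: "(\<phi>1, \<eta>1) \<in> op_adjoint I T" and 2: "(\<phi>2, \<eta>2) \<in> op_adjoint I T"
  shows "(\<lambda>i. \<phi>1 i - c * \<phi>2 i, \<lambda>i. \<eta>1 i - c * \<eta>2 i) \<in> op_adjoint I T"
proof -
  have e: "\<phi>1 \<in> ell2 I" "\<phi>2 \<in> ell2 I" "\<eta>1 \<in> ell2 I" "\<eta>2 \<in> ell2 I"
    using 1 2 by (auto simp: op_adjoint_def)
  have "ell2_inner I (\<lambda>i. \<phi>1 i - c * \<phi>2 i) \<xi> = ell2_inner I (\<lambda>i. \<eta>1 i - c * \<eta>2 i) \<psi>"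
    if "(\<psi>, \<xi>) \<in> T" for \<psi> \<xi>
  proof -
    have "ell2_inner I \<phi>1 \<xi> = ell2_inner I \<eta>1 \<psi>" "ell2_inner I \<phi>2 \<xi> = ell2_inner I \<eta>2 \<psi>"
      using 1 2 that by (auto simp: op_adjoint_def)
    moreover have "ell2_inner I (\<lambda>i. \<phi>1 i - c * \<phi>2 i) \<xi> = ell2_inner I \<phi>1 \<xi> - cnj c * ell2_inner I \<phi>2 \<xi>"
      using T[OF that] e
      by (subst (1 2 3) ell2_inner_commute) (simp add: ell2_inner_right_comb)
    moreover have "ell2_inner I (\<lambda>i. \<eta>1 i - c * \<eta>2 i) \<psi> = ell2_inner I \<eta>1 \<psi> - cnj c * ell2_inner I \<eta>2 \<psi>"
      using T[OF that] e
      by (subst (1 2 3) ell2_inner_commute) (simp add: ell2_inner_right_comb)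
    ultimately show ?thesis by simp
  qed
  then show ?thesis using e by (auto simp: op_adjoint_def ell2_comb)
qed

text \<open>With \<open>r = id\<close> these are the diagonal operators; the Dirac operator and its commutators
  with functions have the same shape, \<open>r\<close> being the reversal of edges.\<close>

definition twist_op :: "'i set \<Rightarrow> ('i \<Rightarrow> 'i) \<Rightarrow> ('i \<Rightarrow> real) \<Rightarrow> 'i lin_op" where
  "twist_op I r t =
    {(\<psi>, \<xi>). \<psi> \<in> ell2 I \<and> \<xi> \<in> ell2 I \<and> (\<forall>i\<in>I. \<xi> i = of_real (t i) * \<psi> (r i))}"

lemma diag_op_eq_twist_op: "diag_op I a = twist_op I (\<lambda>i. i) a"
  by (simp add: diag_op_def twist_op_def)

locale index_involution =
  fixes I :: "'i set" and r :: "'i \<Rightarrow> 'i"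
  assumes r_in: "i \<in> I \<Longrightarrow> r i \<in> I" and r_r: "i \<in> I \<Longrightarrow> r (r i) = i"
begin

lemma bij: "bij_betw r I I"
  by (rule bij_betwI[where g=r]) (auto simp: r_in r_r)

lemma basis_pair: assumes i: "i \<in> I"
  shows "(basis_vec i, \<lambda>j. of_real (t (r i)) * basis_vec (r i) j) \<in> twist_op I r t"
proof -
  have "(\<lambda>j. of_real (t (r i)) * basis_vec (r i) j) \<in> ell2 I"
    by (rule ell2_finite_support[of "{r i}"]) (auto simp: basis_vec_def r_in i)
  moreover have "of_real (t (r i)) * basis_vec (r i) j = complex_of_real (t j) * basis_vec i (r j)"
    if "j \<in> I" for j using r_r[OF i] r_r[OF that] by (auto simp: basis_vec_def)
  ultimately show ?thesis using ell2_basis_vec[OF i] by (auto simp: twist_op_def)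
qed

text \<open>Testing against basis vectors already fixes every coordinate of an adjoint pair; the
  converse is a reindexing of the inner product along \<open>r\<close>. Hence \<open>T\<close> may
  be any operator between the finitely supported part and the maximal one, which spares an exact
  description of the domain of a commutator.\<close>

lemma op_adjoint_twist_op:
  assumes sub: "T \<subseteq> twist_op I r t"
    and fin: "\<And>\<psi> \<xi> F. (\<psi>, \<xi>) \<in> twist_op I r t \<Longrightarrow> finite F \<Longrightarrow> (\<And>i. i \<notin> F \<Longrightarrow> \<psi> i = 0) \<Longrightarrow> (\<psi>, \<xi>) \<in> T"
  shows "op_adjoint I T = twist_op I r (\<lambda>i. t (r i))"
proof (intro set_eqI iffI; clarify)
  fix \<phi> \<eta> assume a: "(\<phi>, \<eta>) \<in> op_adjoint I T"
  have "\<eta> i = of_real (t (r i)) * \<phi> (r i)" if i: "i \<in> I" for i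
  proof -
    have "(basis_vec i, \<lambda>j. of_real (t (r i)) * basis_vec (r i) j) \<in> T"
      by (rule fin[OF basis_pair[OF i], of "{i}"]) (auto simp: basis_vec_def)
    then have "ell2_inner I \<phi> (\<lambda>j. of_real (t (r i)) * basis_vec (r i) j) = ell2_inner I \<eta> (basis_vec i)"
      using a by (auto simp: op_adjoint_def)
    moreover have "ell2_inner I \<phi> (\<lambda>j. of_real (t (r i)) * basis_vec (r i) j) =
        of_real (t (r i)) * cnj (\<phi> (r i))"
      unfolding ell2_inner_def
      by (subst infsum_single[where i="r i"]) (auto simp: basis_vec_def r_in i)
    ultimately have "of_real (t (r i)) * cnj (\<phi> (r i)) = cnj (\<eta> i)"
      by (simp add: ell2_inner_basis_right i)
    then have "cnj (of_real (t (r i)) * cnj (\<phi> (r i))) = \<eta> i" by simp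
    then show ?thesis by simp
  qed
  then show "(\<phi>, \<eta>) \<in> twist_op I r (\<lambda>i. t (r i))"
    using a by (auto simp: op_adjoint_def twist_op_def)
next
  fix \<phi> \<eta> assume a: "(\<phi>, \<eta>) \<in> twist_op I r (\<lambda>i. t (r i))"
  have "ell2_inner I \<phi> \<xi> = ell2_inner I \<eta> \<psi>" if "(\<psi>, \<xi>) \<in> T" for \<psi> \<xi>
  proof -
    have m: "(\<psi>, \<xi>) \<in> twist_op I r t" using that sub by auto
    have "ell2_inner I \<phi> \<xi> = (\<Sum>\<^sub>\<infinity>i\<in>I. cnj (\<phi> (r i)) * \<xi> (r i))"
      unfolding ell2_inner_def using infsum_reindex_bij_betw[OF bij, of "\<lambda>i. cnj (\<phi> i) * \<xi> i"] by simp
    also have "\<dots> = ell2_inner I \<eta> \<psi>"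
      unfolding ell2_inner_def using m a r_in r_r
      by (intro infsum_cong) (auto simp: twist_op_def)
    finally show ?thesis .
  qed
  then show "(\<phi>, \<eta>) \<in> op_adjoint I T"
    using a by (auto simp: op_adjoint_def twist_op_def)
qed

text \<open>Norm convergence implies convergence of coordinates, so limits stay in the maximal
  operator. Conversely truncations of a pair to finite sets approximate it in both components and
  lie in \<open>T\<close>.\<close>

lemma op_closure_twist_op:
  assumes sub: "T \<subseteq> twist_op I r t"
    and fin: "\<And>\<psi> \<xi> F. (\<psi>, \<xi>) \<in> twist_op I r t \<Longrightarrow> finite F \<Longrightarrow> (\<And>i. i \<notin> F \<Longrightarrow> \<psi> i = 0) \<Longrightarrow> (\<psi>, \<xi>) \<in> T"
  shows "op_closure I T = twist_op I r t"
proof (intro set_eqI iffI; clarify)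
  fix \<psi> \<xi> assume a: "(\<psi>, \<xi>) \<in> op_closure I T"
  then have e: "\<psi> \<in> ell2 I" "\<xi> \<in> ell2 I" by (simp_all add: op_closure_def)
  have "\<xi> i = of_real (t i) * \<psi> (r i)" if i: "i \<in> I" for i
  proof -
    have "cmod (\<xi> i - of_real (t i) * \<psi> (r i)) \<le> 0 + \<epsilon>" if \<epsilon>: "\<epsilon> > 0" for \<epsilon>
    proof -
      define \<epsilon>' where "\<epsilon>' = \<epsilon> / (1 + \<bar>t i\<bar>)"
      have "\<epsilon>' > 0" using \<epsilon> by (simp add: \<epsilon>'_def add_pos_nonneg)
      then have "\<exists>(\<psi>', \<xi>')\<in>T. ell2_norm I (\<lambda>i. \<psi> i - \<psi>' i) < \<epsilon>' \<and> ell2_norm I (\<lambda>i. \<xi> i - \<xi>' i) < \<epsilon>'"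
        using a by (simp add: op_closure_def)
      then obtain \<psi>' \<xi>' where p: "(\<psi>', \<xi>') \<in> T" "ell2_norm I (\<lambda>i. \<psi> i - \<psi>' i) < \<epsilon>'"
          "ell2_norm I (\<lambda>i. \<xi> i - \<xi>' i) < \<epsilon>'"
        by auto
      have m: "\<psi>' \<in> ell2 I" "\<xi>' \<in> ell2 I" "\<xi>' i = of_real (t i) * \<psi>' (r i)"
        using p(1) sub i by (auto simp: twist_op_def)
      have "cmod (\<psi> (r i) - \<psi>' (r i)) \<le> \<epsilon>'" "cmod (\<xi> i - \<xi>' i) \<le> \<epsilon>'"
        using ell2_norm_ge(2)[OF ell2_diff[OF e(1) m(1)] r_in[OF i]]
          ell2_norm_ge(2)[OF ell2_diff[OF e(2) m(2)] i] p(2,3) by linarith+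
      moreover have "\<xi> i - of_real (t i) * \<psi> (r i) =
          (\<xi> i - \<xi>' i) - of_real (t i) * (\<psi> (r i) - \<psi>' (r i))"
        by (simp add: m(3) algebra_simps)
      then have "cmod (\<xi> i - of_real (t i) * \<psi> (r i)) \<le>
          cmod (\<xi> i - \<xi>' i) + \<bar>t i\<bar> * cmod (\<psi> (r i) - \<psi>' (r i))"
        by (metis norm_mult norm_of_real norm_triangle_ineq4)
      moreover have "\<bar>t i\<bar> * cmod (\<psi> (r i) - \<psi>' (r i)) \<le> \<bar>t i\<bar> * \<epsilon>'"
        using calculation(1) by (intro mult_left_mono) auto
      ultimately have "cmod (\<xi> i - of_real (t i) * \<psi> (r i)) \<le> \<epsilon>' + \<bar>t i\<bar> * \<epsilon>'"
        by linarith
      also have "\<dots> = (1 + \<bar>t i\<bar>) * \<epsilon>'" by (simp add: algebra_simps)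
      also have "\<dots> = \<epsilon>" using abs_ge_zero[of "t i"] by (simp add: \<epsilon>'_def del: abs_ge_zero)
      finally show ?thesis by simp
    qed
    then have "cmod (\<xi> i - of_real (t i) * \<psi> (r i)) \<le> 0" by (rule field_le_epsilon)
    then show ?thesis by simp
  qed
  then show "(\<psi>, \<xi>) \<in> twist_op I r t" using e by (auto simp: twist_op_def)
next
  fix \<psi> \<xi> assume a: "(\<psi>, \<xi>) \<in> twist_op I r t"
  then have e: "\<psi> \<in> ell2 I" "\<xi> \<in> ell2 I" by (auto simp: twist_op_def)
  have trunc: "\<exists>F. finite F \<and> F \<subseteq> I \<and> (\<forall>G. finite G \<and> F \<subseteq> G \<and> G \<subseteq> I \<longrightarrow>
      ell2_norm I (\<lambda>i. \<phi> i - (if i \<in> G then \<phi> i else 0)) < \<epsilon>)" if "\<phi> \<in> ell2 I" "\<epsilon> > 0" for \<phi> :: "'i \<Rightarrow> complex" and \<epsilon>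
  proof -
    let ?f = "\<lambda>i. (cmod (\<phi> i))\<^sup>2"
    have s: "?f summable_on I" using that by (simp add: ell2_summable)
    then have "(sum ?f \<longlongrightarrow> infsum ?f I) (finite_subsets_at_top I)" by (rule infsum_tendsto)
    then have "\<forall>\<^sub>F F in finite_subsets_at_top I. dist (sum ?f F) (infsum ?f I) < \<epsilon>\<^sup>2"
      using that by (intro tendstoD) auto
    then obtain F where F: "finite F" "F \<subseteq> I" "\<And>G. finite G \<Longrightarrow> F \<subseteq> G \<Longrightarrow> G \<subseteq> I \<Longrightarrow> dist (sum ?f G) (infsum ?f I) < \<epsilon>\<^sup>2"
      by (auto simp: eventually_finite_subsets_at_top)
    have "ell2_norm I (\<lambda>i. \<phi> i - (if i \<in> G then \<phi> i else 0)) < \<epsilon>" if G: "finite G" "F \<subseteq> G" "G \<subseteq> I" for G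
    proof -
      have "(\<Sum>\<^sub>\<infinity>i\<in>I. (cmod (\<phi> i - (if i \<in> G then \<phi> i else 0)))\<^sup>2) = infsum ?f (I - G)"
        by (rule infsum_cong_neutral) auto
      also have "\<dots> = infsum ?f I - sum ?f G"
        using infsum_Diff[OF s, of G] G by simp
      also have "\<dots> < \<epsilon>\<^sup>2" using F(3)[OF G] by (simp add: dist_real_def)
      finally have "sqrt (\<Sum>\<^sub>\<infinity>i\<in>I. (cmod (\<phi> i - (if i \<in> G then \<phi> i else 0)))\<^sup>2) < sqrt (\<epsilon>\<^sup>2)"
        by (rule real_sqrt_less_mono)
      then show ?thesis unfolding ell2_norm_def using \<open>\<epsilon> > 0\<close> by simp
    qed
    then show ?thesis using F(1,2) by (intro exI[of _ F]) simp
  qed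
  have "\<exists>(\<psi>', \<xi>')\<in>T. ell2_norm I (\<lambda>i. \<psi> i - \<psi>' i) < \<epsilon> \<and> ell2_norm I (\<lambda>i. \<xi> i - \<xi>' i) < \<epsilon>"
    if \<epsilon>: "\<epsilon> > 0" for \<epsilon>
  proof -
    obtain F1 where F1: "finite F1 \<and> F1 \<subseteq> I \<and> (\<forall>G. finite G \<and> F1 \<subseteq> G \<and> G \<subseteq> I \<longrightarrow>
        ell2_norm I (\<lambda>i. \<psi> i - (if i \<in> G then \<psi> i else 0)) < \<epsilon>)"
      using trunc[OF e(1) \<epsilon>] by (rule exE)
    obtain F2 where F2: "finite F2 \<and> F2 \<subseteq> I \<and> (\<forall>G. finite G \<and> F2 \<subseteq> G \<and> G \<subseteq> I \<longrightarrow>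
        ell2_norm I (\<lambda>i. \<xi> i - (if i \<in> G then \<xi> i else 0)) < \<epsilon>)"
      using trunc[OF e(2) \<epsilon>] by (rule exE)
    \<comment> \<open>Closing the finite set under \<open>r\<close> makes the truncation of \<xi>
      the image of the truncation of \<psi>.\<close>
    define G where "G = (F1 \<union> F2) \<union> r ` (F1 \<union> F2)"
    have G: "finite G" "G \<subseteq> I" "F1 \<subseteq> G" "F2 \<subseteq> G"
      using conjunct1[OF F1] conjunct1[OF F2] conjunct1[OF conjunct2[OF F1]] conjunct1[OF conjunct2[OF F2]] r_in by (auto simp: G_def)
    have rG: "r i \<in> G \<longleftrightarrow> i \<in> G" if "i \<in> I" for i
    proof -
      have "r j \<in> G" if "j \<in> G" for j
        using that conjunct1[OF conjunct2[OF F1]] conjunct1[OF conjunct2[OF F2]] r_r by (auto simp: G_def)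
      then show ?thesis using r_r[OF that] by metis
    qed
    have "(\<lambda>i. if i \<in> G then \<psi> i else 0, \<lambda>i. if i \<in> G then \<xi> i else 0) \<in> T"
    proof (rule fin[where F=G])
      show "(\<lambda>i. if i \<in> G then \<psi> i else 0, \<lambda>i. if i \<in> G then \<xi> i else 0) \<in> twist_op I r t"
        using a G rG ell2_finite_support[OF G(1,2), of "\<lambda>i. if i \<in> G then \<psi> i else 0"]
          ell2_finite_support[OF G(1,2), of "\<lambda>i. if i \<in> G then \<xi> i else 0"]
        by (simp add: twist_op_def)
    qed (use G in auto)
    then show ?thesis
      by (rule rev_bexI) (use F1 F2 G in simp)
  qed
  then show "(\<psi>, \<xi>) \<in> op_closure I T" using e by (simp add: op_closure_def)
qed

end

lemma op_adjoint_diag_op: "op_adjoint I (diag_op I a) = diag_op I a"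
proof -
  interpret index_involution I "\<lambda>i. i" by unfold_locales auto
  show ?thesis unfolding diag_op_eq_twist_op
    by (rule op_adjoint_twist_op) auto
qed

lemma positive_self_adjoint_diag_op:
  assumes "\<And>i. i \<in> I \<Longrightarrow> a i \<ge> 0"
  shows "positive_self_adjoint I (diag_op I a)"
proof -
  have "Re (ell2_inner I \<psi> \<xi>) \<ge> 0" if "(\<psi>, \<xi>) \<in> diag_op I a" for \<psi> \<xi>
  proof -
    have "ell2_inner I \<psi> \<xi> = (\<Sum>\<^sub>\<infinity>i\<in>I. of_real (a i * (cmod (\<psi> i))\<^sup>2))"
      unfolding ell2_inner_def
    proof (rule infsum_cong)
      fix i assume "i \<in> I"
      then have "cnj (\<psi> i) * \<xi> i = of_real (a i) * (cnj (\<psi> i) * \<psi> i)"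
        using that by (simp add: diag_op_def)
      then show "cnj (\<psi> i) * \<xi> i = of_real (a i * (cmod (\<psi> i))\<^sup>2)"
        by (metis complex_norm_square mult.commute of_real_mult)
    qed
    also have "\<dots> = of_real (\<Sum>\<^sub>\<infinity>i\<in>I. a i * (cmod (\<psi> i))\<^sup>2)" by (rule infsum_complex_of_real)
    finally show ?thesis using assms by (simp add: infsum_nonneg)
  qed
  then show ?thesis by (auto simp: positive_self_adjoint_def op_adjoint_diag_op)
qed

text \<open>On a basis vector with eigenvalue \<open>a\<^sup>2\<close> the vector \<open>v = A e - a e\<close> satisfies
  \<open>A v = - a v\<close>, which positivity only allows for \<open>v = 0\<close>.\<close>

lemma positive_sqrt_unique:
  assumes a: "\<And>i. i \<in> I \<Longrightarrow> a i \<ge> 0"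
    and A: "positive_self_adjoint I A"
    and sq: "op_comp A A = op_comp (diag_op I a) (diag_op I a)"
  shows "A = diag_op I a"
proof -
  have adj: "op_adjoint I A = A" and pos: "\<And>\<psi> \<xi>. (\<psi>, \<xi>) \<in> A \<Longrightarrow> Re (ell2_inner I \<psi> \<xi>) \<ge> 0"
    using A by (auto simp: positive_self_adjoint_def)
  have el: "\<psi> \<in> ell2 I \<and> \<xi> \<in> ell2 I" if "(\<psi>, \<xi>) \<in> A" for \<psi> \<xi>
    using that adj by (auto simp: op_adjoint_def)
  have sym: "ell2_inner I \<phi> \<xi> = ell2_inner I \<eta> \<psi>" if "(\<phi>, \<eta>) \<in> A" "(\<psi>, \<xi>) \<in> A" for \<phi> \<eta> \<psi> \<xi>
  proof -
    have "(\<phi>, \<eta>) \<in> op_adjoint I A" using that(1) adj by simp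
    then show ?thesis using that(2) by (auto simp: op_adjoint_def)
  qed
  have lin: "(\<lambda>i. \<phi>1 i - c * \<phi>2 i, \<lambda>i. \<eta>1 i - c * \<eta>2 i) \<in> A"
    if "(\<phi>1, \<eta>1) \<in> A" "(\<phi>2, \<eta>2) \<in> A" for \<phi>1 \<eta>1 \<phi>2 \<eta>2 c
    using op_adjoint_comb[of A I \<phi>1 \<eta>1 \<phi>2 \<eta>2 c] el that adj by auto
  have zero: "\<psi> = (\<lambda>_. 0)" if "\<psi> \<in> ell2 I" "(\<Sum>\<^sub>\<infinity>i\<in>I. (cmod (\<psi> i))\<^sup>2) \<le> 0" for \<psi> :: "'a \<Rightarrow> complex"
  proof
    fix i show "\<psi> i = 0"
    proof (cases "i \<in> I")
      case True
      have "(cmod (\<psi> i))\<^sup>2 \<le> 0"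
        using ell2_norm_ge(1)[OF that(1) True] that(2) by (rule order_trans)
      then show ?thesis by simp
    qed (simp add: ell2_outside[OF that(1)])
  qed
  have basis: "(basis_vec i, \<lambda>j. of_real (a i) * basis_vec i j) \<in> A" if i: "i \<in> I" for i
  proof -
    let ?b = "basis_vec i"
    have e: "(\<lambda>j. c * ?b j) \<in> ell2 I" for c
      using i by (intro ell2_finite_support[of "{i}"]) (auto simp: basis_vec_def)
    have d: "(\<lambda>j. of_real c * ?b j, \<lambda>j. of_real (a i) * (of_real c * ?b j)) \<in> diag_op I a" for c
      using e[of "of_real c"] e[of "of_real (a i) * of_real c"]
      by (auto simp: diag_op_def basis_vec_def mult.assoc)
    have "(?b, \<lambda>j. of_real (a i) * (of_real (a i) * ?b j)) \<in> op_comp (diag_op I a) (diag_op I a)"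
      using d[of 1] d[of "a i"] by (auto simp: op_comp_def)
    then have "(?b, \<lambda>j. of_real (a i) * (of_real (a i) * ?b j)) \<in> op_comp A A" using sq by simp
    then obtain \<xi> where \<xi>: "(?b, \<xi>) \<in> A" "(\<xi>, \<lambda>j. of_real (a i) * (of_real (a i) * ?b j)) \<in> A"
      unfolding op_comp_def by auto
    show ?thesis
    proof (cases "a i = 0")
      case True
      then have "ell2_inner I \<xi> \<xi> = ell2_inner I (\<lambda>j. 0) ?b" using sym[OF \<xi>(2) \<xi>(1)] by simp
      also have "\<dots> = 0" by (simp add: ell2_inner_def)
      finally have "(\<Sum>\<^sub>\<infinity>i\<in>I. (cmod (\<xi> i))\<^sup>2) = 0" unfolding ell2_inner_self by simp
      then have "\<xi> = (\<lambda>_. 0)" using zero el \<xi>(1) by auto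
      then show ?thesis using \<xi>(1) True by simp
    next
      case False
      define v where "v = (\<lambda>j. \<xi> j - of_real (a i) * ?b j)"
      have v: "(v, \<lambda>j. of_real (a i) * (of_real (a i) * ?b j) - of_real (a i) * \<xi> j) \<in> A"
        unfolding v_def by (rule lin[OF \<xi>(2) \<xi>(1)])
      have "(\<lambda>j. of_real (a i) * (of_real (a i) * ?b j) - of_real (a i) * \<xi> j) = (\<lambda>j. of_real (- a i) * v j)"
        by (auto simp: v_def algebra_simps)
      then have "Re (ell2_inner I v (\<lambda>j. of_real (- a i) * v j)) \<ge> 0" using pos[OF v] by simp
      also have "ell2_inner I v (\<lambda>j. of_real (- a i) * v j) = of_real (- a i) * ell2_inner I v v"
        unfolding ell2_inner_def
        by (subst infsum_cmult_right'[symmetric]) (simp add: algebra_simps)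
      finally have "a i * (\<Sum>\<^sub>\<infinity>i\<in>I. (cmod (v i))\<^sup>2) \<le> 0"
        unfolding ell2_inner_self by simp
      then have "(\<Sum>\<^sub>\<infinity>i\<in>I. (cmod (v i))\<^sup>2) \<le> 0" using a[OF i] False by (simp add: mult_le_0_iff)
      then have "v = (\<lambda>_. 0)" using zero el v by auto
      then have "\<xi> = (\<lambda>j. of_real (a i) * ?b j)" by (auto simp: v_def fun_eq_iff)
      then show ?thesis using \<xi>(1) by simp
    qed
  qed
  have "(\<phi>, \<eta>) \<in> diag_op I a" if m: "(\<phi>, \<eta>) \<in> A" for \<phi> \<eta>
  proof -
    have "\<eta> i = of_real (a i) * \<phi> i" if i: "i \<in> I" for i
    proof -
      have "ell2_inner I \<phi> (\<lambda>j. of_real (a i) * basis_vec i j) = ell2_inner I \<eta> (basis_vec i)"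
        by (rule sym[OF m basis[OF i]])
      moreover have "ell2_inner I \<phi> (\<lambda>j. of_real (a i) * basis_vec i j) = of_real (a i) * cnj (\<phi> i)"
        unfolding ell2_inner_def by (subst infsum_single[where i=i]) (auto simp: basis_vec_def i)
      ultimately have "of_real (a i) * cnj (\<phi> i) = cnj (\<eta> i)" by (simp add: ell2_inner_basis_right i)
      then have "cnj (of_real (a i) * cnj (\<phi> i)) = \<eta> i" by simp
      then show ?thesis by simp
    qed
    then show ?thesis using el[OF m] by (auto simp: diag_op_def)
  qed
  then have sub: "A \<subseteq> diag_op I a" by auto
  \<comment> \<open>Taking adjoints reverses \<open>A\<close> \<subseteq>
    \<open>diag_op I a\<close>, and both sides are their own adjoints: a self-adjoint operator has
    no proper self-adjoint extension.\<close>
  have "(\<phi>, \<eta>) \<in> A" if m: "(\<phi>, \<eta>) \<in> diag_op I a" for \<phi> \<eta>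
  proof -
    have "ell2_inner I \<phi> \<xi> = ell2_inner I \<eta> \<psi>" if "(\<psi>, \<xi>) \<in> A" for \<psi> \<xi>
    proof -
      have "(\<phi>, \<eta>) \<in> op_adjoint I (diag_op I a)" using m op_adjoint_diag_op[of I a] by simp
      then show ?thesis using that sub by (auto simp: op_adjoint_def)
    qed
    then have "(\<phi>, \<eta>) \<in> op_adjoint I A" using m by (auto simp: op_adjoint_def diag_op_def)
    then show ?thesis by (simp add: adj)
  qed
  then show ?thesis using sub by auto
qed

lemma diag_entry_diag_op:
  assumes "i \<in> I" shows "diag_entry I (diag_op I a) i = a i"
proof -
  have "op_apply (diag_op I a) (basis_vec i) = (\<lambda>j. of_real (a i) * basis_vec i j)"
    unfolding op_apply_def
  proof (rule the_equality)
    show "(basis_vec i, \<lambda>j. of_real (a i) * basis_vec i j) \<in> diag_op I a"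
    proof -
      have "(\<lambda>j. of_real (a i) * basis_vec i j) \<in> ell2 I"
        using assms by (intro ell2_finite_support[of "{i}"]) (auto simp: basis_vec_def)
      then show ?thesis using ell2_basis_vec[OF assms] by (auto simp: diag_op_def basis_vec_def)
    qed
    fix \<xi> assume x: "(basis_vec i, \<xi>) \<in> diag_op I a"
    show "\<xi> = (\<lambda>j. of_real (a i) * basis_vec i j)"
    proof
      fix j show "\<xi> j = of_real (a i) * basis_vec i j"
        using x assms by (cases "j \<in> I") (auto simp: diag_op_def basis_vec_def ell2_def)
    qed
  qed
  then show ?thesis unfolding diag_entry_def using assms
    by (simp add: ell2_inner_basis_left) (simp add: basis_vec_def)
qed

text \<open>In the product of the adjoint with the closure the two reversals cancel, leaving
  multiplication by the squares of \<open>t\<close>. Uniqueness of positive roots then evaluates the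
  description operator in \<open>op_abs\<close>.\<close>

lemma (in index_involution) op_abs_twist_op:
  assumes sub: "T \<subseteq> twist_op I r t"
    and fin: "\<And>\<psi> \<xi> F. (\<psi>, \<xi>) \<in> twist_op I r t \<Longrightarrow> finite F \<Longrightarrow> (\<And>i. i \<notin> F \<Longrightarrow> \<psi> i = 0) \<Longrightarrow> (\<psi>, \<xi>) \<in> T"
    and sym: "\<And>i. i \<in> I \<Longrightarrow> \<bar>t (r i)\<bar> = \<bar>t i\<bar>"
  shows "op_abs I T = diag_op I (\<lambda>i. \<bar>t i\<bar>)"
proof -
  have adj: "op_adjoint I T = twist_op I r (\<lambda>i. t (r i))"
    by (rule op_adjoint_twist_op[OF sub]) (rule fin)
  have clo: "op_closure I T = twist_op I r t"
    by (rule op_closure_twist_op[OF sub]) (rule fin)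
  \<comment> \<open>The equality of operators includes their domains. The two intermediate vectors
    differ by a reindexing along \<open>r\<close>, because \<open>t\<close> and its reversal agree
    in absolute value, so they are square summable together.\<close>
  have el: "(\<lambda>i. if i \<in> I then of_real (t i) * \<psi> (r i) else 0) \<in> ell2 I \<longleftrightarrow>
      (\<lambda>i. if i \<in> I then of_real \<bar>t i\<bar> * \<psi> i else 0) \<in> ell2 I" (is "?A \<in> _ \<longleftrightarrow> ?B \<in> _") for \<psi>
  proof -
    have "(\<lambda>i. (cmod (?A i))\<^sup>2) summable_on I \<longleftrightarrow> (\<lambda>i. (cmod (?A (r i)))\<^sup>2) summable_on I"
      using summable_on_reindex_bij_betw[OF bij, of "\<lambda>i. (cmod (?A i))\<^sup>2"] by simp
    also have "\<dots> \<longleftrightarrow> (\<lambda>i. (cmod (?B i))\<^sup>2) summable_on I"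
      by (rule summable_on_cong) (simp add: r_in r_r norm_mult sym)
    finally show ?thesis by (simp add: ell2_def)
  qed
  have m: "(\<psi>, \<zeta>) \<in> op_comp (op_adjoint I T) (op_closure I T) \<longleftrightarrow>
      \<psi> \<in> ell2 I \<and> \<zeta> \<in> ell2 I \<and> (\<lambda>i. if i \<in> I then of_real (t i) * \<psi> (r i) else 0) \<in> ell2 I \<and>
      (\<forall>i\<in>I. \<zeta> i = of_real ((t i)\<^sup>2) * \<psi> i)" (is "?L \<longleftrightarrow> ?R") for \<psi> \<zeta>
  proof
    assume ?L
    then obtain \<xi> where x: "(\<psi>, \<xi>) \<in> twist_op I r t" "(\<xi>, \<zeta>) \<in> twist_op I r (\<lambda>i. t (r i))"
      unfolding adj clo op_comp_def by auto
    have "\<xi> = (\<lambda>i. if i \<in> I then of_real (t i) * \<psi> (r i) else 0)"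
      using x(1) by (auto simp: twist_op_def ell2_def)
    moreover have "\<zeta> i = of_real ((t i)\<^sup>2) * \<psi> i" if i: "i \<in> I" for i
    proof -
      have "\<zeta> i = of_real (t (r i)) * (of_real (t (r i)) * \<psi> (r (r i)))"
        using x i r_in[OF i] by (auto simp: twist_op_def)
      also have "\<dots> = of_real ((t (r i))\<^sup>2) * \<psi> i" by (simp add: r_r i power2_eq_square)
      also have "(t (r i))\<^sup>2 = (t i)\<^sup>2" using sym[OF i] by (metis power2_abs)
      finally show ?thesis .
    qed
    ultimately show ?R using x by (auto simp: twist_op_def)
  next
    assume R: ?R
    define \<xi> where "\<xi> = (\<lambda>i. if i \<in> I then of_real (t i) * \<psi> (r i) else 0)"
    have "(\<psi>, \<xi>) \<in> twist_op I r t" using R by (auto simp: twist_op_def \<xi>_def)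
    moreover have "\<zeta> i = of_real (t (r i)) * \<xi> (r i)" if i: "i \<in> I" for i
    proof -
      have "(t (r i))\<^sup>2 = (t i)\<^sup>2" using sym[OF i] by (metis power2_abs)
      then have "\<zeta> i = of_real ((t (r i))\<^sup>2) * \<psi> i" using R i by simp
      then show ?thesis using r_in r_r i by (simp add: \<xi>_def power2_eq_square)
    qed
    then have "(\<xi>, \<zeta>) \<in> twist_op I r (\<lambda>i. t (r i))" using R by (auto simp: twist_op_def \<xi>_def)
    ultimately show ?L
      unfolding adj clo op_comp_def by auto
  qed
  have d: "(\<psi>, \<zeta>) \<in> op_comp (diag_op I (\<lambda>i. \<bar>t i\<bar>)) (diag_op I (\<lambda>i. \<bar>t i\<bar>)) \<longleftrightarrow>
      \<psi> \<in> ell2 I \<and> \<zeta> \<in> ell2 I \<and> (\<lambda>i. if i \<in> I then of_real \<bar>t i\<bar> * \<psi> i else 0) \<in> ell2 I \<and>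
      (\<forall>i\<in>I. \<zeta> i = of_real ((t i)\<^sup>2) * \<psi> i)" (is "?L \<longleftrightarrow> ?R") for \<psi> \<zeta>
  proof
    assume ?L
    then obtain \<xi> where x: "(\<psi>, \<xi>) \<in> diag_op I (\<lambda>i. \<bar>t i\<bar>)" "(\<xi>, \<zeta>) \<in> diag_op I (\<lambda>i. \<bar>t i\<bar>)"
      unfolding op_comp_def by auto
    have "\<xi> = (\<lambda>i. if i \<in> I then of_real \<bar>t i\<bar> * \<psi> i else 0)"
      using x(1) by (auto simp: diag_op_def ell2_def)
    moreover have "\<zeta> i = of_real ((t i)\<^sup>2) * \<psi> i" if i: "i \<in> I" for i
    proof -
      have "\<zeta> i = of_real (\<bar>t i\<bar> * \<bar>t i\<bar>) * \<psi> i"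
        using x i unfolding diag_op_def by (simp del: abs_mult_self_eq)
      then show ?thesis by (simp only: abs_mult_self_eq power2_eq_square)
    qed
    ultimately show ?R using x by (auto simp: diag_op_def)
  next
    assume R: ?R
    define \<xi> where "\<xi> = (\<lambda>i. if i \<in> I then of_real \<bar>t i\<bar> * \<psi> i else 0)"
    have "(\<psi>, \<xi>) \<in> diag_op I (\<lambda>i. \<bar>t i\<bar>)" using R by (auto simp: diag_op_def \<xi>_def)
    moreover have "\<zeta> i = of_real \<bar>t i\<bar> * \<xi> i" if i: "i \<in> I" for i
    proof -
      have "\<zeta> i = of_real (\<bar>t i\<bar> * \<bar>t i\<bar>) * \<psi> i"
        using R i by (simp only: abs_mult_self_eq power2_eq_square)
      then show ?thesis using i by (simp add: \<xi>_def del: abs_mult_self_eq)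
    qed
    then have "(\<xi>, \<zeta>) \<in> diag_op I (\<lambda>i. \<bar>t i\<bar>)" using R by (auto simp: diag_op_def \<xi>_def)
    ultimately show ?L unfolding op_comp_def by auto
  qed
  have sq: "op_comp (op_adjoint I T) (op_closure I T) = op_comp (diag_op I (\<lambda>i. \<bar>t i\<bar>)) (diag_op I (\<lambda>i. \<bar>t i\<bar>))"
    by (intro set_eqI, clarify) (simp only: m d el)
  show ?thesis unfolding op_abs_def sq
  proof (rule the_equality)
    show "positive_self_adjoint I (diag_op I (\<lambda>i. \<bar>t i\<bar>)) \<and>
      op_comp (diag_op I (\<lambda>i. \<bar>t i\<bar>)) (diag_op I (\<lambda>i. \<bar>t i\<bar>)) = op_comp (diag_op I (\<lambda>i. \<bar>t i\<bar>)) (diag_op I (\<lambda>i. \<bar>t i\<bar>))"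
      by (simp add: positive_self_adjoint_diag_op)
    fix A assume "positive_self_adjoint I A \<and> op_comp A A =
      op_comp (diag_op I (\<lambda>i. \<bar>t i\<bar>)) (diag_op I (\<lambda>i. \<bar>t i\<bar>))"
    then show "A = diag_op I (\<lambda>i. \<bar>t i\<bar>)" by (intro positive_sqrt_unique) simp_all
  qed
qed

subsection \<open>The zeta function as a power series\<close>

lemma finite_words: "finite (words k n)"
proof -
  have "words k n = {xs. set xs \<subseteq> {1..k} \<and> length xs = n}" by (auto simp: words_def)
  then show ?thesis by (simp add: finite_lists_length_eq)
qed

definition reverse_edge :: "'a edge_index \<Rightarrow> 'a edge_index" where
  "reverse_edge = (\<lambda>(\<sigma>, p, q). (\<sigma>, q, p))"

definition dirac_coeff :: "real \<Rightarrow> 'a::real_normed_vector edge_index \<Rightarrow> real" where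
  "dirac_coeff lam = (\<lambda>(\<sigma>, p, q). inverse (lam ^ length \<sigma>) * inverse (edge_length (p, q)))"

lemma edge_reversal: "index_involution (triple_index k w) reverse_edge"
  by unfold_locales (auto simp: triple_index_def edges0_def reverse_edge_def)

lemma edge_length_swap: "edge_length (p, q) = edge_length (q, p)"
  by (simp add: edge_length_def norm_minus_commute)

lemma dirac_coeff_reverse: "dirac_coeff lam (reverse_edge i) = dirac_coeff lam i"
  by (cases i) (simp add: dirac_coeff_def reverse_edge_def edge_length_swap)

lemma dirac_coeff_pos: "0 < lam \<Longrightarrow> i \<in> triple_index k w \<Longrightarrow> dirac_coeff lam i > 0"
  by (auto simp: dirac_coeff_def triple_index_def edges0_def edge_length_def)

lemma dirac_op_eq: "dirac_op k w lam = twist_op (triple_index k w) reverse_edge (dirac_coeff lam)"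
  by (simp add: dirac_op_def twist_op_def reverse_edge_def dirac_coeff_def split_beta cong: ball_cong)

lemma function_op_eq: "function_op k w f =
   {(\<psi>, \<xi>). \<psi> \<in> ell2 (triple_index k w) \<and> \<xi> \<in> ell2 (triple_index k w) \<and>
       (\<forall>i\<in>triple_index k w. \<xi> i = f (word_map w (fst i) (fst (snd i))) * \<psi> i)}"
  by (simp add: function_op_def split_beta)

definition commutator_coeff ::
    "(nat \<Rightarrow> 'a \<Rightarrow> 'a) \<Rightarrow> real \<Rightarrow> ('a \<Rightarrow> real) \<Rightarrow> 'a::real_normed_vector edge_index \<Rightarrow> real" where
  "commutator_coeff w lam f i = dirac_coeff lam i *
     (f (word_map w (fst i) (snd (snd i))) - f (word_map w (fst i) (fst (snd i))))"

lemma op_abs_dirac_op: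
  assumes "0 < lam"
  shows "op_abs (triple_index k w) (dirac_op k w lam) =
    diag_op (triple_index k w) (\<lambda>i. \<bar>dirac_coeff lam i\<bar>)"
  unfolding dirac_op_eq
  by (rule index_involution.op_abs_twist_op[OF edge_reversal]) (auto simp: dirac_coeff_reverse)

text \<open>The natural domain of the commutator requires both products to be defined and can be
  smaller than the domain of the maximal twisted operator. It contains all finitely supported
  vectors, and that determines the adjoint and the closure.\<close>

lemma op_abs_commutator:
  fixes f :: "'a::real_normed_vector \<Rightarrow> real"
  shows "op_abs (triple_index k w) (commutator (dirac_op k w lam) (function_op k w (\<lambda>x. complex_of_real (f x)))) =
    diag_op (triple_index k w) (\<lambda>i. \<bar>commutator_coeff w lam f i\<bar>)"
proof (rule index_involution.op_abs_twist_op[OF edge_reversal])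
  let ?I = "triple_index k w" and ?t = "commutator_coeff w lam f" and ?d = "dirac_coeff lam"
  let ?D = "dirac_op k w lam" and ?F = "function_op k w (\<lambda>x. complex_of_real (f x))"
  let ?g = "\<lambda>i::'a edge_index. f (word_map w (fst i) (fst (snd i)))"
  interpret index_involution ?I reverse_edge by (rule edge_reversal)
  have t: "?t i = ?d i * (?g (reverse_edge i) - ?g i)" for i
    by (cases i) (simp add: commutator_coeff_def reverse_edge_def)
  show "\<bar>?t (reverse_edge i)\<bar> = \<bar>?t i\<bar>" if "i \<in> ?I" for i
    using r_r[OF that] by (simp add: t dirac_coeff_reverse abs_mult abs_minus_commute)
  show "commutator ?D ?F \<subseteq> twist_op ?I reverse_edge ?t"
  proof clarify
    fix \<psi> \<zeta> assume "(\<psi>, \<zeta>) \<in> commutator ?D ?F"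
    then obtain \<xi> \<eta> \<phi> \<phi>' where z: "\<zeta> = (\<lambda>i. \<xi> i - \<eta> i)"
      and 1: "(\<psi>, \<phi>) \<in> ?F" "(\<phi>, \<xi>) \<in> ?D" and 2: "(\<psi>, \<phi>') \<in> ?D" "(\<phi>', \<eta>) \<in> ?F"
      by (auto simp: commutator_def op_diff_def op_comp_def)
    have "\<zeta> i = of_real (?t i) * \<psi> (reverse_edge i)" if "i \<in> ?I" for i
      using 1 2 that r_in[OF that] by (simp add: z t dirac_op_eq function_op_eq twist_op_def algebra_simps)
    moreover have "\<zeta> \<in> ell2 ?I" unfolding z
      using 1 2 by (intro ell2_diff) (auto simp: dirac_op_eq function_op_eq twist_op_def)
    ultimately show "(\<psi>, \<zeta>) \<in> twist_op ?I reverse_edge ?t"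
      using 1 by (simp add: twist_op_def function_op_eq)
  qed
  show "(\<psi>, \<zeta>) \<in> commutator ?D ?F"
    if tw: "(\<psi>, \<zeta>) \<in> twist_op ?I reverse_edge ?t" and G: "finite G" "\<And>i. i \<notin> G \<Longrightarrow> \<psi> i = 0" for \<psi> \<zeta> G
  proof -
    have p: "\<psi> \<in> ell2 ?I" "\<zeta> \<in> ell2 ?I" "\<And>i. i \<in> ?I \<Longrightarrow> \<zeta> i = of_real (?t i) * \<psi> (reverse_edge i)"
      using tw by (auto simp: twist_op_def)
    define \<phi> where "\<phi> = (\<lambda>i. complex_of_real (?g i) * \<psi> i)"
    define \<xi> where "\<xi> = (\<lambda>i. if i \<in> ?I then complex_of_real (?d i) * \<phi> (reverse_edge i) else 0)"
    define \<phi>' where "\<phi>' = (\<lambda>i. if i \<in> ?I then complex_of_real (?d i) * \<psi> (reverse_edge i) else 0)"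
    define \<eta> where "\<eta> = (\<lambda>i. complex_of_real (?g i) * \<phi>' i)"
    have v: "\<psi> (reverse_edge i) = 0" if "i \<in> ?I" "i \<notin> reverse_edge ` (G \<inter> ?I)" for i
    proof -
      have "reverse_edge i \<notin> G"
        using that r_in[OF that(1)] r_r[OF that(1)] by (metis IntI imageI)
      then show ?thesis by (rule G(2))
    qed
    have fG: "finite (G \<inter> ?I)" "finite (reverse_edge ` (G \<inter> ?I))" "reverse_edge ` (G \<inter> ?I) \<subseteq> ?I"
      using G(1) r_in by auto
    have "\<phi> \<in> ell2 ?I"
      by (rule ell2_finite_support[OF fG(1)]) (use G(2) ell2_outside[OF p(1)] in \<open>auto simp: \<phi>_def\<close>)
    moreover have "\<xi> \<in> ell2 ?I" "\<phi>' \<in> ell2 ?I" "\<eta> \<in> ell2 ?I"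
      by (rule ell2_finite_support[OF fG(2,3)]; use v in \<open>auto simp: \<xi>_def \<phi>'_def \<eta>_def \<phi>_def\<close>)+
    ultimately have "(\<psi>, \<phi>) \<in> ?F" "(\<phi>, \<xi>) \<in> ?D" "(\<psi>, \<phi>') \<in> ?D" "(\<phi>', \<eta>) \<in> ?F"
      using p by (simp_all add: dirac_op_eq function_op_eq twist_op_def \<phi>_def \<xi>_def \<phi>'_def \<eta>_def)
    moreover have "\<zeta> = (\<lambda>i. \<xi> i - \<eta> i)"
    proof
      fix i show "\<zeta> i = \<xi> i - \<eta> i"
      proof (cases "i \<in> ?I")
        case True
        then show ?thesis by (simp add: p(3) t \<xi>_def \<eta>_def \<phi>_def \<phi>'_def algebra_simps)
      next
        case False
        then show ?thesis by (simp add: ell2_outside[OF p(2)] \<xi>_def \<eta>_def \<phi>'_def)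
      qed
    qed
    ultimately show ?thesis unfolding commutator_def op_diff_def op_comp_def by blast
  qed
qed

text \<open>The trace is a sum of nonnegative terms over a countable index set, hence the supremum
  over finite sets; the blocks of words of length less than N exhaust the index set, and the words
  of length n contribute one level energy.\<close>

lemma zeta_eq_suminf:
  fixes f :: "'a::real_normed_vector \<Rightarrow> real"
  assumes lam: "0 < lam" and fin: "finite (edges0 k w)"
  shows "zeta k w lam f s =
    (\<Sum>n. ennreal (lam powr (real n * (s - 2)) * level_form k w n (length_form k w s) f))"
proof -
  let ?I = "triple_index k w" and ?t = "commutator_coeff w lam f" and ?d = "dirac_coeff lam"
  define g where "g = (\<lambda>i. (?t i)\<^sup>2 * ?d i powr (- s))"
  define a where "a = (\<lambda>n. lam powr (real n * (s - 2)) * level_form k w n (length_form k w s) f)"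
  have g0: "g i \<ge> 0" for i by (simp add: g_def)
  have d: "diag_entry ?I (commutator_density k w lam f s) i = g i" if i: "i \<in> ?I" for i
    unfolding commutator_density_def Let_def
    using i dirac_coeff_pos[OF lam i]
    by (simp add: diag_entry_diag_op op_abs_commutator op_abs_dirac_op[OF lam] g_def)
  have level: "sum g (words k n \<times> edges0 k w) = a n" for n
  proof -
    have "g (\<sigma>, e) = lam powr (real n * (s - 2)) * (edge_length e powr (s - 2) *
        \<bar>(f \<circ> word_map w \<sigma>) (fst e) - (f \<circ> word_map w \<sigma>) (snd e)\<bar>\<^sup>2)"
      if "\<sigma> \<in> words k n" "e \<in> edges0 k w" for \<sigma> e
    proof -
      have l: "edge_length e > 0" using that by (auto simp: edges0_def edge_length_def)
      have len: "length \<sigma> = n" using that by (simp add: words_def)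
      \<comment> \<open>\<open>y\<close> is the length of the n-th level edge; the Dirac coefficient
        is its inverse, so the exponents combine to \<open>s - 2\<close>.\<close>
      define y where "y = lam powr (real n) * edge_length e"
      have y: "y > 0" "?d (\<sigma>, e) = inverse y"
        using l lam len by (simp_all add: y_def dirac_coeff_def powr_realpow split_beta)
      have "(?d (\<sigma>, e))\<^sup>2 * ?d (\<sigma>, e) powr (- s) = (inverse y) powr 2 * inverse y powr (- s)"
        using y by (simp add: powr_numeral)
      also have "\<dots> = inverse y powr (2 - s)"
        unfolding powr_add[symmetric] by simp
      also have "\<dots> = y powr (s - 2)"
        using y by (simp add: powr_minus[symmetric] inverse_powr powr_minus_divide)
      also have "\<dots> = lam powr (real n * (s - 2)) * edge_length e powr (s - 2)"
        using l lam by (simp add: y_def powr_mult powr_powr)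
      finally have 1: "(?d (\<sigma>, e))\<^sup>2 * ?d (\<sigma>, e) powr (- s) =
        lam powr (real n * (s - 2)) * edge_length e powr (s - 2)" .
      have "g (\<sigma>, e) = ((?d (\<sigma>, e))\<^sup>2 * ?d (\<sigma>, e) powr (- s)) *
          ((f \<circ> word_map w \<sigma>) (fst e) - (f \<circ> word_map w \<sigma>) (snd e))\<^sup>2"
        by (simp add: g_def commutator_coeff_def power_mult_distrib power2_commute)
      then show ?thesis unfolding 1 by simp
    qed
    note 2 = this
    have "sum g (words k n \<times> edges0 k w) = (\<Sum>\<sigma>\<in>words k n. \<Sum>e\<in>edges0 k w. g (\<sigma>, e))"
      by (simp add: sum.cartesian_product)
    also have "\<dots> = a n"
      unfolding a_def level_form_def length_form_def sum_distrib_left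
      by (intro sum.cong refl) (rule 2)
    finally show ?thesis .
  qed
  have block: "sum (\<lambda>i. ennreal (g i)) ((\<Union>n<N. words k n) \<times> edges0 k w) = (\<Sum>n<N. ennreal (a n))" for N
  proof (induction N)
    case (Suc N)
    have "((\<Union>n<Suc N. words k n) \<times> edges0 k w) =
        ((\<Union>n<N. words k n) \<times> edges0 k w) \<union> (words k N \<times> edges0 k w)"
      by (auto simp: less_Suc_eq)
    moreover have "((\<Union>n<N. words k n) \<times> edges0 k w) \<inter> (words k N \<times> edges0 k w) = {}"
      by (auto simp: words_def)
    moreover have "sum (\<lambda>i. ennreal (g i)) (words k N \<times> edges0 k w) = ennreal (a N)"
      by (subst sum_ennreal) (auto simp: g0 level)
    ultimately show ?case using Suc fin
      by (simp add: sum.union_disjoint finite_words)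
  qed simp
  have "zeta k w lam f s = infsum (\<lambda>i. ennreal (g i)) ?I"
    unfolding zeta_def op_trace_def by (rule infsum_cong) (simp add: d)
  also have "\<dots> = (SUP F\<in>{F. finite F \<and> F \<subseteq> ?I}. sum (\<lambda>i. ennreal (g i)) F)"
    by (rule nonneg_infsum_complete) simp
  also have "\<dots> = (\<Sum>n. ennreal (a n))"
  proof (rule antisym)
    show "(SUP F\<in>{F. finite F \<and> F \<subseteq> ?I}. sum (\<lambda>i. ennreal (g i)) F) \<le> (\<Sum>n. ennreal (a n))"
    proof (rule SUP_least, clarify)
      fix F assume F: "finite F" "F \<subseteq> ?I"
      have "F \<subseteq> (\<Union>n<Suc (Max (length ` fst ` F)). words k n) \<times> edges0 k w"
      proof
        fix i assume i: "i \<in> F"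
        then have "length (fst i) \<le> Max (length ` fst ` F)" using F(1) by (intro Max_ge) auto
        moreover have "i \<in> ?I" using i F(2) by (rule rev_subsetD)
        then have "fst i \<in> words k (length (fst i))" "snd i \<in> edges0 k w"
          by (auto simp: triple_index_def words_def)
        ultimately show "i \<in> (\<Union>n<Suc (Max (length ` fst ` F)). words k n) \<times> edges0 k w"
          by (cases i) force
      qed
      then have "sum (\<lambda>i. ennreal (g i)) F \<le>
          sum (\<lambda>i. ennreal (g i)) ((\<Union>n<Suc (Max (length ` fst ` F)). words k n) \<times> edges0 k w)"
        using fin by (intro sum_mono2) (auto simp: finite_words)
      also have "\<dots> \<le> (\<Sum>n. ennreal (a n))"
        unfolding block by (rule sum_le_suminf) auto
      finally show "sum (\<lambda>i. ennreal (g i)) F \<le> (\<Sum>n. ennreal (a n))" .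
    qed
    show "(\<Sum>n. ennreal (a n)) \<le> (SUP F\<in>{F. finite F \<and> F \<subseteq> ?I}. sum (\<lambda>i. ennreal (g i)) F)"
      unfolding suminf_eq_SUP
    proof (rule SUP_least)
      fix N
      show "(\<Sum>n<N. ennreal (a n)) \<le> (SUP F\<in>{F. finite F \<and> F \<subseteq> ?I}. sum (\<lambda>i. ennreal (g i)) F)"
        unfolding block[symmetric]
        by (rule SUP_upper) (use fin in \<open>auto simp: finite_words triple_index_def\<close>)
    qed
  qed
  finally show ?thesis by (simp add: a_def)
qed

subsection \<open>Limits and positive matrices over finite sets\<close>

text \<open>Bolzano-Weierstrass, one coordinate at a time. It supplies the cluster points for Perron
  vectors, energy minimisers and Cesaro means.\<close>

lemma finite_pointwise_subseq:
  fixes f :: "nat \<Rightarrow> 'a \<Rightarrow> real"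
  assumes "finite S" "\<And>n x. x \<in> S \<Longrightarrow> \<bar>f n x\<bar> \<le> B"
  shows "\<exists>r l. strict_mono (r :: nat \<Rightarrow> nat) \<and> (\<forall>x\<in>S. (\<lambda>n. f (r n) x) \<longlonglongrightarrow> l x)"
  using assms
proof (induction S)
  case empty
  show ?case by (rule exI[of _ "\<lambda>n. n"]) (simp add: strict_mono_def)
next
  case (insert y S)
  have "\<exists>r l. strict_mono (r :: nat \<Rightarrow> nat) \<and> (\<forall>x\<in>S. (\<lambda>n. f (r n) x) \<longlonglongrightarrow> l x)"
    by (rule insert.IH) (simp add: insert.prems)
  then obtain r l where r: "strict_mono (r :: nat \<Rightarrow> nat)" "\<And>x. x \<in> S \<Longrightarrow> (\<lambda>n. f (r n) x) \<longlonglongrightarrow> l x"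
    by blast
  have "bounded (range (\<lambda>n. f (r n) y))"
    using insert.prems by (auto simp: bounded_iff)
  then obtain m r' where r': "strict_mono r'" "((\<lambda>n. f (r n) y) \<circ> r') \<longlonglongrightarrow> m"
    using bounded_imp_convergent_subsequence by blast
  have "(\<lambda>n. f ((r \<circ> r') n) x) \<longlonglongrightarrow> (l(y := m)) x" if "x \<in> insert y S" for x
    using that r' LIMSEQ_subseq_LIMSEQ[OF r(2), of x r'] insert.hyps by (auto simp: o_def)
  then show ?case using strict_mono_o[OF r(1) r'(1)] by blast
qed

lemma finite_pos_lower_bound:
  fixes f :: "'a \<Rightarrow> real"
  assumes "finite S" "\<And>x. x \<in> S \<Longrightarrow> f x > 0"
  shows "\<exists>c>0. \<forall>x\<in>S. c \<le> f x"
  using assms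
proof (induction S)
  case (insert y S)
  then obtain c where "c > 0" "\<forall>x\<in>S. c \<le> f x" by auto
  then show ?case using insert.prems[of y] by (intro exI[of _ "min c (f y)"]) auto
qed (auto intro: exI[of _ 1])

lemma finite_upper_bound:
  fixes f :: "'a \<Rightarrow> real"
  assumes "finite S"
  shows "\<exists>K>0. \<forall>x\<in>S. f x \<le> K"
  using assms
proof (induction S)
  case (insert y S)
  then obtain c where "c > 0" "\<forall>x\<in>S. f x \<le> c" by auto
  then show ?case by (intro exI[of _ "max c (f y)"]) auto
qed (auto intro: exI[of _ 1])

definition mat_apply :: "'a set \<Rightarrow> ('a \<Rightarrow> 'a \<Rightarrow> real) \<Rightarrow> ('a \<Rightarrow> real) \<Rightarrow> 'a \<Rightarrow> real" where
  "mat_apply S a v = (\<lambda>q. \<Sum>r\<in>S. a q r * v r)"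

text \<open>The eigenvalue is the largest \<open>t\<close> for which some probability vector satisfies \<open>A v \<ge> t v\<close>.\<close>

lemma perron_vector:
  assumes S: "finite S" "S \<noteq> {}" and a: "\<And>q r. q \<in> S \<Longrightarrow> r \<in> S \<Longrightarrow> a q r > 0"
  shows "\<exists>u \<eta>. \<eta> > 0 \<and> (\<forall>q\<in>S. u q > 0 \<and> mat_apply S a u q = \<eta> * u q)"
proof -
  define R where "R = {t. \<exists>v. (\<forall>q\<in>S. v q \<ge> 0) \<and> sum v S = 1 \<and> (\<forall>q\<in>S. t * v q \<le> mat_apply S a v q)}"
  define B where "B = (\<Sum>q\<in>S. \<Sum>r\<in>S. a q r)"
  have le1: "v q \<le> 1" if "\<forall>q\<in>S. v q \<ge> 0" "sum v S = 1" "q \<in> S" for v :: "'a \<Rightarrow> real" and q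
    using member_le_sum[of q S v] that S by auto
  have RB: "t \<le> B" if "t \<in> R" for t
  proof -
    have "\<exists>v. (\<forall>q\<in>S. v q \<ge> 0) \<and> sum v S = 1 \<and> (\<forall>q\<in>S. t * v q \<le> mat_apply S a v q)"
      using that by (simp add: R_def)
    then obtain v where v: "(\<forall>q\<in>S. v q \<ge> 0) \<and> sum v S = 1 \<and> (\<forall>q\<in>S. t * v q \<le> mat_apply S a v q)"
      by (rule exE)
    have v: "\<forall>q\<in>S. v q \<ge> 0" "sum v S = 1" "\<forall>q\<in>S. t * v q \<le> mat_apply S a v q"
      using v by simp_all
    have "t = (\<Sum>q\<in>S. t * v q)" using v(2) by (simp add: sum_distrib_left[symmetric])
    also have "\<dots> \<le> (\<Sum>q\<in>S. mat_apply S a v q)" using v(3) by (intro sum_mono) auto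
    also have "\<dots> \<le> B" unfolding B_def mat_apply_def
      by (intro sum_mono) (use a le1[OF v(1,2)] in \<open>auto intro!: mult_left_le less_imp_le\<close>)
    finally show ?thesis .
  qed
  have R0: "0 \<in> R"
    unfolding R_def
  proof (intro CollectI exI[of _ "\<lambda>_. 1 / real (card S)"] conjI ballI)
    fix q assume q: "q \<in> S"
    show "0 * (1 / real (card S)) \<le> mat_apply S a (\<lambda>_. 1 / real (card S)) q"
      unfolding mat_apply_def
      by (simp, intro sum_nonneg divide_nonneg_nonneg) (use less_imp_le[OF a[OF q]] in simp_all)
  qed (use S in simp_all)
  have ne: "R \<noteq> {}" using R0 by auto
  have bdd: "bdd_above R" by (rule bdd_aboveI) (rule RB)
  define \<eta> where "\<eta> = Sup R"
  have "\<exists>t\<in>R. \<eta> - 1 / real (Suc n) < t" for n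
    unfolding \<eta>_def using ne bdd by (intro less_cSupD) auto
  then have "\<forall>n. \<exists>t. t \<in> R \<and> \<eta> - 1 / real (Suc n) < t" by blast
  from choice[OF this] obtain t where "\<forall>n. t n \<in> R \<and> \<eta> - 1 / real (Suc n) < t n" by (rule exE)
  then have t: "t n \<in> R" "\<eta> - 1 / real (Suc n) < t n" for n by simp_all
  have "\<forall>n. \<exists>v. (\<forall>q\<in>S. v q \<ge> 0) \<and> sum v S = 1 \<and> (\<forall>q\<in>S. t n * v q \<le> mat_apply S a v q)"
    using t(1) unfolding R_def by simp
  from choice[OF this] obtain V where
    V: "\<forall>n. (\<forall>q\<in>S. V n q \<ge> 0) \<and> sum (V n) S = 1 \<and> (\<forall>q\<in>S. t n * V n q \<le> mat_apply S a (V n) q)"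
    by (rule exE)
  have V: "\<forall>q\<in>S. V n q \<ge> 0" "sum (V n) S = 1" "\<forall>q\<in>S. t n * V n q \<le> mat_apply S a (V n) q" for n
    using spec[OF V, of n] by simp_all
  have V1: "\<bar>V n x\<bar> \<le> 1" if "x \<in> S" for n x
    using le1[OF V(1,2) that, of n] V(1)[of n] that by simp
  have "\<exists>r l. strict_mono (r :: nat \<Rightarrow> nat) \<and> (\<forall>x\<in>S. (\<lambda>n. V (r n) x) \<longlonglongrightarrow> l x)"
    by (rule finite_pointwise_subseq[OF S(1) V1])
  then obtain r v where r: "strict_mono (r :: nat \<Rightarrow> nat)" and v: "\<And>x. x \<in> S \<Longrightarrow> (\<lambda>n. V (r n) x) \<longlonglongrightarrow> v x"
    by blast
  have tl: "t \<longlonglongrightarrow> \<eta>"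
  proof (rule tendsto_sandwich)
    show "\<forall>\<^sub>F n in sequentially. \<eta> - 1 / real (Suc n) \<le> t n"
      by (intro always_eventually allI less_imp_le t(2))
    show "\<forall>\<^sub>F n in sequentially. t n \<le> \<eta>" 
      unfolding \<eta>_def by (intro always_eventually allI cSup_upper t(1) bdd)
    show "(\<lambda>n. \<eta> - 1 / real (Suc n)) \<longlonglongrightarrow> \<eta>"
      using tendsto_diff[OF tendsto_const LIMSEQ_inverse_real_of_nat, of \<eta>] by (simp add: inverse_eq_divide)
  qed simp
  have v0: "v q \<ge> 0" if "q \<in> S" for q
    using V(1) that by (intro LIMSEQ_le_const[OF v[OF that]]) auto
  have v1: "sum v S = 1"
  proof (rule LIMSEQ_unique)
    show "(\<lambda>n. sum (V (r n)) S) \<longlonglongrightarrow> sum v S" by (intro tendsto_sum v)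
  qed (simp add: V(2))
  have lim: "(\<lambda>n. mat_apply S a (V (r n)) q) \<longlonglongrightarrow> mat_apply S a v q" for q
    unfolding mat_apply_def by (intro tendsto_sum tendsto_mult tendsto_const v)
  have vA: "\<eta> * v q \<le> mat_apply S a v q" if "q \<in> S" for q
  proof (rule LIMSEQ_le[OF _ lim])
    show "(\<lambda>n. t (r n) * V (r n) q) \<longlonglongrightarrow> \<eta> * v q"
      using LIMSEQ_subseq_LIMSEQ[OF tl r] v[OF that] by (intro tendsto_mult) (auto simp: o_def)
  qed (use V(3) that in auto)
  have "\<exists>q\<in>S. v q \<noteq> 0" by (rule ccontr) (use v1 in simp)
  then obtain q1 where q1: "q1 \<in> S" "v q1 > 0" using v0 by fastforce
  define y where "y = mat_apply S a v"
  have ypos: "y q > 0" if "q \<in> S" for q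
    unfolding y_def mat_apply_def
    by (rule sum_pos2[OF S(1) q1(1)])
      (use a[OF that q1(1)] q1 v0 less_imp_le[OF a[OF that]] in \<open>simp_all\<close>)
  \<comment> \<open>If one coordinate of \<open>A v - t v\<close> with t = \<eta> were positive,
    applying the strictly positive matrix once more would make all coordinates positive; then
    \<open>y = A v\<close> would allow a larger value than the supremum \<eta>.\<close>
  have eq: "y q = \<eta> * v q" if q: "q \<in> S" for q
  proof (rule ccontr)
    assume "y q \<noteq> \<eta> * v q"
    then have gt: "y q - \<eta> * v q > 0" using vA[OF q] by (simp add: y_def)
    have pos: "mat_apply S a y p - \<eta> * y p > 0" if p: "p \<in> S" for p
    proof -
      have "mat_apply S a y p - \<eta> * y p = (\<Sum>r\<in>S. a p r * (y r - \<eta> * v r))"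
        unfolding mat_apply_def y_def[unfolded mat_apply_def]
        by (simp add: sum_subtractf[symmetric] sum_distrib_left algebra_simps)
      also have "\<dots> > 0"
        by (rule sum_pos2[OF S(1) q])
          (use a[OF p q] gt less_imp_le[OF a[OF p]] vA in \<open>simp_all add: y_def\<close>)
      finally show ?thesis .
    qed
    obtain c where c: "c > 0" "\<forall>p\<in>S. c \<le> (mat_apply S a y p - \<eta> * y p) / y p"
      using finite_pos_lower_bound[OF S(1), of "\<lambda>p. (mat_apply S a y p - \<eta> * y p) / y p"] pos ypos
      by (auto simp: divide_pos_pos)
    have ys: "sum y S > 0" using ypos S by (intro sum_pos) auto
    define z where "z = (\<lambda>p. y p / sum y S)"
    have "(\<eta> + c) * z p \<le> mat_apply S a z p" if p: "p \<in> S" for p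
    proof -
      have "c * y p \<le> mat_apply S a y p - \<eta> * y p"
      proof -
        have "c \<le> (mat_apply S a y p - \<eta> * y p) / y p" using c(2) p by blast
        then show ?thesis using pos_le_divide_eq[OF ypos[OF p]] by blast
      qed
      then have "(\<eta> + c) * y p \<le> mat_apply S a y p" by (simp add: algebra_simps)
      then have "(\<eta> + c) * y p / sum y S \<le> mat_apply S a y p / sum y S"
        using ys by (intro divide_right_mono) auto
      then show ?thesis by (simp add: z_def mat_apply_def sum_divide_distrib)
    qed
    moreover have "sum z S = 1" using ys by (simp add: z_def sum_divide_distrib[symmetric])
    moreover have "\<forall>p\<in>S. z p \<ge> 0" using ypos ys by (auto simp: z_def intro!: divide_nonneg_nonneg less_imp_le)
    ultimately have "\<eta> + c \<in> R" unfolding R_def by (intro CollectI exI[of _ z] conjI ballI) simp_all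
    then have "\<eta> + c \<le> \<eta>" using bdd unfolding \<eta>_def by (intro cSup_upper)
    then show False using c by simp
  qed
  have "\<eta> \<ge> 0" unfolding \<eta>_def using R0 bdd by (rule cSup_upper)
  then have "\<eta> > 0" using ypos[OF q1(1)] eq[OF q1(1)] by (cases "\<eta> = 0") auto
  moreover have "v q > 0" if "q \<in> S" for q
    using ypos[OF that] eq[OF that] v0[OF that] by (cases "v q = 0") auto
  ultimately show ?thesis using eq unfolding y_def by blast
qed

text \<open>Conjugation by \<open>u\<close> turns \<open>a\<close> into \<eta> times a stochastic
  matrix with positive entries, and such a matrix contracts the oscillation of a vector. The ratios
  of the iterates to \<eta>^n \<open>u\<close> thus stay in intervals whose lengths decrease
  geometrically. The normalisation of \<open>v\<close> keeps the lower ends above \<kappa>, so the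
  error is small relative to the limit and uniform in \<open>v\<close>.\<close>

lemma perron_convergence:
  assumes S: "finite S" "S \<noteq> {}" and a: "\<And>q r. q \<in> S \<Longrightarrow> r \<in> S \<Longrightarrow> a q r > 0"
    and \<eta>: "\<eta> > 0" and u: "\<And>q. q \<in> S \<Longrightarrow> u q > 0 \<and> mat_apply S a u q = \<eta> * u q"
  shows "\<exists>\<kappa>>0. \<exists>\<theta>. \<theta> \<longlonglongrightarrow> 0 \<and> (\<forall>n v. (\<forall>q\<in>S. 0 \<le> v q \<and> v q \<le> 1) \<longrightarrow> (\<exists>q\<in>S. v q = 1) \<longrightarrow>
    (\<exists>\<alpha>\<ge>\<kappa> * \<eta> ^ Suc n. \<forall>q\<in>S. \<bar>(mat_apply S a ^^ Suc n) v q - \<alpha> * u q\<bar> \<le> \<theta> n * \<alpha> * u q))"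
proof -
  obtain r0 where r0: "r0 \<in> S" using S by auto
  have pos: "a q r / (\<eta> * u q) > 0" "a q r0 * u r0 / (\<eta> * u q) > 0" if "q \<in> S" "r \<in> S" for q r
    using a u \<eta> r0 that by auto
  obtain \<kappa> where \<kappa>: "\<kappa> > 0" "\<forall>x\<in>S \<times> S. \<kappa> \<le> a (fst x) (snd x) / (\<eta> * u (fst x))"
    using finite_pos_lower_bound[of "S \<times> S" "\<lambda>x. a (fst x) (snd x) / (\<eta> * u (fst x))"] S pos by auto
  obtain K where K: "K > 0" "\<forall>q\<in>S. (\<Sum>r\<in>S. a q r) / (\<eta> * u q) \<le> K"
    using finite_upper_bound[OF S(1), of "\<lambda>q. (\<Sum>r\<in>S. a q r) / (\<eta> * u q)"] by auto
  \<comment> \<open>The minorisation constant: every row of the stochastic matrix gives at least the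
    weight \<open>c\<close> to the coordinate \<open>r0\<close>.\<close>
  obtain c where c: "c > 0" "\<forall>q\<in>S. c \<le> a q r0 * u r0 / (\<eta> * u q)"
    using finite_pos_lower_bound[OF S(1), of "\<lambda>q. a q r0 * u r0 / (\<eta> * u q)"] pos r0 by auto
  have c': "c * (\<eta> * u q) \<le> a q r0 * u r0" if "q \<in> S" for q
  proof -
    have "\<eta> * u q > 0" using u \<eta> that by auto
    moreover have "c \<le> a q r0 * u r0 / (\<eta> * u q)" using c(2) that by blast
    ultimately show ?thesis using pos_le_divide_eq by blast
  qed
  have "a r0 r0 * u r0 \<le> mat_apply S a u r0"
    unfolding mat_apply_def using member_le_sum[of r0 S "\<lambda>r. a r0 r * u r"] S r0 a u
    by (simp add: less_imp_le)
  also have "\<dots> = \<eta> * u r0" using u[OF r0] by blast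
  finally have "c * (\<eta> * u r0) \<le> 1 * (\<eta> * u r0)" using c'[OF r0] by linarith
  then have c1: "c \<le> 1" using u[OF r0] \<eta> by (simp add: mult_le_cancel_right)
  have claim: "\<exists>m M. \<kappa> \<le> m \<and> m \<le> M \<and> M - m \<le> (1 - c) ^ n * (K + \<kappa>) \<and>
      (\<forall>q\<in>S. m * (\<eta> ^ Suc n * u q) \<le> (mat_apply S a ^^ Suc n) v q \<and>
             (mat_apply S a ^^ Suc n) v q \<le> M * (\<eta> ^ Suc n * u q))"
    if v: "\<forall>q\<in>S. 0 \<le> v q \<and> v q \<le> 1" "\<exists>q\<in>S. v q = 1" for v n
  proof (induction n)
    case 0
    obtain q1 where q1: "q1 \<in> S" "v q1 = 1" using v by auto
    \<comment> \<open>Starting interval. The upper end is \<open>K + \<kappa>\<close> rather than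
      \<open>K\<close> so that it visibly exceeds the lower end \<kappa>.\<close>
    have "\<kappa> * (\<eta> * u q) \<le> mat_apply S a v q \<and> mat_apply S a v q \<le> (K + \<kappa>) * (\<eta> * u q)" if q: "q \<in> S" for q
    proof
      have p: "\<eta> * u q > 0" using u \<eta> q by auto
      have "\<kappa> * (\<eta> * u q) \<le> a q q1" using \<kappa>(2) q q1 p by (auto simp: pos_le_divide_eq)
      also have "\<dots> \<le> mat_apply S a v q"
        unfolding mat_apply_def using member_le_sum[of q1 S "\<lambda>r. a q r * v r"] S q1 a v q
        by (simp add: less_imp_le)
      finally show "\<kappa> * (\<eta> * u q) \<le> mat_apply S a v q" .
      have "mat_apply S a v q \<le> (\<Sum>r\<in>S. a q r)"
        unfolding mat_apply_def using a v q by (intro sum_mono mult_left_le) (auto intro: less_imp_le)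
      also have "\<dots> \<le> K * (\<eta> * u q)" using K(2) q p by (auto simp: pos_divide_le_eq)
      also have "\<dots> \<le> (K + \<kappa>) * (\<eta> * u q)" using p \<kappa>(1) by (intro mult_right_mono) auto
      finally show "mat_apply S a v q \<le> (K + \<kappa>) * (\<eta> * u q)" .
    qed
    then show ?case using \<kappa>(1) K(1) by (intro exI[of _ \<kappa>] exI[of _ "K + \<kappa>"]) auto
  next
    case (Suc n)
    define y where "y = (mat_apply S a ^^ Suc n) v"
    define h where "h = \<eta> ^ Suc n"
    have h: "h > 0" using \<eta> by (simp add: h_def)
    obtain m M where mM: "\<kappa> \<le> m" "m \<le> M" "M - m \<le> (1 - c) ^ n * (K + \<kappa>)"
       "\<And>q. q \<in> S \<Longrightarrow> m * (h * u q) \<le> y q \<and> y q \<le> M * (h * u q)"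
      using Suc unfolding y_def[symmetric] h_def[symmetric] by blast
    define x where "x = y r0 / (h * u r0)"
    have hu: "h * u r0 > 0" using h u r0 by auto
    have x: "y r0 = x * (h * u r0)" "m \<le> x" "x \<le> M"
      using hu mM(4)[OF r0] by (auto simp: x_def pos_le_divide_eq pos_divide_le_eq)
    have Au: "mat_apply S a (\<lambda>q. t * (h * u q)) q = t * (\<eta> * h * u q)" if "q \<in> S" for q t
    proof -
      have "mat_apply S a (\<lambda>q. t * (h * u q)) q = t * h * mat_apply S a u q"
        unfolding mat_apply_def sum_distrib_left by (rule sum.cong) (auto simp: algebra_simps)
      then show ?thesis using u[OF that] by simp
    qed
    \<comment> \<open>Of the sum of nonnegative terms only the one at \<open>r0\<close> is kept: the
      lower end moves up by the fraction \<open>c\<close> of its distance to the ratio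
      \<open>x\<close> at \<open>r0\<close>. The upper end moves down likewise, and together the
      width shrinks by the factor \<open>1 - c\<close>.\<close>
    have lo: "(m + c * (x - m)) * (\<eta> * h * u q) \<le> mat_apply S a y q" if q: "q \<in> S" for q
    proof -
      have "(c * (\<eta> * u q)) * (h * (x - m)) \<le> (a q r0 * u r0) * (h * (x - m))"
        using c'[OF q] h x by (intro mult_right_mono) auto
      also have "\<dots> = a q r0 * (y r0 - m * (h * u r0))" by (simp add: x(1) algebra_simps)
      also have "\<dots> \<le> (\<Sum>r\<in>S. a q r * (y r - m * (h * u r)))"
        using mM(4) a[OF q] S r0
        by (intro member_le_sum) (auto intro!: mult_nonneg_nonneg less_imp_le[OF a[OF q]])
      also have "\<dots> = mat_apply S a y q - mat_apply S a (\<lambda>q. m * (h * u q)) q"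
        unfolding mat_apply_def by (simp add: sum_subtractf[symmetric] algebra_simps)
      also have "\<dots> = mat_apply S a y q - m * (\<eta> * h * u q)" by (simp only: Au[OF q])
      finally show ?thesis by (simp add: algebra_simps)
    qed
    have hi: "mat_apply S a y q \<le> (M - c * (M - x)) * (\<eta> * h * u q)" if q: "q \<in> S" for q
    proof -
      have "(c * (\<eta> * u q)) * (h * (M - x)) \<le> (a q r0 * u r0) * (h * (M - x))"
        using c'[OF q] h x by (intro mult_right_mono) auto
      also have "\<dots> = a q r0 * (M * (h * u r0) - y r0)" by (simp add: x(1) algebra_simps)
      also have "\<dots> \<le> (\<Sum>r\<in>S. a q r * (M * (h * u r) - y r))"
        using mM(4) a[OF q] S r0
        by (intro member_le_sum) (auto intro!: mult_nonneg_nonneg less_imp_le[OF a[OF q]])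
      also have "\<dots> = mat_apply S a (\<lambda>q. M * (h * u q)) q - mat_apply S a y q"
        unfolding mat_apply_def by (simp add: sum_subtractf[symmetric] algebra_simps)
      also have "\<dots> = M * (\<eta> * h * u q) - mat_apply S a y q" by (simp only: Au[OF q])
      finally show ?thesis by (simp add: algebra_simps)
    qed
    have "(1 - c) * (M - m) \<le> (1 - c) * ((1 - c) ^ n * (K + \<kappa>))"
      using mM(3) c1 by (intro mult_left_mono) auto
    then have d: "(M - c * (M - x)) - (m + c * (x - m)) \<le> (1 - c) ^ Suc n * (K + \<kappa>)"
      by (simp add: algebra_simps)
    have k: "\<kappa> \<le> m + c * (x - m)" using mM(1) x c(1) by (simp add: add_increasing2)
    have "0 \<le> (1 - c) * (M - m)" using c1 mM(2) by simp
    then have l: "m + c * (x - m) \<le> M - c * (M - x)" by (simp add: algebra_simps)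
    show ?case
      by (rule exI[of _ "m + c * (x - m)"], rule exI[of _ "M - c * (M - x)"])
        (use d k l lo hi in \<open>auto simp: y_def h_def mult.assoc\<close>)
  qed
  show ?thesis
  proof (rule exI[of _ \<kappa>], rule conjI[OF \<kappa>(1)],
      rule exI[of _ "\<lambda>n. (1 - c) ^ n * ((K + \<kappa>) / \<kappa>)"], rule conjI)
    have "(\<lambda>n. (1 - c) ^ n * ((K + \<kappa>) / \<kappa>)) \<longlonglongrightarrow> 0 * ((K + \<kappa>) / \<kappa>)"
      using c c1 by (intro tendsto_mult tendsto_const LIMSEQ_power_zero) auto
    then show "(\<lambda>n. (1 - c) ^ n * ((K + \<kappa>) / \<kappa>)) \<longlonglongrightarrow> 0" by simp
  next
    show "\<forall>n v. (\<forall>q\<in>S. 0 \<le> v q \<and> v q \<le> 1) \<longrightarrow> (\<exists>q\<in>S. v q = 1) \<longrightarrow>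
      (\<exists>\<alpha>\<ge>\<kappa> * \<eta> ^ Suc n. \<forall>q\<in>S. \<bar>(mat_apply S a ^^ Suc n) v q - \<alpha> * u q\<bar> \<le>
        (1 - c) ^ n * ((K + \<kappa>) / \<kappa>) * \<alpha> * u q)"
    proof (rule allI, rule allI, rule impI, rule impI)
    fix n and v :: "'a \<Rightarrow> real" assume v: "\<forall>q\<in>S. 0 \<le> v q \<and> v q \<le> 1" "\<exists>q\<in>S. v q = 1"
    obtain m M where mM: "\<kappa> \<le> m" "m \<le> M" "M - m \<le> (1 - c) ^ n * (K + \<kappa>)"
       "\<And>q. q \<in> S \<Longrightarrow> m * (\<eta> ^ Suc n * u q) \<le> (mat_apply S a ^^ Suc n) v q \<and>
             (mat_apply S a ^^ Suc n) v q \<le> M * (\<eta> ^ Suc n * u q)"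
      using claim[OF v, of n] by blast
    have "\<bar>(mat_apply S a ^^ Suc n) v q - m * \<eta> ^ Suc n * u q\<bar> \<le>
        (1 - c) ^ n * ((K + \<kappa>) / \<kappa>) * (m * \<eta> ^ Suc n) * u q" if q: "q \<in> S" for q
    proof -
      have hu: "\<eta> ^ Suc n * u q > 0" using \<eta> u q by (intro mult_pos_pos) auto
      have "\<bar>(mat_apply S a ^^ Suc n) v q - m * \<eta> ^ Suc n * u q\<bar> \<le> (M - m) * (\<eta> ^ Suc n * u q)"
        using mM(4)[OF q] by (simp add: left_diff_distrib mult.assoc abs_le_iff)
      also have "\<dots> \<le> ((1 - c) ^ n * (K + \<kappa>)) * (\<eta> ^ Suc n * u q)"
        using mM(3) hu by (intro mult_right_mono) auto
      \<comment> \<open>The factor \<open>m / \<kappa>\<close> is at least 1; it converts the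
        absolute error into one relative to \<alpha> = \<open>m * \<eta> ^ Suc n\<close>.\<close>
      also have "\<dots> \<le> ((1 - c) ^ n * (K + \<kappa>)) * (\<eta> ^ Suc n * u q) * (m / \<kappa>)"
        proof -
        have "1 \<le> m / \<kappa>" using mM(1) \<kappa>(1) by (simp add: pos_le_divide_eq)
        moreover have "0 \<le> ((1 - c) ^ n * (K + \<kappa>)) * (\<eta> ^ Suc n * u q)"
          using \<kappa>(1) K(1) less_imp_le[OF hu] c1 by (intro mult_nonneg_nonneg[of "(1 - c) ^ n * (K + \<kappa>)"]) auto
        ultimately show ?thesis using mult_left_mono by fastforce
      qed
      finally show ?thesis by (simp add: field_simps)
    qed
    then show "\<exists>\<alpha>\<ge>\<kappa> * \<eta> ^ Suc n. \<forall>q\<in>S. \<bar>(mat_apply S a ^^ Suc n) v q - \<alpha> * u q\<bar> \<le>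
        (1 - c) ^ n * ((K + \<kappa>) / \<kappa>) * \<alpha> * u q"
      using mM(1) \<eta> by (intro exI[of _ "m * \<eta> ^ Suc n"] conjI mult_right_mono) auto
    qed
  qed
qed

subsection \<open>Quadratic forms on function spaces\<close>

definition fun_subspace :: "('a \<Rightarrow> real) set \<Rightarrow> bool" where
  "fun_subspace F \<longleftrightarrow> (\<forall>f\<in>F. \<forall>g\<in>F. (\<lambda>x. f x + g x) \<in> F) \<and> (\<forall>f\<in>F. \<forall>t. (\<lambda>x. t * f x) \<in> F)"

lemma fun_subspace_add: "fun_subspace F \<Longrightarrow> f \<in> F \<Longrightarrow> g \<in> F \<Longrightarrow> (\<lambda>x. f x + g x) \<in> F"
  and fun_subspace_scale: "fun_subspace F \<Longrightarrow> f \<in> F \<Longrightarrow> (\<lambda>x. t * f x) \<in> F"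
  by (auto simp: fun_subspace_def)

lemma fun_subspace_diff: "fun_subspace F \<Longrightarrow> f \<in> F \<Longrightarrow> g \<in> F \<Longrightarrow> (\<lambda>x. f x - g x) \<in> F"
  using fun_subspace_add[of F f "\<lambda>x. (-1) * g x"] fun_subspace_scale[of F g "-1"] by simp

text \<open>Parallelogram law and homogeneity instead of a bilinear form: both pass directly to
  pointwise limits and to infima over extensions, where no bilinear form is at hand.\<close>

definition quadratic_on :: "('a \<Rightarrow> real) set \<Rightarrow> (('a \<Rightarrow> real) \<Rightarrow> real) \<Rightarrow> bool" where
  "quadratic_on F q \<longleftrightarrow>
    (\<forall>f\<in>F. \<forall>g\<in>F. q (\<lambda>x. f x + g x) + q (\<lambda>x. f x - g x) = 2 * q f + 2 * q g) \<and>
    (\<forall>f\<in>F. \<forall>t. q (\<lambda>x. t * f x) = t\<^sup>2 * q f)"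

definition polar :: "(('a \<Rightarrow> real) \<Rightarrow> real) \<Rightarrow> ('a \<Rightarrow> real) \<Rightarrow> ('a \<Rightarrow> real) \<Rightarrow> real" where
  "polar q f g = (q (\<lambda>x. f x + g x) - q (\<lambda>x. f x - g x)) / 4"

lemma quadratic_onI:
  assumes "\<And>f g. f \<in> F \<Longrightarrow> g \<in> F \<Longrightarrow> q (\<lambda>x. f x + g x) + q (\<lambda>x. f x - g x) = 2 * q f + 2 * q g"
    and "\<And>f t. f \<in> F \<Longrightarrow> q (\<lambda>x. t * f x) = t\<^sup>2 * q f"
  shows "quadratic_on F q"
  using assms by (auto simp: quadratic_on_def)

lemma quadratic_on_parallelogram:
  "quadratic_on F q \<Longrightarrow> f \<in> F \<Longrightarrow> g \<in> F \<Longrightarrow> q (\<lambda>x. f x + g x) + q (\<lambda>x. f x - g x) = 2 * q f + 2 * q g"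
  by (auto simp: quadratic_on_def)

lemma quadratic_on_scale: "quadratic_on F q \<Longrightarrow> f \<in> F \<Longrightarrow> q (\<lambda>x. t * f x) = t\<^sup>2 * q f"
  by (auto simp: quadratic_on_def)

lemma quadratic_on_subset: "quadratic_on F q \<Longrightarrow> G \<subseteq> F \<Longrightarrow> quadratic_on G q"
  unfolding quadratic_on_def by blast

lemma quadratic_on_comb:
  assumes "quadratic_on F q" "quadratic_on F q'"
  shows "quadratic_on F (\<lambda>f. s * q f + t * q' f)"
proof (rule quadratic_onI)
  fix f g assume "f \<in> F" "g \<in> F"
  note p = quadratic_on_parallelogram[OF assms(1) this] quadratic_on_parallelogram[OF assms(2) this]
  have "s * q (\<lambda>x. f x + g x) + t * q' (\<lambda>x. f x + g x) + (s * q (\<lambda>x. f x - g x) + t * q' (\<lambda>x. f x - g x)) =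
    s * (q (\<lambda>x. f x + g x) + q (\<lambda>x. f x - g x)) + t * (q' (\<lambda>x. f x + g x) + q' (\<lambda>x. f x - g x))"
    by (simp add: algebra_simps)
  also have "\<dots> = 2 * (s * q f + t * q' f) + 2 * (s * q g + t * q' g)"
    unfolding p by (simp add: algebra_simps)
  finally show "s * q (\<lambda>x. f x + g x) + t * q' (\<lambda>x. f x + g x) + (s * q (\<lambda>x. f x - g x) + t * q' (\<lambda>x. f x - g x)) =
     2 * (s * q f + t * q' f) + 2 * (s * q g + t * q' g)" .
qed (simp add: quadratic_on_scale[OF assms(1)] quadratic_on_scale[OF assms(2)] algebra_simps)

lemma quadratic_on_sum:
  assumes "\<And>i. i \<in> J \<Longrightarrow> quadratic_on F (q i)"
  shows "quadratic_on F (\<lambda>f. \<Sum>i\<in>J. q i f)"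
proof (rule quadratic_onI)
  fix f g assume fg: "f \<in> F" "g \<in> F"
  have "(\<Sum>i\<in>J. q i (\<lambda>x. f x + g x)) + (\<Sum>i\<in>J. q i (\<lambda>x. f x - g x)) = (\<Sum>i\<in>J. 2 * q i f + 2 * q i g)"
    unfolding sum.distrib[symmetric]
    by (rule sum.cong[OF refl]) (rule quadratic_on_parallelogram[OF assms fg])
  then show "(\<Sum>i\<in>J. q i (\<lambda>x. f x + g x)) + (\<Sum>i\<in>J. q i (\<lambda>x. f x - g x)) = 2 * (\<Sum>i\<in>J. q i f) + 2 * (\<Sum>i\<in>J. q i g)"
    by (simp add: sum.distrib sum_distrib_left)
qed (simp add: quadratic_on_scale[OF assms] sum_distrib_left)

lemma quadratic_on_limit:
  assumes sub: "fun_subspace F" and q: "\<And>n::nat. quadratic_on F (q n)" and l: "\<And>f. f \<in> F \<Longrightarrow> (\<lambda>n. q n f) \<longlonglongrightarrow> Q f"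
  shows "quadratic_on F Q"
proof (rule quadratic_onI)
  note diff = fun_subspace_diff[OF sub]
  fix f g assume fg: "f \<in> F" "g \<in> F"
  have "(\<lambda>n. q n (\<lambda>x. f x + g x) + q n (\<lambda>x. f x - g x)) \<longlonglongrightarrow> Q (\<lambda>x. f x + g x) + Q (\<lambda>x. f x - g x)"
    using sub fg diff by (intro tendsto_add l) (auto simp: fun_subspace_def)
  then have "(\<lambda>n. 2 * q n f + 2 * q n g) \<longlonglongrightarrow> Q (\<lambda>x. f x + g x) + Q (\<lambda>x. f x - g x)"
    using quadratic_on_parallelogram[OF q fg] by simp
  moreover have "(\<lambda>n. 2 * q n f + 2 * q n g) \<longlonglongrightarrow> 2 * Q f + 2 * Q g"
    using fg by (intro tendsto_add tendsto_mult tendsto_const l)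
  ultimately show "Q (\<lambda>x. f x + g x) + Q (\<lambda>x. f x - g x) = 2 * Q f + 2 * Q g" by (rule LIMSEQ_unique)
next
  fix f t assume f: "f \<in> F"
  have "(\<lambda>n. q n (\<lambda>x. t * f x)) \<longlonglongrightarrow> Q (\<lambda>x. t * f x)"
    using sub f by (intro l) (auto simp: fun_subspace_def)
  then have "(\<lambda>n. t\<^sup>2 * q n f) \<longlonglongrightarrow> Q (\<lambda>x. t * f x)"
    using quadratic_on_scale[OF q f] by simp
  moreover have "(\<lambda>n. t\<^sup>2 * q n f) \<longlonglongrightarrow> t\<^sup>2 * Q f" using f by (intro tendsto_mult tendsto_const l)
  ultimately show "Q (\<lambda>x. t * f x) = t\<^sup>2 * Q f" by (rule LIMSEQ_unique)
qed

text \<open>Subtracting the linear part leaves an additive function that vanishes on the integers.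
  It has period 1, so it is bounded everywhere, and a bounded additive function is zero.\<close>

lemma additive_bounded_imp_linear:
  fixes \<phi> :: "real \<Rightarrow> real"
  assumes add: "\<And>s t. \<phi> (s + t) = \<phi> s + \<phi> t" and bd: "\<And>t. \<bar>t\<bar> \<le> 1 \<Longrightarrow> \<bar>\<phi> t\<bar> \<le> C"
  shows "\<phi> t = t * \<phi> 1"
proof -
  define \<psi> where "\<psi> = (\<lambda>t. \<phi> t - t * \<phi> 1)"
  have add': "\<psi> (s + t) = \<psi> s + \<psi> t" for s t by (simp add: \<psi>_def add algebra_simps)
  have p0: "\<psi> 0 = 0" using add'[of 0 0] by simp
  have p1: "\<psi> 1 = 0" by (simp add: \<psi>_def)
  have nat: "\<psi> (real n * t) = real n * \<psi> t" for n t
    by (induction n) (simp_all add: p0 add' distrib_right)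
  have neg: "\<psi> (- t) = - \<psi> t" for t using add'[of t "-t"] p0 by simp
  have int: "\<psi> (of_int m) = 0" for m
    using nat[of _ 1] neg p1 by (cases m rule: int_cases2) auto
  have bd': "\<bar>\<psi> t\<bar> \<le> C + \<bar>\<phi> 1\<bar>" for t
  proof -
    have "\<psi> t = \<psi> (frac t)" using add'[of "frac t" "of_int \<lfloor>t\<rfloor>"] int by (simp add: frac_def)
    moreover have "0 \<le> frac t" "frac t \<le> 1" using frac_lt_1[of t] by auto
    then have "\<bar>\<phi> (frac t)\<bar> \<le> C" "\<bar>frac t * \<phi> 1\<bar> \<le> 1 * \<bar>\<phi> 1\<bar>"
      using bd by (auto simp: abs_mult intro!: mult_left_le_one_le)
    ultimately show ?thesis unfolding \<psi>_def by linarith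
  qed
  have "\<psi> t = 0"
  proof (rule ccontr)
    assume "\<psi> t \<noteq> 0"
    then obtain n :: nat where "real n * \<bar>\<psi> t\<bar> > C + \<bar>\<phi> 1\<bar>"
      using reals_Archimedean3[of "\<bar>\<psi> t\<bar>"] by auto
    then show False using bd'[of "real n * t"] by (simp add: nat abs_mult)
  qed
  then show ?thesis by (simp add: \<psi>_def)
qed

locale nonneg_quadratic =
  fixes F :: "('a \<Rightarrow> real) set" and q :: "('a \<Rightarrow> real) \<Rightarrow> real"
  assumes sub: "fun_subspace F" and quad: "quadratic_on F q" and nonneg: "f \<in> F \<Longrightarrow> q f \<ge> 0"
begin

lemmas F_add = fun_subspace_add[OF sub]
lemmas F_scale = fun_subspace_scale[OF sub]
lemmas F_diff = fun_subspace_diff[OF sub]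

lemmas par = quadratic_on_parallelogram[OF quad]
lemmas scale = quadratic_on_scale[OF quad]

lemma minus: "f \<in> F \<Longrightarrow> q (\<lambda>x. - f x) = q f"
  using scale[of f "-1"] by simp

lemma polar_commute: "f \<in> F \<Longrightarrow> g \<in> F \<Longrightarrow> polar q f g = polar q g f"
  using minus[OF F_diff[of f g]] by (simp add: polar_def add.commute)

text \<open>The Jordan-von Neumann argument: the parallelogram law for the pairs (f + a, b) and (f -
  a, b) gives \<open>J\<close>, which is additivity at midpoints; doubling removes the
  midpoint.\<close>

lemma polar_add:
  assumes f: "f \<in> F" and g: "g \<in> F" and h: "h \<in> F"
  shows "polar q f (\<lambda>x. g x + h x) = polar q f g + polar q f h"
proof -
  have J: "polar q f (\<lambda>x. a x + b x) + polar q f (\<lambda>x. a x - b x) = 2 * polar q f a" if "a \<in> F" "b \<in> F" for a b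
  proof -
    have "q (\<lambda>x. (f x + a x) + b x) + q (\<lambda>x. (f x + a x) - b x) = 2 * q (\<lambda>x. f x + a x) + 2 * q b"
         "q (\<lambda>x. (f x - a x) + b x) + q (\<lambda>x. (f x - a x) - b x) = 2 * q (\<lambda>x. f x - a x) + 2 * q b"
      using par[OF F_add[OF f that(1)] that(2)] par[OF F_diff[OF f that(1)] that(2)] by auto
    moreover have "(\<lambda>x. f x + (a x + b x)) = (\<lambda>x. (f x + a x) + b x)" "(\<lambda>x. f x - (a x + b x)) = (\<lambda>x. (f x - a x) - b x)"
        "(\<lambda>x. f x + (a x - b x)) = (\<lambda>x. (f x + a x) - b x)" "(\<lambda>x. f x - (a x - b x)) = (\<lambda>x. (f x - a x) + b x)"
      by auto
    moreover have "A + B = 2 * X + 2 * Z \<Longrightarrow> C + D = 2 * Y + 2 * Z \<Longrightarrow>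
        (A - D) / 4 + (B - C) / 4 = 2 * ((X - Y) / 4)" for A B C D X Y Z :: real
      by (simp add: field_simps)
    ultimately show ?thesis unfolding polar_def by (simp only:)
  qed
  have z: "polar q f (\<lambda>x. 0) = 0" by (simp add: polar_def)
  have dbl: "polar q f (\<lambda>x. 2 * a x) = 2 * polar q f a" if "a \<in> F" for a
    using J[OF that that] by (simp add: z)
  have m: "(\<lambda>x. (1/2) * (g x + h x)) \<in> F" "(\<lambda>x. (1/2) * (g x - h x)) \<in> F"
    by (intro F_scale F_add F_diff g h)+
  have "polar q f g + polar q f h = 2 * polar q f (\<lambda>x. (1/2) * (g x + h x))"
    using J[OF m] by (simp add: field_simps)
  also have "\<dots> = polar q f (\<lambda>x. 2 * ((1/2) * (g x + h x)))" by (rule dbl[OF m(1), symmetric])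
  also have "(\<lambda>x. 2 * ((1/2) * (g x + h x))) = (\<lambda>x. g x + h x)" by auto
  finally show ?thesis by simp
qed

text \<open>Nonnegativity of \<open>q\<close> bounds the polar form for \<open>t\<close> in the unit
  interval, and this boundedness replaces continuity in passing from additivity to real
  homogeneity.\<close>

lemma polar_scale:
  assumes f: "f \<in> F" and g: "g \<in> F"
  shows "polar q f (\<lambda>x. t * g x) = t * polar q f g"
proof -
  have "polar q f (\<lambda>x. t * g x) = t * polar q f (\<lambda>x. 1 * g x)"
  proof (rule additive_bounded_imp_linear[where C = "q f + q g"])
    fix s t
    show "polar q f (\<lambda>x. (s + t) * g x) = polar q f (\<lambda>x. s * g x) + polar q f (\<lambda>x. t * g x)"
      using polar_add[OF f F_scale[OF g] F_scale[OF g], of s t] by (simp add: distrib_right)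
  next
    fix t :: real assume t: "\<bar>t\<bar> \<le> 1"
    have tg: "(\<lambda>x. t * g x) \<in> F" by (rule F_scale[OF g])
    have "q (\<lambda>x. f x + t * g x) + q (\<lambda>x. f x - t * g x) = 2 * q f + 2 * (t\<^sup>2 * q g)"
      using par[OF f tg] scale[OF g] by simp
    moreover have "t\<^sup>2 * q g \<le> 1 * q g"
      using t nonneg[OF g] by (intro mult_right_mono) (auto simp: abs_square_le_1)
    moreover have "q (\<lambda>x. f x + t * g x) \<ge> 0" "q (\<lambda>x. f x - t * g x) \<ge> 0"
      using F_add[OF f tg] F_diff[OF f tg] nonneg by auto
    moreover have "q f \<ge> 0" "q g \<ge> 0" using nonneg f g by auto
    ultimately show "\<bar>polar q f (\<lambda>x. t * g x)\<bar> \<le> q f + q g"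
      unfolding polar_def by (simp add: abs_le_iff field_simps)
  qed
  then show ?thesis by simp
qed

lemma expand:
  assumes f: "f \<in> F" and g: "g \<in> F"
  shows "q (\<lambda>x. f x + t * g x) = q f + 2 * t * polar q f g + t\<^sup>2 * q g"
proof -
  have "q (\<lambda>x. f x + t * g x) + q (\<lambda>x. f x - t * g x) = 2 * q f + 2 * (t\<^sup>2 * q g)"
    using par[OF f F_scale[OF g]] scale[OF g] by simp
  moreover have "q (\<lambda>x. f x + t * g x) - q (\<lambda>x. f x - t * g x) = 4 * (t * polar q f g)"
    using polar_scale[OF f g, of t] by (simp add: polar_def)
  ultimately show ?thesis by simp
qed

lemma expand_add: "f \<in> F \<Longrightarrow> g \<in> F \<Longrightarrow> q (\<lambda>x. f x + g x) = q f + 2 * polar q f g + q g"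
  using expand[of f g 1] by simp

lemma expand_diff: "f \<in> F \<Longrightarrow> g \<in> F \<Longrightarrow> q (\<lambda>x. f x - g x) = q f - 2 * polar q f g + q g"
  using expand[of f g "-1"] by simp

lemma triangle2: "f \<in> F \<Longrightarrow> g \<in> F \<Longrightarrow> q (\<lambda>x. f x + g x) \<le> 2 * q f + 2 * q g"
  using par[of f g] nonneg[OF F_diff[of f g]] by simp

text \<open>Positivity of \<open>q\<close> at g - (f - g) / \<epsilon> bounds the mixed term. The
  factor in front of \<open>q g\<close> can be brought arbitrarily close to 1, at the expense of the
  difference.\<close>

lemma triangle_eps:
  assumes f: "f \<in> F" and g: "g \<in> F" and e: "\<epsilon> > 0"
  shows "q f \<le> (1 + \<epsilon>) * q g + (1 + 1 / \<epsilon>) * q (\<lambda>x. f x - g x)"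
proof -
  have d: "(\<lambda>x. f x - g x) \<in> F" by (rule F_diff[OF f g])
  have "0 \<le> q (\<lambda>x. g x + (- 1 / \<epsilon>) * (f x - g x))"
    by (intro nonneg F_add F_scale d g)
  also have "\<dots> = q g + 2 * (-1 / \<epsilon>) * polar q g (\<lambda>x. f x - g x) + (-1 / \<epsilon>)\<^sup>2 * q (\<lambda>x. f x - g x)"
    by (rule expand[OF g d])
  finally have "0 \<le> \<epsilon> * (q g + 2 * (-1 / \<epsilon>) * polar q g (\<lambda>x. f x - g x) + (-1 / \<epsilon>)\<^sup>2 * q (\<lambda>x. f x - g x))"
    using e by simp
  also have "\<dots> = \<epsilon> * q g - 2 * polar q g (\<lambda>x. f x - g x) + q (\<lambda>x. f x - g x) / \<epsilon>"
    using e by (simp add: field_simps power2_eq_square)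
  finally have "2 * polar q g (\<lambda>x. f x - g x) \<le> \<epsilon> * q g + q (\<lambda>x. f x - g x) / \<epsilon>" by simp
  moreover have "q f = q g + 2 * polar q g (\<lambda>x. f x - g x) + q (\<lambda>x. f x - g x)"
    using expand_add[OF g d] by simp
  ultimately show ?thesis by (simp add: algebra_simps)
qed

lemma polar_sum_right:
  assumes f: "f \<in> F" and zero: "(\<lambda>x. 0) \<in> F" and "finite J" "\<And>i. i \<in> J \<Longrightarrow> g i \<in> F"
  shows "(\<lambda>x. \<Sum>i\<in>J. c i * g i x) \<in> F \<and> polar q f (\<lambda>x. \<Sum>i\<in>J. c i * g i x) = (\<Sum>i\<in>J. c i * polar q f (g i))"
  using assms(3,4)
proof (induction J)
  case empty
  then show ?case using zero by (simp add: polar_def)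
next
  case (insert j J)
  then have IH: "(\<lambda>x. \<Sum>i\<in>J. c i * g i x) \<in> F" "polar q f (\<lambda>x. \<Sum>i\<in>J. c i * g i x) = (\<Sum>i\<in>J. c i * polar q f (g i))"
    and gj: "g j \<in> F" by auto
  then show ?case
    using insert.hyps F_add[OF F_scale[OF gj] IH(1), of "c j"] polar_add[OF f F_scale[OF gj] IH(1), of "c j"] polar_scale[OF f gj]
    by simp
qed

lemma polar_self: "f \<in> F \<Longrightarrow> polar q f f = q f"
  using scale[of f 2] scale[of f 0] by (simp add: polar_def mult_2[symmetric])

end

lemma fun_subspace_UNIV: "fun_subspace UNIV"
  by (simp add: fun_subspace_def)

subsection \<open>Geometry of nested fractals\<close>

lemma word_map_Nil [simp]: "word_map w [] = id"
  and word_map_Cons [simp]: "word_map w (i # \<sigma>) = w i \<circ> word_map w \<sigma>"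
  by (simp_all add: word_map_def)

lemma words_0: "words k 0 = {[]}"
  by (auto simp: words_def)

lemma words_Suc: "words k (Suc n) = (\<lambda>(i, \<sigma>). i # \<sigma>) ` ({1..k} \<times> words k n)"
proof (intro set_eqI iffI)
  fix \<tau> assume "\<tau> \<in> words k (Suc n)"
  then obtain i \<sigma> where "\<tau> = i # \<sigma>" "i \<in> {1..k}" "\<sigma> \<in> words k n"
    by (cases \<tau>) (auto simp: words_def)
  then show "\<tau> \<in> (\<lambda>(i, \<sigma>). i # \<sigma>) ` ({1..k} \<times> words k n)" by force
qed (auto simp: words_def)

lemma words_1: "words k 1 = (\<lambda>i. [i]) ` {1..k}"
  by (auto simp: words_def length_Suc_conv)

lemma sum_words_Suc: "sum g (words k (Suc n)) = (\<Sum>i\<in>{1..k}. \<Sum>\<sigma>\<in>words k n. g (i # \<sigma>))"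
proof -
  have "sum g (words k (Suc n)) = (\<Sum>x\<in>{1..k} \<times> words k n. g (case x of (i, \<sigma>) \<Rightarrow> i # \<sigma>))"
    unfolding words_Suc by (subst sum.reindex) (auto simp: inj_on_def o_def)
  then show ?thesis by (simp add: sum.cartesian_product split_beta)
qed

lemma level_form_0: "level_form k w 0 E f = E f"
  by (simp add: level_form_def words_0)

lemma level_form_Suc: "level_form k w (Suc n) E f = (\<Sum>i\<in>{1..k}. level_form k w n E (f \<circ> w i))"
  by (simp add: level_form_def sum_words_Suc o_assoc)

lemma level_form_1: "level_form k w 1 E f = (\<Sum>i\<in>{1..k}. E (f \<circ> w i))"
  using level_form_Suc[of k w 0 E f] by (simp add: level_form_0)

section \<open>Reflections in perpendicular bisectors\<close>

context
  fixes p q :: "'a::real_inner"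
  assumes pq: "p \<noteq> q"
begin

lemma bisector_reflection_swap: "bisector_reflection p q p = q" "bisector_reflection p q q = p"
proof -
  have d: "(q - p) \<bullet> (q - p) \<noteq> 0" using pq by simp
  have "p - midpoint p q = (-1/2) *\<^sub>R (q - p)" "q - midpoint p q = (1/2) *\<^sub>R (q - p)"
    by (simp_all add: midpoint_def algebra_simps scaleR_left_distrib[symmetric])
  then show "bisector_reflection p q p = q" "bisector_reflection p q q = p"
    using d by (simp_all add: bisector_reflection_def)
qed

lemma bisector_reflection_diff:
  "bisector_reflection p q x - bisector_reflection p q y =
    (x - y) - (2 * ((x - y) \<bullet> (q - p)) / ((q - p) \<bullet> (q - p))) *\<^sub>R (q - p)"
proof -
  have "2 * ((x - midpoint p q) \<bullet> (q - p)) / ((q - p) \<bullet> (q - p)) - 2 * ((y - midpoint p q) \<bullet> (q - p)) / ((q - p) \<bullet> (q - p)) =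
      2 * ((x - y) \<bullet> (q - p)) / ((q - p) \<bullet> (q - p))"
    unfolding diff_divide_distrib[symmetric] by (simp only: inner_diff_left right_diff_distrib) simp
  moreover have "(x - a *\<^sub>R e) - (y - b *\<^sub>R e) = (x - y) - (a - b) *\<^sub>R e" for a b and e :: 'a
    by (simp add: algebra_simps)
  ultimately show ?thesis
    unfolding bisector_reflection_def by (simp only:)
qed

lemma bisector_reflection_isometry:
  "norm (bisector_reflection p q x - bisector_reflection p q y) = norm (x - y)"
proof -
  have d: "(q - p) \<bullet> (q - p) \<noteq> 0" using pq by simp
  define v where "v = x - y"
  define e where "e = q - p"
  have "(v - (2 * (v \<bullet> e) / (e \<bullet> e)) *\<^sub>R e) \<bullet> (v - (2 * (v \<bullet> e) / (e \<bullet> e)) *\<^sub>R e) = v \<bullet> v"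
    using d unfolding e_def[symmetric]
    by (simp add: inner_diff_left inner_diff_right inner_commute power2_eq_square field_simps)
  then show ?thesis
    unfolding bisector_reflection_diff by (simp add: v_def e_def norm_eq_sqrt_inner)
qed

lemma bisector_reflection_involution: "bisector_reflection p q (bisector_reflection p q z) = z"
proof -
  have d: "(q - p) \<bullet> (q - p) \<noteq> 0" using pq by simp
  have "bisector_reflection p q (bisector_reflection p q z) - p =
      (bisector_reflection p q z - q) -
      (2 * ((bisector_reflection p q z - q) \<bullet> (q - p)) / ((q - p) \<bullet> (q - p))) *\<^sub>R (q - p)"
    using bisector_reflection_diff[of "bisector_reflection p q z" q] by (simp add: bisector_reflection_swap)
  also have "bisector_reflection p q z - q = (z - p) - (2 * ((z - p) \<bullet> (q - p)) / ((q - p) \<bullet> (q - p))) *\<^sub>R (q - p)"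
    using bisector_reflection_diff[of z p] by (simp add: bisector_reflection_swap)
  finally have "bisector_reflection p q (bisector_reflection p q z) - p = z - p"
    using d by (simp add: inner_diff_left[of "z - p"] diff_divide_distrib)
  then show ?thesis by simp
qed

end

text \<open>After rescaling and translation the map is an isometry fixing 0, hence linear and
  injective, and finite dimension gives surjectivity.\<close>

lemma similarity_surj:
  fixes g :: "'a::euclidean_space \<Rightarrow> 'a"
  assumes c: "c > 0" and g: "\<And>x y. norm (g x - g y) = c * norm (x - y)"
  shows "surj g"
proof -
  define h where "h = (\<lambda>x. (1 / c) *\<^sub>R (g x - g 0))"
  have h: "norm (h x - h y) = norm (x - y)" for x y
  proof -
    have "h x - h y = (1 / c) *\<^sub>R (g x - g y)" by (simp add: h_def algebra_simps)
    then show ?thesis using g[of x y] c by simp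
  qed
  have h0: "h 0 = 0" by (simp add: h_def)
  have "linear h" by (rule isometry_linear[of h]) (simp_all add: dist_norm h h0)
  moreover have "inj h"
    by (rule injI) (metis h norm_eq_zero right_minus_eq)
  ultimately have "surj h" by (rule linear_inj_imp_surj)
  show ?thesis unfolding surj_def
  proof
    fix y
    obtain x where "(1 / c) *\<^sub>R (y - g 0) = h x" using \<open>surj h\<close> by (metis surjD)
    then have "g x = y" using c by (simp add: h_def)
    then show "\<exists>x. y = g x" by blast
  qed
qed

section \<open>Cells and vertices of a nested fractal\<close>

locale nested =
  fixes k :: nat and w :: "nat \<Rightarrow> 'a::euclidean_space \<Rightarrow> 'a" and lam :: real and K :: "'a set"
  assumes nf: "nested_fractal k w lam K"
begin

abbreviation V0 :: "'a set" where "V0 \<equiv> ess_fixed_pts k w"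
abbreviation E0 :: "('a \<times> 'a) set" where "E0 \<equiv> edges0 k w"
abbreviation I :: "nat set" where "I \<equiv> {1..k}"

(* keeps membership in I, and the level 1, in the form in which they are stated *)
declare atLeastAtMost_iff [simp del] One_nat_def [simp del]

lemmas nf_rest0 = nf[unfolded nested_fractal_def]
lemmas lam_pos = conjunct1[OF nf_rest0] and nf_rest1 = conjunct2[OF nf_rest0]
lemmas lam_less_1 = conjunct1[OF nf_rest1] and nf_rest2 = conjunct2[OF nf_rest1]
lemmas sim = conjunct1[OF nf_rest2, rule_format] and nf_rest3 = conjunct2[OF nf_rest2]
lemmas compact_K = conjunct1[OF nf_rest3] and nf_rest4 = conjunct2[OF nf_rest3]
lemmas K_ne = conjunct1[OF nf_rest4] and nf_rest5 = conjunct2[OF nf_rest4]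
lemmas K_eq = conjunct1[OF nf_rest5] and nf_rest6 = conjunct2[OF nf_rest5]
lemmas card_V0 = conjunct1[OF nf_rest6] and nf_rest7 = conjunct2[OF nf_rest6]
lemmas open_raw = conjunct1[OF nf_rest7] and nf_rest8 = conjunct2[OF nf_rest7]
lemmas V1_connected = conjunct1[OF nf_rest8, rule_format] and nf_rest9 = conjunct2[OF nf_rest8]
lemmas inter_raw = conjunct1[OF nf_rest9] and reflection_raw = conjunct2[OF nf_rest9]

lemma lam_neq_0 [simp]: "lam \<noteq> 0"
  using lam_pos by simp

lemma w_inj: "i \<in> I \<Longrightarrow> w i x = w i y \<Longrightarrow> x = y"
  using sim[of i x y] lam_pos by simp

lemma w_K: "i \<in> I \<Longrightarrow> y \<in> K \<Longrightarrow> w i y \<in> K"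
  by (subst K_eq) (rule UN_I, assumption, rule imageI)

lemma cell_inter:
  assumes "\<sigma> \<in> words k n" "\<tau> \<in> words k n" "\<sigma> \<noteq> \<tau>"
  shows "word_map w \<sigma> ` V0 \<noteq> word_map w \<tau> ` V0"
    "word_map w \<sigma> ` K \<inter> word_map w \<tau> ` K = word_map w \<sigma> ` V0 \<inter> word_map w \<tau> ` V0"
  by (rule conjunct1[OF inter_raw[rule_format, OF assms]])
    (rule conjunct2[OF inter_raw[rule_format, OF assms]])

lemma reflection_cell:
  "p \<in> V0 \<Longrightarrow> q \<in> V0 \<Longrightarrow> p \<noteq> q \<Longrightarrow> C \<in> cells k w n \<Longrightarrow> bisector_reflection p q ` C \<in> cells k w n"
  by (rule conjunct1[OF reflection_raw[rule_format]])

text \<open>Banach's theorem on the compact set \<open>K\<close> gives existence there. Since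
  \<open>fixed_pt\<close> is a definite description over the whole space, uniqueness outside
  \<open>K\<close> is obtained separately from the contraction identity.\<close>

lemma fixed_pt: assumes i: "i \<in> I" shows "w i (fixed_pt (w i)) = fixed_pt (w i)" "fixed_pt (w i) \<in> K"
proof -
  have "\<exists>!x\<in>K. w i x = x"
    by (rule Banach_fix[where c=lam])
      (use K_ne lam_pos lam_less_1 w_K[OF i] sim[OF i] compact_imp_complete[OF compact_K] in \<open>auto simp: dist_norm\<close>)
  then obtain x where x: "x \<in> K" "w i x = x" by blast
  have "fixed_pt (w i) = x" unfolding fixed_pt_def
  proof (rule the_equality)
    fix y assume "w i y = y"
    then have "norm (y - x) = lam * norm (y - x)" using sim[OF i, of y x] x by simp
    then have "(1 - lam) * norm (y - x) = 0" by (simp add: algebra_simps)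
    then show "y = x" using lam_less_1 by simp
  qed (rule x(2))
  then show "w i (fixed_pt (w i)) = fixed_pt (w i)" "fixed_pt (w i) \<in> K" using x by simp_all
qed

lemma finite_V0: "finite V0"
  by (rule finite_subset[of _ "(\<lambda>i. fixed_pt (w i)) ` I"]) (auto simp: ess_fixed_pts_def)

lemma V0_fixed: "p \<in> V0 \<Longrightarrow> \<exists>i\<in>I. w i p = p"
  using fixed_pt(1) by (fastforce simp: ess_fixed_pts_def)

lemma V0_K: "p \<in> V0 \<Longrightarrow> p \<in> K"
  using fixed_pt(2) by (auto simp: ess_fixed_pts_def)

lemma V0_other: "p \<in> V0 \<Longrightarrow> \<exists>q\<in>V0. q \<noteq> p"
proof (rule ccontr)
  assume "\<not> (\<exists>q\<in>V0. q \<noteq> p)"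
  then have "V0 \<subseteq> {p}" by blast
  then have "card V0 \<le> 1" using card_mono[of "{p}" V0] by simp
  then show False using card_V0 by simp
qed

lemma V0_ne: "V0 \<noteq> {}"
  using card_V0 by auto

lemma I_ne: "I \<noteq> {}"
proof
  assume "I = {}"
  then have "(\<Union>i\<in>I. w i ` K) = {}" by simp
  then have "K = {}" using K_eq by (rule trans[rotated])
  then show False using K_ne by contradiction
qed

lemma finite_E0: "finite E0"
  by (rule finite_subset[of _ "V0 \<times> V0"]) (auto simp: edges0_def finite_V0)

lemma E0_iff: "(p, q) \<in> E0 \<longleftrightarrow> p \<in> V0 \<and> q \<in> V0 \<and> p \<noteq> q"
  by (simp add: edges0_def)

lemma inter_V0:
  assumes "i \<in> I" "j \<in> I" "i \<noteq> j" "y \<in> K" "y' \<in> K" "w i y = w j y'"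
  shows "y \<in> V0"
proof -
  have "[i] \<in> words k 1" "[j] \<in> words k 1" using assms by (auto simp: words_def)
  then have "w i ` K \<inter> w j ` K = w i ` V0 \<inter> w j ` V0" using cell_inter(2)[of "[i]" 1 "[j]"] assms by simp
  moreover have "w i y \<in> w i ` K \<inter> w j ` K" using assms(4-6) by (metis IntI imageI)
  ultimately obtain p where "p \<in> V0" "w i y = w i p" by auto
  then show ?thesis using w_inj assms by metis
qed

text \<open>Distinct level-1 cells of \<open>K\<close> only meet in images of \<open>V\<^sub>0\<close>, so functions on the cells that
  agree there glue together.\<close>

lemma glue:
  assumes g: "\<And>i p. i \<in> I \<Longrightarrow> p \<in> V0 \<Longrightarrow> g i p = f (w i p)"
  shows "\<exists>h::'a \<Rightarrow> 'b. \<forall>i\<in>I. \<forall>y\<in>K. h (w i y) = g i y"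
proof -
  have unique: "g i y = g j y'" if "i \<in> I" "j \<in> I" "y \<in> K" "y' \<in> K" "w i y = w j y'" for i j y y'
  proof (cases "i = j")
    case True
    then show ?thesis using w_inj that by metis
  next
    case False
    then have "y \<in> V0" "y' \<in> V0" using inter_V0[of i j y y'] inter_V0[of j i y' y] that by auto
    then show ?thesis using g that by metis
  qed
  define h where "h = (\<lambda>x. let z = SOME z. fst z \<in> I \<and> snd z \<in> K \<and> w (fst z) (snd z) = x in g (fst z) (snd z))"
  have "h (w i y) = g i y" if iy: "i \<in> I" "y \<in> K" for i y
  proof -
    have "\<exists>z. fst z \<in> I \<and> snd z \<in> K \<and> w (fst z) (snd z) = w i y" using iy by (intro exI[of _ "(i, y)"]) simp
    from someI_ex[OF this] show ?thesis unfolding h_def Let_def by (intro unique) (use iy in auto)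
  qed
  then show ?thesis by blast
qed

lemma word_map_K: "set \<sigma> \<subseteq> I \<Longrightarrow> y \<in> K \<Longrightarrow> word_map w \<sigma> y \<in> K"
  by (induction \<sigma>) (auto intro: w_K)

lemma word_map_norm: "set \<sigma> \<subseteq> I \<Longrightarrow> norm (word_map w \<sigma> x - word_map w \<sigma> y) = lam ^ length \<sigma> * norm (x - y)"
  by (induction \<sigma>) (auto simp: sim)

lemma word_map_surj: "set \<sigma> \<subseteq> I \<Longrightarrow> surj (word_map w \<sigma>)"
proof (induction \<sigma>)
  case (Cons i \<sigma>)
  then have "surj (w i)" by (intro similarity_surj[OF lam_pos] sim) auto
  then show ?case using Cons by (simp add: comp_surj del: o_apply) 
qed (simp add: surj_id)

lemma word_map_inj: "set \<sigma> \<subseteq> I \<Longrightarrow> inj (word_map w \<sigma>)"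
  by (rule injI) (metis word_map_norm lam_pos mult_eq_0_iff norm_eq_zero power_not_zero order_less_irrefl right_minus_eq)

lemma vertices_1: "vertices k w 1 = (\<Union>i\<in>I. w i ` V0)"
  by (simp add: vertices_def words_1)

lemma finite_V1: "finite (vertices k w 1)"
  unfolding vertices_1 by (simp add: finite_V0)

lemma V0_subset_V1: "V0 \<subseteq> vertices k w 1"
proof
  fix p assume p: "p \<in> V0"
  then obtain i where "i \<in> I" "w i p = p" using V0_fixed by blast
  then have "p \<in> w i ` V0" using p by (metis imageI)
  then show "p \<in> vertices k w 1" using \<open>i \<in> I\<close> unfolding vertices_1 by blast
qed

text \<open>Connectedness of the level-1 graph as an induction rule: it suffices to propagate
  membership inside each cell.\<close>

lemma V1_induct:
  assumes "x \<in> A" "x \<in> vertices k w 1"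
    and step: "\<And>i p q. i \<in> I \<Longrightarrow> p \<in> V0 \<Longrightarrow> q \<in> V0 \<Longrightarrow> w i p \<in> A \<Longrightarrow> w i q \<in> A"
  shows "vertices k w 1 \<subseteq> A"
proof
  fix y assume "y \<in> vertices k w 1"
  then have "(x, y) \<in> (edges k w 1)\<^sup>*" using assms V1_connected by blast
  then show "y \<in> A"
  proof (induction rule: rtrancl_induct)
    case (step y z)
    then obtain \<sigma> p q where e: "y = word_map w \<sigma> p" "z = word_map w \<sigma> q" "\<sigma> \<in> words k 1" "(p, q) \<in> E0"
      unfolding edges_def by blast
    then obtain i where "\<sigma> = [i]" "i \<in> I" by (auto simp: words_1)
    then show ?case using e step.IH assms(3)[of i p q] by (auto simp: E0_iff)
  qed (rule assms(1))
qed

subsection \<open>A vertex lies in a single cell\<close>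

lemma disjoint_open_cells:
  assumes U: "(\<Union>i\<in>I. w i ` U) \<subseteq> U" "\<forall>i\<in>I. \<forall>j\<in>I. i \<noteq> j \<longrightarrow> w i ` U \<inter> w j ` U = {}"
  shows "\<sigma> \<in> words k n \<Longrightarrow> \<tau> \<in> words k n \<Longrightarrow> \<sigma> \<noteq> \<tau> \<Longrightarrow> word_map w \<sigma> ` U \<inter> word_map w \<tau> ` U = {}"
proof (induction n arbitrary: \<sigma> \<tau>)
  case (Suc n)
  have sub: "word_map w \<upsilon> ` U \<subseteq> U" if "\<upsilon> \<in> words k n" for \<upsilon> n
    using that
  proof (induction \<upsilon> arbitrary: n)
    case (Cons i \<upsilon>)
    then have "\<upsilon> \<in> words k (length \<upsilon>)" "i \<in> I" by (auto simp: words_def)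
    then show ?case using Cons.IH U(1) by fastforce
  qed simp
  obtain i \<sigma>' j \<tau>' where e: "\<sigma> = i # \<sigma>'" "\<tau> = j # \<tau>'" "i \<in> I" "j \<in> I" "\<sigma>' \<in> words k n" "\<tau>' \<in> words k n"
    using Suc.prems unfolding words_Suc by auto
  show ?case
  proof (cases "i = j")
    case True
    then have "word_map w \<sigma>' ` U \<inter> word_map w \<tau>' ` U = {}" using Suc e by auto
    moreover have "inj (w i)" by (rule injI) (rule w_inj[OF e(3)])
    ultimately have "w i ` (word_map w \<sigma>' ` U) \<inter> w i ` (word_map w \<tau>' ` U) = {}"
      by (simp add: image_Int[symmetric])
    then show ?thesis using True by (simp add: e image_comp)
  next
    case False
    then have "w i ` U \<inter> w j ` U = {}" using U(2) e by blast
    moreover have "word_map w \<sigma> ` U \<subseteq> w i ` U" "word_map w \<tau> ` U \<subseteq> w j ` U"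
      using sub[OF e(5)] sub[OF e(6)] by (auto simp: e)
    ultimately show ?thesis by blast
  qed
qed (simp add: words_0)

text \<open>A packing bound. Magnified by \<lambda>^(-n) about \<open>p\<close>, the open cells are
  disjoint, each contains a ball of fixed radius, and the centres stay within a fixed distance of
  the vertex; so their number is bounded independently of n.\<close>

lemma cells_at_vertex_bounded:
  "\<exists>m. \<forall>n. \<forall>p\<in>V0. card {\<sigma>\<in>words k n. p \<in> word_map w \<sigma> ` V0} \<le> m"
proof -
  obtain U where U: "open U \<and> bounded U \<and> U \<noteq> {} \<and> (\<Union>i\<in>I. w i ` U) \<subseteq> U \<and>
      (\<forall>i\<in>I. \<forall>j\<in>I. i \<noteq> j \<longrightarrow> w i ` U \<inter> w j ` U = {})"
    using open_raw by (rule exE)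
  have U: "open U" "U \<noteq> {}" "(\<Union>i\<in>I. w i ` U) \<subseteq> U"
      "\<forall>i\<in>I. \<forall>j\<in>I. i \<noteq> j \<longrightarrow> w i ` U \<inter> w j ` U = {}"
    using U by blast+
  obtain u0 where u0: "u0 \<in> U" using U by blast
  obtain r where r: "r > 0" "ball u0 r \<subseteq> U" using U(1) u0 by (auto simp: open_contains_ball)
  obtain D where D: "D > 0" "\<forall>v\<in>V0. norm (u0 - v) \<le> D"
    using finite_upper_bound[OF finite_V0, of "\<lambda>v. norm (u0 - v)"] by auto
  obtain T where T: "finite T" "cball (0::'a) D \<subseteq> (\<Union>t\<in>T. ball t (r / 2))"
    using compact_eq_totally_bounded[of "cball (0::'a) D"] r(1) by (meson compact_cball half_gt_zero)
  have "card {\<sigma>\<in>words k n. p \<in> word_map w \<sigma> ` V0} \<le> card T" if p: "p \<in> V0" for n p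
  proof -
    let ?C = "{\<sigma>\<in>words k n. p \<in> word_map w \<sigma> ` V0}"
    define z where "z = (\<lambda>\<sigma>. (1 / lam ^ n) *\<^sub>R (word_map w \<sigma> u0 - p))"
    have ln: "lam ^ n > 0" using lam_pos by simp
    have "\<exists>t. t \<in> T \<and> z \<sigma> \<in> ball t (r / 2)" if \<sigma>: "\<sigma> \<in> ?C" for \<sigma>
    proof -
      obtain v where v: "v \<in> V0" "p = word_map w \<sigma> v" using \<sigma> by auto
      have "norm (word_map w \<sigma> u0 - p) = lam ^ n * norm (u0 - v)"
        using \<sigma> word_map_norm[of \<sigma>] by (simp add: v words_def)
      then have "norm (z \<sigma>) = norm (u0 - v)" using ln by (simp add: z_def)
      then have "z \<sigma> \<in> cball 0 D" using D(2) v by (simp add: dist_norm)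
      then show ?thesis using T(2) by blast
    qed
    then obtain t where t: "\<And>\<sigma>. \<sigma> \<in> ?C \<Longrightarrow> t \<sigma> \<in> T \<and> z \<sigma> \<in> ball (t \<sigma>) (r / 2)" by metis
    \<comment> \<open>Two centres in one ball of radius \<open>r / 2\<close> are closer than
      \<open>r\<close>. Surjectivity of the similarity of \<sigma> then places the centre of the
      cell of \<tau> in the image of \<open>U\<close> under \<sigma>, against disjointness.\<close>
    have "inj_on t ?C"
    proof (rule inj_onI, rule ccontr)
      fix \<sigma> \<tau> assume st: "\<sigma> \<in> ?C" "\<tau> \<in> ?C" "t \<sigma> = t \<tau>" "\<sigma> \<noteq> \<tau>"
      have "dist (z \<sigma>) (z \<tau>) < r"
        using t[OF st(1)] t[OF st(2)] st(3) dist_triangle_half_r[of "t \<sigma>" "z \<sigma>" r "z \<tau>"] by (simp add: dist_commute)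
      moreover have "z \<sigma> - z \<tau> = (1 / lam ^ n) *\<^sub>R (word_map w \<sigma> u0 - word_map w \<tau> u0)"
        by (simp add: z_def algebra_simps)
      then have "dist (z \<sigma>) (z \<tau>) = norm (word_map w \<sigma> u0 - word_map w \<tau> u0) / lam ^ n"
        unfolding dist_norm using ln by simp
      ultimately have "norm (word_map w \<sigma> u0 - word_map w \<tau> u0) / lam ^ n < r" by simp
      then have lt: "norm (word_map w \<sigma> u0 - word_map w \<tau> u0) < lam ^ n * r"
        using ln by (simp only: pos_divide_less_eq mult.commute)
      obtain x where x: "word_map w \<tau> u0 = word_map w \<sigma> x"
        using word_map_surj[of \<sigma>] st(1) by (auto simp: words_def surj_def)
      have "lam ^ n * norm (u0 - x) < lam ^ n * r"
        using lt word_map_norm[of \<sigma> u0 x] st(1) by (simp add: x words_def)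
      then have "x \<in> U" using r(2) ln by (auto simp: dist_norm)
      then have "word_map w \<sigma> ` U \<inter> word_map w \<tau> ` U \<noteq> {}" using x u0 by (metis IntI emptyE imageI)
      then show False using disjoint_open_cells[OF U(3,4)] st by blast
    qed
    then show ?thesis using t T(1) by (intro card_inj_on_le[of t]) auto
  qed
  then show ?thesis by blast
qed

lemma reflection_V0: "p \<in> V0 \<Longrightarrow> q \<in> V0 \<Longrightarrow> p \<noteq> q \<Longrightarrow> bisector_reflection p q ` V0 = V0"
  using reflection_cell[of p q V0 0] by (simp add: cells_def words_0)

lemma inj_on_cell: "inj_on (\<lambda>\<sigma>. word_map w \<sigma> ` V0) (words k n)"
  by (rule inj_onI) (use cell_inter(1) in blast)

text \<open>The reflection exchanging \<open>p\<close> and \<open>q\<close> maps 1-cells to 1-cells,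
  injectively since it is an involution.\<close>

lemma card_cells_at_vertex_le:
  assumes p: "p \<in> V0" and q: "q \<in> V0"
  shows "card {i\<in>I. p \<in> w i ` V0} \<le> card {i\<in>I. q \<in> w i ` V0}"
proof (cases "p = q")
  case False
  let ?R = "bisector_reflection p q"
  have c1: "cells k w 1 = (\<lambda>i. w i ` V0) ` I"
    by (simp add: cells_def setcompr_eq_image words_1 image_image)
  have inj: "inj_on (\<lambda>i. w i ` V0) I"
  proof (rule inj_onI, rule ccontr)
    fix i j assume "i \<in> I" "j \<in> I" "w i ` V0 = w j ` V0" "i \<noteq> j"
    then show False using cell_inter(1)[of "[i]" 1 "[j]"] by (simp add: words_def)
  qed
  have e: "card {i\<in>I. x \<in> w i ` V0} = card {C\<in>cells k w 1. x \<in> C}" for x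
  proof -
    have "{C\<in>cells k w 1. x \<in> C} = (\<lambda>i. w i ` V0) ` {i\<in>I. x \<in> w i ` V0}" by (auto simp: c1)
    then show ?thesis using inj by (simp add: card_image inj_on_subset)
  qed
  have "inj_on ((`) ?R) {C\<in>cells k w 1. p \<in> C}"
    by (rule inj_on_inverseI[of _ "(`) ?R"]) (simp add: image_image bisector_reflection_involution[OF False])
  moreover have "(`) ?R ` {C\<in>cells k w 1. p \<in> C} \<subseteq> {C\<in>cells k w 1. q \<in> C}"
    using reflection_cell[OF p q False] bisector_reflection_swap(1)[OF False] by force
  moreover have "finite {C\<in>cells k w 1. q \<in> C}" by (simp add: c1)
  ultimately show ?thesis unfolding e by (rule card_inj_on_le)
qed simp

text \<open>By symmetry all vertices of \<open>V0\<close> lie in the same number \<open>N\<close> of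
  1-cells. Repeating this inside the cells yields at least \<open>N ^ n\<close> cells of level n at
  a vertex, while the packing argument bounds their number; so \<open>N\<close> cannot exceed
  1.\<close>

lemma unique_cell:
  assumes p: "p \<in> V0" and ij: "i \<in> I" "j \<in> I" "p \<in> w i ` V0" "p \<in> w j ` V0"
  shows "i = j"
proof -
  define N where "N = card {i\<in>I. p \<in> w i ` V0}"
  have N: "card {i\<in>I. q \<in> w i ` V0} = N" if "q \<in> V0" for q
    unfolding N_def using card_cells_at_vertex_le p that by (meson le_antisym)
  have fin: "finite {\<sigma>\<in>words k n. q \<in> word_map w \<sigma> ` V0}" for n q by (simp add: finite_words)
  have pow: "N ^ n \<le> card {\<sigma>\<in>words k n. q \<in> word_map w \<sigma> ` V0}" if "q \<in> V0" for n q
    using that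
  proof (induction n arbitrary: q)
    case 0
    then have "{\<sigma>\<in>words k 0. q \<in> word_map w \<sigma> ` V0} = {[]}" by (auto simp: words_0)
    then show ?case by simp
  next
    case (Suc n)
    let ?J = "{i\<in>I. q \<in> w i ` V0}"
    have "\<exists>r. r \<in> V0 \<and> q = w i r" if "i \<in> ?J" for i using that by auto
    then obtain r where r: "\<And>i. i \<in> ?J \<Longrightarrow> r i \<in> V0 \<and> q = w i (r i)" by metis
    \<comment> \<open>A level-1 cell at \<open>q\<close> shows \<open>q\<close> as the image of some
      vertex \<open>r i\<close> of \<open>V0\<close>, so the induction hypothesis counts the
      subcells through that vertex.\<close>
    let ?S = "SIGMA i:?J. {\<sigma>\<in>words k n. r i \<in> word_map w \<sigma> ` V0}"
    have "N ^ Suc n = (\<Sum>i\<in>?J. N ^ n)" using N[OF Suc.prems] by simp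
    also have "\<dots> \<le> (\<Sum>i\<in>?J. card {\<sigma>\<in>words k n. r i \<in> word_map w \<sigma> ` V0})"
      using r Suc.IH by (intro sum_mono) blast
    also have "\<dots> = card ?S" using fin by (subst card_SigmaI) auto
    also have "\<dots> \<le> card {\<sigma>\<in>words k (Suc n). q \<in> word_map w \<sigma> ` V0}"
    proof (rule card_inj_on_le[of "\<lambda>(i, \<sigma>). i # \<sigma>"])
      show "(\<lambda>(i, \<sigma>). i # \<sigma>) ` ?S \<subseteq> {\<sigma>\<in>words k (Suc n). q \<in> word_map w \<sigma> ` V0}"
      proof (rule subsetI)
        fix \<tau> assume "\<tau> \<in> (\<lambda>(i, \<sigma>). i # \<sigma>) ` ?S"
        then obtain i \<sigma> where a: "\<tau> = i # \<sigma>" "i \<in> ?J" "\<sigma> \<in> words k n" "r i \<in> word_map w \<sigma> ` V0"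
          by auto
        have "i # \<sigma> \<in> words k (Suc n)" using a(2,3) by (auto simp: words_def)
        moreover have "q \<in> w i ` word_map w \<sigma> ` V0" using r[OF a(2)] a(4) by (metis imageI)
        ultimately show "\<tau> \<in> {\<sigma>\<in>words k (Suc n). q \<in> word_map w \<sigma> ` V0}"
          by (simp add: a(1) image_comp)
      qed
    qed (auto simp: inj_on_def fin)
    finally show ?case .
  qed
  obtain m where m: "\<forall>n. \<forall>p\<in>V0. card {\<sigma>\<in>words k n. p \<in> word_map w \<sigma> ` V0} \<le> m"
    using cells_at_vertex_bounded by blast
  have "N \<le> 1"
  proof (rule ccontr)
    assume "\<not> N \<le> 1"
    then have "2 ^ m \<le> N ^ m" by (intro power_mono) auto
    moreover have "N ^ m \<le> m" using pow[OF p, of m] m p by (meson order_trans)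
    moreover have "m < 2 ^ m" by (rule less_exp)
    ultimately show False by linarith
  qed
  moreover have "{i, j} \<subseteq> {i\<in>I. p \<in> w i ` V0}" using ij by auto
  then have "card {i, j} \<le> N" unfolding N_def by (intro card_mono) auto
  ultimately show ?thesis by (cases "i = j") auto
qed

text \<open>The point \<open>w i q\<close> is fixed by some \<open>w j\<close>, hence lies in cell
  \<open>j\<close> as well as in cell \<open>i\<close>; as the cell is unique, \<open>w i\<close>
  fixes it, and injectivity identifies it with \<open>q\<close>.\<close>

lemma V0_image_fixed:
  assumes "i \<in> I" "q \<in> V0" "w i q \<in> V0"
  shows "w i q = q"
proof -
  obtain j where j: "j \<in> I" "w j (w i q) = w i q" using V0_fixed assms by blast
  then have "i = j" using unique_cell[of "w i q" i j] assms by (metis imageI)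
  then show ?thesis using j w_inj assms by metis
qed

text \<open>The reflection permutes cells only as sets: identifying both cells with
  \<open>V0\<close> may leave a nontrivial isometry of \<open>V0\<close>. Hence the hypothesis
  \<open>inv\<close>, which holds for conductances that depend on distances only.\<close>

lemma level_form_reflection:
  assumes pq: "p \<in> V0" "q \<in> V0" "p \<noteq> q"
    and local: "\<And>f g. (\<And>x. x \<in> V0 \<Longrightarrow> f x = g x) \<Longrightarrow> E f = E g"
    and inv: "\<And>\<phi> f. bij_betw \<phi> V0 V0 \<Longrightarrow> (\<And>x y. x \<in> V0 \<Longrightarrow> y \<in> V0 \<Longrightarrow> norm (\<phi> x - \<phi> y) = norm (x - y)) \<Longrightarrow>
      E (f \<circ> \<phi>) = E f"
  shows "level_form k w n E (f \<circ> bisector_reflection p q) = level_form k w n E f"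
proof -
  let ?R = "bisector_reflection p q" and ?c = "\<lambda>\<sigma>. word_map w \<sigma> ` V0"
  have "\<exists>\<tau>. \<tau> \<in> words k n \<and> ?R ` ?c \<sigma> = ?c \<tau>" if "\<sigma> \<in> words k n" for \<sigma>
  proof -
    have "?c \<sigma> \<in> cells k w n" using that by (auto simp: cells_def)
    then have "?R ` ?c \<sigma> \<in> cells k w n" by (rule reflection_cell[OF pq])
    then show ?thesis by (auto simp: cells_def)
  qed
  then obtain \<beta> where \<beta>: "\<And>\<sigma>. \<sigma> \<in> words k n \<Longrightarrow> \<beta> \<sigma> \<in> words k n \<and> ?R ` ?c \<sigma> = ?c (\<beta> \<sigma>)" by metis
  have \<beta>\<beta>: "\<beta> (\<beta> \<sigma>) = \<sigma>" if \<sigma>: "\<sigma> \<in> words k n" for \<sigma>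
  proof -
    have "?c (\<beta> (\<beta> \<sigma>)) = ?R ` ?R ` ?c \<sigma>" using \<beta> \<sigma> by metis
    also have "\<dots> = ?c \<sigma>" by (simp add: image_image bisector_reflection_involution[OF pq(3)])
    finally show ?thesis using inj_on_cell \<beta> \<sigma> by (meson inj_onD)
  qed
  have bij: "bij_betw \<beta> (words k n) (words k n)"
    by (rule bij_betwI[where g=\<beta>]) (use \<beta> \<beta>\<beta> in auto)
  have "E (f \<circ> ?R \<circ> word_map w \<sigma>) = E (f \<circ> word_map w (\<beta> \<sigma>))" if \<sigma>: "\<sigma> \<in> words k n" for \<sigma>
  proof -
    let ?\<tau> = "\<beta> \<sigma>"
    have s: "set \<sigma> \<subseteq> I" "set ?\<tau> \<subseteq> I" "length \<sigma> = n" "length ?\<tau> = n"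
      using \<sigma> \<beta>[OF \<sigma>] by (auto simp: words_def)
    \<comment> \<open>The comparison map of the two cells. Both words have length n, so the scaling
      factors cancel and it is an isometry.\<close>
    define \<phi> where "\<phi> = (\<lambda>x. inv (word_map w ?\<tau>) (?R (word_map w \<sigma> x)))"
    have \<phi>: "word_map w ?\<tau> (\<phi> x) = ?R (word_map w \<sigma> x)" for x
      unfolding \<phi>_def by (rule surj_f_inv_f[OF word_map_surj[OF s(2)]])
    have iso: "norm (\<phi> x - \<phi> y) = norm (x - y)" for x y
    proof -
      have "lam ^ n * norm (\<phi> x - \<phi> y) = lam ^ n * norm (x - y)"
        using word_map_norm[OF s(2), of "\<phi> x" "\<phi> y"] word_map_norm[OF s(1), of x y]
          bisector_reflection_isometry[OF pq(3)] by (simp add: \<phi> s)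
      then show ?thesis using lam_pos by simp
    qed
    have "\<phi> ` V0 \<subseteq> V0"
    proof clarify
      fix x assume "x \<in> V0"
      then have "word_map w ?\<tau> (\<phi> x) \<in> ?c ?\<tau>" using \<beta>[OF \<sigma>] \<phi> by auto
      then show "\<phi> x \<in> V0" using word_map_inj[OF s(2)] by (simp add: inj_image_mem_iff)
    qed
    moreover have inj: "inj_on \<phi> V0"
      by (rule inj_onI) (metis iso norm_eq_zero right_minus_eq)
    ultimately have "bij_betw \<phi> V0 V0"
      using endo_inj_surj[OF finite_V0] by (simp add: bij_betw_def)
    then have "E ((f \<circ> word_map w ?\<tau>) \<circ> \<phi>) = E (f \<circ> word_map w ?\<tau>)" using iso by (intro inv)
    then show ?thesis by (simp add: o_def \<phi>)
  qed
  then have "level_form k w n E (f \<circ> ?R) = (\<Sum>\<sigma>\<in>words k n. E (f \<circ> word_map w (\<beta> \<sigma>)))"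
    unfolding level_form_def by (intro sum.cong) auto
  also have "\<dots> = level_form k w n E f"
    unfolding level_form_def using sum.reindex_bij_betw[OF bij, of "\<lambda>\<sigma>. E (f \<circ> word_map w \<sigma>)"] by simp
  finally show ?thesis .
qed

lemma K_words: "x \<in> K \<Longrightarrow> \<exists>\<sigma>\<in>words k n. \<exists>y\<in>K. x = word_map w \<sigma> y"
proof (induction n arbitrary: x)
  case (Suc n)
  have "x \<in> (\<Union>i\<in>I. w i ` K)" using Suc.prems K_eq by (rule back_subst)
  then obtain i y where iy: "i \<in> I" "y \<in> K" "x = w i y" by blast
  obtain \<sigma> z where "\<sigma> \<in> words k n" "z \<in> K" "y = word_map w \<sigma> z" using Suc.IH[OF iy(2)] by blast
  then show ?case using iy by (intro bexI[of _ "i # \<sigma>"] bexI[of _ z]) (auto simp: words_def)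
qed (simp add: words_0)

lemma vertices_dense:
  assumes x: "x \<in> K" and e: "\<epsilon> > 0"
  shows "\<exists>n. \<exists>\<sigma>\<in>words k n. \<exists>p\<in>V0. dist (word_map w \<sigma> p) x < \<epsilon>"
proof -
  obtain p where p: "p \<in> V0" using V0_ne by blast
  obtain B where B: "\<And>y. y \<in> K \<Longrightarrow> norm y \<le> B" using compact_imp_bounded[OF compact_K] by (auto simp: bounded_iff)
  have "(\<lambda>n. lam ^ n * (2 * B + 1)) \<longlonglongrightarrow> 0 * (2 * B + 1)"
    using lam_pos lam_less_1 by (intro tendsto_mult tendsto_const LIMSEQ_power_zero) auto
  then have "\<forall>\<^sub>F n in sequentially. lam ^ n * (2 * B + 1) < \<epsilon>" using e by (intro order_tendstoD) auto
  then obtain n where n: "lam ^ n * (2 * B + 1) < \<epsilon>" by (auto simp: eventually_sequentially)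
  obtain \<sigma> y where s: "\<sigma> \<in> words k n" "y \<in> K" "x = word_map w \<sigma> y" using K_words[OF x] by blast
  have "dist (word_map w \<sigma> p) x = lam ^ n * norm (p - y)"
    using word_map_norm[of \<sigma> p y] s by (simp add: dist_norm words_def)
  also have "\<dots> \<le> lam ^ n * (2 * B + 1)"
    using norm_triangle_ineq4[of p y] B[OF V0_K[OF p]] B[OF s(2)] lam_pos by (intro mult_left_mono) auto
  finally show ?thesis using n s(1) p by (meson le_less_trans)
qed

end

subsection \<open>Discrete energy forms and harmonic functions\<close>

text \<open>Edges are oriented, so each pair of vertices is counted twice; this is where later
  factors 1/2 in conductances come from.\<close>

definition edge_form :: "nat \<Rightarrow> (nat \<Rightarrow> 'a \<Rightarrow> 'a) \<Rightarrow> ('a \<Rightarrow> 'a \<Rightarrow> real) \<Rightarrow> ('a \<Rightarrow> real) \<Rightarrow> real" where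
  "edge_form k w c g = (\<Sum>(p, q)\<in>edges0 k w. c p q * (g p - g q)\<^sup>2)"

text \<open>Connectedness of the graph of positive conductances, expressed by cuts: every proper
  part has an edge leaving it. In this form it applies directly to level sets and zero sets of
  functions.\<close>

definition linked :: "('a \<Rightarrow> 'a \<Rightarrow> real) \<Rightarrow> 'a set \<Rightarrow> bool" where
  "linked c S \<longleftrightarrow> (\<forall>A. A \<subseteq> S \<longrightarrow> A \<noteq> {} \<longrightarrow> A \<noteq> S \<longrightarrow> (\<exists>x\<in>A. \<exists>y\<in>S - A. c x y > 0))"

lemma linkedD:
  assumes "linked c S" "A \<subseteq> S" "x \<in> A" "y \<in> S" "y \<notin> A"
  shows "\<exists>x\<in>A. \<exists>y\<in>S - A. c x y > 0"
  using assms unfolding linked_def by blast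

lemma linked_if_pos:
  assumes "\<And>x y. x \<in> S \<Longrightarrow> y \<in> S \<Longrightarrow> x \<noteq> y \<Longrightarrow> c x y > 0"
  shows "linked c S"
  unfolding linked_def
proof (intro allI impI)
  fix A assume A: "A \<subseteq> S" "A \<noteq> {}" "A \<noteq> S"
  then obtain x y where "x \<in> A" "y \<in> S - A" by blast
  moreover have "c x y > 0" using assms[of x y] A(1) calculation by blast
  ultimately show "\<exists>x\<in>A. \<exists>y\<in>S - A. c x y > 0" by blast
qed

text \<open>First variation at a minimum. The test value t = -P / (C + 1) covers C = 0 as
  well.\<close>

lemma quadratic_slope_zero:
  fixes P C :: real
  assumes "\<And>t. 0 \<le> 2 * t * P + t\<^sup>2 * C" "C \<ge> 0"
  shows "P = 0"
proof (rule ccontr)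
  assume P: "P \<noteq> 0"
  define Y where "Y = P / (C + 1)"
  have Y: "P = Y * (C + 1)" "Y \<noteq> 0" using P assms(2) by (simp_all add: Y_def)
  have "0 \<le> 2 * (- Y) * P + (- Y)\<^sup>2 * C" by (rule assms(1))
  also have "\<dots> = Y\<^sup>2 * (C - 2 * (C + 1))"
    by (simp add: Y(1) power2_eq_square algebra_simps)
  also have "\<dots> < 0" using Y(2) assms(2) by (intro mult_pos_neg) auto
  finally show False by simp
qed

lemma quadratic_on_difference: "quadratic_on UNIV (\<lambda>g. c * (g p - g q)\<^sup>2)"
  by (rule quadratic_onI) (simp_all add: power2_eq_square algebra_simps)

lemma quadratic_on_edge_form: "quadratic_on UNIV (edge_form k w c)"
proof -
  have "quadratic_on UNIV (\<lambda>g. \<Sum>e\<in>edges0 k w. c (fst e) (snd e) * (g (fst e) - g (snd e))\<^sup>2)"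
    by (rule quadratic_on_sum) (rule quadratic_on_difference)
  then show ?thesis by (simp add: edge_form_def[abs_def] split_beta)
qed

lemma quadratic_on_comp:
  assumes "quadratic_on UNIV q" shows "quadratic_on UNIV (\<lambda>f. q (f \<circ> \<phi>))"
proof (rule quadratic_onI)
  fix f g :: "'b \<Rightarrow> real"
  show "q ((\<lambda>x. f x + g x) \<circ> \<phi>) + q ((\<lambda>x. f x - g x) \<circ> \<phi>) = 2 * q (f \<circ> \<phi>) + 2 * q (g \<circ> \<phi>)"
    using quadratic_on_parallelogram[OF assms, of "f \<circ> \<phi>" "g \<circ> \<phi>"] by (simp add: o_def)
  show "q ((\<lambda>x. t * f x) \<circ> \<phi>) = t\<^sup>2 * q (f \<circ> \<phi>)" for t
    using quadratic_on_scale[OF assms, of "f \<circ> \<phi>"] by (simp add: o_def)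
qed

lemma quadratic_on_level_form: "quadratic_on UNIV E \<Longrightarrow> quadratic_on UNIV (level_form k w n E)"
  unfolding level_form_def[abs_def] by (intro quadratic_on_sum quadratic_on_comp)

lemma edge_form_cong:
  assumes "\<And>x. x \<in> ess_fixed_pts k w \<Longrightarrow> f x = g x"
  shows "edge_form k w c f = edge_form k w c g"
  unfolding edge_form_def by (rule sum.cong) (auto simp: edges0_def assms)

lemma edge_form_shift: "edge_form k w c (\<lambda>x. g x + t) = edge_form k w c g"
  by (simp add: edge_form_def)

lemma edge_form_nonneg:
  assumes "\<And>p q. p \<in> ess_fixed_pts k w \<Longrightarrow> q \<in> ess_fixed_pts k w \<Longrightarrow> p \<noteq> q \<Longrightarrow> c p q \<ge> 0"
  shows "edge_form k w c f \<ge> 0"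
  unfolding edge_form_def by (rule sum_nonneg) (auto simp: edges0_def assms)

lemma edge_form_contraction:
  assumes "\<And>p q. p \<in> ess_fixed_pts k w \<Longrightarrow> q \<in> ess_fixed_pts k w \<Longrightarrow> p \<noteq> q \<Longrightarrow> c p q \<ge> 0"
    and \<phi>: "\<And>x y. \<bar>\<phi> x - \<phi> y\<bar> \<le> \<bar>x - y :: real\<bar>"
  shows "edge_form k w c (\<lambda>x. \<phi> (f x)) \<le> edge_form k w c f"
  unfolding edge_form_def
proof (rule sum_mono, clarify)
  fix p q assume "(p, q) \<in> edges0 k w"
  moreover have "(\<phi> (f p) - \<phi> (f q))\<^sup>2 \<le> (f p - f q)\<^sup>2" using \<phi> by (simp add: abs_le_square_iff)
  ultimately show "c p q * (\<phi> (f p) - \<phi> (f q))\<^sup>2 \<le> c p q * (f p - f q)\<^sup>2"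
    by (intro mult_left_mono) (auto simp: edges0_def assms)
qed

lemma polar_sum: "polar (\<lambda>f. \<Sum>i\<in>J. q i f) f g = (\<Sum>i\<in>J. polar (q i) f g)"
  unfolding polar_def sum_subtractf[symmetric] sum_divide_distrib ..

lemma polar_edge_form:
  "polar (edge_form k w c) f g = (\<Sum>(p, q)\<in>edges0 k w. c p q * ((f p - f q) * (g p - g q)))"
proof -
  have "polar (edge_form k w c) f g =
      (\<Sum>e\<in>edges0 k w. polar (\<lambda>g. c (fst e) (snd e) * (g (fst e) - g (snd e))\<^sup>2) f g)"
    unfolding polar_sum[symmetric] by (simp add: edge_form_def[abs_def] split_beta)
  also have "\<dots> = (\<Sum>e\<in>edges0 k w. c (fst e) (snd e) * ((f (fst e) - f (snd e)) * (g (fst e) - g (snd e))))"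
  proof (rule sum.cong[OF refl])
    fix e :: "'a \<times> 'a"
    have "(C * ((a + b) - (a' + b'))\<^sup>2 - C * ((a - b) - (a' - b'))\<^sup>2) / 4 = C * ((a - a') * (b - b'))"
      for C a b a' b' :: real by (simp add: power2_eq_square field_simps)
    then show "polar (\<lambda>g. c (fst e) (snd e) * (g (fst e) - g (snd e))\<^sup>2) f g =
        c (fst e) (snd e) * ((f (fst e) - f (snd e)) * (g (fst e) - g (snd e)))"
      unfolding polar_def .
  qed
  finally show ?thesis by (simp add: split_beta)
qed

lemma polar_level_form_1:
  "polar (level_form k w 1 E) f g = (\<Sum>i\<in>{1..k}. polar E (f \<circ> w i) (g \<circ> w i))"
proof -
  have "level_form k w 1 E = (\<lambda>f. \<Sum>i\<in>{1..k}. E (f \<circ> w i))" by (rule ext) (rule level_form_1)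
  then show ?thesis by (simp only: polar_sum) (simp add: polar_def o_def)
qed

text \<open>Conductances may vanish here as long as the graph is connected. The harmonic theory is
  used twice: for the given eigenform, where all are positive, and for the trace form, where
  positivity is derived from it.\<close>

locale conductances = nested +
  fixes c :: "'a \<Rightarrow> 'a \<Rightarrow> real"
  assumes c_sym: "p \<in> V0 \<Longrightarrow> q \<in> V0 \<Longrightarrow> c p q = c q p"
    and c_nonneg: "p \<in> V0 \<Longrightarrow> q \<in> V0 \<Longrightarrow> p \<noteq> q \<Longrightarrow> c p q \<ge> 0"
    and c_linked: "linked c V0"
begin

declare atLeastAtMost_iff [simp del] One_nat_def [simp del]

abbreviation E :: "('a \<Rightarrow> real) \<Rightarrow> real" where "E \<equiv> edge_form k w c"
abbreviation S :: "('a \<Rightarrow> real) \<Rightarrow> real" where "S \<equiv> level_form k w 1 E"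

lemma E_nonneg: "E f \<ge> 0"
  by (rule edge_form_nonneg) (rule c_nonneg)

lemma S_nonneg: "S f \<ge> 0"
  unfolding level_form_1 by (intro sum_nonneg E_nonneg)

sublocale E: nonneg_quadratic UNIV E
  by unfold_locales (simp_all add: fun_subspace_UNIV quadratic_on_edge_form E_nonneg)

sublocale S: nonneg_quadratic UNIV S
  by unfold_locales (simp_all add: fun_subspace_UNIV quadratic_on_edge_form quadratic_on_level_form S_nonneg)

lemma S_contraction: "(\<And>x y. \<bar>\<phi> x - \<phi> y\<bar> \<le> \<bar>x - y :: real\<bar>) \<Longrightarrow> S (\<lambda>x. \<phi> (f x)) \<le> S f"
  unfolding level_form_1 o_def by (intro sum_mono edge_form_contraction c_nonneg)

lemma E_zero:
  assumes "E f = 0" "x \<in> V0" "y \<in> V0"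
  shows "f x = f y"
proof (rule ccontr)
  assume "f x \<noteq> f y"
  then obtain a b where ab: "a \<in> {z\<in>V0. f z = f x}" "b \<in> V0 - {z\<in>V0. f z = f x}" "c a b > 0"
    using linkedD[OF c_linked, of "{z\<in>V0. f z = f x}" x y] assms by auto
  have "\<forall>e\<in>E0. (case e of (p, q) \<Rightarrow> c p q * (f p - f q)\<^sup>2) = 0"
    using assms(1) unfolding edge_form_def
    by (subst (asm) sum_nonneg_eq_0_iff) (auto simp: finite_E0 E0_iff c_nonneg)
  moreover have "f a \<noteq> f b" "a \<in> V0" "b \<in> V0" using ab by auto
  moreover have "(a, b) \<in> E0" using calculation by (auto simp: E0_iff)
  ultimately have "c a b * (f a - f b)\<^sup>2 = 0" by fast
  then show False using \<open>c a b > 0\<close> \<open>f a \<noteq> f b\<close> by simp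
qed

lemma S_zero:
  assumes "S f = 0" "\<And>x. x \<in> V0 \<Longrightarrow> f x = 0" "x \<in> vertices k w 1"
  shows "f x = 0"
proof -
  have z: "E (f \<circ> w i) = 0" if "i \<in> I" for i
    using assms(1) that unfolding level_form_1 by (subst (asm) sum_nonneg_eq_0_iff) (auto simp: E_nonneg)
  obtain p where p: "p \<in> V0" using V0_ne by blast
  have "vertices k w 1 \<subseteq> {x. f x = 0}"
  proof (rule V1_induct[of p])
    fix i a b assume "i \<in> I" "a \<in> V0" "b \<in> V0" "w i a \<in> {x. f x = 0}"
    then show "w i b \<in> {x. f x = 0}" using E_zero[OF z, of i a b] by simp
  qed (use p assms(2) V0_subset_V1 in auto)
  then show ?thesis using assms(3) by auto
qed

text \<open>Clamping to a range that contains the boundary values does not increase the energy and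
  leaves the boundary values alone, so a minimising sequence can be taken bounded; then it has a
  cluster point on the finite set \<open>V1\<close>.\<close>

lemma minimizer_exists:
  "\<exists>g. (\<forall>x\<in>V0. g x = u x) \<and> (\<forall>z. (\<forall>x\<in>V0. z x = u x) \<longrightarrow> S g \<le> S z)"
proof -
  let ?Z = "{z. \<forall>x\<in>V0. z x = u x}"
  obtain B where B: "B > 0" "\<forall>x\<in>V0. \<bar>u x\<bar> \<le> B" using finite_upper_bound[OF finite_V0, of "\<lambda>x. \<bar>u x\<bar>"] by auto
  define m where "m = Inf (S ` ?Z)"
  have bdd: "bdd_below (S ` ?Z)" by (rule bdd_belowI[of _ 0]) (use S_nonneg in auto)
  have ne: "S ` ?Z \<noteq> {}" by auto
  have m: "m \<le> S z" if "z \<in> ?Z" for z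
    unfolding m_def by (rule cInf_lower) (use that bdd in auto)
  have "\<exists>z. z \<in> ?Z \<and> S z < m + 1 / real (Suc n)" for n
    using cInf_lessD[OF ne, of "m + 1 / real (Suc n)"] unfolding m_def[symmetric] by auto
  then have "\<forall>n. \<exists>z. z \<in> ?Z \<and> S z < m + 1 / real (Suc n)" by (rule allI)
  from choice[OF this] obtain Z where Z: "\<forall>n. Z n \<in> ?Z \<and> S (Z n) < m + 1 / real (Suc n)" by (rule exE)
  define \<phi> where "\<phi> = (\<lambda>t. max (- B) (min B t))"
  define Y where "Y = (\<lambda>n x. \<phi> (Z n x))"
  have Y1: "S (Y n) \<le> m + 1 / real (Suc n)" for n
  proof -
    have "S (Y n) \<le> S (Z n)" unfolding Y_def by (rule S_contraction) (auto simp: \<phi>_def)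
    then show ?thesis using Z by (meson less_imp_le order_trans)
  qed
  have Y2: "Y n x = u x" if "x \<in> V0" for n x
    using Z B that by (auto simp: Y_def \<phi>_def)
  have Y3: "\<bar>Y n x\<bar> \<le> B" for n x using B(1) by (auto simp: Y_def \<phi>_def)
  have "\<exists>r l. strict_mono (r :: nat \<Rightarrow> nat) \<and> (\<forall>x\<in>vertices k w 1. (\<lambda>n. Y (r n) x) \<longlonglongrightarrow> l x)"
    by (rule finite_pointwise_subseq[OF finite_V1 Y3])
  then obtain r g where r: "strict_mono (r :: nat \<Rightarrow> nat)" and g: "\<forall>x\<in>vertices k w 1. (\<lambda>n. Y (r n) x) \<longlonglongrightarrow> g x"
    by blast
  have "(\<lambda>n. S (Y (r n))) \<longlonglongrightarrow> S g"
    unfolding level_form_1 edge_form_def split_beta o_def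
    by (intro tendsto_intros) (use g in \<open>auto simp: vertices_1 E0_iff\<close>)
  moreover have "(\<lambda>n. m + 1 / real (Suc (r n))) \<longlonglongrightarrow> m + 0"
    using LIMSEQ_subseq_LIMSEQ[OF LIMSEQ_inverse_real_of_nat r]
    by (intro tendsto_add tendsto_const) (simp add: o_def inverse_eq_divide)
  ultimately have "S g \<le> m + 0"
    by (rule LIMSEQ_le) (use Y1 in auto)
  moreover have "g x = u x" if "x \<in> V0" for x
  proof (rule LIMSEQ_unique)
    show "(\<lambda>n. Y (r n) x) \<longlonglongrightarrow> g x" using g V0_subset_V1 that by blast
    show "(\<lambda>n. Y (r n) x) \<longlonglongrightarrow> u x" using Y2[OF that] by simp
  qed
  ultimately show ?thesis using m by (intro exI[of _ g]) force
qed

text \<open>The harmonic extension of the indicator of \<open>p\<close>. Only its values on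
  \<open>V1\<close> enter the energy; elsewhere the choice is arbitrary.\<close>

definition hb :: "'a \<Rightarrow> 'a \<Rightarrow> real" where
  "hb p = (SOME g. (\<forall>x\<in>V0. g x = (if x = p then 1 else 0)) \<and>
     (\<forall>z. (\<forall>x\<in>V0. z x = (if x = p then 1 else 0)) \<longrightarrow> S g \<le> S z))"

lemma hb: "\<forall>x\<in>V0. hb p x = (if x = p then 1 else 0)"
  "(\<And>x. x \<in> V0 \<Longrightarrow> z x = (if x = p then 1 else 0)) \<Longrightarrow> S (hb p) \<le> S z"
  using someI_ex[OF minimizer_exists[of "\<lambda>x. if x = p then 1 else 0"], folded hb_def] by auto

text \<open>The harmonic extension from \<open>V\<^sub>0\<close> to \<open>V\<^sub>1\<close>; the sum makes it linear by construction.\<close>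

definition H :: "('a \<Rightarrow> real) \<Rightarrow> 'a \<Rightarrow> real" where
  "H u = (\<lambda>x. \<Sum>p\<in>V0. u p * hb p x)"

lemma H_V0: "x \<in> V0 \<Longrightarrow> H u x = u x"
proof -
  assume x: "x \<in> V0"
  have "H u x = (\<Sum>p\<in>V0. if p = x then u p else 0)"
    unfolding H_def by (rule sum.cong) (use x hb(1) in auto)
  also have "\<dots> = u x" using x by (simp add: finite_V0)
  finally show ?thesis .
qed

lemma H_cong: "(\<And>x. x \<in> V0 \<Longrightarrow> u x = v x) \<Longrightarrow> H u = H v"
  unfolding H_def by (auto intro!: sum.cong)

lemma H_add: "H (\<lambda>x. u x + v x) = (\<lambda>x. H u x + H v x)"
  by (auto simp: H_def sum.distrib distrib_right)

lemma H_diff: "H (\<lambda>x. u x - v x) = (\<lambda>x. H u x - H v x)"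
  by (auto simp: H_def sum_subtractf left_diff_distrib)

lemma H_scale: "H (\<lambda>x. t * u x) = (\<lambda>x. t * H u x)"
  by (auto simp: H_def sum_distrib_left mult.assoc)

lemma hb_orthogonal:
  assumes z: "\<And>x. x \<in> V0 \<Longrightarrow> z x = 0"
  shows "polar S (hb p) z = 0"
proof (rule quadratic_slope_zero[OF _ S_nonneg[of z]])
  fix t
  have "S (hb p) \<le> S (\<lambda>x. hb p x + t * z x)" by (rule hb(2)) (use hb(1) z in auto)
  also have "\<dots> = S (hb p) + 2 * t * polar S (hb p) z + t\<^sup>2 * S z" by (rule S.expand) auto
  finally show "0 \<le> 2 * t * polar S (hb p) z + t\<^sup>2 * S z" by simp
qed

lemma H_orthogonal:
  assumes z: "\<And>x. x \<in> V0 \<Longrightarrow> z x = 0"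
  shows "polar S (H u) z = 0"
proof -
  have "polar S (H u) z = polar S z (H u)" by (rule S.polar_commute) auto
  also have "\<dots> = (\<Sum>p\<in>V0. u p * polar S z (hb p))"
    unfolding H_def by (rule conjunct2[OF S.polar_sum_right]) (auto simp: finite_V0)
  also have "\<dots> = 0" using hb_orthogonal[OF z] S.polar_commute[of z] by simp
  finally show ?thesis .
qed

lemma S_H_add:
  assumes "\<And>x. x \<in> V0 \<Longrightarrow> z x = 0"
  shows "S (\<lambda>x. H u x + z x) = S (H u) + S z"
  using S.expand_add[of "H u" z] H_orthogonal[OF assms] by simp

lemma S_decompose:
  assumes "\<And>x. x \<in> V0 \<Longrightarrow> g x = u x"
  shows "S g = S (H u) + S (\<lambda>x. g x - H u x)"
  using S_H_add[of "\<lambda>x. g x - H u x" u] assms by (simp add: H_V0)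

lemma S_H_minimal: "(\<And>x. x \<in> V0 \<Longrightarrow> g x = u x) \<Longrightarrow> S (H u) \<le> S g"
  using S_decompose[of g u] S_nonneg[of "\<lambda>x. g x - H u x"] by simp

lemma H_unique:
  assumes "\<And>x. x \<in> V0 \<Longrightarrow> g x = u x" "S g \<le> S (H u)" "x \<in> vertices k w 1"
  shows "g x = H u x"
proof -
  have "S (\<lambda>x. g x - H u x) = 0"
    using S_decompose[of g u, OF assms(1)] assms(2) S_nonneg[of "\<lambda>x. g x - H u x"] by simp
  then have "g x - H u x = 0" by (rule S_zero) (use assms in \<open>auto simp: H_V0\<close>)
  then show ?thesis by simp
qed

text \<open>The absolute value of \<open>H u\<close> has the same boundary values and no more
  energy, so uniqueness of the minimiser identifies it with \<open>H u\<close> on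
  \<open>V1\<close>.\<close>

lemma H_nonneg:
  assumes "\<And>x. x \<in> V0 \<Longrightarrow> u x \<ge> 0" "x \<in> vertices k w 1"
  shows "H u x \<ge> 0"
proof -
  have "\<bar>H u x\<bar> = H u x"
    by (rule H_unique) (use assms S_contraction[of abs] in \<open>auto simp: H_V0\<close>)
  then show ?thesis by simp
qed

lemma H_const: "x \<in> vertices k w 1 \<Longrightarrow> H (\<lambda>_. t) x = t"
proof -
  assume x: "x \<in> vertices k w 1"
  have "S (\<lambda>_. t) = 0" by (simp add: level_form_1 edge_form_def o_def)
  then have "S (\<lambda>_. t) \<le> S (H (\<lambda>_. t))" using S_nonneg by simp
  then show ?thesis using H_unique[of "\<lambda>_. t" "\<lambda>_. t" x] x by simp
qed

text \<open>Harmonicity is tested on the indicator of the zero \<open>w i r\<close>. As the function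
  is nonnegative, all terms of this sum have one sign, so each vanishes, including the one of the
  edge towards \<open>w i s\<close>.\<close>

lemma H_zero_neighbour:
  assumes u: "\<And>x. x \<in> V0 \<Longrightarrow> u x \<ge> 0"
    and x: "w i r \<notin> V0" "H u (w i r) = 0" and i: "i \<in> I" and rs: "r \<in> V0" "s \<in> V0" "c r s > 0"
  shows "H u (w i s) = 0"
proof (cases "r = s")
  case False
  let ?x = "w i r"
  define z :: "'a \<Rightarrow> real" where "z = (\<lambda>y. if y = ?x then 1 else 0)"
  define g where "g = H u"
  have g0: "g y \<ge> 0" if "y \<in> vertices k w 1" for y unfolding g_def by (rule H_nonneg[OF u that])
  have gx: "g ?x = 0" using x by (simp add: g_def)
  define T where "T = (\<lambda>j e. - (c (fst e) (snd e) * ((g (w j (fst e)) - g (w j (snd e))) * (z (w j (fst e)) - z (w j (snd e))))))"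
  have "polar S g z = 0" unfolding g_def by (rule H_orthogonal) (use x in \<open>auto simp: z_def\<close>)
  then have "(\<Sum>j\<in>I. \<Sum>e\<in>E0. T j e) = 0"
    by (simp add: polar_level_form_1 polar_edge_form split_beta T_def sum_negf)
  moreover have T0: "T j e \<ge> 0" if "j \<in> I" "e \<in> E0" for j e
  proof -
    have ab: "fst e \<in> V0" "snd e \<in> V0" "fst e \<noteq> snd e" using that by (auto simp: edges0_def)
    have v: "w j (fst e) \<in> vertices k w 1" "w j (snd e) \<in> vertices k w 1" using that ab by (auto simp: vertices_1)
    have "(g (w j (fst e)) - g (w j (snd e))) * (z (w j (fst e)) - z (w j (snd e))) \<le> 0"
      using g0[OF v(1)] g0[OF v(2)] gx by (auto simp: z_def)
    then show ?thesis using c_nonneg[OF ab] by (simp add: T_def mult_nonneg_nonpos)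
  qed
  ultimately have "T i (r, s) = 0"
  proof -
    assume "(\<Sum>j\<in>I. \<Sum>e\<in>E0. T j e) = 0"
    then have "(\<Sum>e\<in>E0. T i e) = 0"
      by (subst (asm) sum_nonneg_eq_0_iff) (use i T0 in \<open>auto intro!: sum_nonneg\<close>)
    then show ?thesis
      by (subst (asm) sum_nonneg_eq_0_iff) (use i T0 rs False in \<open>auto simp: finite_E0 E0_iff\<close>)
  qed
  moreover have "w i s \<noteq> ?x" using w_inj[OF i] False by metis
  ultimately show ?thesis using rs gx by (simp add: T_def z_def g_def)
qed (use x in simp)

end

text \<open>No cut vertices: this is what remains of the completeness of the graph in the maximum
  principle, and it is available for the trace form by symmetry.\<close>

locale robust_conductances = conductances +
  assumes c_linked_del: "v \<in> V0 \<Longrightarrow> linked c (V0 - {v})"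
begin

text \<open>Deleting the at most one vertex of \<open>V\<^sub>0\<close> from a level-1 cell leaves it connected, so a
  positive value of a nonnegative harmonic function spreads from cell to cell.\<close>

lemma strong_maximum_principle:
  assumes u: "\<And>x. x \<in> V0 \<Longrightarrow> u x \<ge> 0" and p: "p \<in> V0" "u p > 0"
    and x: "x \<in> vertices k w 1" "x \<notin> V0"
  shows "H u x > 0"
proof -
  define g where "g = H u"
  \<comment> \<open>\<open>J i\<close> indexes the interior vertices of cell \<open>i\<close>, those
    not in \<open>V0\<close>; \<open>pos i\<close> says that the function is positive at all of
    them.\<close>
  define J where "J = (\<lambda>i. {s\<in>V0. w i s \<notin> V0})"
  define pos where "pos = (\<lambda>i. \<forall>t\<in>J i. g (w i t) > 0)"
  have g0: "g y \<ge> 0" if "y \<in> vertices k w 1" for y unfolding g_def by (rule H_nonneg[OF u that])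
  have g0': "g (w i s) \<ge> 0" if "i \<in> I" "s \<in> V0" for i s by (rule g0) (use that in \<open>auto simp: vertices_1\<close>)
  have nb: "g (w i s) = 0" if "i \<in> I" "r \<in> J i" "s \<in> V0" "c r s > 0" "g (w i r) = 0" for i r s
    using H_zero_neighbour[of u i r s, OF u] that by (simp add: J_def g_def)
  \<comment> \<open>A cell has at most one vertex in \<open>V0\<close>: such a vertex is a fixed
    point of \<open>w i\<close>, and a contraction has only one.\<close>
  have Jv: "J i = V0 - {v}" if "i \<in> I" "v \<in> V0" "w i v \<in> V0" for i v
  proof -
    have wv: "w i v = v" using V0_image_fixed that by blast
    have "w i s \<notin> V0" if s: "s \<in> V0" "s \<noteq> v" for s
    proof
      assume "w i s \<in> V0"
      then have "w i s = s" using V0_image_fixed \<open>i \<in> I\<close> s by blast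
      then have "norm (s - v) = lam * norm (s - v)" using sim[OF \<open>i \<in> I\<close>, of s v] wv by simp
      then have "(1 - lam) * norm (s - v) = 0" by (simp add: algebra_simps)
      then show False using s lam_less_1 by simp
    qed
    then show ?thesis using that by (auto simp: J_def)
  qed
  have Jlink: "linked c (J i)" if "i \<in> I" for i
  proof (cases "\<exists>v\<in>V0. w i v \<in> V0")
    case True
    then show ?thesis using Jv that c_linked_del by auto
  next
    case False
    then have "J i = V0" by (auto simp: J_def)
    then show ?thesis using c_linked by simp
  qed
  have A: "pos i" if iA: "i \<in> I" "s \<in> J i" "g (w i s) > 0" for i s
    unfolding pos_def
  proof (rule ballI, rule ccontr)
    fix t assume t: "t \<in> J i" "\<not> 0 < g (w i t)"
    obtain a b where ab: "a \<in> {s\<in>J i. g (w i s) > 0}" "b \<in> J i - {s\<in>J i. g (w i s) > 0}" "c a b > 0"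
      using linkedD[OF Jlink[OF iA(1)], of "{s\<in>J i. g (w i s) > 0}" s t] iA t by auto
    have V: "a \<in> V0" "b \<in> V0" using ab by (auto simp: J_def)
    have "g (w i b) = 0" using ab g0'[OF iA(1) V(2)] by auto
    then have "g (w i a) = 0" using nb[of i b a] iA(1) ab V c_sym by auto
    then show False using ab by simp
  qed
  \<comment> \<open>Positivity enters a cell from a boundary vertex: a neighbour \<open>b\<close>
    joined to it is interior, and a zero at \<open>b\<close> would spread back to the boundary
    vertex.\<close>
  have B: "pos i" if i: "i \<in> I" "s \<in> V0" "w i s \<in> V0" "g (w i s) > 0" for i s
  proof -
    have Ji: "J i = V0 - {s}" by (rule Jv[OF i(1-3)])
    obtain t where t: "t \<in> V0" "t \<noteq> s" using V0_other i(2) by blast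
    obtain b where b: "b \<in> V0 - {s}" "c s b > 0"
      using linkedD[OF c_linked, of "{s}" s t] i t by auto
    have "g (w i b) \<noteq> 0"
      using nb[of i b s] b i Ji c_sym[of s b] by auto
    then have "g (w i b) > 0" using g0'[OF i(1), of b] b by simp
    then show ?thesis using A[OF i(1), of b] b Ji by simp
  qed
  define P where "P = {x. \<exists>i\<in>I. \<exists>s\<in>V0. x = w i s \<and> pos i}"
  have "vertices k w 1 \<subseteq> P"
  proof (rule V1_induct[of p])
    obtain j where j: "j \<in> I" "w j p = p" using V0_fixed p by blast
    have "g (w j p) > 0" using p j by (simp add: g_def H_V0)
    then have "pos j" using B[of j p] j p by simp
    then show "p \<in> P" unfolding P_def using j p by (auto intro!: bexI[of _ j] bexI[of _ p])
    show "p \<in> vertices k w 1" using p V0_subset_V1 by blast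
  next
    fix i a b assume i: "i \<in> I" and a: "a \<in> V0" and b: "b \<in> V0" and P: "w i a \<in> P"
    then obtain j s where js: "j \<in> I" "s \<in> V0" "w i a = w j s" "pos j" by (auto simp: P_def)
    \<comment> \<open>Cells sharing a vertex: at a vertex of \<open>V0\<close> they coincide,
      otherwise the common vertex is interior to both and passes positivity on.\<close>
    have "pos i"
    proof (cases "w i a \<in> V0")
      case True
      have "w i a \<in> w i ` V0" using a by simp
      moreover have "w i a \<in> w j ` V0" unfolding js(3) using js(2) by simp
      ultimately have "i = j" by (rule unique_cell[OF True i js(1)])
      then show ?thesis using js by simp
    next
      case False
      then have "s \<in> J j" "a \<in> J i" using js a by (auto simp: J_def)
      then have "g (w i a) > 0" using js by (auto simp: pos_def)
      then show ?thesis using A[OF i \<open>a \<in> J i\<close>] by simp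
    qed
    then show "w i b \<in> P" using i b by (auto simp: P_def)
  qed
  then obtain i s where "i \<in> I" "s \<in> V0" "x = w i s" "pos i" using x by (auto simp: P_def)
  then show ?thesis using x by (auto simp: pos_def J_def g_def)
qed

end

subsection \<open>The renormalisation operator on quadratic forms\<close>

locale eigen = nested +
  fixes c :: "'a \<Rightarrow> 'a \<Rightarrow> real" and rho :: real
  assumes c_symmetric: "p \<in> V0 \<Longrightarrow> q \<in> V0 \<Longrightarrow> p \<noteq> q \<Longrightarrow> c p q = c q p"
    and c_pos: "p \<in> V0 \<Longrightarrow> q \<in> V0 \<Longrightarrow> p \<noteq> q \<Longrightarrow> c p q > 0"
    and rho_pos: "rho > 0"
    and eig: "Inf {level_form k w 1 (edge_form k w c) g | g. \<forall>x\<in>V0. g x = f x} = rho * edge_form k w c f"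
begin

declare atLeastAtMost_iff [simp del] One_nat_def [simp del]

sublocale robust_conductances
proof unfold_locales
  show "c p q = c q p" if "p \<in> V0" "q \<in> V0" for p q
    using c_symmetric[OF that] by (cases "p = q") auto
qed (auto intro!: linked_if_pos c_pos less_imp_le)

lemma S_H: "S (H u) = rho * E u"
proof -
  have "Inf {S g | g. \<forall>x\<in>V0. g x = u x} = S (H u)"
    by (rule cInf_eq_minimum) (auto simp: H_V0 intro: S_H_minimal)
  then show ?thesis using eig[of u] by simp
qed

definition lev :: "nat \<Rightarrow> (('a \<Rightarrow> real) \<Rightarrow> real) \<Rightarrow> ('a \<Rightarrow> real) \<Rightarrow> real" where
  "lev n q f = level_form k w n q f / rho ^ n"

lemma lev_0 [simp]: "lev 0 q f = q f"
  by (simp add: lev_def level_form_0)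

lemma lev_Suc: "lev (Suc n) q f = (\<Sum>i\<in>I. lev n q (f \<circ> w i)) / rho"
  by (simp add: lev_def level_form_Suc sum_divide_distrib mult.commute)

lemma lev_add: "lev (m + n) q f = lev m (lev n q) f"
  by (induction m arbitrary: f) (simp_all add: lev_Suc)

lemma lev_mono: "(\<And>f. q f \<le> q' f) \<Longrightarrow> lev n q f \<le> lev n q' f"
  unfolding lev_def level_form_def using rho_pos by (intro divide_right_mono sum_mono) auto

lemma lev_nonneg: "(\<And>f. q f \<ge> 0) \<Longrightarrow> lev n q f \<ge> 0"
  unfolding lev_def level_form_def using rho_pos by (intro divide_nonneg_nonneg sum_nonneg) auto

lemma lev_cmult: "lev n (\<lambda>f. t * q f) f = t * lev n q f"
  by (simp add: lev_def level_form_def sum_distrib_left)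

lemma lev_comb: "lev n (\<lambda>f. s * q f + t * q' f) f = s * lev n q f + t * lev n q' f"
  by (simp add: lev_def level_form_def sum_distrib_left sum.distrib add_divide_distrib)

lemma lev_bound:
  assumes "\<And>f. \<bar>q f\<bar> \<le> C * q' f" shows "\<bar>lev n q f\<bar> \<le> C * lev n q' f"
proof -
  have b: "q f \<le> C * q' f" "(- C) * q' f \<le> q f" for f using assms[of f] by auto
  have "lev n q f \<le> C * lev n q' f" using lev_mono[of q "\<lambda>f. C * q' f" n f, OF b(1)] by (simp only: lev_cmult)
  moreover have "(- C) * lev n q' f \<le> lev n q f"
    using lev_mono[of "\<lambda>f. (- C) * q' f" q n f, OF b(2)] by (simp only: lev_cmult)
  ultimately show ?thesis by (simp add: abs_le_iff)
qed

lemma quadratic_on_lev: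
  assumes "quadratic_on UNIV q" shows "quadratic_on UNIV (lev n q)"
proof -
  have "quadratic_on UNIV (\<lambda>f. (1 / rho ^ n) * level_form k w n q f + 0 * level_form k w n q f)"
    by (intro quadratic_on_comb quadratic_on_level_form assms)
  then show ?thesis by (simp add: lev_def[abs_def])
qed

lemma E_le_lev_1: "E f \<le> lev 1 E f"
  using S_H_minimal[of f f] S_H[of f] rho_pos by (simp add: lev_def field_simps)

lemma lev_E_Suc: "lev n E f \<le> lev (Suc n) E f"
  using lev_mono[of E "lev 1 E" n f] E_le_lev_1 lev_add[of n 1 E f] unfolding Suc_eq_plus1 by simp

lemma lev_E_mono: "m \<le> n \<Longrightarrow> lev m E f \<le> lev n E f"
  by (rule lift_Suc_mono_le[of "\<lambda>n. lev n E f"]) (rule lev_E_Suc)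

definition A :: "nat \<Rightarrow> ('a \<Rightarrow> real) \<Rightarrow> 'a \<Rightarrow> real" where
  "A i u = H u \<circ> w i"

definition T :: "(('a \<Rightarrow> real) \<Rightarrow> real) \<Rightarrow> ('a \<Rightarrow> real) \<Rightarrow> real" where
  "T q u = (\<Sum>i\<in>I. q (A i u)) / rho"

lemma A_cong: "(\<And>x. x \<in> V0 \<Longrightarrow> u x = v x) \<Longrightarrow> A i u = A i v"
  unfolding A_def using H_cong[of u v] by simp

lemma A_add: "A i (\<lambda>x. u x + v x) = (\<lambda>x. A i u x + A i v x)"
  and A_diff: "A i (\<lambda>x. u x - v x) = (\<lambda>x. A i u x - A i v x)"
  and A_scale: "A i (\<lambda>x. t * u x) = (\<lambda>x. t * A i u x)"
  by (auto simp: A_def H_add H_diff H_scale)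

lemma A_shift: "i \<in> I \<Longrightarrow> x \<in> V0 \<Longrightarrow> A i (\<lambda>x. u x + t) x = A i u x + t"
  by (simp add: A_def H_add, rule H_const) (auto simp: vertices_1)

lemma T_E: "T E u = E u"
  using S_H[of u] rho_pos by (simp add: T_def A_def level_form_1)

lemma T_mono: "(\<And>f. q f \<le> q' f) \<Longrightarrow> T q f \<le> T q' f"
  unfolding T_def using rho_pos by (intro divide_right_mono sum_mono) auto

lemma T_comb: "T (\<lambda>f. s * q f + t * q' f) = (\<lambda>f. s * T q f + t * T q' f)"
  by (auto simp: T_def sum_distrib_left sum.distrib add_divide_distrib)

lemma Tn_E: "(T ^^ n) E = E"
  by (induction n) (auto simp: T_E)

lemma Tn_mono: "(\<And>f. q f \<le> q' f) \<Longrightarrow> (T ^^ n) q f \<le> (T ^^ n) q' f"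
  by (induction n arbitrary: f) (auto intro: T_mono)

lemma Tn_comb: "(T ^^ n) (\<lambda>f. s * q f + t * q' f) = (\<lambda>f. s * (T ^^ n) q f + t * (T ^^ n) q' f)"
  by (induction n) (auto simp: T_comb)

lemma Tn_cmult: "(T ^^ n) (\<lambda>f. t * q f) = (\<lambda>f. t * (T ^^ n) q f)"
  using Tn_comb[of n t q 0 q] by simp

text \<open>\<open>T\<close> is positive and fixes \<open>E\<close>, so a two-sided bound by a
  multiple of \<open>E\<close> survives all iterations with the same constant.\<close>

lemma Tn_bound:
  assumes "\<And>f. \<bar>q f\<bar> \<le> C * E f" shows "\<bar>(T ^^ n) q f\<bar> \<le> C * E f"
proof -
  have b: "q f \<le> C * E f" "(- C) * E f \<le> q f" for f using assms[of f] by auto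
  have "(T ^^ n) q f \<le> C * E f" using Tn_mono[of q "\<lambda>f. C * E f" n f, OF b(1)] by (simp only: Tn_cmult Tn_E)
  moreover have "(- C) * E f \<le> (T ^^ n) q f"
    using Tn_mono[of "\<lambda>f. (- C) * E f" q n f, OF b(2)] by (simp only: Tn_cmult Tn_E)
  ultimately show ?thesis by (simp add: abs_le_iff)
qed

lemma Tn_nonneg:
  assumes "\<And>f. q f \<ge> 0" shows "(T ^^ n) q f \<ge> 0"
proof -
  have "(T ^^ n) (\<lambda>f. 0 * E f) f \<le> (T ^^ n) q f" by (rule Tn_mono) (simp add: assms)
  moreover have "(T ^^ n) (\<lambda>f. 0 * E f) = (\<lambda>f. 0 * (T ^^ n) E f)" by (rule Tn_cmult)
  ultimately show ?thesis by simp
qed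

text \<open>Quadratic forms on \<open>V0\<close> modulo constants, not necessarily nonnegative. The
  bound in the last clause serves as a norm: convergence of iterates is always measured by multiples
  of \<open>E\<close>.\<close>

definition form :: "(('a \<Rightarrow> real) \<Rightarrow> real) \<Rightarrow> bool" where
  "form q \<longleftrightarrow> quadratic_on UNIV q \<and> (\<forall>f g. (\<forall>x\<in>V0. f x = g x) \<longrightarrow> q f = q g) \<and>
    (\<forall>f t. q (\<lambda>x. f x + t) = q f) \<and> (\<exists>C. \<forall>f. \<bar>q f\<bar> \<le> C * E f)"

lemma form_quadratic: "form q \<Longrightarrow> quadratic_on UNIV q"
  and form_cong: "form q \<Longrightarrow> (\<And>x. x \<in> V0 \<Longrightarrow> f x = g x) \<Longrightarrow> q f = q g"
  and form_shift: "form q \<Longrightarrow> q (\<lambda>x. f x + t) = q f"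
  and form_bound: "form q \<Longrightarrow> \<exists>C. \<forall>f. \<bar>q f\<bar> \<le> C * E f"
  by (simp_all add: form_def)

lemma edge_form_bound: "\<exists>C. \<forall>f. \<bar>edge_form k w b f\<bar> \<le> C * E f"
proof -
  obtain C where C: "C > 0" "\<forall>e\<in>E0. \<bar>b (fst e) (snd e)\<bar> / c (fst e) (snd e) \<le> C"
    using finite_upper_bound[OF finite_E0, of "\<lambda>e. \<bar>b (fst e) (snd e)\<bar> / c (fst e) (snd e)"] by auto
  have "\<bar>edge_form k w b f\<bar> \<le> C * E f" for f
  proof -
    have "\<bar>edge_form k w b f\<bar> \<le> (\<Sum>(p, q)\<in>E0. \<bar>b p q * (f p - f q)\<^sup>2\<bar>)"
      unfolding edge_form_def split_beta by (rule sum_abs)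
    also have "\<dots> \<le> (\<Sum>(p, q)\<in>E0. C * (c p q * (f p - f q)\<^sup>2))"
    proof (rule sum_mono, clarify)
      fix p q assume e: "(p, q) \<in> E0"
      then have pos: "c p q > 0" using c_pos by (auto simp: E0_iff)
      have "\<bar>b p q\<bar> / c p q \<le> C" using C(2) e by force
      then have "\<bar>b p q\<bar> \<le> C * c p q" using pos_divide_le_eq[OF pos] by blast
      then have "\<bar>b p q\<bar> * (f p - f q)\<^sup>2 \<le> C * c p q * (f p - f q)\<^sup>2" by (intro mult_right_mono) auto
      then show "\<bar>b p q * (f p - f q)\<^sup>2\<bar> \<le> C * (c p q * (f p - f q)\<^sup>2)" by (simp add: abs_mult mult.assoc)
    qed
    also have "\<dots> = C * E f" by (simp add: edge_form_def sum_distrib_left split_beta)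
    finally show ?thesis .
  qed
  then show ?thesis by blast
qed

lemma form_edge_form: "form (edge_form k w b)"
  unfolding form_def
  by (simp add: quadratic_on_edge_form edge_form_shift edge_form_bound) (metis edge_form_cong)

lemma form_comb:
  assumes "form q" "form q'" shows "form (\<lambda>f. s * q f + t * q' f)"
proof -
  obtain C C' where C: "\<And>f. \<bar>q f\<bar> \<le> C * E f" "\<And>f. \<bar>q' f\<bar> \<le> C' * E f"
    using form_bound[OF assms(1)] form_bound[OF assms(2)] by blast
  have "\<bar>s * q f + t * q' f\<bar> \<le> (\<bar>s\<bar> * C + \<bar>t\<bar> * C') * E f" for f
  proof -
    have "\<bar>s * q f + t * q' f\<bar> \<le> \<bar>s\<bar> * \<bar>q f\<bar> + \<bar>t\<bar> * \<bar>q' f\<bar>" by (metis abs_mult abs_triangle_ineq)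
    also have "\<dots> \<le> \<bar>s\<bar> * (C * E f) + \<bar>t\<bar> * (C' * E f)" using C by (intro add_mono mult_left_mono) auto
    finally show ?thesis by (simp add: algebra_simps)
  qed
  moreover have "s * q f + t * q' f = s * q g + t * q' g" if "\<forall>x\<in>V0. f x = g x" for f g
    using form_cong[OF assms(1), of f g] form_cong[OF assms(2), of f g] that by simp
  ultimately show ?thesis using assms unfolding form_def
    by (auto intro: quadratic_on_comb)
qed

lemma form_T: assumes "form q" shows "form (T q)"
proof -
  obtain C where C: "\<And>f. \<bar>q f\<bar> \<le> C * E f" using form_bound[OF assms] by blast
  have "quadratic_on UNIV (T q)"
  proof (rule quadratic_onI)
    fix f g :: "'a \<Rightarrow> real" and t
    have "(\<Sum>i\<in>I. q (A i (\<lambda>x. f x + g x)) + q (A i (\<lambda>x. f x - g x))) = (\<Sum>i\<in>I. 2 * q (A i f) + 2 * q (A i g))"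
      unfolding A_add A_diff
      by (rule sum.cong[OF refl]) (rule quadratic_on_parallelogram[OF form_quadratic[OF assms]], auto)
    then show "T q (\<lambda>x. f x + g x) + T q (\<lambda>x. f x - g x) = 2 * T q f + 2 * T q g"
      using rho_pos by (simp add: T_def sum.distrib sum_distrib_left[symmetric] field_simps)
    show "T q (\<lambda>x. t * f x) = t\<^sup>2 * T q f"
      unfolding T_def A_scale quadratic_on_scale[OF form_quadratic[OF assms] UNIV_I]
      by (simp add: sum_distrib_left)
  qed
  moreover have "T q f = T q g" if "\<forall>x\<in>V0. f x = g x" for f g
    unfolding T_def using A_cong[of f g] that by simp
  moreover have "T q (\<lambda>x. f x + t) = T q f" for f t
  proof -
    have "q (A i (\<lambda>x. f x + t)) = q (A i f)" if "i \<in> I" for i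
    proof -
      have "q (A i (\<lambda>x. f x + t)) = q (\<lambda>x. A i f x + t)"
        by (rule form_cong[OF assms]) (rule A_shift[OF that])
      then show ?thesis using form_shift[OF assms] by simp
    qed
    then show ?thesis by (simp add: T_def)
  qed
  moreover have "\<bar>T q f\<bar> \<le> C * E f" for f using Tn_bound[of q C "Suc 0" f] C by simp
  ultimately show ?thesis unfolding form_def by blast
qed

lemma form_Tn: "form q \<Longrightarrow> form ((T ^^ n) q)"
  by (induction n) (auto intro: form_T)

lemma E_sup_bound: "\<exists>C>0. \<forall>f B. (\<forall>x\<in>V0. \<bar>f x\<bar> \<le> B) \<longrightarrow> E f \<le> C * B\<^sup>2"
proof -
  define C where "C = (\<Sum>(p, q)\<in>E0. 4 * c p q) + 1"
  have "E f \<le> C * B\<^sup>2" if f: "\<forall>x\<in>V0. \<bar>f x\<bar> \<le> B" for f B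
  proof -
    have "E f \<le> (\<Sum>(p, q)\<in>E0. c p q * (4 * B\<^sup>2))"
      unfolding edge_form_def
    proof (rule sum_mono, clarify)
      fix p q assume "(p, q) \<in> E0"
      then have V: "p \<in> V0" "q \<in> V0" "p \<noteq> q" by (auto simp: E0_iff)
      have "\<bar>f p - f q\<bar> \<le> 2 * B" using f V by (smt (verit))
      then have "(f p - f q)\<^sup>2 \<le> (2 * B)\<^sup>2" by (rule abs_le_square_iff[THEN iffD1, OF order_trans]) simp
      then show "c p q * (f p - f q)\<^sup>2 \<le> c p q * (4 * B\<^sup>2)" using c_pos[OF V]
        by (intro mult_left_mono) (auto simp: power_mult_distrib)
    qed
    also have "\<dots> = (\<Sum>(p, q)\<in>E0. 4 * c p q) * B\<^sup>2" by (simp add: sum_distrib_left split_beta algebra_simps)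
    also have "\<dots> \<le> C * B\<^sup>2" by (intro mult_right_mono) (auto simp: C_def)
    finally show ?thesis .
  qed
  moreover have "(\<Sum>(p, q)\<in>E0. 4 * c p q) \<ge> 0"
    by (rule sum_nonneg) (auto simp: E0_iff intro!: less_imp_le c_pos)
  then have "C > 0" by (simp add: C_def)
  ultimately show ?thesis by blast
qed

lemma E_pos:
  assumes "p \<in> V0" "q \<in> V0" "f p \<noteq> f q"
  shows "E f > 0"
  using E_zero[of f p q] E_nonneg[of f] assms by fastforce

subsection \<open>Perron vectors at the vertices\<close>

text \<open>A normal form for nonconstant functions on \<open>V0\<close>: an affine change gives it
  with \<open>p\<close> a maximum point of the original function. The vertex thereby selects which
  \<open>A i\<close> to iterate.\<close>

definition valid :: "'a \<Rightarrow> ('a \<Rightarrow> real) \<Rightarrow> bool" where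
  "valid p v \<longleftrightarrow> v p = 0 \<and> (\<forall>q\<in>V0. 0 \<le> v q \<and> v q \<le> 1) \<and> (\<exists>q\<in>V0. v q = 1)"

text \<open>If \<open>w i\<close> fixes \<open>p\<close>, then \<open>A i\<close> preserves the
  functions vanishing at \<open>p\<close>. In the remaining coordinates its entries are values of
  harmonic extensions of indicators at points outside \<open>V0\<close>, positive by the maximum
  principle, so Perron theory applies.\<close>

lemma perron_vertex:
  assumes p: "p \<in> V0"
  shows "\<exists>i e \<eta> \<kappa> \<theta>. i \<in> I \<and> e p = 0 \<and> (\<forall>q\<in>V0 - {p}. e q > 0) \<and> \<eta> > 0 \<and> (\<forall>q\<in>V0. A i e q = \<eta> * e q) \<and>
    \<kappa> > 0 \<and> \<theta> \<longlonglongrightarrow> 0 \<and> (\<forall>n v. valid p v \<longrightarrow>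
      (\<exists>\<alpha>\<ge>\<kappa> * \<eta> ^ Suc n. \<forall>q\<in>V0. \<bar>(A i ^^ Suc n) v q - \<alpha> * e q\<bar> \<le> \<theta> n * \<alpha> * e q))"
proof -
  obtain i where i: "i \<in> I" "w i p = p" using V0_fixed[OF p] by blast
  define X where "X = V0 - {p}"
  define a where "a = (\<lambda>q r. hb r (w i q))"
  have X: "finite X" "X \<noteq> {}" using finite_V0 V0_other[OF p] by (auto simp: X_def)
  have VX: "V0 = insert p X" using p by (auto simp: X_def)
  have apos: "a q r > 0" if q: "q \<in> X" and r: "r \<in> X" for q r
  proof -
    have "w i q \<notin> V0"
    proof
      assume "w i q \<in> V0"
      then have "w i q = q" using V0_image_fixed i q by (auto simp: X_def)
      then have "norm (q - p) = lam * norm (q - p)" using sim[OF i(1), of q p] i by simp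
      then have "(1 - lam) * norm (q - p) = 0" by (simp add: algebra_simps)
      then show False using q lam_less_1 by (simp add: X_def)
    qed
    moreover have "w i q \<in> vertices k w 1" using i q by (auto simp: vertices_1 X_def)
    ultimately have "H (\<lambda>x. if x = r then 1 else 0) (w i q) > 0"
      by (intro strong_maximum_principle[of _ r]) (use r in \<open>auto simp: X_def\<close>)
    also have "H (\<lambda>x. if x = r then 1 else 0) (w i q) = (\<Sum>x\<in>V0. if x = r then hb x (w i q) else 0)"
      unfolding H_def by (rule sum.cong) auto
    also have "\<dots> = a q r" using r by (simp add: a_def X_def finite_V0)
    finally show ?thesis .
  qed
  have Ap: "A i v p = v p" for v using H_V0[OF p] i by (simp add: A_def)
  have AX: "A i v q = mat_apply X a v q" if "v p = 0" for v q
    unfolding A_def H_def mat_apply_def a_def VX o_def using X that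
    by (subst sum.insert) (auto simp: X_def mult.commute)
  have mcong: "mat_apply X a v q = mat_apply X a v' q" if "\<And>r. r \<in> X \<Longrightarrow> v r = v' r" for v v' q
    unfolding mat_apply_def using that by (intro sum.cong) auto
  have An: "(A i ^^ n) v p = 0 \<and> (\<forall>q\<in>X. (A i ^^ n) v q = (mat_apply X a ^^ n) v q)" if v: "v p = 0" for v n
  proof (induction n)
    case (Suc n)
    have "(A i ^^ Suc n) v q = (mat_apply X a ^^ Suc n) v q" if q: "q \<in> X" for q
      using AX[of "(A i ^^ n) v" q] Suc mcong[of "(A i ^^ n) v" "(mat_apply X a ^^ n) v" q] by simp
    then show ?case using Suc Ap by simp
  qed (use v in simp)
  have "\<exists>u \<eta>. \<eta> > 0 \<and> (\<forall>q\<in>X. u q > 0 \<and> mat_apply X a u q = \<eta> * u q)"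
    by (rule perron_vector[OF X apos])
  then obtain u \<eta> where u: "\<eta> > 0" "\<forall>q\<in>X. u q > 0 \<and> mat_apply X a u q = \<eta> * u q" by blast
  define e where "e = (\<lambda>q. if q = p then 0 else u q)"
  have eX: "e q = u q" if "q \<in> X" for q using that by (simp add: e_def X_def)
  have ep: "e p = 0" by (simp add: e_def)
  have ee: "e q > 0 \<and> mat_apply X a e q = \<eta> * e q" if "q \<in> X" for q
    using u that eX mcong[of e u q] by simp
  obtain \<kappa> \<theta> where conv: "\<kappa> > 0" "\<theta> \<longlonglongrightarrow> 0"
    "\<forall>n v. (\<forall>q\<in>X. 0 \<le> v q \<and> v q \<le> 1) \<longrightarrow> (\<exists>q\<in>X. v q = 1) \<longrightarrow>
    (\<exists>\<alpha>\<ge>\<kappa> * \<eta> ^ Suc n. \<forall>q\<in>X. \<bar>(mat_apply X a ^^ Suc n) v q - \<alpha> * e q\<bar> \<le> \<theta> n * \<alpha> * e q)"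
    using perron_convergence[OF X apos u(1) ee] by blast
  have "\<exists>\<alpha>\<ge>\<kappa> * \<eta> ^ Suc n. \<forall>q\<in>V0. \<bar>(A i ^^ Suc n) v q - \<alpha> * e q\<bar> \<le> \<theta> n * \<alpha> * e q"
    if v: "valid p v" for n v
  proof -
    have v1: "v p = 0" "\<forall>q\<in>X. 0 \<le> v q \<and> v q \<le> 1" using v by (auto simp: valid_def X_def)
    have "\<exists>q\<in>X. v q = 1"
    proof -
      obtain q where "q \<in> V0" "v q = 1" using v by (auto simp: valid_def)
      then show ?thesis using v1(1) by (intro bexI[of _ q]) (auto simp: X_def)
    qed
    then obtain \<alpha> where \<alpha>: "\<alpha> \<ge> \<kappa> * \<eta> ^ Suc n"
      "\<forall>q\<in>X. \<bar>(mat_apply X a ^^ Suc n) v q - \<alpha> * e q\<bar> \<le> \<theta> n * \<alpha> * e q"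
      using conv(3) v1(2) by blast
    have "\<bar>(A i ^^ Suc n) v q - \<alpha> * e q\<bar> \<le> \<theta> n * \<alpha> * e q" if "q \<in> V0" for q
    proof (cases "q = p")
      case True
      then show ?thesis using An[of v "Suc n", OF v1(1)] ep by simp
    next
      case False
      then have "q \<in> X" using that by (simp add: X_def)
      then show ?thesis using An[of v "Suc n", OF v1(1)] \<alpha>(2) by metis
    qed
    then show ?thesis using \<alpha>(1) by blast
  qed
  moreover have "\<forall>q\<in>V0. A i e q = \<eta> * e q"
    unfolding VX using ee AX[of e, OF ep] Ap[of e] ep by simp
  ultimately show ?thesis
    by (intro exI[of _ i] exI[of _ e] exI[of _ \<eta>] exI[of _ \<kappa>] exI[of _ \<theta>])
      (use i ep ee u conv in \<open>simp add: X_def\<close>)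
qed

text \<open>The iterate is a sum of nonnegative terms over words; only the constant word of letters
  \<open>i\<close> is kept.\<close>

lemma Tn_ge_A:
  assumes i: "i \<in> I" and D: "\<And>f. D f \<ge> 0"
  shows "(1 / rho) ^ n * D ((A i ^^ n) v) \<le> (T ^^ n) D v"
proof (induction n arbitrary: v)
  case (Suc n)
  have "(1 / rho) ^ Suc n * D ((A i ^^ Suc n) v) = (1 / rho) * ((1 / rho) ^ n * D ((A i ^^ n) (A i v)))"
    by (simp add: funpow_swap1)
  also have "\<dots> \<le> (1 / rho) * (T ^^ n) D (A i v)"
    using rho_pos by (intro mult_left_mono Suc.IH) auto
  also have "\<dots> \<le> (1 / rho) * (\<Sum>j\<in>I. (T ^^ n) D (A j v))"
    using rho_pos i Tn_nonneg[of D n] D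
    by (intro mult_left_mono member_le_sum[of i I "\<lambda>j. (T ^^ n) D (A j v)"]) auto
  also have "\<dots> = (T ^^ Suc n) D v" by (simp add: T_def[of "(T ^^ n) D"])
  finally show ?case .
qed simp

text \<open>If a form is small on some \<open>A\<^sup>n v\<close> then it is small on the Perron vector, because
  the directions of \<open>A\<^sup>n v\<close> converge to it.\<close>

lemma small_on_perron_vector:
  assumes p: "p \<in> V0"
  shows "\<exists>i e \<eta>. i \<in> I \<and> E e > 0 \<and> \<eta> > 0 \<and> (\<forall>q\<in>V0. A i e q = \<eta> * e q) \<and>
    (\<forall>C \<tau>. \<tau> > 0 \<longrightarrow> (\<forall>\<^sub>F n in sequentially. \<exists>\<epsilon>>0. \<forall>D v. form D \<longrightarrow> (\<forall>f. 0 \<le> D f \<and> D f \<le> C * E f) \<longrightarrow>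
      valid p v \<longrightarrow> D ((A i ^^ Suc n) v) \<le> \<epsilon> \<longrightarrow> D e \<le> \<tau>))"
proof -
  obtain i e \<eta> \<kappa> \<theta> where P: "i \<in> I" "e p = 0" "\<forall>q\<in>V0 - {p}. e q > 0" "\<eta> > 0"
    "\<forall>q\<in>V0. A i e q = \<eta> * e q" "\<kappa> > 0" "\<theta> \<longlonglongrightarrow> 0"
    and conv: "\<forall>n v. valid p v \<longrightarrow>
      (\<exists>\<alpha>\<ge>\<kappa> * \<eta> ^ Suc n. \<forall>q\<in>V0. \<bar>(A i ^^ Suc n) v q - \<alpha> * e q\<bar> \<le> \<theta> n * \<alpha> * e q)"
    using perron_vertex[OF p] by blast
  obtain q where q: "q \<in> V0" "q \<noteq> p" using V0_other[OF p] by blast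
  have "e q > 0" using P(3) q by simp
  then have "e q \<noteq> e p" using P(2) by simp
  then have Ee: "E e > 0" by (rule E_pos[OF q(1) p])
  obtain B where B: "B > 0" "\<forall>x\<in>V0. e x \<le> B" using finite_upper_bound[OF finite_V0] by blast
  have e0: "e x \<ge> 0" if "x \<in> V0" for x using P(2,3) that by (cases "x = p") (auto intro: less_imp_le)
  obtain C3 where C3: "C3 > 0" "\<forall>f B. (\<forall>x\<in>V0. \<bar>f x\<bar> \<le> B) \<longrightarrow> E f \<le> C3 * B\<^sup>2"
    using E_sup_bound by blast
  have "\<forall>\<^sub>F n in sequentially. \<exists>\<epsilon>>0. \<forall>D v. form D \<longrightarrow> (\<forall>f. 0 \<le> D f \<and> D f \<le> C * E f) \<longrightarrow>
      valid p v \<longrightarrow> D ((A i ^^ Suc n) v) \<le> \<epsilon> \<longrightarrow> D e \<le> \<tau>" if \<tau>: "\<tau> > 0" for C \<tau>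
  proof -
    have "(\<lambda>n. 2 * (\<bar>C\<bar> * (C3 * (\<theta> n * B)\<^sup>2))) \<longlonglongrightarrow> 2 * (\<bar>C\<bar> * (C3 * (0 * B)\<^sup>2))"
      by (intro tendsto_intros P(7))
    then have "\<forall>\<^sub>F n in sequentially. 2 * (\<bar>C\<bar> * (C3 * (\<theta> n * B)\<^sup>2)) < \<tau> / 2"
      by (rule order_tendstoD(2)) (use \<tau> in simp)
    then show ?thesis
    proof (rule eventually_mono)
      fix n assume n: "2 * (\<bar>C\<bar> * (C3 * (\<theta> n * B)\<^sup>2)) < \<tau> / 2"
      \<comment> \<open>\<open>h\<close> bounds the scale \<alpha> of the iterate from below for all
        valid \<open>v\<close>. A form value at most \<tau> / 4 times the square of \<open>h\<close>
        becomes at most \<tau> / 4 after normalisation; the distance to the Perron vector accounts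
        for the other half of \<tau>.\<close>
      define h where "h = \<kappa> * \<eta> ^ Suc n"
      have h: "h > 0" using P(4,6) by (simp add: h_def)
      show "\<exists>\<epsilon>>0. \<forall>D v. form D \<longrightarrow> (\<forall>f. 0 \<le> D f \<and> D f \<le> C * E f) \<longrightarrow>
        valid p v \<longrightarrow> D ((A i ^^ Suc n) v) \<le> \<epsilon> \<longrightarrow> D e \<le> \<tau>"
      proof (rule exI[of _ "\<tau> / 4 * h\<^sup>2"], rule conjI, use \<tau> h in simp, intro allI impI)
        fix D v assume D: "form D" "\<forall>f. 0 \<le> D f \<and> D f \<le> C * E f" and v: "valid p v"
          and le: "D ((A i ^^ Suc n) v) \<le> \<tau> / 4 * h\<^sup>2"
        interpret D: nonneg_quadratic UNIV D
          by unfold_locales (use D fun_subspace_UNIV form_quadratic in auto)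
        obtain \<alpha> where \<alpha>: "\<alpha> \<ge> h" "\<forall>q\<in>V0. \<bar>(A i ^^ Suc n) v q - \<alpha> * e q\<bar> \<le> \<theta> n * \<alpha> * e q"
          using conv v unfolding h_def by blast
        define y where "y = (\<lambda>x. (1 / \<alpha>) * (A i ^^ Suc n) v x)"
        have \<alpha>0: "\<alpha> > 0" using \<alpha> h by simp
        have y: "\<bar>y x - e x\<bar> \<le> \<bar>\<theta> n\<bar> * B" if x: "x \<in> V0" for x
        proof -
          have "y x - e x = ((A i ^^ Suc n) v x - \<alpha> * e x) / \<alpha>" using \<alpha>0 by (simp add: y_def field_simps)
          then have "\<bar>y x - e x\<bar> = \<bar>(A i ^^ Suc n) v x - \<alpha> * e x\<bar> / \<alpha>" using \<alpha>0 by simp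
          also have "\<dots> \<le> (\<theta> n * \<alpha> * e x) / \<alpha>" using \<alpha>(2) x \<alpha>0 by (intro divide_right_mono) auto
          also have "\<dots> = \<theta> n * e x" using \<alpha>0 by simp
          also have "\<dots> \<le> \<bar>\<theta> n\<bar> * B" using e0[OF x] B x by (intro mult_mono) auto
          finally show ?thesis .
        qed
        have "D y = (1 / \<alpha>)\<^sup>2 * D ((A i ^^ Suc n) v)" unfolding y_def by (rule D.scale) simp
        also have "\<dots> \<le> (1 / h)\<^sup>2 * (\<tau> / 4 * h\<^sup>2)"
          using le \<alpha>(1) h D(2) by (intro mult_mono power_mono divide_left_mono) auto
        also have "\<dots> = \<tau> / 4" using h by (simp add: power2_eq_square)
        finally have Dy: "D y \<le> \<tau> / 4" .
        have "D (\<lambda>x. e x - y x) \<le> C * E (\<lambda>x. e x - y x)" using D(2) by blast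
        also have "\<dots> \<le> \<bar>C\<bar> * E (\<lambda>x. e x - y x)" using E_nonneg by (intro mult_right_mono) auto
        also have "\<dots> \<le> \<bar>C\<bar> * (C3 * (\<bar>\<theta> n\<bar> * B)\<^sup>2)"
          using C3(2)[rule_format, of "\<lambda>x. e x - y x" "\<bar>\<theta> n\<bar> * B"] y
          by (intro mult_left_mono) (auto simp: abs_minus_commute)
        finally have "2 * D (\<lambda>x. e x - y x) \<le> \<tau> / 2" using n by (simp add: power_mult_distrib)
        moreover have "D (\<lambda>x. y x + (e x - y x)) \<le> 2 * D y + 2 * D (\<lambda>x. e x - y x)"
          by (rule D.triangle2) auto
        ultimately show "D e \<le> \<tau>" using Dy by simp
      qed
    qed
  qed
  then show ?thesis using P Ee by blast
qed

end

subsection \<open>Convergence of the iterated operator\<close>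

context eigen
begin

declare atLeastAtMost_iff [simp del] One_nat_def [simp del]

definition perron_data :: "'a \<Rightarrow> nat \<Rightarrow> ('a \<Rightarrow> real) \<Rightarrow> real \<Rightarrow> bool" where
  "perron_data p i e \<eta> \<longleftrightarrow> i \<in> I \<and> E e > 0 \<and> \<eta> > 0 \<and> (\<forall>q\<in>V0. A i e q = \<eta> * e q) \<and>
    (\<forall>C \<tau>. \<tau> > 0 \<longrightarrow> (\<forall>\<^sub>F n in sequentially. \<exists>\<epsilon>>0. \<forall>D v. form D \<longrightarrow> (\<forall>f. 0 \<le> D f \<and> D f \<le> C * E f) \<longrightarrow>
      valid p v \<longrightarrow> D ((A i ^^ Suc n) v) \<le> \<epsilon> \<longrightarrow> D e \<le> \<tau>))"

text \<open>The sign is reversed: \<open>p\<close> is a point of maximum, and (max - u) / (max -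
  min) vanishes there and attains 1 at a minimum.\<close>

lemma normalise:
  assumes "E u > 0"
  shows "\<exists>p\<in>V0. \<exists>s t. s \<noteq> 0 \<and> valid p (\<lambda>x. s * u x + t)"
proof -
  have "Max (u ` V0) \<in> u ` V0" "Min (u ` V0) \<in> u ` V0" using finite_V0 V0_ne by (auto intro: Max_in Min_in)
  then obtain p q where p: "p \<in> V0" "u p = Max (u ` V0)" and q: "q \<in> V0" "u q = Min (u ` V0)" by (metis imageE)
  have mx: "u x \<le> u p" "u q \<le> u x" if "x \<in> V0" for x using that finite_V0 p q by simp_all
  define d where "d = u p - u q"
  have "d \<noteq> 0"
  proof
    assume "d = 0"
    then have "u x = u p" if "x \<in> V0" for x using mx[OF that] by (simp add: d_def)
    then have "E u = E (\<lambda>_. u p)" by (rule edge_form_cong)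
    also have "\<dots> = 0" by (simp add: edge_form_def)
    finally show False using assms by simp
  qed
  then have d: "d > 0" using mx[OF q(1)] by (simp add: d_def)
  have e: "(- 1 / d) * u x + u p / d = (u p - u x) / d" for x by (simp add: diff_divide_distrib)
  have "valid p (\<lambda>x. (- 1 / d) * u x + u p / d)"
    unfolding valid_def e
  proof (intro conjI ballI)
    fix x assume x: "x \<in> V0"
    show "0 \<le> (u p - u x) / d" "(u p - u x) / d \<le> 1"
      using mx[OF x] d by (simp_all add: d_def)
  next
    show "\<exists>x\<in>V0. (u p - u x) / d = 1" using q d by (intro bexI[of _ q]) (simp_all add: d_def)
  qed simp
  moreover have "- 1 / d \<noteq> 0" using d by simp
  ultimately show ?thesis using p(1) by blast
qed

lemma form_affine: "form q \<Longrightarrow> q (\<lambda>x. s * u x + t) = s\<^sup>2 * q u"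
  using form_shift[of q "\<lambda>x. s * u x" t] quadratic_on_scale[OF form_quadratic] by simp

lemma form_E: "form E"
  by (rule form_edge_form)

lemma A_eigen:
  assumes "\<forall>q\<in>V0. A i e q = \<eta> * e q" "x \<in> V0"
  shows "(A i ^^ m) e x = \<eta> ^ m * e x"
proof -
  have "\<forall>x\<in>V0. (A i ^^ m) e x = \<eta> ^ m * e x"
  proof (induction m)
    case (Suc m)
    have "A i ((A i ^^ m) e) = A i (\<lambda>x. \<eta> ^ m * e x)" by (rule A_cong) (use Suc in simp)
    also have "\<dots> = (\<lambda>x. \<eta> ^ m * A i e x)" by (rule A_scale)
    finally show ?case using assms(1) by (simp add: mult.assoc)
  qed simp
  then show ?thesis using assms(2) by simp
qed

text \<open>Let \<open>M0\<close> be the limit of the largest ratio \<open>T\<^sup>n W / E\<close>. A late near-maximiser propagates under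
  some \<open>A i\<close> to a Perron vector \<open>e\<close>, on which then all \<open>T\<^sup>n W\<close> in a long time window are at least
  \<open>M0 / 2\<close> times \<open>E\<close>. The sum over the window telescopes, so it is bounded, whence \<open>M0 = 0\<close>.\<close>

lemma T_difference_upper:
  assumes Y: "form Y" and \<epsilon>: "\<epsilon> > 0"
  shows "\<exists>N. \<forall>n\<ge>N. \<forall>u. (T ^^ n) (\<lambda>u. Y u - T Y u) u \<le> \<epsilon> * E u"
proof -
  define W where "W = (\<lambda>u. Y u - T Y u)"
  define Wn where "Wn = (\<lambda>n. (T ^^ n) W)"
  have fW: "form W" using form_comb[OF Y form_T[OF Y], of 1 "-1"] by (simp add: W_def)
  have fWn: "form (Wn n)" for n unfolding Wn_def by (rule form_Tn[OF fW])
  obtain CY0 where "\<forall>f. \<bar>Y f\<bar> \<le> CY0 * E f" using form_bound[OF Y] by blast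
  then have CY: "\<bar>Y f\<bar> \<le> \<bar>CY0\<bar> * E f" for f
    using E_nonneg[of f] by (meson abs_ge_self mult_right_mono order_trans)
  obtain CW0 where "\<forall>f. \<bar>W f\<bar> \<le> CW0 * E f" using form_bound[OF fW] by blast
  then have CW: "\<bar>W f\<bar> \<le> \<bar>CW0\<bar> * E f" for f
    using E_nonneg[of f] by (meson abs_ge_self mult_right_mono order_trans)
  have CWn: "\<bar>Wn n f\<bar> \<le> \<bar>CW0\<bar> * E f" for n f unfolding Wn_def by (rule Tn_bound) (rule CW)
  \<comment> \<open>Bounds valid for some iterate. By \<open>persist\<close> they hold for all later
    ones, so the infimum \<open>M0\<close> is the limit of the best nonnegative bounds.\<close>
  define P where "P = (\<lambda>M. M \<ge> 0 \<and> (\<exists>n. \<forall>u. Wn n u \<le> M * E u))"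
  have Wadd: "Wn (m + n) = (T ^^ m) (Wn n)" for m n by (simp add: Wn_def funpow_add)
  have persist: "Wn n' u \<le> M * E u" if M: "\<forall>u. Wn n u \<le> M * E u" and le: "n \<le> n'" for M n n' u
  proof -
    have "Wn n' u = (T ^^ (n' - n)) (Wn n) u" using le Wadd[of "n' - n" n] by simp
    also have "\<dots> \<le> (T ^^ (n' - n)) (\<lambda>u. M * E u) u" by (rule Tn_mono) (use M in blast)
    finally show ?thesis by (simp only: Tn_cmult Tn_E)
  qed
  define M0 where "M0 = Inf {M. P M}"
  have ne: "{M. P M} \<noteq> {}"
  proof -
    have "Wn 0 u \<le> \<bar>CW0\<bar> * E u" for u using CWn[of 0 u] by simp
    then have "P \<bar>CW0\<bar>" unfolding P_def by auto
    then show ?thesis by blast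
  qed
  have bdd: "bdd_below {M. P M}" by (rule bdd_belowI[of _ 0]) (simp add: P_def)
  have M0_le: "M0 \<le> M" if "P M" for M unfolding M0_def using that bdd by (intro cInf_lower) auto
  have "M0 \<le> 0"
  proof (rule ccontr)
    assume "\<not> M0 \<le> 0"
    then have M0: "M0 > 0" by simp
    have "\<forall>p\<in>V0. \<exists>i e \<eta>. perron_data p i e \<eta>"
      unfolding perron_data_def using small_on_perron_vector by blast
    then obtain i e \<eta> where pd: "\<And>p. p \<in> V0 \<Longrightarrow> perron_data p (i p) (e p) (\<eta> p)" by metis
    have pd1: "i p \<in> I" "E (e p) > 0" "\<eta> p > 0" "\<forall>q\<in>V0. A (i p) (e p) q = \<eta> p * e p q" if "p \<in> V0" for p
      using pd[OF that] by (simp_all add: perron_data_def)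
    \<comment> \<open>Length of the time window: if every term in it is at least
      \<open>M0 / 2\<close> times \<open>E\<close>, their sum exceeds the bound 2 |CY0|
      \<open>E\<close> of the telescoped sum.\<close>
    obtain L :: nat where L: "real L * M0 > 4 * \<bar>CY0\<bar>" using reals_Archimedean3[OF M0] by blast
    define C where "C = M0 + 1 + \<bar>CW0\<bar>"
    define g where "g = (\<lambda>p. (\<eta> p)\<^sup>2 / rho)"
    \<comment> \<open>On the Perron vector the branch \<open>A i\<close> multiplies a form by
      \<open>g\<close> per step; \<open>G\<close> is a lower bound for the product of at most
      \<open>L\<close> such factors, whether \<open>g\<close> is above or below 1.\<close>
    define G where "G = (\<lambda>p. min 1 (g p) ^ L)"
    define \<tau> where "\<tau> = (\<lambda>p. G p * (M0 / 2 * E (e p)))"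
    have g: "g p > 0" "G p > 0" if "p \<in> V0" for p using pd1[OF that] rho_pos by (simp_all add: g_def G_def)
    have \<tau>: "\<tau> p > 0" if "p \<in> V0" for p using g[OF that] pd1[OF that] M0 by (simp add: \<tau>_def)
    obtain C3 where C3: "C3 > 0" "\<forall>f B. (\<forall>x\<in>V0. \<bar>f x\<bar> \<le> B) \<longrightarrow> E f \<le> C3 * B\<^sup>2"
      using E_sup_bound by blast
    have Ev: "E v \<le> C3" if "valid p v" for p v
    proof -
      have "\<forall>x\<in>V0. \<bar>v x\<bar> \<le> 1" using that by (simp add: valid_def)
      then have "E v \<le> C3 * 1\<^sup>2" using C3(2) by blast
      then show ?thesis by simp
    qed
    have "\<forall>\<^sub>F n in sequentially. \<forall>p\<in>V0. \<exists>\<epsilon>>0. \<forall>D v. form D \<longrightarrow> (\<forall>f. 0 \<le> D f \<and> D f \<le> C * E f) \<longrightarrow>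
      valid p v \<longrightarrow> D ((A (i p) ^^ Suc n) v) \<le> \<epsilon> \<longrightarrow> D (e p) \<le> \<tau> p"
      by (rule eventually_ball_finite[OF finite_V0]) (use pd \<tau> in \<open>simp add: perron_data_def\<close>)
    then obtain n where "\<forall>p\<in>V0. \<exists>\<epsilon>>0. \<forall>D v. form D \<longrightarrow> (\<forall>f. 0 \<le> D f \<and> D f \<le> C * E f) \<longrightarrow>
      valid p v \<longrightarrow> D ((A (i p) ^^ Suc n) v) \<le> \<epsilon> \<longrightarrow> D (e p) \<le> \<tau> p"
      using eventually_happens trivial_limit_sequentially by blast
    then obtain \<epsilon>p where \<epsilon>p: "\<forall>p\<in>V0. \<epsilon>p p > 0 \<and> (\<forall>D v. form D \<longrightarrow> (\<forall>f. 0 \<le> D f \<and> D f \<le> C * E f) \<longrightarrow>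
      valid p v \<longrightarrow> D ((A (i p) ^^ Suc n) v) \<le> \<epsilon>p p \<longrightarrow> D (e p) \<le> \<tau> p)"
      by (rule bchoice[THEN exE])
    obtain \<epsilon>0 where \<epsilon>0: "\<epsilon>0 > 0" "\<forall>p\<in>V0. \<epsilon>0 \<le> \<epsilon>p p"
      using finite_pos_lower_bound[OF finite_V0, of \<epsilon>p] \<epsilon>p by blast
    \<comment> \<open>Tolerance for the near-maximiser: bounds 1 and \<open>M0\<close> keep the
      constant \<open>C\<close> valid and \<open>M0 - \<delta> / 2\<close> nonnegative; the third
      absorbs the factor lost in following a single branch for \<open>Suc n\<close> steps.\<close>
    define \<delta> where "\<delta> = Min {1, M0, \<epsilon>0 / (rho ^ Suc n * C3)}"
    have X: "\<epsilon>0 / (rho ^ Suc n * C3) > 0" using \<epsilon>0 rho_pos C3 by simp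
    have \<delta>: "\<delta> > 0" "\<delta> \<le> 1" "\<delta> \<le> M0" "\<delta> \<le> \<epsilon>0 / (rho ^ Suc n * C3)"
      using X M0 by (simp_all add: \<delta>_def)
    have "\<exists>M2\<in>{M. P M}. M2 < M0 + \<delta> / 2"
      unfolding M0_def using ne \<delta>(1) by (intro cInf_lessD) (simp_all add: M0_def)
    then obtain M2 n0 where M2: "P M2" "M2 < M0 + \<delta> / 2" and n0: "\<forall>u. Wn n0 u \<le> M2 * E u"
      by (auto simp: P_def)
    have M02: "M0 \<le> M2" by (rule M0_le[OF M2(1)])
    \<comment> \<open>The defect from the bound \<open>M2\<close>. It is nonnegative from time
      \<open>n0\<close> on and evolves under \<open>T\<close>, because \<open>E\<close> is fixed;
      thus smallness can be traced backwards in time.\<close>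
    define D where "D = (\<lambda>m u. M2 * E u - Wn m u)"
    have fD: "form (D m)" for m
      using form_comb[OF form_E fWn, of M2 "-1" m] by (simp add: D_def)
    have D0: "D m u \<ge> 0" if "n0 \<le> m" for m u using persist[OF n0 that] by (simp add: D_def)
    have DC: "D m u \<le> C * E u" for m u
    proof -
      have "M2 * E u \<le> (M0 + 1) * E u" using M2(2) \<delta> E_nonneg by (intro mult_right_mono) auto
      then show ?thesis using CWn[of m u] by (simp add: D_def C_def algebra_simps abs_le_iff)
    qed
    have Dadd: "D (m + m') = (T ^^ m) (D m')" for m m'
      using Tn_comb[of m M2 E "-1" "Wn m'"] by (simp add: D_def Wadd Tn_E)
    \<comment> \<open>The window runs from \<open>n0\<close> to \<open>n1\<close>; the
      near-maximiser is taken \<open>Suc n\<close> steps later, to leave time for the direction to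
      approach the Perron vector.\<close>
    define n1 where "n1 = n0 + L"
    define N where "N = Suc n + n1"
    have "\<not> P (M0 - \<delta> / 2)" using M0_le[of "M0 - \<delta> / 2"] \<delta>(1) by auto
    moreover have "M0 - \<delta> / 2 \<ge> 0" using \<delta> M0 by simp
    ultimately obtain u where u: "Wn N u > (M0 - \<delta> / 2) * E u" unfolding P_def by (meson not_le)
    have "E u \<noteq> 0"
    proof
      assume "E u = 0"
      then show False using u CWn[of N u] by simp
    qed
    then have "E u > 0" using E_nonneg[of u] by simp
    then obtain p s t where p: "p \<in> V0" and s: "s \<noteq> 0" and v: "valid p (\<lambda>x. s * u x + t)"
      using normalise by blast
    define v where "v = (\<lambda>x. s * u x + t)"
    have "s\<^sup>2 * Wn N u > s\<^sup>2 * ((M0 - \<delta> / 2) * E u)" using u s by (intro mult_strict_left_mono) auto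
    then have Wv: "Wn N v > (M0 - \<delta> / 2) * E v"
      unfolding v_def form_affine[OF fWn] form_affine[OF form_E] by (simp add: algebra_simps)
    have "D N v \<le> \<delta> * C3"
    proof -
      have "D N v \<le> (M2 - (M0 - \<delta> / 2)) * E v" using Wv by (simp add: D_def left_diff_distrib)
      also have "\<dots> \<le> \<delta> * E v" using M2(2) E_nonneg by (intro mult_right_mono) auto
      also have "\<dots> \<le> \<delta> * C3" using Ev v \<delta>(1) unfolding v_def by (intro mult_left_mono) auto
      finally show ?thesis .
    qed
    then have "D N v \<le> \<epsilon>0 / (rho ^ Suc n * C3) * C3"
      using \<delta>(4) C3(1) by (meson mult_right_mono order_trans less_imp_le)
    also have "\<dots> = \<epsilon>0 / rho ^ Suc n" using C3(1) by simp
    finally have DN: "D N v \<le> \<epsilon>0 / rho ^ Suc n" .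
    have "(1 / rho) ^ Suc n * D n1 ((A (i p) ^^ Suc n) v) \<le> (T ^^ Suc n) (D n1) v"
      by (rule Tn_ge_A[OF pd1(1)[OF p]]) (rule D0, simp add: n1_def)
    also have "\<dots> = D N v" unfolding N_def Dadd ..
    also have "\<dots> \<le> \<epsilon>0 / rho ^ Suc n" by (rule DN)
    finally have "D n1 ((A (i p) ^^ Suc n) v) \<le> \<epsilon>0"
      using rho_pos by (simp add: power_one_over field_simps)
    then have le: "D n1 ((A (i p) ^^ Suc n) v) \<le> \<epsilon>p p" using \<epsilon>0(2) p by fastforce
    have De: "D n1 (e p) \<le> \<tau> p"
      using \<epsilon>p p fD[of n1] D0[of n1] DC[of n1] v[folded v_def] le by (simp add: n1_def)
    \<comment> \<open>Going back from \<open>n1\<close> to \<open>n0 + l\<close> along the Perron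
      branch divides the defect bound by \<open>g\<close> to the power \<open>L - l\<close>, which
      the factor \<open>G\<close> in \<tau> has paid for.\<close>
    have low: "Wn (n0 + l) (e p) \<ge> M0 / 2 * E (e p)" if l: "l < L" for l
    proof -
      let ?m = "L - l"
      have "g p ^ ?m * D (n0 + l) (e p) = (1 / rho) ^ ?m * ((\<eta> p ^ ?m)\<^sup>2 * D (n0 + l) (e p))"
        by (simp add: g_def power_divide power_mult[symmetric] mult.commute power_one_over)
      also have "(\<eta> p ^ ?m)\<^sup>2 * D (n0 + l) (e p) = D (n0 + l) (\<lambda>x. \<eta> p ^ ?m * e p x)"
        by (rule quadratic_on_scale[OF form_quadratic[OF fD] UNIV_I, symmetric])
      also have "\<dots> = D (n0 + l) ((A (i p) ^^ ?m) (e p))"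
        by (rule form_cong[OF fD]) (simp add: A_eigen[OF pd1(4)[OF p]])
      also have "(1 / rho) ^ ?m * D (n0 + l) ((A (i p) ^^ ?m) (e p)) \<le> (T ^^ ?m) (D (n0 + l)) (e p)"
        by (rule Tn_ge_A[OF pd1(1)[OF p]]) (rule D0, simp)
      also have "\<dots> = D n1 (e p)" using l by (simp add: Dadd[symmetric] n1_def add.commute)
      also have "\<dots> \<le> G p * (M0 / 2 * E (e p))" using De by (simp add: \<tau>_def)
      also have "\<dots> \<le> g p ^ ?m * (M0 / 2 * E (e p))"
      proof (rule mult_right_mono)
        have "G p \<le> min 1 (g p) ^ ?m" unfolding G_def using g[OF p] by (intro power_decreasing) auto
        also have "\<dots> \<le> g p ^ ?m" using g[OF p] by (intro power_mono) auto
        finally show "G p \<le> g p ^ ?m" .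
      qed (use M0 pd1[OF p] in simp)
      finally have "D (n0 + l) (e p) \<le> M0 / 2 * E (e p)" using g[OF p] by simp
      moreover have "M0 * E (e p) \<le> M2 * E (e p)" using M02 E_nonneg by (intro mult_right_mono)
      ultimately show ?thesis by (simp add: D_def)
    qed
    have tele: "(\<Sum>l<m. Wn (n0 + l) f) = (T ^^ n0) Y f - (T ^^ (n0 + m)) Y f" for m f
    proof (induction m)
      case (Suc m)
      have "Wn (n0 + m) f = (T ^^ (n0 + m)) (\<lambda>u. 1 * Y u + (-1) * T Y u) f" by (simp add: Wn_def W_def)
      also have "\<dots> = (T ^^ (n0 + m)) Y f - (T ^^ (n0 + m)) (T Y) f" by (simp only: Tn_comb)
      finally show ?case using Suc by (simp add: funpow_swap1)
    qed simp
    have "real L * (M0 / 2 * E (e p)) = (\<Sum>l<L. M0 / 2 * E (e p))" by simp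
    also have "\<dots> \<le> (\<Sum>l<L. Wn (n0 + l) (e p))" by (intro sum_mono low) simp
    also have "\<dots> = (T ^^ n0) Y (e p) - (T ^^ (n0 + L)) Y (e p)" by (rule tele)
    also have "\<dots> \<le> 2 * (\<bar>CY0\<bar> * E (e p))"
      using Tn_bound[of Y "\<bar>CY0\<bar>" n0 "e p", OF CY] Tn_bound[of Y "\<bar>CY0\<bar>" "n0 + L" "e p", OF CY]
      by (simp add: abs_le_iff)
    finally have "(real L * M0) * E (e p) \<le> (4 * \<bar>CY0\<bar>) * E (e p)" by simp
    then show False using L pd1(2)[OF p] by (simp add: mult_le_cancel_right)
  qed
  then have "Inf {M. P M} < \<epsilon>" using \<epsilon> by (simp add: M0_def)
  then obtain M where M: "P M" "M < \<epsilon>" using cInf_lessD[OF ne] by auto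
  then obtain n where n: "\<forall>u. Wn n u \<le> M * E u" by (auto simp: P_def)
  have "Wn n' u \<le> \<epsilon> * E u" if "n \<le> n'" for n' u
    using persist[OF n that, of u] M(2) E_nonneg[of u] mult_right_mono[of M \<epsilon> "E u"] by linarith
  then show ?thesis unfolding Wn_def W_def by blast
qed

lemma T_difference_small:
  assumes Y: "form Y" and \<epsilon>: "\<epsilon> > 0"
  shows "\<exists>N. \<forall>n\<ge>N. \<forall>u. \<bar>(T ^^ n) (\<lambda>u. Y u - T Y u) u\<bar> \<le> \<epsilon> * E u"
proof -
  obtain N1 where N1: "\<forall>n\<ge>N1. \<forall>u. (T ^^ n) (\<lambda>u. Y u - T Y u) u \<le> \<epsilon> * E u"
    using T_difference_upper[OF Y \<epsilon>] by blast
  define Z where "Z = (\<lambda>u. (-1) * Y u)"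
  have "form (\<lambda>u. (-1) * Y u + 0 * Y u)" by (rule form_comb[OF Y Y])
  then have Z: "form Z" by (simp add: Z_def)
  obtain N2 where N2: "\<forall>n\<ge>N2. \<forall>u. (T ^^ n) (\<lambda>u. Z u - T Z u) u \<le> \<epsilon> * E u"
    using T_difference_upper[OF Z \<epsilon>] by blast
  have "T Z = (\<lambda>u. (-1) * T Y u)" unfolding Z_def using Tn_cmult[of "Suc 0" "-1" Y] by simp
  then have "(\<lambda>u. Z u - T Z u) = (\<lambda>u. (-1) * (Y u - T Y u))" by (auto simp: Z_def)
  then have e: "(T ^^ n) (\<lambda>u. Z u - T Z u) u = - (T ^^ n) (\<lambda>u. Y u - T Y u) u" for n u
    using Tn_cmult[of n "-1" "\<lambda>u. Y u - T Y u"] by simp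
  have "\<bar>(T ^^ n) (\<lambda>u. Y u - T Y u) u\<bar> \<le> \<epsilon> * E u" if "n \<ge> max N1 N2" for n u
  proof -
    have "(T ^^ n) (\<lambda>u. Y u - T Y u) u \<le> \<epsilon> * E u" using N1 that by simp
    moreover have "(T ^^ n) (\<lambda>u. Z u - T Z u) u \<le> \<epsilon> * E u" using N2 that by simp
    ultimately show ?thesis unfolding e by linarith
  qed
  then show ?thesis by blast
qed

text \<open>Invariance under constants makes the rows of the Gram matrix of the indicators sum to
  zero, so only off-diagonal entries are left when the form is rewritten in differences. The half
  compensates for both orientations of an edge.\<close>

lemma form_representation:
  assumes q: "form q" "\<And>f. q f \<ge> 0"
  defines "\<Delta> \<equiv> \<lambda>p x. if x = p then 1 else (0::real)"
  shows "q f = edge_form k w (\<lambda>p r. - polar q (\<Delta> p) (\<Delta> r) / 2) f"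
proof -
  interpret q: nonneg_quadratic UNIV q
    by unfold_locales (use q fun_subspace_UNIV form_quadratic in auto)
  define b where "b = (\<lambda>p r. polar q (\<Delta> p) (\<Delta> r))"
  have b_sym: "b p r = b r p" for p r unfolding b_def by (rule q.polar_commute) auto
  have comb: "polar q g (\<lambda>x. \<Sum>r\<in>V0. h r * \<Delta> r x) = (\<Sum>r\<in>V0. h r * polar q g (\<Delta> r))" for g h
    using q.polar_sum_right[of g V0 \<Delta> h] finite_V0 by simp
  have val: "(\<Sum>r\<in>V0. h r * \<Delta> r x) = h x" if "x \<in> V0" for h x
  proof -
    have "(\<Sum>r\<in>V0. h r * \<Delta> r x) = (\<Sum>r\<in>V0. if r = x then h r else 0)"
      unfolding \<Delta>_def by (rule sum.cong) auto
    then show ?thesis using that finite_V0 by simp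
  qed
  define F where "F = (\<lambda>x. \<Sum>r\<in>V0. f r * \<Delta> r x)"
  have "q f = q F" by (rule form_cong[OF q(1)]) (simp add: F_def val)
  also have "\<dots> = polar q F F" by (rule q.polar_self[symmetric]) simp
  also have "\<dots> = (\<Sum>r\<in>V0. f r * polar q F (\<Delta> r))" by (subst (2) F_def) (rule comb)
  also have "\<dots> = (\<Sum>r\<in>V0. f r * polar q (\<Delta> r) F)"
    using q.polar_commute[of F] by simp
  also have "\<dots> = (\<Sum>r\<in>V0. \<Sum>p\<in>V0. b r p * (f r * f p))"
    unfolding F_def comb by (simp add: b_def sum_distrib_left algebra_simps)
  finally have qf: "q f = (\<Sum>r\<in>V0. \<Sum>p\<in>V0. b r p * (f r * f p))" .
  have row: "(\<Sum>p\<in>V0. b r p) = 0" for r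
  proof -
    have "(\<Sum>p\<in>V0. b r p) = polar q (\<Delta> r) (\<lambda>x. \<Sum>p\<in>V0. 1 * \<Delta> p x)"
      unfolding comb by (simp add: b_def)
    moreover have "q (\<lambda>x. \<Delta> r x + (\<Sum>p\<in>V0. 1 * \<Delta> p x)) = q (\<lambda>x. \<Delta> r x + 1)"
      by (rule form_cong[OF q(1)]) (simp only: val)
    moreover have "q (\<lambda>x. \<Delta> r x - (\<Sum>p\<in>V0. 1 * \<Delta> p x)) = q (\<lambda>x. \<Delta> r x + (-1))"
      by (rule form_cong[OF q(1)]) (simp only: val diff_conv_add_uminus)
    ultimately show ?thesis by (simp only: polar_def form_shift[OF q(1)]) simp
  qed
  have "edge_form k w (\<lambda>p r. - b p r / 2) f = (\<Sum>(p, r)\<in>V0 \<times> V0. - b p r / 2 * (f p - f r)\<^sup>2)"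
    unfolding edge_form_def by (rule sum.mono_neutral_left) (auto simp: finite_V0 E0_iff)
  also have "\<dots> = (\<Sum>p\<in>V0. \<Sum>r\<in>V0. - b p r / 2 * (f p - f r)\<^sup>2)"
    by (simp add: sum.cartesian_product)
  also have "\<dots> = (\<Sum>p\<in>V0. \<Sum>r\<in>V0. b p r * (f p * f r) - (1/2) * (f p)\<^sup>2 * b p r - (1/2) * (f r)\<^sup>2 * b r p)"
    by (intro sum.cong refl) (simp add: b_sym power2_eq_square field_simps)
  also have "\<dots> = (\<Sum>p\<in>V0. \<Sum>r\<in>V0. b p r * (f p * f r)) - (\<Sum>p\<in>V0. \<Sum>r\<in>V0. (1/2) * (f p)\<^sup>2 * b p r)
      - (\<Sum>p\<in>V0. \<Sum>r\<in>V0. (1/2) * (f r)\<^sup>2 * b r p)"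
    by (simp only: sum_subtractf)
  also have "(\<Sum>p\<in>V0. \<Sum>r\<in>V0. (1/2) * (f r)\<^sup>2 * b r p) = (\<Sum>p\<in>V0. \<Sum>r\<in>V0. (1/2) * (f p)\<^sup>2 * b p r)"
    by (rule sum.swap)
  also have "(\<Sum>p\<in>V0. \<Sum>r\<in>V0. (1/2) * (f p)\<^sup>2 * b p r) = 0"
    unfolding sum_distrib_left[symmetric] row by simp
  finally show ?thesis unfolding qf by (simp add: b_def)
qed

lemma T_sum: "T (\<lambda>u. \<Sum>j\<in>J. p j u) u = (\<Sum>j\<in>J. T (p j) u)"
  unfolding T_def sum_divide_distrib[symmetric] by (subst sum.swap) (rule refl)

lemma T_cmult: "T (\<lambda>u. t * p u) u = t * T p u"
  by (simp add: T_def sum_distrib_left)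

lemma form_sum:
  assumes "\<And>j. j < (n::nat) \<Longrightarrow> form (p j)" shows "form (\<lambda>u. \<Sum>j<n. p j u)"
  using assms
proof (induction n)
  case 0
  then show ?case using form_comb[OF form_E form_E, of 0 0] by simp
next
  case (Suc n)
  then show ?case using form_comb[of "\<lambda>u. \<Sum>j<n. p j u" "p n" 1 1] by simp
qed

lemma form_cmult: "form p \<Longrightarrow> form (\<lambda>u. t * p u)"
  using form_comb[of p p t 0] by simp

text \<open>The mean ergodic theorem: a cluster point of the Cesaro means is a fixed point of \<open>T\<close>, and
  the difference to it is, up to an arbitrarily small error, of the form \<open>Y - T Y\<close>.\<close>

lemma Tn_converges:
  assumes q: "form q" "\<And>u. q u \<ge> 0"
  shows "\<exists>l. \<forall>\<epsilon>>0. \<exists>N. \<forall>n\<ge>N. \<forall>u. \<bar>(T ^^ n) q u - l u\<bar> \<le> \<epsilon> * E u"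
proof -
  obtain C where C: "\<And>u. \<bar>q u\<bar> \<le> C * E u" using form_bound[OF q(1)] by blast
  define X where "X = (\<lambda>N u. \<Sum>j<N. (T ^^ j) q u)"
  define M where "M = (\<lambda>N u. (1 / real (Suc N)) * X (Suc N) u)"
  have fX: "form (X N)" for N unfolding X_def by (rule form_sum) (rule form_Tn[OF q(1)])
  have fM: "form (M N)" for N unfolding M_def by (rule form_cmult[OF fX])
  have M0: "M N u \<ge> 0" for N u
    unfolding M_def X_def by (intro mult_nonneg_nonneg sum_nonneg Tn_nonneg q(2)) simp
  have MC: "M N u \<le> C * E u" for N u
  proof -
    have "X (Suc N) u \<le> (\<Sum>j<Suc N. C * E u)"
      unfolding X_def using Tn_bound[of q C _ u, OF C] by (intro sum_mono) (simp add: abs_le_iff)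
    then have "X (Suc N) u \<le> real (Suc N) * (C * E u)" by simp
    then have "(1 / real (Suc N)) * X (Suc N) u \<le> (1 / real (Suc N)) * (real (Suc N) * (C * E u))"
      by (rule mult_left_mono) simp
    then show ?thesis by (simp add: M_def)
  qed
  have TX: "T (X N) u = X (Suc N) u - q u" for N u
    unfolding X_def T_sum sum.lessThan_Suc_shift by simp
  have XT: "X (Suc N) u = X N u + (T ^^ N) q u" for N u by (simp add: X_def)
  have TM: "T (M N) u - M N u = (1 / real (Suc N)) * ((T ^^ Suc N) q u - q u)" for N u
    unfolding M_def T_cmult TX XT[of "Suc N"] by (simp add: algebra_simps)
  define \<Delta> where "\<Delta> = (\<lambda>p x::'a. if x = p then 1 else (0::real))"
  define b where "b = (\<lambda>N e. - polar (M N) (\<Delta> (fst e)) (\<Delta> (snd e)) / 2)"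
  have Mb: "M N u = edge_form k w (\<lambda>p r. b N (p, r)) u" for N u
    unfolding b_def \<Delta>_def fst_conv snd_conv by (rule form_representation[OF fM M0])
  \<comment> \<open>The conductances of all Cesaro means are combinations of values at sums and
    differences of indicators, which are bounded by \<open>E\<close>; so finitely many bounded
    sequences determine a cluster point.\<close>
  obtain B where B: "B > 0" "\<forall>e\<in>E0. C * E (\<lambda>x. \<Delta> (fst e) x + \<Delta> (snd e) x) + C * E (\<lambda>x. \<Delta> (fst e) x - \<Delta> (snd e) x) \<le> B"
    using finite_upper_bound[OF finite_E0, of "\<lambda>e. C * E (\<lambda>x. \<Delta> (fst e) x + \<Delta> (snd e) x) + C * E (\<lambda>x. \<Delta> (fst e) x - \<Delta> (snd e) x)"]
    by auto
  have bB: "\<bar>b N e\<bar> \<le> B" if e: "e \<in> E0" for N e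
  proof -
    let ?f = "\<lambda>x. \<Delta> (fst e) x + \<Delta> (snd e) x" and ?g = "\<lambda>x. \<Delta> (fst e) x - \<Delta> (snd e) x"
    have 1: "C * E ?f + C * E ?g \<le> B" using B(2) e by blast
    have 2: "b N e = - ((M N ?f - M N ?g) / 4) / 2" by (simp add: b_def polar_def)
    have "\<bar>- ((x - y) / 4) / 2\<bar> \<le> B" if "0 \<le> x" "0 \<le> y" "x \<le> X" "y \<le> Y" "X + Y \<le> B" for x y X Y :: real
      using that by simp
    then show ?thesis unfolding 2 using M0 M0 MC MC 1 by blast
  qed
  have "\<exists>r \<beta>. strict_mono (r :: nat \<Rightarrow> nat) \<and> (\<forall>e\<in>E0. (\<lambda>n. b (r n) e) \<longlonglongrightarrow> \<beta> e)"
    by (rule finite_pointwise_subseq[OF finite_E0 bB])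
  then obtain r \<beta> where r: "strict_mono (r :: nat \<Rightarrow> nat)" and \<beta>: "\<forall>e\<in>E0. (\<lambda>n. b (r n) e) \<longlonglongrightarrow> \<beta> e" by blast
  define l where "l = edge_form k w (\<lambda>p r. \<beta> (p, r))"
  have lim: "(\<lambda>n. M (r n) u) \<longlonglongrightarrow> l u" for u
    unfolding Mb l_def edge_form_def split_beta by (intro tendsto_intros) (use \<beta> in simp)
  have lT: "T l u = l u" for u
  proof (rule LIMSEQ_unique)
    show "(\<lambda>n. T (M (r n)) u) \<longlonglongrightarrow> T l u"
      unfolding T_def using rho_pos by (intro tendsto_intros lim) simp
    have "(\<lambda>n. 1 / real (Suc (r n)) * (2 * (C * E u))) \<longlonglongrightarrow> 0 * (2 * (C * E u))"
      using LIMSEQ_subseq_LIMSEQ[OF LIMSEQ_inverse_real_of_nat r]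
      by (intro tendsto_mult tendsto_const) (simp add: o_def inverse_eq_divide)
    then have "(\<lambda>n. T (M (r n)) u - M (r n) u) \<longlonglongrightarrow> 0"
    proof (rule Lim_null_comparison[rotated, OF tendsto_eq_rhs])
      show "\<forall>\<^sub>F n in sequentially. norm (T (M (r n)) u - M (r n) u) \<le> 1 / real (Suc (r n)) * (2 * (C * E u))"
      proof (rule always_eventually, rule allI)
        fix n
        have "\<bar>(T ^^ Suc (r n)) q u - q u\<bar> \<le> 2 * (C * E u)"
          using Tn_bound[of q C "Suc (r n)" u, OF C] C[of u] by linarith
        then have "\<bar>1 / real (Suc (r n))\<bar> * \<bar>(T ^^ Suc (r n)) q u - q u\<bar> \<le> \<bar>1 / real (Suc (r n))\<bar> * (2 * (C * E u))"
          by (rule mult_left_mono) simp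
        then show "norm (T (M (r n)) u - M (r n) u) \<le> 1 / real (Suc (r n)) * (2 * (C * E u))"
          unfolding TM by (simp add: abs_mult)
      qed
    qed simp
    from tendsto_add[OF this lim[of u]] show "(\<lambda>n. T (M (r n)) u) \<longlonglongrightarrow> l u" by simp
  qed
  have lTn: "(T ^^ n) l = l" for n
  proof (induction n)
    case (Suc n)
    have "(T ^^ Suc n) l = T l" using Suc by simp
    also have "\<dots> = l" by (rule ext) (rule lT)
    finally show ?case .
  qed simp
  have "\<exists>N. \<forall>n\<ge>N. \<forall>u. \<bar>(T ^^ n) q u - l u\<bar> \<le> \<epsilon> * E u" if \<epsilon>: "\<epsilon> > 0" for \<epsilon>
  proof -
    have "\<forall>\<^sub>F n in sequentially. \<forall>e\<in>E0. dist (b (r n) e) (\<beta> e) < \<epsilon> / 2 * c (fst e) (snd e)"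
    proof (rule eventually_ball_finite[OF finite_E0], rule ballI)
      fix e assume e: "e \<in> E0"
      then have "c (fst e) (snd e) > 0" by (intro c_pos) (auto simp: edges0_def)
      then show "\<forall>\<^sub>F n in sequentially. dist (b (r n) e) (\<beta> e) < \<epsilon> / 2 * c (fst e) (snd e)"
        using \<epsilon> \<beta> e by (intro tendstoD) auto
    qed
    then obtain m where "\<forall>e\<in>E0. dist (b (r m) e) (\<beta> e) < \<epsilon> / 2 * c (fst e) (snd e)"
      using eventually_happens trivial_limit_sequentially by blast
    then have m: "\<bar>b (r m) e - \<beta> e\<bar> \<le> \<epsilon> / 2 * c (fst e) (snd e)" if "e \<in> E0" for e
      using that by (simp add: dist_real_def less_imp_le)
    define N where "N = r m"
    have Ml: "\<bar>M N u - l u\<bar> \<le> \<epsilon> / 2 * E u" for u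
    proof -
      have "M N u - l u = (\<Sum>e\<in>E0. (b N e - \<beta> e) * (u (fst e) - u (snd e))\<^sup>2)"
        unfolding Mb l_def edge_form_def split_beta by (simp add: sum_subtractf[symmetric] left_diff_distrib)
      also have "\<bar>\<dots>\<bar> \<le> (\<Sum>e\<in>E0. \<bar>(b N e - \<beta> e) * (u (fst e) - u (snd e))\<^sup>2\<bar>)" by (rule sum_abs)
      also have "\<dots> \<le> (\<Sum>e\<in>E0. (\<epsilon> / 2 * c (fst e) (snd e)) * (u (fst e) - u (snd e))\<^sup>2)"
      proof (rule sum_mono)
        fix e assume "e \<in> E0"
        from mult_right_mono[OF m[OF this], of "(u (fst e) - u (snd e))\<^sup>2"]
        show "\<bar>(b N e - \<beta> e) * (u (fst e) - u (snd e))\<^sup>2\<bar> \<le> (\<epsilon> / 2 * c (fst e) (snd e)) * (u (fst e) - u (snd e))\<^sup>2"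
          unfolding N_def abs_mult by simp
      qed
      also have "\<dots> = \<epsilon> / 2 * E u"
        unfolding edge_form_def split_beta sum_distrib_left by (simp add: mult.assoc)
      finally show ?thesis .
    qed
    \<comment> \<open>The average of the partial sums \<open>X j\<close>: as X j - T X j = q - T^j
      q, this solves Y - T Y = q - M N.\<close>
    define Y where "Y = (\<lambda>u. (1 / real (Suc N)) * (\<Sum>j<Suc N. X j u))"
    have fY: "form Y" unfolding Y_def by (intro form_cmult form_sum fX)
    have YT: "Y u - T Y u = q u - M N u" for u
    proof -
      have "Y u - T Y u = (1 / real (Suc N)) * (\<Sum>j<Suc N. X j u - T (X j) u)"
        unfolding Y_def T_cmult T_sum right_diff_distrib[symmetric] sum_subtractf[symmetric] ..
      also have "(\<Sum>j<Suc N. X j u - T (X j) u) = (\<Sum>j<Suc N. q u - (T ^^ j) q u)"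
        unfolding TX XT by (intro sum.cong) auto
      also have "\<dots> = real (Suc N) * q u - X (Suc N) u"
        unfolding sum_subtractf X_def by simp
      finally show ?thesis by (simp add: M_def right_diff_distrib)
    qed
    obtain N' where N': "\<forall>n\<ge>N'. \<forall>u. \<bar>(T ^^ n) (\<lambda>u. Y u - T Y u) u\<bar> \<le> \<epsilon> / 2 * E u"
      using T_difference_small[OF fY, of "\<epsilon> / 2"] \<epsilon> by auto
    have "\<bar>(T ^^ n) q u - l u\<bar> \<le> \<epsilon> * E u" if n: "n \<ge> N'" for n u
    proof -
      have "q = (\<lambda>u. 1 * (Y u - T Y u) + 1 * M N u)" by (rule ext) (simp add: YT)
      then have "(T ^^ n) q = (T ^^ n) (\<lambda>u. 1 * (Y u - T Y u) + 1 * M N u)" by (rule arg_cong)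
      then have "(T ^^ n) q u = (T ^^ n) (\<lambda>u. Y u - T Y u) u + (T ^^ n) (M N) u"
        unfolding Tn_comb by simp
      moreover have "\<bar>(T ^^ n) (\<lambda>u. 1 * M N u + (-1) * l u) u\<bar> \<le> \<epsilon> / 2 * E u"
        by (rule Tn_bound) (use Ml in simp)
      then have "\<bar>(T ^^ n) (M N) u - l u\<bar> \<le> \<epsilon> / 2 * E u" unfolding Tn_comb lTn by simp
      moreover have "\<bar>(T ^^ n) (\<lambda>u. Y u - T Y u) u\<bar> \<le> \<epsilon> / 2 * E u" using N' n by blast
      moreover have "\<bar>x + y - z\<bar> \<le> e * s" if "\<bar>y - z\<bar> \<le> e / 2 * s" "\<bar>x\<bar> \<le> e / 2 * s" for x y z e s :: real
      proof -
        have "\<bar>x + y - z\<bar> \<le> \<bar>x\<bar> + \<bar>y - z\<bar>" by linarith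
        also have "\<dots> \<le> e / 2 * s + e / 2 * s" using that by linarith
        finally show ?thesis by simp
      qed
      ultimately show ?thesis by simp
    qed
    then show ?thesis by blast
  qed
  then show ?thesis by blast
qed

subsection \<open>Convergence of the rescaled energies\<close>

text \<open>The rescaled level-n energy for \<open>q\<close> of the difference between
  \<open>f\<close> and the n-fold harmonic extension of \<open>u\<close>, written recursively so
  that this extension need not exist as a function.\<close>

primrec rem :: "nat \<Rightarrow> (('a \<Rightarrow> real) \<Rightarrow> real) \<Rightarrow> ('a \<Rightarrow> real) \<Rightarrow> ('a \<Rightarrow> real) \<Rightarrow> real" where
  "rem 0 q f u = q (\<lambda>x. f x - u x)"
| "rem (Suc n) q f u = (\<Sum>i\<in>I. rem n q (f \<circ> w i) (A i u)) / rho"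

text \<open>Pythagoras at every level, since harmonic functions are orthogonal to those vanishing on
  the boundary. For \<open>u = f\<close> the remainder is exactly the energy gained between levels 0
  and n.\<close>

lemma rem_E: "rem n E f u = lev n E f - E f + E (\<lambda>x. f x - u x)"
proof (induction n arbitrary: f u)
  case (Suc n)
  have "rem (Suc n) E f u = lev (Suc n) E f - S f / rho + S (\<lambda>x. f x - H u x) / rho"
    by (simp add: Suc.IH lev_Suc level_form_1 A_def o_def sum.distrib sum_subtractf
      add_divide_distrib diff_divide_distrib)
  moreover have "S (\<lambda>x. f x - H u x) = rho * E (\<lambda>x. f x - u x) + S (\<lambda>x. f x - H f x)"
  proof -
    have "S (\<lambda>x. H (\<lambda>x. f x - u x) x + (f x - H f x)) = S (H (\<lambda>x. f x - u x)) + S (\<lambda>x. f x - H f x)"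
      by (rule S_H_add) (simp add: H_V0)
    moreover have "S (\<lambda>x. H f x - H u x) = rho * E (\<lambda>x. f x - u x)"
      using S_H[of "\<lambda>x. f x - u x"] by (simp only: H_diff)
    ultimately show ?thesis by (simp add: H_diff)
  qed
  moreover have "S f = rho * E f + S (\<lambda>x. f x - H f x)"
    using S_decompose[of f f] by (simp add: S_H)
  ultimately show ?case using rho_pos by (simp add: add_divide_distrib)
qed simp

lemma rem_le: "(\<And>f. q f \<le> C * E f) \<Longrightarrow> rem n q f u \<le> C * rem n E f u"
proof (induction n arbitrary: f u)
  case (Suc n)
  have "(\<Sum>i\<in>I. rem n q (f \<circ> w i) (A i u)) / rho \<le> (\<Sum>i\<in>I. C * rem n E (f \<circ> w i) (A i u)) / rho"
    using rho_pos by (intro divide_right_mono sum_mono Suc.IH Suc.prems) simp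
  then show ?case by (simp add: sum_distrib_left)
qed simp

text \<open>The iterate of \<open>T\<close> is the level-n energy of the harmonic extension, so both
  inequalities are the weighted triangle inequality summed over cells, with \<open>rem\<close> as
  the energy of the difference.\<close>

lemma lev_Tn_close:
  assumes q: "quadratic_on UNIV q" "\<And>f. q f \<ge> 0" and \<epsilon>: "\<epsilon> > 0"
  shows "lev n q f \<le> (1 + \<epsilon>) * (T ^^ n) q u + (1 + 1 / \<epsilon>) * rem n q f u"
    "(T ^^ n) q u \<le> (1 + \<epsilon>) * lev n q f + (1 + 1 / \<epsilon>) * rem n q f u"
proof -
  interpret q: nonneg_quadratic UNIV q
    by unfold_locales (use q fun_subspace_UNIV in auto)
  show "lev n q f \<le> (1 + \<epsilon>) * (T ^^ n) q u + (1 + 1 / \<epsilon>) * rem n q f u"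
  proof (induction n arbitrary: f u)
    case 0
    show ?case using q.triangle_eps[of f u, OF _ _ \<epsilon>] by simp
  next
    case (Suc n)
    have "lev (Suc n) q f \<le> (\<Sum>i\<in>I. (1 + \<epsilon>) * (T ^^ n) q (A i u) + (1 + 1 / \<epsilon>) * rem n q (f \<circ> w i) (A i u)) / rho"
      unfolding lev_Suc using rho_pos by (intro divide_right_mono sum_mono Suc.IH) simp
    also have "\<dots> = (1 + \<epsilon>) * T ((T ^^ n) q) u + (1 + 1 / \<epsilon>) * rem (Suc n) q f u"
      by (simp add: T_def[of "(T ^^ n) q"] sum.distrib sum_distrib_left add_divide_distrib)
    finally show ?case by simp
  qed
  show "(T ^^ n) q u \<le> (1 + \<epsilon>) * lev n q f + (1 + 1 / \<epsilon>) * rem n q f u"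
  proof (induction n arbitrary: f u)
    case 0
    have "q (\<lambda>x. u x - f x) = q (\<lambda>x. f x - u x)" using q.minus[of "\<lambda>x. f x - u x"] by simp
    then show ?case using q.triangle_eps[of u f, OF _ _ \<epsilon>] by simp
  next
    case (Suc n)
    have "(T ^^ Suc n) q u = (\<Sum>i\<in>I. (T ^^ n) q (A i u)) / rho" by (simp add: T_def[of "(T ^^ n) q"])
    also have "\<dots> \<le> (\<Sum>i\<in>I. (1 + \<epsilon>) * lev n q (f \<circ> w i) + (1 + 1 / \<epsilon>) * rem n q (f \<circ> w i) (A i u)) / rho"
      using rho_pos by (intro divide_right_mono sum_mono Suc.IH) simp
    also have "\<dots> = (1 + \<epsilon>) * lev (Suc n) q f + (1 + 1 / \<epsilon>) * rem (Suc n) q f u"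
      by (simp add: lev_Suc sum.distrib sum_distrib_left add_divide_distrib)
    finally show ?case .
  qed
qed

text \<open>Continuity is left out. Only vertex values enter, which makes this space closed under
  the gluing of functions on cells.\<close>

definition finite_E :: "('a \<Rightarrow> real) set" where
  "finite_E = {f. \<exists>B. \<forall>n. lev n E f \<le> B}"

lemma finite_E_limit: "f \<in> finite_E \<Longrightarrow> \<exists>L. (\<lambda>n. lev n E f) \<longlonglongrightarrow> L \<and> (\<forall>n. lev n E f \<le> L)"
proof -
  assume "f \<in> finite_E"
  then obtain B where B: "\<forall>n. lev n E f \<le> B" by (auto simp: finite_E_def)
  have inc: "incseq (\<lambda>n. lev n E f)" by (rule incseq_SucI) (rule lev_E_Suc)
  obtain L where "(\<lambda>n. lev n E f) \<longlonglongrightarrow> L" "\<forall>n. lev n E f \<le> L"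
    using incseq_convergent[OF inc B] .
  then show ?thesis by blast
qed

text \<open>On each level-m cell \<open>f\<close> is replaced by the harmonic extension of its
  vertex values. The error is controlled by the energy of \<open>f\<close> beyond level m, which is
  small, and the replaced energies are level-m sums of iterates of \<open>T\<close>, which
  converge.\<close>

lemma lev_form_convergent:
  assumes q: "form q" "\<And>u. q u \<ge> 0" and f: "f \<in> finite_E"
  shows "convergent (\<lambda>n. lev n q f)"
proof -
  obtain L where L: "(\<lambda>n. lev n E f) \<longlonglongrightarrow> L" "\<forall>n. lev n E f \<le> L" using finite_E_limit[OF f] by blast
  have L0: "L \<ge> 0" using L(2) lev_nonneg[of E 0 f] E_nonneg order_trans by blast
  obtain C0 where "\<forall>u. \<bar>q u\<bar> \<le> C0 * E u" using form_bound[OF q(1)] by blast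
  then have "q u \<le> \<bar>C0\<bar> * E u" for u
    using E_nonneg[of u] mult_right_mono[of C0 "\<bar>C0\<bar>" "E u"] by (smt (verit, ccfv_threshold))
  then obtain C where C: "C \<ge> 0" "\<And>u. q u \<le> C * E u" using abs_ge_zero by blast
  have absC: "\<bar>q u\<bar> \<le> C * E u" for u using C(2)[of u] q(2)[of u] by simp
  obtain l where l: "\<forall>\<epsilon>>0. \<exists>N. \<forall>n\<ge>N. \<forall>u. \<bar>(T ^^ n) q u - l u\<bar> \<le> \<epsilon> * E u"
    using Tn_converges[OF q] by blast
  have "\<exists>x. \<forall>\<^sub>F n in sequentially. \<bar>lev n q f - x\<bar> \<le> \<eta>" if \<eta>: "\<eta> > 0" for \<eta>
  proof -
    \<comment> \<open>Makes \<epsilon> times any energy below \<open>C * L\<close> at most \<eta> /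
      4; adding 1 allows for \<open>C * L = 0\<close>.\<close>
    define \<epsilon> where "\<epsilon> = (\<eta> / 4) / (C * L + 1)"
    have CL: "C * L + 1 > 0" using C L0 by (simp add: add_nonneg_pos)
    then have CL': "C * L + 1 \<noteq> 0" by simp
    have \<epsilon>: "\<epsilon> > 0" using \<eta> CL by (simp add: \<epsilon>_def)
    have \<epsilon>CL: "\<epsilon> * (C * L) \<le> \<eta> / 4"
    proof -
      have "\<epsilon> * (C * L) \<le> \<epsilon> * (C * L + 1)" using \<epsilon> by simp
      also have "\<dots> = \<eta> / 4" 
      proof -
        have "\<eta> / 4 / x * x = \<eta> / 4" if "x \<noteq> 0" for x using that by simp
        then show ?thesis unfolding \<epsilon>_def using CL' by blast
      qed
      finally show ?thesis .
    qed
    have "(\<lambda>m. (1 + 1 / \<epsilon>) * (C * (L - lev m E f))) \<longlonglongrightarrow> (1 + 1 / \<epsilon>) * (C * (L - L))"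
      by (intro tendsto_intros L(1))
    then have "\<forall>\<^sub>F m in sequentially. (1 + 1 / \<epsilon>) * (C * (L - lev m E f)) < \<eta> / 4"
      by (rule order_tendstoD(2)) (use \<eta> in simp)
    then obtain m where m: "(1 + 1 / \<epsilon>) * (C * (L - lev m E f)) < \<eta> / 4"
      using eventually_happens trivial_limit_sequentially by blast
    define a where "a = (\<lambda>n. lev m ((T ^^ n) q) f)"
    have close: "\<bar>lev (m + n) q f - a n\<bar> \<le> \<eta> / 2" for n
    proof -
      have r: "lev m (\<lambda>g. rem n q g g) f \<le> C * (L - lev m E f)"
      proof -
        have "rem n q g g \<le> C * (1 * lev n E g + (-1) * E g)" for g
          using rem_le[of q C n g g, OF C(2)] by (simp add: rem_E edge_form_def)
        then have "lev m (\<lambda>g. rem n q g g) f \<le> lev m (\<lambda>g. C * (1 * lev n E g + (-1) * E g)) f"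
          by (rule lev_mono)
        also have "\<dots> = C * (lev (m + n) E f - lev m E f)" unfolding lev_cmult lev_comb lev_add by simp
        also have "\<dots> \<le> C * (L - lev m E f)" using L(2) C(1) by (intro mult_left_mono) auto
        finally show ?thesis .
      qed
      have r': "(1 + 1 / \<epsilon>) * lev m (\<lambda>g. rem n q g g) f \<le> \<eta> / 4"
      proof -
        have "(1 + 1 / \<epsilon>) * lev m (\<lambda>g. rem n q g g) f \<le> (1 + 1 / \<epsilon>) * (C * (L - lev m E f))"
          by (rule mult_left_mono[OF r]) (use \<epsilon> in simp)
        then show ?thesis using m by (rule order_trans[OF _ less_imp_le])
      qed
      have "a n \<le> C * lev m E f"
        unfolding a_def using lev_bound[of "(T ^^ n) q" C E m f] Tn_bound[of q C n, OF absC] by (simp add: abs_le_iff)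
      then have aL: "a n \<le> C * L" using L(2) C(1) mult_left_mono[of "lev m E f" L C] by fastforce
      have "lev (m + n) q f \<le> C * lev (m + n) E f"
        using lev_bound[of q C E "m + n" f, OF absC] by (simp add: abs_le_iff)
      then have sL: "lev (m + n) q f \<le> C * L" using L(2) C(1) mult_left_mono[of "lev (m + n) E f" L C] by fastforce
      have "lev (m + n) q f \<le> lev m (\<lambda>g. (1 + \<epsilon>) * (T ^^ n) q g + (1 + 1 / \<epsilon>) * rem n q g g) f"
        unfolding lev_add by (rule lev_mono) (rule lev_Tn_close(1)[OF form_quadratic[OF q(1)] q(2) \<epsilon>])
      then have 1: "lev (m + n) q f \<le> a n + \<epsilon> * a n + (1 + 1 / \<epsilon>) * lev m (\<lambda>g. rem n q g g) f"
        unfolding lev_comb a_def by (simp add: distrib_right)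
      have "a n \<le> lev m (\<lambda>g. (1 + \<epsilon>) * lev n q g + (1 + 1 / \<epsilon>) * rem n q g g) f"
        unfolding a_def by (rule lev_mono) (rule lev_Tn_close(2)[OF form_quadratic[OF q(1)] q(2) \<epsilon>])
      then have 2: "a n \<le> lev (m + n) q f + \<epsilon> * lev (m + n) q f + (1 + 1 / \<epsilon>) * lev m (\<lambda>g. rem n q g g) f"
        unfolding lev_comb lev_add by (simp add: distrib_right)
      have "\<epsilon> * a n \<le> \<eta> / 4" "\<epsilon> * lev (m + n) q f \<le> \<eta> / 4"
        using mult_left_mono[OF aL, of \<epsilon>] mult_left_mono[OF sL, of \<epsilon>] \<epsilon> \<epsilon>CL by linarith+
      moreover have "\<bar>x - y\<bar> \<le> \<eta> / 2" if "x \<le> y + e1 + r" "y \<le> x + e2 + r" "e1 \<le> \<eta> / 4" "e2 \<le> \<eta> / 4" "r \<le> \<eta> / 4"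
        for x y e1 e2 r :: real using that by linarith
      ultimately show ?thesis using 1 2 r' by blast
    qed
    obtain N where N: "\<forall>n\<ge>N. \<forall>u. \<bar>(T ^^ n) q u - l u\<bar> \<le> \<eta> / (2 * (L + 1)) * E u"
      using l \<eta> L0 by (meson divide_pos_pos mult_pos_pos zero_less_numeral add_nonneg_pos zero_less_one)
    have al: "\<bar>a n - lev m l f\<bar> \<le> \<eta> / 2" if n: "n \<ge> N" for n
    proof -
      have "\<bar>lev m (\<lambda>u. 1 * (T ^^ n) q u + (-1) * l u) f\<bar> \<le> \<eta> / (2 * (L + 1)) * lev m E f"
        by (rule lev_bound) (use N n in simp)
      then have "\<bar>a n - lev m l f\<bar> \<le> \<eta> / (2 * (L + 1)) * lev m E f"
        unfolding lev_comb a_def by simp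
      also have "\<dots> \<le> \<eta> / (2 * (L + 1)) * (L + 1)"
        using L(2) \<eta> L0 by (intro mult_left_mono) (auto simp: add_increasing2)
      also have "\<dots> = \<eta> / 2" using L0 by (simp add: field_simps)
      finally show ?thesis .
    qed
    have "\<bar>lev n q f - lev m l f\<bar> \<le> \<eta>" if "n \<ge> m + N" for n
    proof -
      have "\<bar>lev n q f - a (n - m)\<bar> \<le> \<eta> / 2" using close[of "n - m"] that by simp
      moreover have "\<bar>a (n - m) - lev m l f\<bar> \<le> \<eta> / 2" using al[of "n - m"] that by simp
      ultimately show ?thesis by linarith
    qed
    then show ?thesis unfolding eventually_sequentially by blast
  qed
  \<comment> \<open>The approximate limit depends on the level chosen for \<eta>, so it is not the
    limit itself; it suffices for the Cauchy property.\<close>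
  note almost = this
  have "Cauchy (\<lambda>n. lev n q f)"
  proof (rule CauchyI)
    fix \<eta> :: real assume \<eta>: "\<eta> > 0"
    then obtain x N where x: "\<forall>n\<ge>N. \<bar>lev n q f - x\<bar> \<le> \<eta> / 3"
      using almost[of "\<eta> / 3"] by (auto simp: eventually_sequentially)
    have "norm (lev m q f - lev n q f) < \<eta>" if "m \<ge> N" "n \<ge> N" for m n
    proof -
      have "\<bar>lev m q f - x\<bar> \<le> \<eta> / 3" "\<bar>lev n q f - x\<bar> \<le> \<eta> / 3" using x that by auto
      then have "\<bar>lev m q f - lev n q f\<bar> < \<eta>" using \<eta> by linarith
      then show ?thesis by simp
    qed
    then show "\<exists>N. \<forall>m\<ge>N. \<forall>n\<ge>N. norm (lev m q f - lev n q f) < \<eta>" by blast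
  qed
  then show ?thesis by (simp add: Cauchy_convergent_iff)
qed

end

subsection \<open>The eigenform with the same limit\<close>

context nested
begin

lemma other_image:
  assumes "i \<in> I" "p \<in> V0" "w i p = p" "s \<in> V0" "s \<noteq> p"
  shows "w i s \<notin> V0"
proof
  assume "w i s \<in> V0"
  then have "w i s = s" using V0_image_fixed assms by blast
  then have "norm (s - p) = lam * norm (s - p)" using sim[OF assms(1), of s p] assms by simp
  then have "(1 - lam) * norm (s - p) = 0" by (simp add: algebra_simps)
  then show False using assms lam_less_1 by simp
qed

lemma V1_not_V0: "\<exists>x\<in>vertices k w 1. x \<notin> V0"
proof -
  obtain p where p: "p \<in> V0" using V0_ne by blast
  obtain i where i: "i \<in> I" "w i p = p" using V0_fixed[OF p] by blast
  obtain s where s: "s \<in> V0" "s \<noteq> p" using V0_other[OF p] by blast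
  have "w i s \<in> vertices k w 1" using i s by (auto simp: vertices_1)
  then show ?thesis using other_image[OF i(1) p i(2) s] by blast
qed

lemma words_Suc_K: "\<sigma> \<in> words k n \<Longrightarrow> p \<in> V0 \<Longrightarrow> word_map w \<sigma> p \<in> K"
  by (rule word_map_K) (auto simp: words_def V0_K)

text \<open>Appending to a word the letter whose map fixes the vertex does not move its
  image.\<close>

lemma vertices_Suc: "vertices k w n \<subseteq> vertices k w (Suc n)"
proof
  fix x assume "x \<in> vertices k w n"
  then obtain \<sigma> p where s: "\<sigma> \<in> words k n" "p \<in> V0" "x = word_map w \<sigma> p" by (auto simp: vertices_def)
  obtain j where j: "j \<in> I" "w j p = p" using V0_fixed[OF s(2)] by blast
  have "word_map w (\<sigma> @ [j]) p = x"
    unfolding s(3) using j(2) by (induction \<sigma>) simp_all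
  moreover have "\<sigma> @ [j] \<in> words k (Suc n)" using s(1) j(1) by (auto simp: words_def)
  ultimately show "x \<in> vertices k w (Suc n)" using s(2) by (auto simp: vertices_def)
qed

end

text \<open>A connected proper subset of maximal size has a neighbour outside it. Adding this
  neighbour preserves connectedness, so by maximality it exhausts the graph, and the added vertex is
  not a cut vertex.\<close>

lemma linked_non_cut_vertex:
  assumes V: "finite V" "card V \<ge> 2" and l: "linked c V"
    and sym: "\<And>x y. x \<in> V \<Longrightarrow> y \<in> V \<Longrightarrow> c x y = c y x"
  shows "\<exists>v\<in>V. linked c (V - {v})"
proof -
  define P where "P = (\<lambda>A. A \<subseteq> V \<and> A \<noteq> {} \<and> A \<noteq> V \<and> linked c A)"
  obtain v0 where v0: "v0 \<in> V" using V by fastforce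
  have "V \<noteq> {v0}" using V by auto
  moreover have "linked c {v0}" by (rule linked_if_pos) simp
  ultimately have P0: "P {v0}" unfolding P_def using v0 by simp
  have bd: "\<forall>A. P A \<longrightarrow> card A < Suc (card V)"
    using card_mono[OF V(1)] by (auto simp: P_def less_Suc_eq_le)
  obtain A where A: "P A" "\<forall>B. P B \<longrightarrow> card B \<le> card A"
    using ex_has_greatest_nat[OF P0 bd] by blast
  have A': "A \<subseteq> V" "A \<noteq> {}" "A \<noteq> V" "linked c A" using A(1) by (simp_all add: P_def)
  obtain a x where x: "a \<in> A" "x \<in> V - A" "c a x > 0"
  proof -
    obtain a0 y0 where "a0 \<in> A" "y0 \<in> V" "y0 \<notin> A" using A'(1-3) by blast
    from linkedD[OF l A'(1) this] show ?thesis using that by (elim bexE)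
  qed
  have "linked c (insert x A)"
    unfolding linked_def
  proof (intro allI impI)
    fix B assume B: "B \<subseteq> insert x A" "B \<noteq> {}" "B \<noteq> insert x A"
    consider "B \<inter> A = {}" | "B \<inter> A = A" | "B \<inter> A \<noteq> {}" "B \<inter> A \<noteq> A" by blast
    then show "\<exists>y\<in>B. \<exists>z\<in>insert x A - B. c y z > 0"
    proof cases
      case 1
      then have "x \<in> B" "a \<notin> B" using B x by auto
      moreover have "c x a > 0" using x A'(1) sym[of a x] by auto
      ultimately show ?thesis using x(1) by blast
    next
      case 2
      then have "a \<in> B" "x \<notin> B" using B x by auto
      then show ?thesis using x by blast
    next
      case 3
      then obtain y0 z0 where yz: "y0 \<in> B \<inter> A" "z0 \<in> A" "z0 \<notin> B \<inter> A" by blast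
      obtain y z where "y \<in> B \<inter> A" "z \<in> A - B \<inter> A" "c y z > 0"
        using linkedD[OF A'(4) Int_lower2 yz] by (elim bexE)
      then show ?thesis by blast
    qed
  qed
  then have ext: "P (insert x A)" if "insert x A \<noteq> V" using that A'(1) x(2) by (simp add: P_def)
  have "finite A" using A'(1) V(1) by (rule finite_subset)
  then have "\<not> card (insert x A) \<le> card A" using x(2) by simp
  then have "insert x A = V" using ext A(2) by blast
  then have "V - {x} = A" using x by auto
  then show ?thesis using A'(4) x by (intro bexI[of _ x]) auto
qed

text \<open>\<open>c\<close> belongs to the given eigenform, about whose symmetry nothing is
  assumed; \<open>b\<close> belongs to the form whose limit is sought, and all invariance under
  reflections comes from it.\<close>

locale renorm = eigen +
  fixes b :: "'a \<Rightarrow> 'a \<Rightarrow> real"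
  assumes b_symmetric: "x \<in> V0 \<Longrightarrow> y \<in> V0 \<Longrightarrow> b x y = b y x"
    and b_pos: "x \<in> V0 \<Longrightarrow> y \<in> V0 \<Longrightarrow> x \<noteq> y \<Longrightarrow> b x y > 0"
    and b_isometry: "bij_betw \<phi> V0 V0 \<Longrightarrow> (\<And>x y. x \<in> V0 \<Longrightarrow> y \<in> V0 \<Longrightarrow> norm (\<phi> x - \<phi> y) = norm (x - y)) \<Longrightarrow>
      edge_form k w b (f \<circ> \<phi>) = edge_form k w b f"
begin

declare atLeastAtMost_iff [simp del] One_nat_def [simp del]

abbreviation q :: "('a \<Rightarrow> real) \<Rightarrow> real" where "q \<equiv> edge_form k w b"
abbreviation FE :: "('a \<Rightarrow> real) set" where "FE \<equiv> finite_E"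

lemma q_nonneg: "q f \<ge> 0"
  by (rule edge_form_nonneg) (simp add: b_pos less_imp_le)

lemma q_le_E: "\<exists>C>0. \<forall>f. q f \<le> C * E f"
proof -
  obtain C where C: "\<forall>f. \<bar>q f\<bar> \<le> C * E f" using edge_form_bound by blast
  have "q f \<le> (\<bar>C\<bar> + 1) * E f" for f
  proof -
    have "q f \<le> C * E f" using C by (meson abs_le_D1)
    also have "\<dots> \<le> (\<bar>C\<bar> + 1) * E f" using E_nonneg by (intro mult_right_mono) auto
    finally show ?thesis .
  qed
  moreover have "\<bar>C\<bar> + 1 > 0" by simp
  ultimately show ?thesis by blast
qed

lemma E_le_q: "\<exists>C>0. \<forall>f. C * E f \<le> q f"
proof -
  have "\<exists>C>0. \<forall>e\<in>E0. C \<le> b (fst e) (snd e) / c (fst e) (snd e)"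
    by (rule finite_pos_lower_bound[OF finite_E0]) (auto simp: edges0_def b_pos c_pos)
  then obtain C where C: "C > 0" "\<forall>e\<in>E0. C \<le> b (fst e) (snd e) / c (fst e) (snd e)" by blast
  have "C * E f \<le> q f" for f
    unfolding edge_form_def sum_distrib_left
  proof (rule sum_mono, clarify)
    fix x y assume e: "(x, y) \<in> E0"
    then have pos: "c x y > 0" using c_pos by (auto simp: E0_iff)
    have "C \<le> b x y / c x y" using C(2) e by force
    then have "C * c x y \<le> b x y" using pos_le_divide_eq[OF pos] by blast
    then have "(C * c x y) * (f x - f y)\<^sup>2 \<le> b x y * (f x - f y)\<^sup>2" by (rule mult_right_mono) simp
    then show "C * (c x y * (f x - f y)\<^sup>2) \<le> b x y * (f x - f y)\<^sup>2" by (simp add: mult.assoc)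
  qed
  then show ?thesis using C(1) by blast
qed

lemma form_q: "form q"
  by (rule form_edge_form)

lemma lev_cong_K:
  assumes "\<And>y. y \<in> K \<Longrightarrow> f y = g y"
  shows "lev n (edge_form k w a) f = lev n (edge_form k w a) g"
  unfolding lev_def level_form_def
  by (rule arg_cong[of _ _ "\<lambda>x. x / _"], rule sum.cong[OF refl], rule edge_form_cong)
    (simp add: assms words_Suc_K)

lemma lev_E_nonneg: "lev n E f \<ge> 0"
  by (rule lev_nonneg) (rule E_nonneg)

lemma FE_I: "(\<And>n. lev n E f \<le> B) \<Longrightarrow> f \<in> FE"
  by (auto simp: finite_E_def)

lemma FE_subspace: "fun_subspace FE"
  unfolding fun_subspace_def
proof (intro conjI ballI allI)
  fix f g assume "f \<in> FE" "g \<in> FE"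
  then obtain B B' where B: "\<And>n. lev n E f \<le> B" "\<And>n. lev n E g \<le> B'" by (auto simp: finite_E_def)
  show "(\<lambda>x. f x + g x) \<in> FE"
  proof (rule FE_I)
    fix n
    interpret L: nonneg_quadratic UNIV "lev n E"
      by unfold_locales (auto simp: fun_subspace_UNIV quadratic_on_edge_form quadratic_on_lev lev_E_nonneg)
    have "lev n E (\<lambda>x. f x + g x) \<le> 2 * lev n E f + 2 * lev n E g" by (rule L.triangle2) auto
    then show "lev n E (\<lambda>x. f x + g x) \<le> 2 * B + 2 * B'" using B[of n] by linarith
  qed
next
  fix f t assume "f \<in> FE"
  then obtain B where B: "\<And>n. lev n E f \<le> B" by (auto simp: finite_E_def)
  show "(\<lambda>x. t * f x) \<in> FE"
  proof (rule FE_I)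
    fix n
    have "lev n E (\<lambda>x. t * f x) = t\<^sup>2 * lev n E f"
      by (rule quadratic_on_scale[OF quadratic_on_lev[OF quadratic_on_edge_form] UNIV_I])
    then show "lev n E (\<lambda>x. t * f x) \<le> t\<^sup>2 * B" using B[of n] by (simp add: mult_left_mono)
  qed
qed

lemma FE_comp: assumes "f \<in> FE" "i \<in> I" shows "f \<circ> w i \<in> FE"
proof -
  obtain B where B: "\<And>n. lev n E f \<le> B" using assms by (auto simp: finite_E_def)
  show ?thesis
  proof (rule FE_I)
    fix n
    have "lev n E (f \<circ> w i) \<le> (\<Sum>j\<in>I. lev n E (f \<circ> w j))"
      by (rule member_le_sum) (use assms lev_E_nonneg in auto)
    also have "\<dots> = rho * lev (Suc n) E f" using rho_pos by (simp add: lev_Suc)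
    also have "\<dots> \<le> rho * B" using B rho_pos by (intro mult_left_mono) auto
    finally show "lev n E (f \<circ> w i) \<le> rho * B" .
  qed
qed

lemma FE_glue: assumes "\<And>i. i \<in> I \<Longrightarrow> f \<circ> w i \<in> FE" shows "f \<in> FE"
proof -
  have "\<forall>i\<in>I. \<exists>B. \<forall>n. lev n E (f \<circ> w i) \<le> B" using assms by (auto simp: finite_E_def)
  from bchoice[OF this] obtain B where B: "\<forall>i\<in>I. \<forall>n. lev n E (f \<circ> w i) \<le> B i" by (rule exE)
  show ?thesis
  proof (rule FE_I)
    fix n
    have "lev n E f \<le> lev (Suc n) E f" by (rule lev_E_Suc)
    also have "\<dots> \<le> (\<Sum>i\<in>I. B i) / rho" unfolding lev_Suc
      using rho_pos B by (intro divide_right_mono sum_mono) auto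
    finally show "lev n E f \<le> (\<Sum>i\<in>I. B i) / rho" .
  qed
qed

lemma FE_cong_K: "f \<in> FE \<Longrightarrow> (\<And>y. y \<in> K \<Longrightarrow> g y = f y) \<Longrightarrow> g \<in> FE"
  using lev_cong_K[of g f _ c] by (auto simp: finite_E_def)

section \<open>Limit forms on functions of finite energy\<close>

definition Einf :: "('a \<Rightarrow> real) \<Rightarrow> real" where "Einf f = lim (\<lambda>n. lev n E f)"
definition Q :: "('a \<Rightarrow> real) \<Rightarrow> real" where "Q f = lim (\<lambda>n. lev n q f)"

lemma Einf_lim: "f \<in> FE \<Longrightarrow> (\<lambda>n. lev n E f) \<longlonglongrightarrow> Einf f"
  and lev_le_Einf: "f \<in> FE \<Longrightarrow> lev n E f \<le> Einf f"
proof -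
  assume "f \<in> FE"
  then obtain L where L: "(\<lambda>n. lev n E f) \<longlonglongrightarrow> L" "\<forall>n. lev n E f \<le> L" using finite_E_limit by blast
  then have "Einf f = L" unfolding Einf_def by (intro limI)
  then show "(\<lambda>n. lev n E f) \<longlonglongrightarrow> Einf f" "lev n E f \<le> Einf f" using L by auto
qed

lemma Q_lim: "f \<in> FE \<Longrightarrow> (\<lambda>n. lev n q f) \<longlonglongrightarrow> Q f"
  unfolding Q_def using lev_form_convergent[OF form_q q_nonneg] by (simp add: convergent_LIMSEQ_iff)

sublocale Einf: nonneg_quadratic FE Einf
proof unfold_locales
  show "quadratic_on FE Einf"
    by (rule quadratic_on_limit[OF FE_subspace, of "\<lambda>n. lev n E"])
      (auto intro: quadratic_on_subset[OF quadratic_on_lev[OF quadratic_on_edge_form]] Einf_lim)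
  show "Einf f \<ge> 0" if "f \<in> FE" for f
    by (rule LIMSEQ_le_const[OF Einf_lim[OF that]]) (auto simp: lev_E_nonneg)
qed (rule FE_subspace)

sublocale Q: nonneg_quadratic FE Q
proof unfold_locales
  show "quadratic_on FE Q"
    by (rule quadratic_on_limit[OF FE_subspace, of "\<lambda>n. lev n q"])
      (auto intro: quadratic_on_subset[OF quadratic_on_lev[OF quadratic_on_edge_form]] Q_lim)
  show "Q f \<ge> 0" if "f \<in> FE" for f
    by (rule LIMSEQ_le_const[OF Q_lim[OF that]]) (auto intro!: lev_nonneg q_nonneg)
qed (rule FE_subspace)

lemma Q_le_Einf: "(\<And>g. q g \<le> C * E g) \<Longrightarrow> f \<in> FE \<Longrightarrow> Q f \<le> C * Einf f"
  by (rule LIMSEQ_le[OF Q_lim tendsto_mult[OF tendsto_const Einf_lim]])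
    (auto simp: lev_cmult[symmetric] intro!: lev_mono)

lemma Einf_le_Q: "(\<And>g. C * E g \<le> q g) \<Longrightarrow> f \<in> FE \<Longrightarrow> C * Einf f \<le> Q f"
  by (rule LIMSEQ_le[OF tendsto_mult[OF tendsto_const Einf_lim] Q_lim])
    (auto simp: lev_cmult[symmetric] intro!: lev_mono)

lemma Q_cong_K: "(\<And>y. y \<in> K \<Longrightarrow> f y = g y) \<Longrightarrow> Q f = Q g"
  unfolding Q_def using lev_cong_K[of f g _ b] by simp

lemma Q_self_similar: "f \<in> FE \<Longrightarrow> Q f = (\<Sum>i\<in>I. Q (f \<circ> w i)) / rho"
proof (rule LIMSEQ_unique)
  assume f: "f \<in> FE"
  show "(\<lambda>n. lev (Suc n) q f) \<longlonglongrightarrow> Q f" using Q_lim[OF f] by (rule LIMSEQ_Suc)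
  show "(\<lambda>n. lev (Suc n) q f) \<longlonglongrightarrow> (\<Sum>i\<in>I. Q (f \<circ> w i)) / rho"
    unfolding lev_Suc using rho_pos f by (intro tendsto_intros Q_lim FE_comp) auto
qed

lemma lev_contraction:
  assumes "\<And>p r. p \<in> V0 \<Longrightarrow> r \<in> V0 \<Longrightarrow> p \<noteq> r \<Longrightarrow> a p r \<ge> 0" and "\<And>x y. \<bar>\<phi> x - \<phi> y\<bar> \<le> \<bar>x - y :: real\<bar>"
  shows "lev n (edge_form k w a) (\<lambda>x. \<phi> (f x)) \<le> lev n (edge_form k w a) f"
  unfolding lev_def level_form_def o_def using rho_pos
  by (intro divide_right_mono sum_mono edge_form_contraction assms) auto

lemma FE_contraction:
  assumes f: "f \<in> FE" and \<phi>: "\<And>x y. \<bar>\<phi> x - \<phi> y\<bar> \<le> \<bar>x - y :: real\<bar>"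
  shows "(\<lambda>x. \<phi> (f x)) \<in> FE" "Q (\<lambda>x. \<phi> (f x)) \<le> Q f"
proof -
  have "lev n E (\<lambda>x. \<phi> (f x)) \<le> lev n E f" for n by (rule lev_contraction) (simp_all add: c_nonneg \<phi>)
  then show g: "(\<lambda>x. \<phi> (f x)) \<in> FE" using lev_le_Einf[OF f] by (intro FE_I[of _ "Einf f"]) (meson order_trans)
  have "lev n q (\<lambda>x. \<phi> (f x)) \<le> lev n q f" for n by (rule lev_contraction) (simp_all add: b_pos less_imp_le \<phi>)
  then show "Q (\<lambda>x. \<phi> (f x)) \<le> Q f" by (intro LIMSEQ_le[OF Q_lim[OF g] Q_lim[OF f]]) auto
qed

text \<open>The harmonic extension to \<open>V\<^sub>n\<close>, built from the outermost level inwards.\<close>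

primrec ext :: "nat \<Rightarrow> ('a \<Rightarrow> real) \<Rightarrow> 'a \<Rightarrow> real" where
  "ext 0 u = u"
| "ext (Suc n) u = (SOME h. \<forall>i\<in>I. \<forall>y\<in>K. h (w i y) = ext n (A i u) y)"

text \<open>Gluing at level n + 1 requires the level-n functions to have the prescribed values on
  \<open>V0\<close>, and these values are in turn read off the recursion at the fixed points; hence
  one joint statement.\<close>

lemma ext_aux:
  "(\<forall>u. \<forall>x\<in>V0. ext n u x = u x) \<and> (\<forall>u. \<forall>i\<in>I. \<forall>y\<in>K. ext (Suc n) u (w i y) = ext n (A i u) y)"
proof -
  have rec: "\<forall>i\<in>I. \<forall>y\<in>K. ext (Suc n) u (w i y) = ext n (A i u) y"
    if V: "\<forall>u. \<forall>x\<in>V0. ext n u x = u x" for n u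
  proof -
    have "\<exists>h. \<forall>i\<in>I. \<forall>y\<in>K. h (w i y) = ext n (A i u) y"
      by (rule glue[of "\<lambda>i. ext n (A i u)" "H u"]) (simp add: V A_def)
    from someI_ex[OF this] show ?thesis by simp
  qed
  have "\<forall>u. \<forall>x\<in>V0. ext n u x = u x"
  proof (induction n)
    case (Suc n)
    show ?case
    proof (intro allI ballI)
      fix u x assume x: "x \<in> V0"
      obtain j where j: "j \<in> I" "w j x = x" using V0_fixed[OF x] by blast
      have "ext (Suc n) u (w j x) = ext n (A j u) x" using rec[OF Suc] j(1) V0_K[OF x] by blast
      also have "\<dots> = A j u x" using Suc x by blast
      finally show "ext (Suc n) u x = u x" using j x by (simp add: A_def H_V0 del: ext.simps)
    qed
  qed simp
  then show ?thesis using rec by blast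
qed

lemma ext_V0: "x \<in> V0 \<Longrightarrow> ext n u x = u x"
  and ext_Suc: "i \<in> I \<Longrightarrow> y \<in> K \<Longrightarrow> ext (Suc n) u (w i y) = ext n (A i u) y"
  using ext_aux[of n] by blast+

lemma ext_stable: "\<sigma> \<in> words k n \<Longrightarrow> p \<in> V0 \<Longrightarrow> ext (Suc n) u (word_map w \<sigma> p) = ext n u (word_map w \<sigma> p)"
proof (induction n arbitrary: \<sigma> u)
  case 0
  then have "\<sigma> = []" by (simp add: words_0)
  then show ?case using 0 ext_V0[of p "Suc 0" u] by (simp del: ext.simps(2))
next
  case (Suc n)
  then obtain i \<sigma>' where s: "\<sigma> = i # \<sigma>'" "i \<in> I" "\<sigma>' \<in> words k n" unfolding words_Suc by auto
  have K: "word_map w \<sigma>' p \<in> K" using words_Suc_K s Suc.prems by blast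
  have "ext (Suc (Suc n)) u (w i (word_map w \<sigma>' p)) = ext (Suc n) (A i u) (word_map w \<sigma>' p)"
    by (rule ext_Suc[OF s(2) K])
  also have "\<dots> = ext n (A i u) (word_map w \<sigma>' p)" by (rule Suc.IH[OF s(3) Suc.prems(2)])
  also have "\<dots> = ext (Suc n) u (w i (word_map w \<sigma>' p))" by (rule ext_Suc[OF s(2) K, symmetric])
  finally show ?case by (simp add: s(1) del: ext.simps)
qed

lemma lev_ext: "lev n E (ext n u) = E u"
proof (induction n arbitrary: u)
  case (Suc n)
  have "lev (Suc n) E (ext (Suc n) u) = (\<Sum>i\<in>I. lev n E (ext (Suc n) u \<circ> w i)) / rho" by (rule lev_Suc)
  also have "(\<Sum>i\<in>I. lev n E (ext (Suc n) u \<circ> w i)) = (\<Sum>i\<in>I. lev n E (ext n (A i u)))"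
    by (intro sum.cong refl lev_cong_K) (simp add: ext_Suc del: ext.simps)
  also have "\<dots> / rho = T E u" by (simp add: Suc.IH T_def)
  finally show ?case by (simp add: T_E)
qed simp

lemma harmonic_extension: "\<exists>f\<in>FE. (\<forall>x\<in>V0. f x = u x) \<and> (\<forall>n. lev n E f = E u)"
proof -
  have stable: "ext m u x = ext n u x" if "x \<in> vertices k w n" "n \<le> m" for x m n
    using that(2)
  proof (induction m rule: dec_induct)
    case (step m)
    have "x \<in> vertices k w m"
      using that(1) step(1) lift_Suc_mono_le[of "vertices k w" n m, OF vertices_Suc] by blast
    then obtain \<sigma> p where "\<sigma> \<in> words k m" "p \<in> V0" "x = word_map w \<sigma> p" by (auto simp: vertices_def)
    then show ?case using step.IH ext_stable by (simp del: ext.simps)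
  qed simp
  \<comment> \<open>The extensions agree on earlier vertices, so the first level containing a point
    decides. Values off the vertices are arbitrary, which the energies do not see.\<close>
  define f where "f = (\<lambda>x. ext (LEAST n. x \<in> vertices k w n) u x)"
  have f: "f x = ext n u x" if "x \<in> vertices k w n" for x n
  proof -
    have "x \<in> vertices k w (LEAST n. x \<in> vertices k w n)" "(LEAST n. x \<in> vertices k w n) \<le> n"
      using LeastI[of "\<lambda>n. x \<in> vertices k w n", OF that] Least_le[of "\<lambda>n. x \<in> vertices k w n", OF that] .
    then show ?thesis unfolding f_def by (rule stable[symmetric])
  qed
  have "lev n E f = E u" for n
  proof -
    have "lev n E f = lev n E (ext n u)"
      unfolding lev_def level_form_def
      by (rule arg_cong[of _ _ "\<lambda>x. x / _"], rule sum.cong[OF refl], rule edge_form_cong)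
        (simp, rule f, unfold vertices_def, rule UN_I, assumption, rule imageI)
    then show ?thesis by (simp add: lev_ext)
  qed
  moreover have "f x = u x" if "x \<in> V0" for x
    using f[of x 0] that by (simp add: vertices_def words_0)
  ultimately show ?thesis by (intro bexI[of _ f] FE_I[of _ "E u"]) auto
qed

section \<open>The trace of the limit form on the vertices\<close>

definition tr :: "('a \<Rightarrow> real) \<Rightarrow> real" where
  "tr u = Inf (Q ` {f\<in>FE. \<forall>x\<in>V0. f x = u x})"

lemma tr_le: "f \<in> FE \<Longrightarrow> (\<And>x. x \<in> V0 \<Longrightarrow> f x = u x) \<Longrightarrow> tr u \<le> Q f"
  unfolding tr_def by (rule cInf_lower) (auto intro!: bdd_belowI[of _ 0] Q.nonneg)

lemma tr_approx: "\<epsilon> > 0 \<Longrightarrow> \<exists>f\<in>FE. (\<forall>x\<in>V0. f x = u x) \<and> Q f < tr u + \<epsilon>"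
proof -
  assume "\<epsilon> > 0"
  moreover have "Q ` {f\<in>FE. \<forall>x\<in>V0. f x = u x} \<noteq> {}" using harmonic_extension[of u] by blast
  ultimately have "\<exists>y\<in>Q ` {f\<in>FE. \<forall>x\<in>V0. f x = u x}. y < tr u + \<epsilon>"
    unfolding tr_def by (intro cInf_lessD) auto
  then show ?thesis by blast
qed

lemma tr_greatest: "(\<And>f. f \<in> FE \<Longrightarrow> (\<And>x. x \<in> V0 \<Longrightarrow> f x = u x) \<Longrightarrow> B \<le> Q f) \<Longrightarrow> B \<le> tr u"
proof -
  assume B: "\<And>f. f \<in> FE \<Longrightarrow> (\<And>x. x \<in> V0 \<Longrightarrow> f x = u x) \<Longrightarrow> B \<le> Q f"
  have "Q ` {f\<in>FE. \<forall>x\<in>V0. f x = u x} \<noteq> {}" using harmonic_extension[of u] by blast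
  then show ?thesis unfolding tr_def by (rule cInf_greatest) (auto intro: B)
qed

lemma tr_cong: "(\<And>x. x \<in> V0 \<Longrightarrow> u x = v x) \<Longrightarrow> tr u = tr v"
proof -
  assume "\<And>x. x \<in> V0 \<Longrightarrow> u x = v x"
  then have "{f\<in>FE. \<forall>x\<in>V0. f x = u x} = {f\<in>FE. \<forall>x\<in>V0. f x = v x}" by auto
  then show ?thesis by (simp add: tr_def)
qed

lemma tr_nonneg: "tr u \<ge> 0"
  by (rule tr_greatest) (rule Q.nonneg)

lemma E_le_tr: assumes C: "\<And>g. C * E g \<le> q g" "C > 0" shows "C * E u \<le> tr u"
proof (rule tr_greatest)
  fix f assume f: "f \<in> FE" "\<And>x. x \<in> V0 \<Longrightarrow> f x = u x"
  have "E u = E f" by (rule edge_form_cong) (simp add: f(2))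
  also have "\<dots> \<le> Einf f" using lev_le_Einf[OF f(1), of 0] by simp
  finally have "C * E u \<le> C * Einf f" using C(2) by simp
  also have "\<dots> \<le> Q f" by (rule Einf_le_Q[OF C(1) f(1)])
  finally show "C * E u \<le> Q f" .
qed

lemma tr_le_E: assumes C: "\<And>g. q g \<le> C * E g" shows "tr u \<le> C * E u"
proof -
  obtain f where f: "f \<in> FE" "\<forall>x\<in>V0. f x = u x" "\<forall>n. lev n E f = E u" using harmonic_extension by blast
  have "Einf f = E u" using Einf_lim[OF f(1)] f(3) by (simp add: LIMSEQ_const_iff)
  then show ?thesis using tr_le[OF f(1)] f(2) Q_le_Einf[OF C f(1)] by (metis order_trans)
qed

text \<open>Sums and differences of near-minimal extensions are extensions, which gives one
  inequality in the parallelogram law. The reverse one is the same inequality applied to u + v and u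
  - v.\<close>

lemma tr_quadratic: "quadratic_on UNIV tr"
proof (rule quadratic_onI)
  have scale_le: "tr (\<lambda>x. t * u x) \<le> t\<^sup>2 * tr u" for u t
  proof (cases "t = 0")
    case True
    have "(\<lambda>x. 0 * u x) \<in> FE"
      using harmonic_extension[of u] Q.F_scale[of _ 0] by auto
    then have "tr (\<lambda>x. 0 * u x) \<le> Q (\<lambda>x. 0 * u x)" by (rule tr_le) simp
    also have "\<dots> = 0" using Q.scale[OF \<open>(\<lambda>x. 0 * u x) \<in> FE\<close>, of 0] by simp
    finally show ?thesis using True by simp
  next
    case False
    have "tr (\<lambda>x. t * u x) / t\<^sup>2 \<le> tr u"
    proof (rule tr_greatest)
      fix f assume f: "f \<in> FE" "\<And>x. x \<in> V0 \<Longrightarrow> f x = u x"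
      have "tr (\<lambda>x. t * u x) \<le> Q (\<lambda>x. t * f x)" by (rule tr_le[OF Q.F_scale[OF f(1)]]) (simp add: f(2))
      also have "\<dots> = t\<^sup>2 * Q f" by (rule Q.scale[OF f(1)])
      finally show "tr (\<lambda>x. t * u x) / t\<^sup>2 \<le> Q f" using False by (simp add: divide_le_eq mult.commute)
    qed
    then show ?thesis using False by (simp add: divide_le_eq mult.commute)
  qed
  show scale: "tr (\<lambda>x. t * u x) = t\<^sup>2 * tr u" for u t
  proof (cases "t = 0")
    case True
    then show ?thesis using scale_le[of 0 u] tr_nonneg[of "\<lambda>x. 0 * u x"] by simp
  next
    case False
    then have "tr u \<le> (1 / t)\<^sup>2 * tr (\<lambda>x. t * u x)" using scale_le[of "1 / t" "\<lambda>x. t * u x"] by simp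
    then have "t\<^sup>2 * tr u \<le> tr (\<lambda>x. t * u x)" using False by (simp add: power_divide pos_le_divide_eq mult.commute)
    then show ?thesis using scale_le[of t u] by simp
  qed
  have par_le: "tr (\<lambda>x. u x + v x) + tr (\<lambda>x. u x - v x) \<le> 2 * tr u + 2 * tr v" for u v
  proof (rule field_le_epsilon)
    fix e :: real assume "e > 0"
    then have e4: "e / 4 > 0" by simp
    obtain f where f: "f \<in> FE" "\<forall>x\<in>V0. f x = u x" "Q f < tr u + e / 4" using tr_approx[OF e4] by blast
    obtain g where g: "g \<in> FE" "\<forall>x\<in>V0. g x = v x" "Q g < tr v + e / 4" using tr_approx[OF e4] by blast
    have "tr (\<lambda>x. u x + v x) \<le> Q (\<lambda>x. f x + g x)" "tr (\<lambda>x. u x - v x) \<le> Q (\<lambda>x. f x - g x)"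
      by (rule tr_le[OF Q.F_add[OF f(1) g(1)]] tr_le[OF Q.F_diff[OF f(1) g(1)]]; use f g in simp)+
    moreover have "Q (\<lambda>x. f x + g x) + Q (\<lambda>x. f x - g x) = 2 * Q f + 2 * Q g" by (rule Q.par[OF f(1) g(1)])
    ultimately show "tr (\<lambda>x. u x + v x) + tr (\<lambda>x. u x - v x) \<le> 2 * tr u + 2 * tr v + e" using f(3) g(3) by linarith
  qed
  fix u v :: "'a \<Rightarrow> real"
  have "tr (\<lambda>x. (u x + v x) + (u x - v x)) + tr (\<lambda>x. (u x + v x) - (u x - v x)) \<le>
      2 * tr (\<lambda>x. u x + v x) + 2 * tr (\<lambda>x. u x - v x)" by (rule par_le)
  moreover have "(\<lambda>x. (u x + v x) + (u x - v x)) = (\<lambda>x. 2 * u x)" "(\<lambda>x. (u x + v x) - (u x - v x)) = (\<lambda>x. 2 * v x)"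
    by auto
  ultimately have "4 * tr u + 4 * tr v \<le> 2 * tr (\<lambda>x. u x + v x) + 2 * tr (\<lambda>x. u x - v x)"
    by (simp only: scale) simp
  then show "tr (\<lambda>x. u x + v x) + tr (\<lambda>x. u x - v x) = 2 * tr u + 2 * tr v" using par_le[of u v] by linarith
qed

lemma FE_shift:
  assumes f: "f \<in> FE" shows "(\<lambda>x. f x + t) \<in> FE" "Q (\<lambda>x. f x + t) = Q f"
proof -
  have "lev n (edge_form k w a) (\<lambda>x. f x + t) = lev n (edge_form k w a) f" for n a
    by (simp add: lev_def level_form_def edge_form_def)
  then show "(\<lambda>x. f x + t) \<in> FE" "Q (\<lambda>x. f x + t) = Q f" using f by (simp_all add: finite_E_def Q_def)
qed

lemma form_tr: "form tr"
proof -
  obtain C where C: "\<forall>f. q f \<le> C * E f" using q_le_E by blast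
  have "\<bar>tr u\<bar> \<le> C * E u" for u using tr_le_E[of C u] C tr_nonneg[of u] by simp
  moreover have "tr (\<lambda>x. u x + t) = tr u" for u t
  proof -
    have le: "tr (\<lambda>x. u x + t) \<le> tr u" for u t
    proof (rule tr_greatest)
      fix f assume f: "f \<in> FE" "\<And>x. x \<in> V0 \<Longrightarrow> f x = u x"
      have "tr (\<lambda>x. u x + t) \<le> Q (\<lambda>x. f x + t)" by (rule tr_le[OF FE_shift(1)[OF f(1)]]) (simp add: f(2))
      then show "tr (\<lambda>x. u x + t) \<le> Q f" by (simp add: FE_shift(2)[OF f(1)])
    qed
    show ?thesis using le[of u t] le[of "\<lambda>x. u x + t" "- t"] by simp
  qed
  ultimately show ?thesis unfolding form_def using tr_quadratic by (auto intro: tr_cong)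
qed

lemma tr_abs: "tr (\<lambda>x. \<bar>u x\<bar>) \<le> tr u"
proof (rule tr_greatest)
  fix f assume f: "f \<in> FE" "\<And>x. x \<in> V0 \<Longrightarrow> f x = u x"
  have "(\<lambda>x. \<bar>f x\<bar>) \<in> FE" "Q (\<lambda>x. \<bar>f x\<bar>) \<le> Q f" by (rule FE_contraction[OF f(1)]; simp)+
  then show "tr (\<lambda>x. \<bar>u x\<bar>) \<le> Q f" using tr_le[of "\<lambda>x. \<bar>f x\<bar>" "\<lambda>x. \<bar>u x\<bar>"] f(2) by simp
qed

text \<open>Composition with the reflection maps extensions to extensions and preserves the energies
  of \<open>q\<close>. Those of \<open>E\<close> need not be preserved, so finiteness of energy is
  transported through the comparison of \<open>E\<close> with \<open>q\<close>.\<close>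

lemma tr_reflection:
  assumes pr: "p \<in> V0" "r \<in> V0" "p \<noteq> r"
  shows "tr (u \<circ> bisector_reflection p r) = tr u"
proof -
  let ?R = "bisector_reflection p r"
  have lq: "lev n q (f \<circ> ?R) = lev n q f" for n f
  proof -
    have "level_form k w n q (f \<circ> ?R) = level_form k w n q f"
    proof (rule level_form_reflection[OF pr])
      show "q f = q g" if "\<And>x. x \<in> V0 \<Longrightarrow> f x = g x" for f g by (rule edge_form_cong) (rule that)
      show "q (f \<circ> \<phi>) = q f" if "bij_betw \<phi> V0 V0"
        "\<And>x y. x \<in> V0 \<Longrightarrow> y \<in> V0 \<Longrightarrow> norm (\<phi> x - \<phi> y) = norm (x - y)" for \<phi> f
        by (rule b_isometry) (rule that, rule that(2))
    qed
    then show ?thesis by (simp add: lev_def)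
  qed
  have le: "tr (u \<circ> ?R) \<le> tr u" for u
  proof (rule tr_greatest)
    fix f assume f: "f \<in> FE" "\<And>x. x \<in> V0 \<Longrightarrow> f x = u x"
    obtain C where C: "C > 0" "\<forall>f. C * E f \<le> q f" using E_le_q by blast
    obtain C' where C': "C' > 0" "\<forall>f. q f \<le> C' * E f" using q_le_E by blast
    have "f \<circ> ?R \<in> FE"
    proof (rule FE_I)
      fix n
      have "C * lev n E (f \<circ> ?R) \<le> lev n q (f \<circ> ?R)"
        unfolding lev_cmult[symmetric] by (rule lev_mono) (use C in blast)
      also have "\<dots> \<le> C' * lev n E f" unfolding lq lev_cmult[symmetric] by (rule lev_mono) (use C' in blast)
      also have "\<dots> \<le> C' * Einf f" using lev_le_Einf[OF f(1)] C' by simp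
      finally show "lev n E (f \<circ> ?R) \<le> C' * Einf f / C" using C by (simp add: pos_le_divide_eq mult.commute)
    qed
    moreover have "(f \<circ> ?R) x = (u \<circ> ?R) x" if "x \<in> V0" for x
      using f(2) reflection_V0[OF pr] that by auto
    ultimately have "tr (u \<circ> ?R) \<le> Q (f \<circ> ?R)" by (rule tr_le)
    then show "tr (u \<circ> ?R) \<le> Q f" by (simp add: Q_def lq)
  qed
  have "u \<circ> ?R \<circ> ?R = u" by (rule ext) (simp add: bisector_reflection_involution[OF pr(3)])
  then show ?thesis using le[of u] le[of "u \<circ> ?R"] by simp
qed

section \<open>Conductances of the trace\<close>

definition \<Delta> :: "'a \<Rightarrow> 'a \<Rightarrow> real" where "\<Delta> p x = (if x = p then 1 else 0)"
definition c' :: "'a \<Rightarrow> 'a \<Rightarrow> real" where "c' p r = - polar tr (\<Delta> p) (\<Delta> r) / 2"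

lemma tr_eq: "tr u = edge_form k w c' u"
  using form_representation[OF form_tr tr_nonneg, of u] by (simp add: c'_def[abs_def] \<Delta>_def[abs_def])

sublocale tr: nonneg_quadratic UNIV tr
  by unfold_locales (simp_all add: fun_subspace_UNIV tr_quadratic tr_nonneg)

lemma c'_sym: "c' p r = c' r p"
  unfolding c'_def using tr.polar_commute[of "\<Delta> p" "\<Delta> r"] by simp

text \<open>The Markov property tested on a difference of two indicators: its absolute value is
  their sum, so the mixed term is nonpositive.\<close>

lemma c'_nonneg: "p \<noteq> r \<Longrightarrow> c' p r \<ge> 0"
proof -
  assume "p \<noteq> r"
  then have "(\<lambda>x. \<bar>\<Delta> p x - \<Delta> r x\<bar>) = (\<lambda>x. \<Delta> p x + \<Delta> r x)" by (auto simp: \<Delta>_def)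
  then have "tr (\<lambda>x. \<Delta> p x + \<Delta> r x) \<le> tr (\<lambda>x. \<Delta> p x - \<Delta> r x)"
    using tr_abs[of "\<lambda>x. \<Delta> p x - \<Delta> r x"] by simp
  then show ?thesis by (simp add: c'_def polar_def)
qed

text \<open>Across a cut without conductance the indicator of one side would have trace energy 0,
  whereas the trace dominates a positive multiple of \<open>E\<close>.\<close>

lemma c'_linked: "linked c' V0"
  unfolding linked_def
proof (intro allI impI, rule ccontr)
  fix B assume B: "B \<subseteq> V0" "B \<noteq> {}" "B \<noteq> V0" and "\<not> (\<exists>x\<in>B. \<exists>y\<in>V0 - B. c' x y > 0)"
  then have z: "c' x y = 0" if "x \<in> B" "y \<in> V0 - B" for x y
    using that c'_nonneg[of x y] by force
  define u :: "'a \<Rightarrow> real" where "u = (\<lambda>x. if x \<in> B then 1 else 0)"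
  obtain x y where xy: "x \<in> B" "y \<in> V0 - B" using B by blast
  have "tr u = 0"
    unfolding tr_eq edge_form_def
  proof (rule sum.neutral, clarify)
    fix x y assume "(x, y) \<in> E0"
    then have "x \<in> V0" "y \<in> V0" by (simp_all add: E0_iff)
    then show "c' x y * (u x - u y)\<^sup>2 = 0"
      using z[of x y] z[of y x] c'_sym[of x y] by (cases "x \<in> B"; cases "y \<in> B") (simp_all add: u_def)
  qed
  moreover have "E u > 0" using E_pos[of x y u] xy B(1) by (auto simp: u_def)
  moreover obtain C where "C > 0" "\<forall>f. C * E f \<le> q f" using E_le_q by blast
  ultimately show False using E_le_tr[of C u] by (simp add: mult_le_0_iff)
qed

lemma c'_reflection:
  assumes pr: "p \<in> V0" "r \<in> V0" "p \<noteq> r"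
  shows "c' (bisector_reflection p r x) (bisector_reflection p r y) = c' x y"
proof -
  let ?R = "bisector_reflection p r"
  have d: "\<Delta> (?R x) = \<Delta> x \<circ> ?R" for x
  proof
    fix z
    have "z = ?R x \<longleftrightarrow> ?R z = x" using bisector_reflection_involution[OF pr(3)] by metis
    then show "\<Delta> (?R x) z = (\<Delta> x \<circ> ?R) z" by (simp add: \<Delta>_def)
  qed
  have "tr (\<lambda>z. (\<Delta> x \<circ> ?R) z + (\<Delta> y \<circ> ?R) z) = tr (\<lambda>z. \<Delta> x z + \<Delta> y z)"
    using tr_reflection[OF pr, of "\<lambda>z. \<Delta> x z + \<Delta> y z"] by (simp add: o_def)
  moreover have "tr (\<lambda>z. (\<Delta> x \<circ> ?R) z - (\<Delta> y \<circ> ?R) z) = tr (\<lambda>z. \<Delta> x z - \<Delta> y z)"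
    using tr_reflection[OF pr, of "\<lambda>z. \<Delta> x z - \<Delta> y z"] by (simp add: o_def)
  ultimately show ?thesis unfolding c'_def d polar_def by simp
qed

text \<open>Reflections act transitively on \<open>V\<^sub>0\<close>, and every finite connected graph has a vertex
  whose removal leaves it connected; so no vertex is a cut vertex.\<close>

lemma c'_linked_del: assumes v: "v \<in> V0" shows "linked c' (V0 - {v})"
proof -
  obtain x where x: "x \<in> V0" "linked c' (V0 - {x})"
    using linked_non_cut_vertex[OF finite_V0 card_V0 c'_linked c'_sym] by blast
  show ?thesis
  proof (cases "x = v")
    case False
    let ?R = "bisector_reflection x v"
    note inv = bisector_reflection_involution[OF False]
    have RV: "?R y \<in> V0" if "y \<in> V0" for y using reflection_V0[OF x(1) v False] that by blast
    have Rx: "?R x = v" "?R v = x" by (rule bisector_reflection_swap[OF False])+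
    have Rd: "?R y \<in> V0 - {x}" if "y \<in> V0 - {v}" for y using RV[of y] that inv[of y] Rx by auto
    show ?thesis unfolding linked_def
    proof (intro allI impI)
      fix B assume B: "B \<subseteq> V0 - {v}" "B \<noteq> {}" "B \<noteq> V0 - {v}"
      have sub: "?R ` B \<subseteq> V0 - {x}"
      proof (rule image_subsetI)
        fix y assume "y \<in> B"
        then have "y \<in> V0 - {v}" using B(1) by (rule rev_subsetD)
        then show "?R y \<in> V0 - {x}" by (rule Rd)
      qed
      have "?R ` B \<noteq> {}" using B(2) by simp
      moreover have "?R ` B \<noteq> V0 - {x}"
      proof
        assume e: "?R ` B = V0 - {x}"
        have "V0 - {v} \<subseteq> B"
        proof
          fix y assume "y \<in> V0 - {v}"
          then have "?R y \<in> V0 - {x}" by (rule Rd)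
          then have "?R y \<in> ?R ` B" by (simp only: e)
          then obtain z where "z \<in> B" "?R y = ?R z" by blast
          then show "y \<in> B" using inv by metis
        qed
        then show False using B by blast
      qed
      ultimately obtain a0 z0 where "a0 \<in> ?R ` B" "z0 \<in> V0 - {x}" "z0 \<notin> ?R ` B" using sub by blast
      from linkedD[OF x(2) sub this]
      obtain a z where az: "a \<in> ?R ` B" "z \<in> (V0 - {x}) - ?R ` B" "c' a z > 0" by (elim bexE)
      then obtain y where y: "y \<in> B" "a = ?R y" by blast
      have "?R z \<in> V0 - {v}" using RV[of z] az(2) inv[of z] Rx by auto
      moreover have "?R z \<notin> B" using az(2) inv[of z] by (metis DiffD2 imageI)
      moreover have "c' y (?R z) > 0"
        using az(3) c'_reflection[OF x(1) v False, of y "?R z"] by (simp add: y(2) inv)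
      ultimately show "\<exists>y\<in>B. \<exists>z\<in>V0 - {v} - B. c' y z > 0" using y(1) by blast
    qed
  qed (use x in simp)
qed

text \<open>The second use of the harmonic theory: the maximum principle for the trace form is now
  available, with some conductances possibly still zero.\<close>

sublocale Tr: robust_conductances k w lam K c'
  by unfold_locales (rule c'_sym c'_nonneg c'_linked c'_linked_del; assumption)+

end

context renorm
begin

declare atLeastAtMost_iff [simp del] One_nat_def [simp del]

lemma tr_fun: "tr = edge_form k w c'"
  by (rule ext) (rule tr_eq)

section \<open>The trace as an eigenform\<close>

lemma glue_FE:
  assumes g: "\<And>i. i \<in> I \<Longrightarrow> g i \<in> FE" "\<And>i p. i \<in> I \<Longrightarrow> p \<in> V0 \<Longrightarrow> g i p = f (w i p)"
  shows "\<exists>h\<in>FE. (\<forall>i\<in>I. \<forall>y\<in>K. h (w i y) = g i y) \<and> Q h = (\<Sum>i\<in>I. Q (g i)) / rho"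
proof -
  obtain h where h: "\<forall>i\<in>I. \<forall>y\<in>K. h (w i y) = g i y" using glue[of g f, OF g(2)] by blast
  have "h \<circ> w i \<in> FE" if i: "i \<in> I" for i
    by (rule FE_cong_K[OF g(1)[OF i]]) (use h i in simp)
  then have hF: "h \<in> FE" by (rule FE_glue)
  have "Q (h \<circ> w i) = Q (g i)" if "i \<in> I" for i by (rule Q_cong_K) (use h that in simp)
  then have "Q h = (\<Sum>i\<in>I. Q (g i)) / rho" using Q_self_similar[OF hF] by simp
  then show ?thesis using h hF by blast
qed

text \<open>Near-minimal extensions chosen separately in the n-cells glue together. With
  \<open>lev_tr_le\<close> this shows that the level-n energy of the trace is the infimum of
  \<open>Q\<close> over functions agreeing with \<open>f\<close> on the level-n vertices.\<close>

lemma lev_tr_approx: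
  "\<epsilon> > 0 \<Longrightarrow> \<exists>g\<in>FE. (\<forall>\<sigma>\<in>words k n. \<forall>p\<in>V0. g (word_map w \<sigma> p) = f (word_map w \<sigma> p)) \<and> Q g \<le> lev n tr f + \<epsilon>"
proof (induction n arbitrary: f \<epsilon>)
  case 0
  then show ?case using tr_approx[of \<epsilon> f] by (auto simp: words_0 intro: less_imp_le)
next
  case (Suc n)
  \<comment> \<open>An equal share of \<epsilon> for each cell, multiplied by \<open>rho\<close>
    because the recursion divides the sum over cells by it.\<close>
  define e where "e = \<epsilon> * rho / real (card I)"
  have cI: "real (card I) > 0" using I_ne by (simp add: card_gt_0_iff)
  have e: "e > 0" using Suc.prems rho_pos cI by (simp add: e_def)
  have "\<exists>g. g \<in> FE \<and> (\<forall>\<sigma>\<in>words k n. \<forall>p\<in>V0. g (word_map w \<sigma> p) = (f \<circ> w i) (word_map w \<sigma> p)) \<and>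
      Q g \<le> lev n tr (f \<circ> w i) + e" for i
    using Suc.IH[OF e, of "f \<circ> w i"] by blast
  then have "\<forall>i. \<exists>g. g \<in> FE \<and> (\<forall>\<sigma>\<in>words k n. \<forall>p\<in>V0. g (word_map w \<sigma> p) = (f \<circ> w i) (word_map w \<sigma> p)) \<and>
      Q g \<le> lev n tr (f \<circ> w i) + e" by blast
  from choice[OF this] obtain g where
    g: "\<forall>i. g i \<in> FE \<and> (\<forall>\<sigma>\<in>words k n. \<forall>p\<in>V0. g i (word_map w \<sigma> p) = (f \<circ> w i) (word_map w \<sigma> p)) \<and>
      Q (g i) \<le> lev n tr (f \<circ> w i) + e" by (rule exE)
  have g1: "g i \<in> FE" and g2: "\<sigma> \<in> words k n \<Longrightarrow> p \<in> V0 \<Longrightarrow> g i (word_map w \<sigma> p) = f (w i (word_map w \<sigma> p))"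
    and g3: "Q (g i) \<le> lev n tr (f \<circ> w i) + e" for i \<sigma> p
    using spec[OF g, of i] by simp_all
  have "g i p = f (w i p)" if "p \<in> V0" for i p
  proof -
    have "vertices k w 0 \<subseteq> vertices k w n"
      by (rule lift_Suc_mono_le[of "vertices k w"]) (rule vertices_Suc, simp)
    moreover have "p \<in> vertices k w 0" using that by (simp add: vertices_def words_0)
    ultimately have "p \<in> vertices k w n" by (rule subsetD)
    then obtain \<sigma> p' where "\<sigma> \<in> words k n" "p' \<in> V0" "p = word_map w \<sigma> p'" by (auto simp: vertices_def)
    then show ?thesis using g2 by simp
  qed
  then obtain h where h: "h \<in> FE" "\<forall>i\<in>I. \<forall>y\<in>K. h (w i y) = g i y" "Q h = (\<Sum>i\<in>I. Q (g i)) / rho"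
    using glue_FE[of g f, OF g1] by blast
  have "h (word_map w \<tau> p) = f (word_map w \<tau> p)" if \<tau>: "\<tau> \<in> words k (Suc n)" and p: "p \<in> V0" for \<tau> p
  proof -
    obtain i \<sigma> where s: "\<tau> = i # \<sigma>" "i \<in> I" "\<sigma> \<in> words k n" using \<tau> unfolding words_Suc by auto
    then show ?thesis using h(2) words_Suc_K[OF s(3) p] g2[OF s(3) p] by simp
  qed
  moreover have "Q h \<le> lev (Suc n) tr f + \<epsilon>"
  proof -
    have "Q h \<le> (\<Sum>i\<in>I. lev n tr (f \<circ> w i) + e) / rho"
      unfolding h(3) using rho_pos g3 by (intro divide_right_mono sum_mono) auto
    also have "\<dots> = lev (Suc n) tr f + real (card I) * e / rho"
      by (simp add: lev_Suc sum.distrib add_divide_distrib)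
    also have "real (card I) * e / rho = \<epsilon>" using rho_pos cI by (simp add: e_def)
    finally show ?thesis .
  qed
  ultimately show ?case using h(1) by blast
qed

lemma lev_tr_le: "f \<in> FE \<Longrightarrow> lev n tr f \<le> Q f"
proof (induction n arbitrary: f)
  case 0
  then show ?case using tr_le[of f f] by simp
next
  case (Suc n)
  have "lev (Suc n) tr f \<le> (\<Sum>i\<in>I. Q (f \<circ> w i)) / rho"
    unfolding lev_Suc using rho_pos Suc by (intro divide_right_mono sum_mono) (auto intro: FE_comp)
  then show ?case using Q_self_similar[OF Suc.prems] by simp
qed

lemma lev_tr_1: "rho * lev 1 tr f = Tr.S f"
  using rho_pos by (simp add: lev_def tr_fun)

lemma tr_renorm_le:
  assumes "\<And>x. x \<in> V0 \<Longrightarrow> g x = u x"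
  shows "rho * tr u \<le> Tr.S g"
proof -
  have "tr u \<le> lev 1 tr g"
  proof (rule field_le_epsilon)
    fix e :: real assume "e > 0"
    then obtain h where h: "h \<in> FE" "\<forall>\<sigma>\<in>words k 1. \<forall>p\<in>V0. h (word_map w \<sigma> p) = g (word_map w \<sigma> p)"
      "Q h \<le> lev 1 tr g + e" using lev_tr_approx[of e 1 g] by blast
    have "h x = u x" if x: "x \<in> V0" for x
    proof -
      obtain j where j: "j \<in> I" "w j x = x" using V0_fixed[OF x] by blast
      have "[j] \<in> words k 1" using j by (simp add: words_1)
      then have "h (word_map w [j] x) = g (word_map w [j] x)" using h(2) x by blast
      then show ?thesis using j assms[OF x] by simp
    qed
    then have "tr u \<le> Q h" by (rule tr_le[OF h(1)])
    then show "tr u \<le> lev 1 tr g + e" using h(3) by simp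
  qed
  then show ?thesis unfolding lev_tr_1[symmetric] using rho_pos by (simp add: mult_left_mono)
qed

text \<open>Minimisation in two stages: minimising \<open>Q\<close> with values given on
  \<open>V0\<close> is minimising inside the 1-cells with values given on \<open>V1\<close>, and
  then over those values. By self-similarity the inner minimum is the trace in each cell.\<close>

lemma tr_renorm: "Tr.S (Tr.H u) = rho * tr u"
proof (rule antisym)
  have "Tr.S (Tr.H u) / rho \<le> tr u"
  proof (rule tr_greatest)
    fix f assume f: "f \<in> FE" "\<And>x. x \<in> V0 \<Longrightarrow> f x = u x"
    have "Tr.S (Tr.H u) \<le> Tr.S f" by (rule Tr.S_H_minimal) (rule f(2))
    also have "\<dots> = rho * lev 1 tr f" by (rule lev_tr_1[symmetric])
    also have "\<dots> \<le> rho * Q f" using lev_tr_le[OF f(1)] rho_pos by (intro mult_left_mono) auto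
    finally show "Tr.S (Tr.H u) / rho \<le> Q f" using rho_pos by (simp add: divide_le_eq mult.commute)
  qed
  then show "Tr.S (Tr.H u) \<le> rho * tr u" using rho_pos by (simp add: divide_le_eq mult.commute)
  show "rho * tr u \<le> Tr.S (Tr.H u)" by (rule tr_renorm_le) (rule Tr.H_V0)
qed

text \<open>If the conductance between \<open>p\<close> and \<open>r\<close> vanished, the harmonic extensions \<open>h, h'\<close> of the
  indicators of \<open>p\<close> and \<open>r\<close> would satisfy \<open>\<bar>h - h'\<bar> = h + h'\<close>, but both are positive inside.\<close>

lemma c'_pos:
  assumes pr: "p \<in> V0" "r \<in> V0" "p \<noteq> r"
  shows "c' p r > 0"
proof (rule ccontr)
  assume "\<not> c' p r > 0"
  then have "c' p r = 0" using c'_nonneg[OF pr(3)] by simp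
  then have eq: "tr (\<lambda>x. \<Delta> p x + \<Delta> r x) = tr (\<lambda>x. \<Delta> p x - \<Delta> r x)" by (simp add: c'_def polar_def)
  define h h' where "h = Tr.H (\<Delta> p)" and "h' = Tr.H (\<Delta> r)"
  have "Tr.S (\<lambda>x. \<bar>h x - h' x\<bar>) \<le> Tr.S (\<lambda>x. h x - h' x)" by (rule Tr.S_contraction) simp
  also have "\<dots> = Tr.S (Tr.H (\<lambda>x. \<Delta> p x - \<Delta> r x))" by (simp add: h_def h'_def Tr.H_diff)
  also have "\<dots> = Tr.S (Tr.H (\<lambda>x. \<Delta> p x + \<Delta> r x))" by (simp only: tr_renorm eq)
  finally have le: "Tr.S (\<lambda>x. \<bar>h x - h' x\<bar>) \<le> Tr.S (Tr.H (\<lambda>x. \<Delta> p x + \<Delta> r x))" .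
  have bd: "\<bar>h x - h' x\<bar> = \<Delta> p x + \<Delta> r x" if "x \<in> V0" for x
    using that pr by (auto simp: h_def h'_def Tr.H_V0 \<Delta>_def)
  obtain x where x: "x \<in> vertices k w 1" "x \<notin> V0" using V1_not_V0 by blast
  have "\<bar>h x - h' x\<bar> = Tr.H (\<lambda>x. \<Delta> p x + \<Delta> r x) x" by (rule Tr.H_unique[OF bd le x(1)])
  then have "\<bar>h x - h' x\<bar> = h x + h' x" by (simp add: Tr.H_add h_def h'_def)
  moreover have "h x > 0" unfolding h_def by (rule Tr.strong_maximum_principle[OF _ pr(1) _ x]) (simp_all add: \<Delta>_def)
  moreover have "h' x > 0" unfolding h'_def by (rule Tr.strong_maximum_principle[OF _ pr(2) _ x]) (simp_all add: \<Delta>_def)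
  ultimately show False by linarith
qed

lemma eigenform_tr:
  assumes s: "s > 0"
  shows "eigenform k w (\<lambda>u. s * tr u) rho"
  unfolding eigenform_def
proof (intro conjI allI)
  show "discrete_form k w (\<lambda>u. s * tr u)"
    unfolding discrete_form_def
  proof (intro exI conjI allI)
    show "\<forall>(p, r)\<in>E0. s * c' p r = s * c' r p \<and> s * c' p r > 0"
    proof (rule ballI, clarify)
      fix p r assume "(p, r) \<in> E0"
      then show "s * c' p r = s * c' r p \<and> s * c' p r > 0"
        using c'_pos[of p r] c'_sym[of p r] s by (simp add: E0_iff)
    qed
    show "s * tr g = (\<Sum>(p, r)\<in>E0. s * c' p r * (g p - g r)\<^sup>2)" for g
      by (simp add: tr_eq edge_form_def sum_distrib_left split_beta mult.assoc)
  qed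
  show "rho > 0" by (rule rho_pos)
  have S: "level_form k w 1 (\<lambda>u. s * tr u) g = s * Tr.S g" for g
    by (simp add: level_form_1 tr_fun sum_distrib_left)
  show "Inf {level_form k w 1 (\<lambda>u. s * tr u) g |g. \<forall>x\<in>V0. g x = f x} = rho * (s * tr f)" for f
  proof (rule cInf_eq_minimum)
    have "rho * (s * tr f) = level_form k w 1 (\<lambda>u. s * tr u) (Tr.H f)" unfolding S tr_renorm by simp
    then show "rho * (s * tr f) \<in> {level_form k w 1 (\<lambda>u. s * tr u) g |g. \<forall>x\<in>V0. g x = f x}"
      using Tr.H_V0 by blast
    fix y assume "y \<in> {level_form k w 1 (\<lambda>u. s * tr u) g |g. \<forall>x\<in>V0. g x = f x}"
    then obtain g where "y = s * Tr.S g" "\<forall>x\<in>V0. g x = f x" unfolding S by blast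
    then show "rho * (s * tr f) \<le> y" using tr_renorm_le[of g f] s by (simp add: mult.left_commute)
  qed
qed

text \<open>Functions of bounded energy vanishing on \<open>V\<^sub>n\<close> tend weakly to 0. The near-minimiser \<open>x\<close> of
  the functional \<open>C Einf z - Q z + Q (f - z)\<close> replaces the Riesz representation of \<open>Q(f, \<cdot>)\<close>, so
  that no completeness is needed.\<close>

lemma weakly_null:
  assumes f: "f \<in> FE" and \<eta>: "\<eta> > 0" and B: "B > 0"
  shows "\<exists>N. \<forall>n\<ge>N. \<forall>v\<in>FE. (\<forall>\<sigma>\<in>words k n. \<forall>p\<in>V0. v (word_map w \<sigma> p) = 0) \<longrightarrow> Einf v \<le> B \<longrightarrow>
    polar Q f v \<le> \<eta>"
proof -
  obtain C where C: "C > 0" "\<forall>g. q g \<le> C * E g" using q_le_E by blast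
  \<comment> \<open>Up to the constant \<open>Q f\<close> this is C \<open>Einf z\<close> minus
    twice the polar form of \<open>f\<close> and \<open>z\<close>; its first variation at a minimum
    would represent that polar form by C times the one of \<open>Einf\<close>. It is bounded below
    because \<open>Q\<close> is at most C \<open>Einf\<close>.\<close>
  define J where "J = (\<lambda>z. C * Einf z - Q z + Q (\<lambda>x. f x - z x))"
  have J0: "J z \<ge> 0" if "z \<in> FE" for z
    using Q_le_Einf[of C z] C(2) that Q.nonneg[OF Q.F_diff[OF f that]] by (simp add: J_def)
  \<comment> \<open>The constants \<open>t\<close> and \<open>e\<close> are balanced so that
    near-minimality and the quadratic term in \<open>t\<close> each contribute \<eta> / 4.\<close>
  define t where "t = \<eta> / (2 * C * B)"
  have t: "t > 0" "t * C * B / 2 = \<eta> / 4" using \<eta> C B by (simp_all add: t_def)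
  define e where "e = \<eta> * t / 2"
  have e: "e > 0" "e / (2 * t) = \<eta> / 4" using \<eta> t by (simp_all add: e_def)
  have ne: "J ` FE \<noteq> {}" using f by blast
  have bdd: "bdd_below (J ` FE)" by (rule bdd_belowI[of _ 0]) (use J0 in auto)
  have "\<exists>y\<in>J ` FE. y < Inf (J ` FE) + e" using ne e by (intro cInf_lessD) auto
  then obtain x where x: "x \<in> FE" "J x < Inf (J ` FE) + e" by blast
  have Jx: "J x - e \<le> J z" if "z \<in> FE" for z
    using x(2) cInf_lower[of "J z" "J ` FE"] that bdd by force
  define s where "s = \<eta> / (4 * C * B)"
  have s: "s > 0" "C * (s * B / 2) = \<eta> / 8" using \<eta> C B by (simp_all add: s_def)
  have "(\<lambda>n. C * ((Einf x - lev n E x) / (2 * s))) \<longlonglongrightarrow> C * ((Einf x - Einf x) / (2 * s))"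
    by (intro tendsto_intros Einf_lim x) (use s in simp)
  then have "\<forall>\<^sub>F n in sequentially. C * ((Einf x - lev n E x) / (2 * s)) < \<eta> / 8"
    by (rule order_tendstoD(2)) (use \<eta> in simp)
  then obtain N where N: "\<forall>n\<ge>N. C * ((Einf x - lev n E x) / (2 * s)) < \<eta> / 8"
    by (auto simp: eventually_sequentially)
  have "polar Q f v \<le> \<eta>"
    if n: "n \<ge> N" and v: "v \<in> FE" "\<forall>\<sigma>\<in>words k n. \<forall>p\<in>V0. v (word_map w \<sigma> p) = 0" "Einf v \<le> B" for n v
  proof -
    \<comment> \<open>Since \<open>v\<close> vanishes on the level-n vertices, moving from
      \<open>x\<close> by a multiple of \<open>v\<close> leaves the level-n energy alone. The polar
      form of \<open>x\<close> and \<open>v\<close> is therefore bounded by the energy of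
      \<open>x\<close> beyond level n.\<close>
    have "lev n E x = lev n E (\<lambda>y. x y + (- s) * v y)"
      unfolding lev_def level_form_def
      by (rule arg_cong[of _ _ "\<lambda>x. x / _"], rule sum.cong[OF refl], rule edge_form_cong) (use v(2) in simp)
    also have "\<dots> \<le> Einf (\<lambda>y. x y + (- s) * v y)"
      by (rule lev_le_Einf) (rule Einf.F_add[OF x(1) Einf.F_scale[OF v(1)]])
    also have "\<dots> = Einf x + 2 * (- s) * polar Einf x v + (- s)\<^sup>2 * Einf v" by (rule Einf.expand[OF x(1) v(1)])
    finally have "2 * s * polar Einf x v \<le> (Einf x - lev n E x) + s\<^sup>2 * Einf v" by simp
    also have "\<dots> \<le> (Einf x - lev n E x) + s\<^sup>2 * B" using v(3) by (simp add: mult_left_mono)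
    finally have "polar Einf x v \<le> ((Einf x - lev n E x) + s\<^sup>2 * B) / (2 * s)"
      using s(1) by (simp add: pos_le_divide_eq mult.commute mult.left_commute)
    also have "\<dots> = (Einf x - lev n E x) / (2 * s) + s * B / 2"
      using s(1) by (simp add: add_divide_distrib power2_eq_square)
    finally have "C * polar Einf x v \<le> C * ((Einf x - lev n E x) / (2 * s) + s * B / 2)"
      using C(1) by (intro mult_left_mono) auto
    also have "\<dots> = C * ((Einf x - lev n E x) / (2 * s)) + C * (s * B / 2)" by (rule distrib_left)
    also have "\<dots> \<le> \<eta> / 8 + \<eta> / 8" using N n s(2) by (intro add_mono) (auto intro: less_imp_le)
    finally have 1: "C * polar Einf x v \<le> \<eta> / 4" by simp
    have tv: "(\<lambda>y. x y + t * v y) \<in> FE" by (rule Q.F_add[OF x(1) Q.F_scale[OF v(1)]])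
    have fx: "(\<lambda>y. f y - x y) \<in> FE" by (rule Q.F_diff[OF f x(1)])
    have pl: "polar Q f v = polar Q (\<lambda>y. f y - x y) v + polar Q x v"
    proof -
      have "polar Q v (\<lambda>y. (f y - x y) + x y) = polar Q v (\<lambda>y. f y - x y) + polar Q v x"
        by (rule Q.polar_add[OF v(1) fx x(1)])
      then show ?thesis using Q.polar_commute[OF v(1)] f fx x(1) by simp
    qed
    have "(\<lambda>y. f y - (x y + t * v y)) = (\<lambda>y. (f y - x y) + (- t) * v y)" by auto
    then have "Q (\<lambda>y. f y - (x y + t * v y)) = Q (\<lambda>y. f y - x y) + 2 * (- t) * polar Q (\<lambda>y. f y - x y) v + (- t)\<^sup>2 * Q v"
      using Q.expand[OF fx v(1), of "- t"] by simp
    then have "J (\<lambda>y. x y + t * v y) = J x + 2 * t * (C * polar Einf x v) + t\<^sup>2 * (C * Einf v) - 2 * t * polar Q f v"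
      unfolding J_def Einf.expand[OF x(1) v(1)] Q.expand[OF x(1) v(1)] pl by (simp add: algebra_simps)
    then have "2 * t * polar Q f v \<le> e + 2 * t * (C * polar Einf x v) + t\<^sup>2 * (C * Einf v)"
      using Jx[OF tv] by linarith
    also have "\<dots> \<le> e + 2 * t * (\<eta> / 4) + t\<^sup>2 * (C * B)"
      using 1 v(3) C(1) t(1) by (intro add_mono mult_left_mono) auto
    finally have "polar Q f v \<le> (e + 2 * t * (\<eta> / 4) + t\<^sup>2 * (C * B)) / (2 * t)"
      using t(1) by (simp add: pos_le_divide_eq mult.commute mult.left_commute)
    also have "\<dots> = e / (2 * t) + \<eta> / 4 + t * C * B / 2"
      using t(1) by (simp add: add_divide_distrib power2_eq_square)
    also have "\<dots> \<le> \<eta>" unfolding t(2) e(2) using \<eta> by simp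
    finally show ?thesis .
  qed
  then show ?thesis by blast
qed

text \<open>A near-minimiser \<open>g\<close> with the level-n values of \<open>f\<close> differs
  from \<open>f\<close> by a function of bounded energy vanishing there. Such differences are almost
  orthogonal to \<open>f\<close>, so \<open>Q g\<close> cannot fall much below
  \<open>Q f\<close>.\<close>

lemma lev_tr_lim: assumes f: "f \<in> FE" shows "(\<lambda>n. lev n tr f) \<longlonglongrightarrow> Q f"
proof (rule LIMSEQ_I)
  fix e :: real assume e: "e > 0"
  obtain C where C: "C > 0" "\<forall>g. C * E g \<le> q g" using E_le_q by blast
  \<comment> \<open>From Q v \<le> 2 Q f + 2 Q g and Q g \<le> Q f + 1, after comparing
    \<open>Q\<close> with \<open>Einf\<close>.\<close>
  define B where "B = (4 * Q f + 2) / C"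
  have B: "B > 0" using C Q.nonneg[OF f] by (simp add: B_def add_nonneg_pos)
  have e4: "e / 4 > 0" using e by simp
  obtain N where N: "\<forall>n\<ge>N. \<forall>v\<in>FE. (\<forall>\<sigma>\<in>words k n. \<forall>p\<in>V0. v (word_map w \<sigma> p) = 0) \<longrightarrow> Einf v \<le> B \<longrightarrow>
    polar Q f v \<le> e / 4"
    using weakly_null[OF f e4 B] by blast
  have "norm (lev n tr f - Q f) < e" if n: "n \<ge> N" for n
  proof -
    have "min 1 (e / 4) > 0" using e by simp
    then obtain g where g: "g \<in> FE" "\<forall>\<sigma>\<in>words k n. \<forall>p\<in>V0. g (word_map w \<sigma> p) = f (word_map w \<sigma> p)"
      "Q g \<le> lev n tr f + min 1 (e / 4)" using lev_tr_approx by blast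
    define v where "v = (\<lambda>x. f x - g x)"
    have v: "v \<in> FE" unfolding v_def by (rule Q.F_diff[OF f g(1)])
    have "Q g \<le> Q f + 1" using g(3) lev_tr_le[OF f, of n] by linarith
    moreover have "Q v \<le> 2 * Q f + 2 * Q g"
      using Q.par[OF f g(1)] Q.nonneg[OF Q.F_add[OF f g(1)]] by (simp add: v_def)
    moreover have "C * Einf v \<le> Q v" by (rule Einf_le_Q[OF _ v]) (use C in blast)
    ultimately have "C * Einf v \<le> 4 * Q f + 2" by linarith
    then have "Einf v \<le> B" using C(1) by (simp add: B_def pos_le_divide_eq mult.commute)
    moreover have "\<forall>\<sigma>\<in>words k n. \<forall>p\<in>V0. v (word_map w \<sigma> p) = 0" using g(2) by (simp add: v_def)
    ultimately have "polar Q f v \<le> e / 4" using N n v by blast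
    moreover have "g = (\<lambda>x. f x - v x)" by (simp add: v_def)
    then have "Q g = Q f - 2 * polar Q f v + Q v" using Q.expand_diff[OF f v] by simp
    ultimately have "Q f - e / 2 \<le> Q g" using Q.nonneg[OF v] by simp
    then show ?thesis using g(3) lev_tr_le[OF f, of n] e by (simp add: abs_less_iff)
  qed
  then show "\<exists>no. \<forall>n\<ge>no. norm (lev n tr f - Q f) < e" by blast
qed

subsection \<open>Finite energy and nonconstant functions\<close>

lemma limit_form_FE:
  assumes "f \<in> FE" "(\<lambda>n. lev n G f) \<longlonglongrightarrow> L"
  shows "limit_form k w rho G f = ennreal L" "(\<lambda>n. ennreal (level_form k w n G f / rho ^ n)) \<longlonglongrightarrow> ennreal L"
proof -
  show l: "(\<lambda>n. ennreal (level_form k w n G f / rho ^ n)) \<longlonglongrightarrow> ennreal L"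
    using assms(2) unfolding lev_def by (rule tendsto_ennrealI)
  show "limit_form k w rho G f = ennreal L" unfolding limit_form_def by (rule limI[OF l])
qed

lemma limit_form_not_FE:
  assumes f: "f \<notin> FE" and G: "\<And>g. C * E g \<le> G g" and C: "C > 0"
  shows "limit_form k w rho G f = \<infinity>"
proof -
  have "filterlim (\<lambda>n. lev n E f) at_top sequentially"
    unfolding filterlim_at_top eventually_sequentially
  proof
    fix Z
    obtain N where "\<not> lev N E f \<le> Z" using f by (auto simp: finite_E_def)
    then show "\<exists>N. \<forall>n\<ge>N. Z \<le> lev n E f" using lev_E_mono[of N _ f] by (meson not_le order_trans less_imp_le)
  qed
  then have "filterlim (\<lambda>n. C * lev n E f) at_top sequentially"
    using C by (intro filterlim_tendsto_pos_mult_at_top[OF tendsto_const])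
  then have "filterlim (\<lambda>n. lev n G f) at_top sequentially"
    by (rule filterlim_at_top_mono) (intro always_eventually allI, unfold lev_cmult[symmetric], rule lev_mono, rule G)
  then have "(\<lambda>n. ennreal (lev n G f)) \<longlonglongrightarrow> top" by (simp add: ennreal_tendsto_top_eq_at_top)
  then show ?thesis unfolding limit_form_def lev_def by (simp add: limI infinity_ennreal_def)
qed

lemma finite_energy_eq:
  assumes G: "\<And>g. C * E g \<le> G g" "C > 0" and L: "\<And>f. f \<in> FE \<Longrightarrow> (\<lambda>n. lev n G f) \<longlonglongrightarrow> L f"
  shows "finite_energy k w K rho G = {f. continuous_on K f \<and> f \<in> FE}"
proof -
  have "limit_form k w rho G f < \<infinity> \<longleftrightarrow> f \<in> FE" for f
    using limit_form_FE(1)[OF _ L, of f] limit_form_not_FE[of f C G, OF _ G] by (cases "f \<in> FE") auto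
  then show ?thesis by (simp add: finite_energy_def)
qed

lemma energy_zero_imp_const:
  assumes "\<And>n. lev n E f = 0" "\<sigma> \<in> words k n" "p \<in> V0" "p' \<in> V0"
  shows "f (word_map w \<sigma> p) = f p'"
  using assms
proof (induction n arbitrary: f \<sigma> p')
  case 0
  have "E f = 0" using 0(1)[of 0] by simp
  then have "f p = f p'" by (rule E_zero[OF _ 0(3,4)])
  then show ?case using 0(2) by (simp add: words_0)
next
  case (Suc n)
  obtain i \<sigma>' where s: "\<sigma> = i # \<sigma>'" "i \<in> I" "\<sigma>' \<in> words k n" using Suc.prems(2) unfolding words_Suc by auto
  have z: "lev m E (f \<circ> w j) = 0" if "j \<in> I" for m j
  proof -
    have "(\<Sum>j\<in>I. lev m E (f \<circ> w j)) = 0" using Suc.prems(1)[of "Suc m"] rho_pos by (simp add: lev_Suc)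
    then show ?thesis
      by (subst (asm) sum_nonneg_eq_0_iff) (use that lev_E_nonneg in auto)
  qed
  have "vertices k w 1 \<subseteq> {x. f x = f p'}"
  proof (rule V1_induct[of p'])
    fix j a b' assume j: "j \<in> I" "a \<in> V0" "b' \<in> V0" "w j a \<in> {x. f x = f p'}"
    have "E (f \<circ> w j) = 0" using z[OF j(1), of 0] by simp
    then have "(f \<circ> w j) a = (f \<circ> w j) b'" by (rule E_zero[OF _ j(2,3)])
    then show "w j b' \<in> {x. f x = f p'}" using j(4) by simp
  qed (use Suc.prems(4) V0_subset_V1 in auto)
  moreover have "w i p' \<in> vertices k w 1" using s(2) Suc.prems(4) by (auto simp: vertices_1)
  ultimately have "f (w i p') = f p'" by auto
  moreover have "(f \<circ> w i) (word_map w \<sigma>' p) = (f \<circ> w i) p'"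
    by (rule Suc.IH[OF z[OF s(2)] s(3) Suc.prems(3,4)])
  ultimately show ?case by (simp add: s(1))
qed

text \<open>Zero limit energy makes all level energies vanish, so \<open>f\<close> is constant on
  the vertices; these are dense in \<open>K\<close>, and continuity does the rest.\<close>

lemma Q_pos:
  assumes f: "f \<in> FE" "continuous_on K f" "\<not> f constant_on K"
  shows "Q f > 0"
proof (rule ccontr)
  assume "\<not> Q f > 0"
  then have Q0: "Q f = 0" using Q.nonneg[OF f(1)] by simp
  obtain C where C: "C > 0" "\<forall>g. C * E g \<le> q g" using E_le_q by blast
  have z: "lev n E f = 0" for n
  proof -
    have "C * lev n E f \<le> C * Einf f" using lev_le_Einf[OF f(1)] C by simp
    also have "\<dots> \<le> 0" using Einf_le_Q[of C f] C(2) f(1) Q0 by simp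
    finally have "lev n E f \<le> 0" using C(1) by (simp add: mult_le_0_iff)
    then show ?thesis using lev_E_nonneg[of n f] by simp
  qed
  obtain p0 where p0: "p0 \<in> V0" using V0_ne by blast
  have "f x = f p0" if x: "x \<in> K" for x
  proof (rule ccontr)
    assume "f x \<noteq> f p0"
    then have "dist (f x) (f p0) > 0" by simp
    then obtain d where d: "d > 0" "\<forall>y\<in>K. dist y x < d \<longrightarrow> dist (f y) (f x) < dist (f x) (f p0)"
      using f(2) x unfolding continuous_on_iff by blast
    obtain n \<sigma> p where s: "\<sigma> \<in> words k n" "p \<in> V0" "dist (word_map w \<sigma> p) x < d"
      using vertices_dense[OF x d(1)] by blast
    have "f (word_map w \<sigma> p) = f p0" by (rule energy_zero_imp_const[OF z s(1,2) p0])
    moreover have "dist (f (word_map w \<sigma> p)) (f x) < dist (f x) (f p0)"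
      using d(2) s(3) words_Suc_K[OF s(1,2)] by blast
    ultimately show False by (simp add: dist_commute)
  qed
  then show False using f(3) unfolding constant_on_def by blast
qed

end

subsection \<open>Abelian limits of the zeta function\<close>

text \<open>The weights (1 - x) x^n have total mass 1 and move off to infinity as x tends to 1, so
  any finite number of terms loses its influence.\<close>

lemma abel_mean:
  fixes B :: "nat \<Rightarrow> real"
  assumes L: "B \<longlonglongrightarrow> L"
  shows "((\<lambda>x. (1 - x) * (\<Sum>n. x ^ n * B n)) \<longlongrightarrow> L) (at_left 1)"
proof (rule tendstoI)
  fix e :: real assume e: "e > 0"
  have e4: "e / 4 > 0" using e by simp
  obtain N where N: "\<forall>n\<ge>N. norm (B n - L) < e / 4" using LIMSEQ_D[OF L e4] by blast
  define C where "C = (\<Sum>n<N. \<bar>B n - L\<bar>)"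
  have "((\<lambda>x. (1 - x) * C) \<longlongrightarrow> (1 - 1) * C) (at_left 1)" by (intro tendsto_intros)
  then have ev1: "\<forall>\<^sub>F x in at_left 1. (1 - x) * C < e / 4"
    by (rule order_tendstoD(2)) (use e in simp)
  have ev2: "\<forall>\<^sub>F x in at_left (1::real). x \<in> {0<..<1}" by (rule eventually_at_left_real) simp
  show "\<forall>\<^sub>F x in at_left 1. dist ((1 - x) * (\<Sum>n. x ^ n * B n)) L < e"
    using ev1 ev2
  proof eventually_elim
    case (elim x)
    then have x: "0 < x" "x < 1" by auto
    have geo: "summable (\<lambda>n. x ^ n)" "(\<Sum>n. x ^ n) = 1 / (1 - x)"
      using x by (simp_all add: summable_geometric suminf_geometric)
    obtain M where M: "\<And>n. \<bar>B n\<bar> \<le> M" using convergent_imp_Bseq[OF convergentI[OF L]] by (auto simp: Bseq_def)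
    have sB: "summable (\<lambda>n. x ^ n * B n)"
      by (rule summable_comparison_test'[OF summable_mult2[OF geo(1), of M], of 0])
        (use M x in \<open>simp add: abs_mult mult_left_mono\<close>)
    have sL: "summable (\<lambda>n. x ^ n * L)" by (rule summable_mult2[OF geo(1)])
    have sD: "summable (\<lambda>n. x ^ n * (B n - L))" using summable_diff[OF sB sL] by (simp add: right_diff_distrib)
    have "(1 - x) * (\<Sum>n. x ^ n * B n) - L = (1 - x) * ((\<Sum>n. x ^ n * B n) - (\<Sum>n. x ^ n * L))"
      using x suminf_mult2[OF geo(1), of L, symmetric] geo(2) by (simp add: right_diff_distrib)
    also have "\<dots> = (1 - x) * (\<Sum>n. x ^ n * (B n - L))"
      using suminf_diff[OF sB sL] by (simp add: right_diff_distrib)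
    finally have 1: "\<bar>(1 - x) * (\<Sum>n. x ^ n * B n) - L\<bar> = (1 - x) * \<bar>\<Sum>n. x ^ n * (B n - L)\<bar>"
      using x by (simp add: abs_mult)
    \<comment> \<open>A summable majorant: the full deviations before \<open>N\<close>, geometric
      weights times \<open>e / 4\<close> in the tail.\<close>
    define g where "g = (\<lambda>n. (if n \<in> {..<N} then \<bar>B n - L\<bar> else 0) + x ^ n * (e / 4))"
    have sg: "summable g" unfolding g_def
      by (intro summable_add summable_mult2[OF geo(1)] summable_If_finite_set) simp
    have gs: "suminf g = C + 1 / (1 - x) * (e / 4)"
    proof -
      have "suminf g = (\<Sum>n. if n \<in> {..<N} then \<bar>B n - L\<bar> else 0) + (\<Sum>n. x ^ n * (e / 4))"
        unfolding g_def by (intro suminf_add[symmetric] summable_mult2[OF geo(1)] summable_If_finite_set) simp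
      also have "(\<Sum>n. if n \<in> {..<N} then \<bar>B n - L\<bar> else 0) = C"
        unfolding C_def by (rule sums_unique[symmetric, OF sums_If_finite_set]) simp
      also have "(\<Sum>n. x ^ n * (e / 4)) = 1 / (1 - x) * (e / 4)" using suminf_mult2[OF geo(1), of "e / 4"] geo(2) by simp
      finally show ?thesis .
    qed
    have bnd: "\<bar>x ^ n * (B n - L)\<bar> \<le> g n" for n
    proof (cases "n < N")
      case True
      have "\<bar>x ^ n * (B n - L)\<bar> \<le> 1 * \<bar>B n - L\<bar>"
        unfolding abs_mult using x by (intro mult_right_mono) (auto simp: power_le_one)
      moreover have "x ^ n * (e / 4) \<ge> 0" using x e by simp
      ultimately show ?thesis using True by (simp add: g_def)
    next
      case False
      then have "\<bar>B n - L\<bar> \<le> e / 4" using N by (simp add: less_imp_le)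
      then show ?thesis using False x by (simp add: g_def abs_mult mult_left_mono)
    qed
    have sA: "summable (\<lambda>n. \<bar>x ^ n * (B n - L)\<bar>)"
      by (rule summable_comparison_test'[OF sg, of 0]) (use bnd in simp)
    have "\<bar>\<Sum>n. x ^ n * (B n - L)\<bar> \<le> (\<Sum>n. \<bar>x ^ n * (B n - L)\<bar>)" by (rule summable_rabs[OF sA])
    also have "\<dots> \<le> suminf g" by (rule suminf_le[OF bnd sA sg])
    finally have "(1 - x) * \<bar>\<Sum>n. x ^ n * (B n - L)\<bar> \<le> (1 - x) * (C + 1 / (1 - x) * (e / 4))"
      unfolding gs using x by (intro mult_left_mono) auto
    also have "\<dots> = (1 - x) * C + e / 4"
    proof -
      have "(1 - x) * (1 / (1 - x) * y) = y" for y using x by simp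
      then show ?thesis by (simp only: distrib_left)
    qed
    also have "\<dots> < e" using elim e by simp
    finally show ?case unfolding dist_real_def 1 .
  qed
qed

text \<open>The origin of the factor 1 / log (1 / \<lambda>): the quotient is minus the inverse of a
  difference quotient of \<lambda>^(s - d), whose derivative at d is log \<lambda>.\<close>

lemma powr_slope:
  fixes lam d :: real
  assumes "0 < lam" "lam < 1"
  shows "((\<lambda>s. (s - d) / (1 - lam powr (s - d))) \<longlongrightarrow> 1 / ln (1 / lam)) (at_right d)"
proof -
  have "((\<lambda>s. lam powr (s - d)) has_real_derivative ln lam) (at d)"
    using assms by (auto intro!: derivative_eq_intros)
  then have "((\<lambda>s. (lam powr (s - d) - 1) / (s - d)) \<longlongrightarrow> ln lam) (at d)"
    using assms by (simp add: has_field_derivative_iff)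
  then have "((\<lambda>s. (lam powr (s - d) - 1) / (s - d)) \<longlongrightarrow> ln lam) (at_right d)"
    by (rule filterlim_at_split[THEN iffD1, THEN conjunct2])
  moreover have "ln lam \<noteq> 0" using assms by simp
  ultimately have "((\<lambda>s. - inverse ((lam powr (s - d) - 1) / (s - d))) \<longlongrightarrow> - inverse (ln lam)) (at_right d)"
    by (intro tendsto_minus tendsto_inverse)
  moreover have "- inverse ((lam powr (s - d) - 1) / (s - d)) = (s - d) / (1 - lam powr (s - d))" for s
    by (simp add: inverse_eq_divide minus_divide_right)
  moreover have "- inverse (ln lam) = 1 / ln (1 / lam)"
    using assms by (simp add: ln_div inverse_eq_divide)
  ultimately show ?thesis by simp
qed

text \<open>The conductances in the zeta function depend on s, while convergence is known at
  \<open>d\<close> only. The sequence \<open>b s\<close> is therefore kept apart from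
  \<open>B\<close>, with \<open>e s\<close> bounding the relative deviation.\<close>

locale zeta_series =
  fixes lam d L :: real and B :: "nat \<Rightarrow> real" and b :: "real \<Rightarrow> nat \<Rightarrow> real" and e :: "real \<Rightarrow> real"
  assumes lam: "0 < lam" "lam < 1" and B0: "\<And>n. B n \<ge> 0" and BL: "B \<longlonglongrightarrow> L"
    and b0: "\<And>s n. b s n \<ge> 0" and bB: "\<And>s n. \<bar>b s n - B n\<bar> \<le> e s * B n"
    and e0: "(e \<longlongrightarrow> 0) (at_right d)"
begin

definition Z :: "real \<Rightarrow> ennreal" where
  "Z s = (\<Sum>n. ennreal (lam powr (real n * (s - d)) * b s n))"

lemma powr_nat: "lam powr (real n * (s - d)) = (lam powr (s - d)) ^ n"
  using lam by (simp add: powr_powr[symmetric] powr_realpow mult.commute[of "real n"])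

lemma x_bounds: "s > d \<Longrightarrow> 0 < lam powr (s - d) \<and> lam powr (s - d) < 1"
  using lam powr_less_mono2[of "s - d" lam 1] by simp

lemma summable_B: assumes "s > d" shows "summable (\<lambda>n. (lam powr (s - d)) ^ n * B n)"
    "summable (\<lambda>n. (lam powr (s - d)) ^ n * b s n)"
proof -
  let ?x = "lam powr (s - d)"
  have x: "0 < ?x" "?x < 1" using x_bounds[OF assms] by auto
  have geo: "summable (\<lambda>n. ?x ^ n)" using x by (simp add: summable_geometric)
  obtain M where M: "\<And>n. \<bar>B n\<bar> \<le> M" using convergent_imp_Bseq[OF convergentI[OF BL]] by (auto simp: Bseq_def)
  show "summable (\<lambda>n. ?x ^ n * B n)"
    by (rule summable_comparison_test'[OF summable_mult2[OF geo, of M], of 0])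
      (use M x in \<open>simp add: abs_mult mult_left_mono\<close>)
  have "\<bar>b s n\<bar> \<le> M + \<bar>e s\<bar> * M" for n
  proof -
    have "\<bar>b s n\<bar> \<le> \<bar>B n\<bar> + \<bar>b s n - B n\<bar>" by linarith
    also have "\<dots> \<le> \<bar>B n\<bar> + e s * B n" using bB[of s n] by simp
    also have "e s * B n \<le> \<bar>e s\<bar> * \<bar>B n\<bar>" by (metis abs_ge_self abs_mult)
    also have "\<dots> \<le> \<bar>e s\<bar> * M" using M by (intro mult_left_mono) auto
    finally show ?thesis using M[of n] by linarith
  qed
  then show "summable (\<lambda>n. ?x ^ n * b s n)"
    by (intro summable_comparison_test'[OF summable_mult2[OF geo, of "M + \<bar>e s\<bar> * M"], of 0])
      (use x in \<open>simp add: abs_mult mult_left_mono\<close>)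
qed

lemma Z_eq: "s > d \<Longrightarrow> Z s = ennreal (\<Sum>n. (lam powr (s - d)) ^ n * b s n)"
  unfolding Z_def powr_nat using summable_B(2) b0 by (intro suminf_ennreal2) auto

text \<open>With x = \<lambda>^(s - d), tending to 1 from below, Abel's theorem handles the series
  with coefficients \<open>B\<close>; replacing them by \<open>b s\<close> changes it by a relative
  error \<open>e s\<close>, which tends to 0.\<close>

lemma residue: "((\<lambda>s. ennreal (s - d) * Z s) \<longlongrightarrow> ennreal (1 / ln (1 / lam) * L)) (at_right d)"
proof -
  define R where "R = (\<lambda>s. (s - d) * (\<Sum>n. (lam powr (s - d)) ^ n * B n))"
  define R' where "R' = (\<lambda>s. (s - d) * (\<Sum>n. (lam powr (s - d)) ^ n * b s n))"
  have right: "\<forall>\<^sub>F s in at_right d. s > d" by (rule eventually_at_right_less)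
  have "((\<lambda>s. lam powr (s - d)) \<longlongrightarrow> lam powr (d - d)) (at_right d)"
    using lam by (intro tendsto_intros) auto
  then have "((\<lambda>s. lam powr (s - d)) \<longlongrightarrow> 1) (at_right d)" using lam by simp
  then have "filterlim (\<lambda>s. lam powr (s - d)) (at_left 1) (at_right d)"
    unfolding filterlim_at using right by (auto elim!: eventually_mono dest: x_bounds)
  from filterlim_compose[OF abel_mean[OF BL] this]
  have "((\<lambda>s. (s - d) / (1 - lam powr (s - d)) * ((1 - lam powr (s - d)) * (\<Sum>n. (lam powr (s - d)) ^ n * B n)))
      \<longlongrightarrow> 1 / ln (1 / lam) * L) (at_right d)"
    by (intro tendsto_mult powr_slope lam)
  then have Rlim: "(R \<longlongrightarrow> 1 / ln (1 / lam) * L) (at_right d)"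
  proof (rule Lim_transform_eventually)
    show "\<forall>\<^sub>F s in at_right d. (s - d) / (1 - lam powr (s - d)) *
      ((1 - lam powr (s - d)) * (\<Sum>n. (lam powr (s - d)) ^ n * B n)) = R s"
      using right by eventually_elim (use x_bounds in \<open>force simp: R_def\<close>)
  qed
  have R0: "R s \<ge> 0" if "s > d" for s
    unfolding R_def using that B0 x_bounds[OF that]
    by (intro mult_nonneg_nonneg suminf_nonneg summable_B) auto
  have diff: "\<bar>R' s - R s\<bar> \<le> e s * R s" if s: "s > d" for s
  proof -
    let ?x = "lam powr (s - d)"
    have x: "?x > 0" using x_bounds[OF s] by simp
    note sB = summable_B(1)[OF s] and sb = summable_B(2)[OF s]
    have bnd: "\<bar>?x ^ n * b s n - ?x ^ n * B n\<bar> \<le> e s * (?x ^ n * B n)" for n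
    proof -
      have "\<bar>?x ^ n * b s n - ?x ^ n * B n\<bar> = ?x ^ n * \<bar>b s n - B n\<bar>"
        using x by (simp add: right_diff_distrib[symmetric] abs_mult)
      also have "\<dots> \<le> ?x ^ n * (e s * B n)" using x bB by (intro mult_left_mono) auto
      finally show ?thesis by (simp add: mult.left_commute)
    qed
    have sA: "summable (\<lambda>n. \<bar>?x ^ n * b s n - ?x ^ n * B n\<bar>)"
      by (rule summable_comparison_test'[OF summable_mult[OF sB, of "e s"], of 0]) (use bnd in simp)
    have "\<bar>(\<Sum>n. ?x ^ n * b s n) - (\<Sum>n. ?x ^ n * B n)\<bar> = \<bar>\<Sum>n. ?x ^ n * b s n - ?x ^ n * B n\<bar>"
      using suminf_diff[OF sb sB] by simp
    also have "\<dots> \<le> (\<Sum>n. \<bar>?x ^ n * b s n - ?x ^ n * B n\<bar>)" by (rule summable_rabs[OF sA])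
    also have "\<dots> \<le> (\<Sum>n. e s * (?x ^ n * B n))" by (rule suminf_le[OF bnd sA summable_mult[OF sB]])
    also have "\<dots> = e s * (\<Sum>n. ?x ^ n * B n)" by (rule suminf_mult[OF sB])
    finally have "(s - d) * \<bar>(\<Sum>n. ?x ^ n * b s n) - (\<Sum>n. ?x ^ n * B n)\<bar> \<le> (s - d) * (e s * (\<Sum>n. ?x ^ n * B n))"
      using s by (intro mult_left_mono) auto
    moreover have "\<bar>R' s - R s\<bar> = (s - d) * \<bar>(\<Sum>n. ?x ^ n * b s n) - (\<Sum>n. ?x ^ n * B n)\<bar>"
      using s unfolding R_def R'_def right_diff_distrib[symmetric] by (simp add: abs_mult)
    ultimately show ?thesis by (simp add: R_def mult.left_commute)
  qed
  have "((\<lambda>s. e s * R s) \<longlongrightarrow> 0 * (1 / ln (1 / lam) * L)) (at_right d)" by (intro tendsto_mult e0 Rlim)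
  then have eR: "((\<lambda>s. e s * R s) \<longlongrightarrow> 0) (at_right d)" by simp
  have "\<forall>\<^sub>F s in at_right d. norm (R' s - R s) \<le> e s * R s"
    using right by (rule eventually_mono) (simp add: diff)
  then have "((\<lambda>s. R' s - R s) \<longlongrightarrow> 0) (at_right d)" using eR by (rule Lim_null_comparison)
  from tendsto_add[OF this Rlim] have "(R' \<longlongrightarrow> 1 / ln (1 / lam) * L) (at_right d)" by simp
  then have "((\<lambda>s. ennreal (R' s)) \<longlongrightarrow> ennreal (1 / ln (1 / lam) * L)) (at_right d)" by (rule tendsto_ennrealI)
  then show ?thesis
  proof (rule Lim_transform_eventually)
    show "\<forall>\<^sub>F s in at_right d. ennreal (R' s) = ennreal (s - d) * Z s"
      using right
    proof eventually_elim
      case (elim s)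
      have "(\<Sum>n. (lam powr (s - d)) ^ n * b s n) \<ge> 0"
        using x_bounds[OF elim] b0 by (intro suminf_nonneg summable_B(2)[OF elim]) auto
      then show ?case unfolding Z_eq[OF elim] R'_def using elim by (simp add: ennreal_mult)
    qed
  qed
qed

text \<open>Below \<open>d\<close> the powers of \<lambda> are at least 1, so the terms stay above
  \<kappa> \<open>B n\<close>, which has a positive limit, and cannot tend to 0.\<close>

lemma Z_infinite:
  assumes L: "L > 0" and s: "s < d" and \<kappa>: "\<kappa> > 0" "\<And>n. \<kappa> * B n \<le> b s n"
  shows "Z s = \<infinity>"
proof (rule ccontr)
  assume "Z s \<noteq> \<infinity>"
  then have "summable (\<lambda>n. lam powr (real n * (s - d)) * b s n)"
    unfolding Z_def using b0 by (intro summable_suminf_not_top) (auto simp: infinity_ennreal_def)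
  then have lim: "(\<lambda>n. lam powr (real n * (s - d)) * b s n) \<longlonglongrightarrow> 0" by (rule summable_LIMSEQ_zero)
  have "\<kappa> * L \<le> 0"
  proof (rule LIMSEQ_le[OF tendsto_mult[OF tendsto_const BL] lim], intro exI allI impI)
    fix n
    have "\<kappa> * B n \<le> 1 * b s n" using \<kappa>(2) by simp
    also have "\<dots> \<le> lam powr (real n * (s - d)) * b s n"
    proof (rule mult_right_mono[OF _ b0])
      have "lam powr 0 \<le> lam powr (real n * (s - d))"
        using lam s by (intro powr_mono') (auto simp: mult_le_0_iff)
      then show "1 \<le> lam powr (real n * (s - d))" using lam by simp
    qed
    finally show "\<kappa> * B n \<le> lam powr (real n * (s - d)) * b s n" .
  qed
  then show False using L \<kappa> by (simp add: mult_le_0_iff)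
qed

lemma abscissa:
  assumes L: "L > 0" and \<kappa>: "\<And>s. \<exists>\<kappa>>0. \<forall>n. \<kappa> * B n \<le> b s n"
  shows "abscissa_of_convergence Z = ereal d"
  unfolding abscissa_of_convergence_def
proof (rule antisym)
  show "Inf {ereal s |s. Z s < \<infinity>} \<le> ereal d"
  proof (rule ccontr)
    assume "\<not> Inf {ereal s |s. Z s < \<infinity>} \<le> ereal d"
    then have "ereal d < Inf {ereal s |s. Z s < \<infinity>}" by (simp only: not_le)
    from ereal_dense2[OF this] obtain r where r: "ereal d < ereal r" "ereal r < Inf {ereal s |s. Z s < \<infinity>}"
      by (elim exE conjE)
    then have "Z r < \<infinity>" using Z_eq[of r] by simp
    then have "Inf {ereal s |s. Z s < \<infinity>} \<le> ereal r" by (intro Inf_lower) blast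
    then show False using r(2) by simp
  qed
  show "ereal d \<le> Inf {ereal s |s. Z s < \<infinity>}"
  proof (rule Inf_greatest)
    fix y assume "y \<in> {ereal s |s. Z s < \<infinity>}"
    then obtain s where s: "y = ereal s" "Z s < \<infinity>" by blast
    obtain \<kappa> where "\<kappa> > 0" "\<forall>n. \<kappa> * B n \<le> b s n" using \<kappa> by blast
    then have "\<not> s < d" using Z_infinite[OF L, of s \<kappa>] s(2) by auto
    then show "ereal d \<le> y" using s(1) by simp
  qed
qed

end

subsection \<open>The residue\<close>

lemma (in nested) edge_form_isometry:
  assumes bij: "bij_betw \<phi> V0 V0"
    and iso: "\<And>x y. x \<in> V0 \<Longrightarrow> y \<in> V0 \<Longrightarrow> norm (\<phi> x - \<phi> y) = norm (x - y)"
  shows "edge_form k w (\<lambda>p r. \<psi> (norm (p - r))) (f \<circ> \<phi>) = edge_form k w (\<lambda>p r. \<psi> (norm (p - r))) f"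
proof -
  let ?m = "\<lambda>e. (\<phi> (fst e), \<phi> (snd e))"
  have inj: "inj_on \<phi> V0" and V: "\<And>x. x \<in> V0 \<Longrightarrow> \<phi> x \<in> V0" using bij by (auto simp: bij_betw_def)
  have E0: "e \<in> E0 \<longleftrightarrow> fst e \<in> V0 \<and> snd e \<in> V0 \<and> fst e \<noteq> snd e" for e
    by (cases e) (simp add: edges0_def)
  have "inj_on ?m E0"
    by (rule inj_onI) (simp add: E0 prod_eq_iff inj_on_eq_iff[OF inj])
  moreover have "?m ` E0 \<subseteq> E0"
    by (rule image_subsetI) (simp add: E0 V inj_on_eq_iff[OF inj])
  ultimately have m: "bij_betw ?m E0 E0"
    using endo_inj_surj[OF finite_E0] by (simp add: bij_betw_def)
  let ?g = "\<lambda>e. \<psi> (norm (fst e - snd e)) * (f (fst e) - f (snd e))\<^sup>2"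
  have "(\<Sum>e\<in>E0. ?g (?m e)) = sum ?g E0" by (rule sum.reindex_bij_betw[OF m])
  moreover have "(\<Sum>e\<in>E0. ?g (?m e)) = (\<Sum>e\<in>E0. \<psi> (norm (fst e - snd e)) * ((f \<circ> \<phi>) (fst e) - (f \<circ> \<phi>) (snd e))\<^sup>2)"
    by (rule sum.cong[OF refl]) (simp add: E0 iso)
  ultimately show ?thesis by (simp add: edge_form_def split_beta)
qed

lemma length_form_eq: "length_form k w d = edge_form k w (\<lambda>p r. norm (p - r) powr (d - 2))"
  by (rule ext) (simp add: length_form_def edge_form_def edge_length_def split_beta)

locale spectral = renorm +
  assumes b_eq: "b = (\<lambda>p r. norm (p - r) powr (critical_exponent lam rho - 2))"
begin

abbreviation \<delta> :: real where "\<delta> \<equiv> critical_exponent lam rho"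

lemma q_eq: "q = length_form k w \<delta>"
  by (simp add: length_form_eq b_eq)

text \<open>The defining property of \<delta>: it trades the powers \<lambda>^(n (s - 2)) of the
  trace for \<lambda>^(n (s - \<delta>)) and the energy scaling by \<open>rho\<close>.\<close>

lemma rho_eq: "lam powr (\<delta> - 2) = 1 / rho"
proof -
  have "lam powr (\<delta> - 2) = exp (- ln rho)"
    using lam_pos lam_less_1 by (simp add: powr_def critical_exponent_def)
  then show ?thesis using rho_pos by (simp add: exp_minus inverse_eq_divide)
qed

text \<open>A sum over the finitely many edges in place of a maximum: it still bounds the relative
  error of each edge and tends to 0 termwise.\<close>

definition dev :: "real \<Rightarrow> real" where
  "dev s = (\<Sum>e\<in>E0. \<bar>norm (fst e - snd e) powr (s - \<delta>) - 1\<bar>)"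

lemma dev_tendsto: "(dev \<longlongrightarrow> 0) (at_right \<delta>)"
proof -
  have "((\<lambda>s. \<bar>norm (fst e - snd e) powr (s - \<delta>) - 1\<bar>) \<longlongrightarrow> \<bar>norm (fst e - snd e) powr (\<delta> - \<delta>) - 1\<bar>) (at_right \<delta>)"
    if "e \<in> E0" for e
    using that by (intro tendsto_intros) (auto simp: edges0_def)
  then have "(dev \<longlongrightarrow> (\<Sum>e\<in>E0. \<bar>norm (fst e - snd e) powr (\<delta> - \<delta>) - 1\<bar>)) (at_right \<delta>)"
    unfolding dev_def[abs_def] by (rule tendsto_sum)
  moreover have "(\<Sum>e\<in>E0. \<bar>norm (fst e - snd e) powr (\<delta> - \<delta>) - 1\<bar>) = 0"
    by (rule sum.neutral) (auto simp: edges0_def)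
  ultimately show ?thesis by simp
qed

lemma length_form_close: "\<bar>length_form k w s g - q g\<bar> \<le> dev s * q g"
proof -
  let ?l = "\<lambda>e::'a \<times> 'a. norm (fst e - snd e)"
  have q: "q g = (\<Sum>e\<in>E0. ?l e powr (\<delta> - 2) * (g (fst e) - g (snd e))\<^sup>2)"
    by (simp add: edge_form_def b_eq split_beta)
  have l: "length_form k w s g = (\<Sum>e\<in>E0. ?l e powr (s - 2) * (g (fst e) - g (snd e))\<^sup>2)"
    by (simp add: length_form_eq edge_form_def split_beta)
  have eq: "length_form k w s g - q g =
      (\<Sum>e\<in>E0. (?l e powr (s - \<delta>) - 1) * (?l e powr (\<delta> - 2) * (g (fst e) - g (snd e))\<^sup>2))"
    unfolding q l sum_subtractf[symmetric]
  proof (rule sum.cong[OF refl])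
    fix e assume "e \<in> E0"
    have "?l e powr (s - 2) = ?l e powr (s - \<delta>) * ?l e powr (\<delta> - 2)" by (simp add: powr_add[symmetric])
    then show "?l e powr (s - 2) * (g (fst e) - g (snd e))\<^sup>2 - ?l e powr (\<delta> - 2) * (g (fst e) - g (snd e))\<^sup>2 =
        (?l e powr (s - \<delta>) - 1) * (?l e powr (\<delta> - 2) * (g (fst e) - g (snd e))\<^sup>2)"
      by (simp add: algebra_simps)
  qed
  have "\<bar>length_form k w s g - q g\<bar> \<le>
      (\<Sum>e\<in>E0. \<bar>(?l e powr (s - \<delta>) - 1) * (?l e powr (\<delta> - 2) * (g (fst e) - g (snd e))\<^sup>2)\<bar>)"
    unfolding eq by (rule sum_abs)
  also have "\<dots> \<le> (\<Sum>e\<in>E0. dev s * (?l e powr (\<delta> - 2) * (g (fst e) - g (snd e))\<^sup>2))"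
  proof (rule sum_mono)
    fix e assume e: "e \<in> E0"
    have "\<bar>?l e powr (s - \<delta>) - 1\<bar> \<le> dev s"
      unfolding dev_def using member_le_sum[OF e, of "\<lambda>e. \<bar>?l e powr (s - \<delta>) - 1\<bar>"] finite_E0 by simp
    then have "\<bar>?l e powr (s - \<delta>) - 1\<bar> * (?l e powr (\<delta> - 2) * (g (fst e) - g (snd e))\<^sup>2) \<le>
        dev s * (?l e powr (\<delta> - 2) * (g (fst e) - g (snd e))\<^sup>2)"
      by (rule mult_right_mono) simp
    then show "\<bar>(?l e powr (s - \<delta>) - 1) * (?l e powr (\<delta> - 2) * (g (fst e) - g (snd e))\<^sup>2)\<bar> \<le>
        dev s * (?l e powr (\<delta> - 2) * (g (fst e) - g (snd e))\<^sup>2)"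
      by (simp add: abs_mult)
  qed
  also have "\<dots> = dev s * q g" unfolding q by (rule sum_distrib_left[symmetric])
  finally show ?thesis .
qed

text \<open>\<open>dev\<close> is small only near \<delta>; divergence at every s below \<delta>
  needs a positive comparison constant for each s, provided by the finitely many edge
  lengths.\<close>

lemma length_form_lower: "\<exists>\<kappa>>0. \<forall>g. \<kappa> * q g \<le> length_form k w s g"
proof -
  let ?l = "\<lambda>e::'a \<times> 'a. norm (fst e - snd e)"
  have "\<exists>\<kappa>>0. \<forall>e\<in>E0. \<kappa> \<le> ?l e powr (s - \<delta>)"
    by (rule finite_pos_lower_bound[OF finite_E0]) (auto simp: edges0_def)
  then obtain \<kappa> where \<kappa>: "\<kappa> > 0" "\<forall>e\<in>E0. \<kappa> \<le> ?l e powr (s - \<delta>)" by blast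
  have "\<kappa> * (\<Sum>e\<in>E0. ?l e powr (\<delta> - 2) * (g (fst e) - g (snd e))\<^sup>2) \<le>
      (\<Sum>e\<in>E0. ?l e powr (s - 2) * (g (fst e) - g (snd e))\<^sup>2)" for g :: "'a \<Rightarrow> real"
    unfolding sum_distrib_left
  proof (rule sum_mono)
    fix e assume e: "e \<in> E0"
    have "?l e powr (s - 2) = ?l e powr (s - \<delta>) * ?l e powr (\<delta> - 2)" by (simp add: powr_add[symmetric])
    moreover have "\<kappa> * (?l e powr (\<delta> - 2) * (g (fst e) - g (snd e))\<^sup>2) \<le>
        ?l e powr (s - \<delta>) * (?l e powr (\<delta> - 2) * (g (fst e) - g (snd e))\<^sup>2)"
      using \<kappa>(2) e by (intro mult_right_mono) auto
    ultimately show "\<kappa> * (?l e powr (\<delta> - 2) * (g (fst e) - g (snd e))\<^sup>2) \<le>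
        ?l e powr (s - 2) * (g (fst e) - g (snd e))\<^sup>2"
      by (simp add: mult.assoc)
  qed
  then have "\<kappa> * q g \<le> length_form k w s g" for g
    by (simp add: length_form_eq b_eq edge_form_def split_beta)
  then show ?thesis using \<kappa>(1) by blast
qed

lemma zeta_series: "f \<in> FE \<Longrightarrow>
    zeta_series lam \<delta> (Q f) (\<lambda>n. lev n q f) (\<lambda>s n. lev n (length_form k w s) f) dev"
proof unfold_locales
  assume f: "f \<in> FE"
  show "0 < lam" "lam < 1" by (rule lam_pos lam_less_1)+
  show "0 \<le> lev n q f" for n by (rule lev_nonneg) (rule q_nonneg)
  show "(\<lambda>n. lev n q f) \<longlonglongrightarrow> Q f" by (rule Q_lim[OF f])
  show "0 \<le> lev n (length_form k w s) f" for s n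
    by (rule lev_nonneg) (simp add: length_form_eq edge_form_nonneg)
  show "\<bar>lev n (length_form k w s) f - lev n q f\<bar> \<le> dev s * lev n q f" for s n
    using lev_bound[of "\<lambda>g. 1 * length_form k w s g + (-1) * q g" "dev s" q n f] length_form_close
    unfolding lev_comb by simp
  show "(dev \<longlongrightarrow> 0) (at_right \<delta>)" by (rule dev_tendsto)
qed

lemma zeta_eq: "f \<in> FE \<Longrightarrow> zeta k w lam f = zeta_series.Z lam \<delta> (\<lambda>s n. lev n (length_form k w s) f)"
proof
  fix s assume "f \<in> FE"
  have "lam powr (real n * (s - 2)) * level_form k w n (length_form k w s) f =
      lam powr (real n * (s - \<delta>)) * lev n (length_form k w s) f" for n
  proof -
    have "lam powr (real n * (s - 2)) = lam powr (real n * (s - \<delta>)) * (lam powr (\<delta> - 2)) powr real n"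
      unfolding powr_powr powr_add[symmetric] by (simp add: algebra_simps)
    also have "(lam powr (\<delta> - 2)) powr real n = (1 / rho) ^ n"
      unfolding rho_eq using rho_pos by (simp add: powr_realpow)
    finally show ?thesis by (simp add: lev_def power_one_over)
  qed
  then show "zeta k w lam f s = zeta_series.Z lam \<delta> (\<lambda>s n. lev n (length_form k w s) f) s"
    unfolding zeta_eq_suminf[OF lam_pos finite_E0] zeta_series.Z_def[OF zeta_series[OF \<open>f \<in> FE\<close>]] by simp
qed

lemma log_pos: "1 / ln (1 / lam) > 0"
  using lam_pos lam_less_1 by simp

lemma residue_zeta:
  assumes f: "f \<in> FE"
  shows "((\<lambda>s. ennreal (s - \<delta>) * zeta k w lam f s) \<longlongrightarrow> ennreal (1 / ln (1 / lam) * Q f)) (at_right \<delta>)"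
  unfolding zeta_eq[OF f] by (rule zeta_series.residue[OF zeta_series[OF f]])

lemma abscissa_zeta:
  assumes f: "f \<in> FE" and Q: "Q f > 0"
  shows "abscissa_of_convergence (zeta k w lam f) = ereal \<delta>"
  unfolding zeta_eq[OF f]
proof (rule zeta_series.abscissa[OF zeta_series[OF f] Q])
  fix s
  obtain \<kappa> where \<kappa>: "\<kappa> > 0" "\<forall>g. \<kappa> * q g \<le> length_form k w s g" using length_form_lower by blast
  have "\<kappa> * lev n q f \<le> lev n (length_form k w s) f" for n
    unfolding lev_cmult[symmetric] by (rule lev_mono) (use \<kappa> in blast)
  then show "\<exists>\<kappa>>0. \<forall>n. \<kappa> * lev n q f \<le> lev n (length_form k w s) f" using \<kappa>(1) by blast
qed

lemma spectral_energy:
  "(\<forall>f\<in>finite_energy k w K rho E. \<not> f constant_on K \<longrightarrow>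
      (let \<delta> = critical_exponent lam rho; E = length_form k w \<delta>; Z = zeta k w lam f in
         abscissa_of_convergence Z = ereal \<delta> \<and>
         (\<lambda>n. ennreal (level_form k w n E f / rho ^ n)) \<longlonglongrightarrow> limit_form k w rho E f \<and>
         limit_form k w rho E f < \<infinity> \<and>
         has_right_residue Z \<delta> (ennreal (1 / ln (1 / lam)) * limit_form k w rho E f)))
   \<and> self_similar_dirichlet_form k w K (finite_energy k w K rho E)
        (\<lambda>f. right_residue (zeta k w lam f) (critical_exponent lam rho))"
proof
  have FE: "finite_energy k w K rho E = {f. continuous_on K f \<and> f \<in> FE}"
    by (rule finite_energy_eq[of 1 E Einf]) (simp_all add: Einf_lim)
  show "\<forall>f\<in>finite_energy k w K rho E. \<not> f constant_on K \<longrightarrow>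
      (let \<delta> = critical_exponent lam rho; E = length_form k w \<delta>; Z = zeta k w lam f in
         abscissa_of_convergence Z = ereal \<delta> \<and>
         (\<lambda>n. ennreal (level_form k w n E f / rho ^ n)) \<longlonglongrightarrow> limit_form k w rho E f \<and>
         limit_form k w rho E f < \<infinity> \<and>
         has_right_residue Z \<delta> (ennreal (1 / ln (1 / lam)) * limit_form k w rho E f))"
    unfolding Let_def q_eq[symmetric]
  proof (intro ballI impI conjI)
    fix f assume "f \<in> finite_energy k w K rho E" and nc: "\<not> f constant_on K"
    then have f: "continuous_on K f" "f \<in> FE" by (simp_all add: FE)
    note lf = limit_form_FE[OF f(2) Q_lim[OF f(2)]]
    show "abscissa_of_convergence (zeta k w lam f) = ereal \<delta>"
      by (rule abscissa_zeta[OF f(2) Q_pos[OF f(2,1) nc]])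
    show "(\<lambda>n. ennreal (level_form k w n q f / rho ^ n)) \<longlonglongrightarrow> limit_form k w rho q f"
      unfolding lf(1) by (rule lf(2))
    show "limit_form k w rho q f < \<infinity>" unfolding lf(1) by simp
    show "has_right_residue (zeta k w lam f) \<delta> (ennreal (1 / ln (1 / lam)) * limit_form k w rho q f)"
      unfolding has_right_residue_def lf(1)
      using residue_zeta[OF f(2)] Q.nonneg[OF f(2)] log_pos by (simp only: ennreal_mult less_imp_le)
  qed
  \<comment> \<open>The factor of the residue is put into the eigenform: multiples of the trace are
    again eigenforms, and the energies of this multiple converge to the residue.\<close>
  define s where "s = 1 / ln (1 / lam)"
  have s: "s > 0" unfolding s_def by (rule log_pos)
  have lim: "(\<lambda>n. lev n (\<lambda>u. s * tr u) f) \<longlonglongrightarrow> s * Q f" if "f \<in> FE" for f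
    unfolding lev_cmult using that by (intro tendsto_mult tendsto_const lev_tr_lim)
  obtain C where C: "C > 0" "\<forall>g. C * E g \<le> q g" using E_le_q by blast
  have "s * C * E g \<le> s * tr g" for g
    using E_le_tr[of C g] C s by (simp add: mult.assoc)
  then have FE': "finite_energy k w K rho (\<lambda>u. s * tr u) = {f. continuous_on K f \<and> f \<in> FE}"
    by (rule finite_energy_eq[where L="\<lambda>f. s * Q f"]) (use s C lim in auto)
  show "self_similar_dirichlet_form k w K (finite_energy k w K rho E)
        (\<lambda>f. right_residue (zeta k w lam f) (critical_exponent lam rho))"
    unfolding self_similar_dirichlet_form_def
  proof (intro exI conjI ballI)
    show "eigenform k w (\<lambda>u. s * tr u) rho" by (rule eigenform_tr[OF s])
    show "finite_energy k w K rho E = finite_energy k w K rho (\<lambda>u. s * tr u)" unfolding FE FE' ..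
    fix f assume "f \<in> finite_energy k w K rho E"
    then have f: "f \<in> FE" by (simp add: FE)
    have "right_residue (zeta k w lam f) \<delta> = ennreal (s * Q f)"
      unfolding right_residue_def s_def by (rule tendsto_Lim[OF _ residue_zeta[OF f]]) simp
    then show "right_residue (zeta k w lam f) \<delta> = limit_form k w rho (\<lambda>u. s * tr u) f"
      using limit_form_FE(1)[OF f lim[OF f]] by simp
  qed
qed

end

theorem theorem3p1:
  fixes k :: nat and w :: "nat \<Rightarrow> 'a::euclidean_space \<Rightarrow> 'a" and lam rho :: real
    and K :: "'a set" and Ehat :: "('a \<Rightarrow> real) \<Rightarrow> real"
  assumes "nested_fractal k w lam K"
    and "eigenform k w Ehat rho"
  shows "(\<forall>f\<in>finite_energy k w K rho Ehat. \<not> f constant_on K \<longrightarrow>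
            (let \<delta> = critical_exponent lam rho; E = length_form k w \<delta>; Z = zeta k w lam f in
               abscissa_of_convergence Z = ereal \<delta> \<and>
               (\<lambda>n. ennreal (level_form k w n E f / rho ^ n)) \<longlonglongrightarrow> limit_form k w rho E f \<and>
               limit_form k w rho E f < \<infinity> \<and>
               has_right_residue Z \<delta> (ennreal (1 / ln (1 / lam)) * limit_form k w rho E f)))
       \<and> self_similar_dirichlet_form k w K (finite_energy k w K rho Ehat)
            (\<lambda>f. right_residue (zeta k w lam f) (critical_exponent lam rho))"
proof -
  interpret nested k w lam K by (rule nested.intro[OF assms(1)])
  obtain c where c: "\<forall>(p, q)\<in>edges0 k w. c p q = c q p \<and> c p q > 0"
      "\<forall>g. Ehat g = (\<Sum>(p, q)\<in>edges0 k w. c p q * (g p - g q)\<^sup>2)"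
    using assms(2) unfolding eigenform_def discrete_form_def by blast
  have E: "Ehat = edge_form k w c" by (rule ext) (simp add: c(2) edge_form_def)
  have cp: "c p q = c q p" "c p q > 0" if "p \<in> V0" "q \<in> V0" "p \<noteq> q" for p q
    using c(1) that by (auto simp: edges0_def)
  have "eigen k w lam K c rho"
  proof (intro_locales, unfold_locales)
    show "Inf {level_form k w 1 (edge_form k w c) g |g. \<forall>x\<in>V0. g x = f x} = rho * edge_form k w c f" for f
      using assms(2) by (simp add: eigenform_def E)
    show "rho > 0" using assms(2) by (simp add: eigenform_def)
  qed (rule cp; assumption)+
  then interpret eigen k w lam K c rho .
  interpret spectral k w lam K c rho "\<lambda>p r. norm (p - r) powr (critical_exponent lam rho - 2)"
  proof unfold_locales
    show "edge_form k w (\<lambda>p r. norm (p - r) powr (critical_exponent lam rho - 2)) (f \<circ> \<phi>) =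
        edge_form k w (\<lambda>p r. norm (p - r) powr (critical_exponent lam rho - 2)) f"
      if "bij_betw \<phi> V0 V0" "\<And>x y. x \<in> V0 \<Longrightarrow> y \<in> V0 \<Longrightarrow> norm (\<phi> x - \<phi> y) = norm (x - y)" for \<phi> f
      by (rule edge_form_isometry[where \<psi>="\<lambda>t. t powr (critical_exponent lam rho - 2)"]) (rule that, rule that(2))
  qed (simp_all add: norm_minus_commute)
  show ?thesis unfolding E by (rule spectral_energy)
qed

end
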